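(* For every integer $n\ge 1$ and all integers $k_1,k_2,\ldots,k_n$, the fundamental group $\pi_1(\Sigma_2(L(k_1,k_2,\ldots,k_n)))$ of the double branched cover of the link $L(k_1,k_2,\ldots,k_n)\subset S^3$ is not left-orderable.
   Context: A nontrivial group $G$ is called left-orderable if it admits a total order $\le$ that is invariant under left multiplication: $g\le h$ if and only if $fg\le fh$, for all $f,g,h\in G$. By this convention the trivial group is not left-orderable. For a link $L\subset S^3$, $\Sigma_2(L)$ denotes the double cover of $S^3$ branched along $L$. Links from signed plane graphs: let $\Gamma$ be a connected plane graph (multiple edges and loops allowed) whose edges carry signs $\pm1$. It determines a link diagram (the medial diagram): place one crossing at the midpoint of each edge and join these crossings by arcs running along the edges around the corners of the faces, so that the complementary regions of the diagram are checkerboard coloured, the black regions corresponding to the vertices of $\Gamma$ and the white regions to the faces of $\Gamma$. At each crossing the over-strand is chosen so that rotating the over-strand counterclockwise until it reaches the under-strand sweeps out the two black corners if the edge has sign $+1$, and the two white corners if the edge has sign $-1$. (The opposite global sign convention replaces the link by its mirror image, which does not change the fundamental group of the double branched cover.) An edge with integer weight $w$ is shorthand for a path of $|w|$ edges in series, each of sign $\operatorname{sgn}(w)$; if $w=0$ the edge is contracted to a point. Definition of $L(k_1,\ldots,k_n)$: it is the link given by the following weighted plane wheel graph. There is a central vertex $0$ and a rim cycle with $2n$ vertices, in cyclic order $x_1,y_1,x_2,y_2,\ldots,x_n,y_n$ (subscripts modulo $n$). The rim edge joining $x_i$ to $y_i$ has weight $k_i$; the rim edge joining $y_i$ to $x_{i+1}$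 has weight $+1$; the spoke joining $0$ to $x_i$ has weight $-2$; and the spoke joining $0$ to $y_i$ has weight $+1$, for $i=1,\ldots,n$. For $n=1$ the rim consists of two parallel edges joining $x_1$ and $y_1$, of weights $k_1$ and $+1$. *)

theory Defs
  imports "HOL-Analysis.Analysis" "HOL-Algebra.Group"
begin

section \<open>Left-orderable groups\<close>

definition left_orderable :: "('a, 'b) monoid_scheme \<Rightarrow> bool" where
  "left_orderable G \<longleftrightarrow>
     carrier G \<noteq> {\<one>\<^bsub>G\<^esub>} \<and>
     (\<exists>r. linear_order_on (carrier G) r \<and>
        (\<forall>f\<in>carrier G. \<forall>g\<in>carrier G. \<forall>h\<in>carrier G.
           (g, h) \<in> r \<longleftrightarrow> (f \<otimes>\<^bsub>G\<^esub> g, f \<otimes>\<^bsub>G\<^esub> h) \<in> r))"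


section \<open>The fundamental group\<close>

definition loops :: "'a::topological_space set \<Rightarrow> 'a \<Rightarrow> (real \<Rightarrow> 'a) set" where
  "loops X a = {p. path p \<and> path_image p \<subseteq> X \<and> pathstart p = a \<and> pathfinish p = a}"

definition homotopy_class :: "'a::topological_space set \<Rightarrow> (real \<Rightarrow> 'a) \<Rightarrow> (real \<Rightarrow> 'a) set" where
  "homotopy_class X p = {q. homotopic_paths X p q}"

definition fundamental_group :: "'a::topological_space set \<Rightarrow> 'a \<Rightarrow> (real \<Rightarrow> 'a) set monoid" where
  "fundamental_group X a =
     \<lparr>carrier = homotopy_class X ` loops X a,
      monoid.mult = (\<lambda>A B. \<Union>p\<in>A. \<Union>q\<in>B. homotopy_class X (p +++ q)),
      one = homotopy_class X (\<lambda>_. a)\<rparr>"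

lemma homotopy_class_eq_iff:
  assumes "p \<in> loops X a"
  shows "homotopy_class X p = homotopy_class X q \<longleftrightarrow> homotopic_paths X p q"
proof
  have "homotopic_paths X p p"
    using assms by (simp add: loops_def)
  then show "homotopic_paths X p q" if "homotopy_class X p = homotopy_class X q"
    using that unfolding homotopy_class_def by (metis homotopic_paths_sym mem_Collect_eq)
  show "homotopy_class X p = homotopy_class X q" if pq: "homotopic_paths X p q"
    unfolding homotopy_class_def
    using homotopic_paths_trans[OF pq] homotopic_paths_trans[OF homotopic_paths_sym[OF pq]]
    by blast
qed

lemma join_loops: "p \<in> loops X a \<Longrightarrow> q \<in> loops X a \<Longrightarrow> p +++ q \<in> loops X a"
  by (auto simp: loops_def path_image_join)

lemma const_loop: "a \<in> X \<Longrightarrow> (\<lambda>_. a) \<in> loops X a"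
  by (auto simp: loops_def path_def pathstart_def pathfinish_def path_image_def)

lemma reverse_loop: "p \<in> loops X a \<Longrightarrow> reversepath p \<in> loops X a"
  by (auto simp: loops_def)

lemma mult_homotopy_class:
  assumes "p \<in> loops X a" "q \<in> loops X a"
  shows "homotopy_class X p \<otimes>\<^bsub>fundamental_group X a\<^esub> homotopy_class X q
         = homotopy_class X (p +++ q)"
proof -
  have *: "homotopy_class X (p' +++ q') = homotopy_class X (p +++ q)"
    if "homotopic_paths X p p'" "homotopic_paths X q q'" for p' q'
  proof -
    have "homotopic_paths X (p +++ q) (p' +++ q')"
      using that assms by (intro homotopic_paths_join) (auto simp: loops_def)
    then show ?thesis
      using homotopy_class_eq_iff[OF join_loops[OF assms]] by metis
  qed
  have "p \<in> homotopy_class X p" "q \<in> homotopy_class X q"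
    using assms by (auto simp: homotopy_class_def loops_def)
  then have "(\<Union>p'\<in>homotopy_class X p. \<Union>q'\<in>homotopy_class X q. homotopy_class X (p' +++ q'))
      = homotopy_class X (p +++ q)"
    using * unfolding homotopy_class_def[of X p] homotopy_class_def[of X q] by blast
  then show ?thesis
    by (simp add: fundamental_group_def)
qed

lemma homotopic_const_join:
  assumes "p \<in> loops X a"
  shows "homotopic_paths X ((\<lambda>_. a) +++ p) p"
proof -
  have p: "path p" "path_image p \<subseteq> X" "p 0 = a"
    using assms by (auto simp: loops_def pathstart_def)
  have "homotopic_paths X p ((\<lambda>_. a) +++ p)"
  proof (rule homotopic_paths_reparametrize[where f = "\<lambda>t. max 0 (2 * t - 1)"])
    show "continuous_on {0..1} (\<lambda>t::real. max 0 (2 * t - 1))"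
      by (intro continuous_intros)
    show "((\<lambda>_. a) +++ p) t = p (max 0 (2 * t - 1))" if "t \<in> {0..1}" for t
    proof (cases "t \<le> 1 / 2")
      case True
      then have "max 0 (2 * t - 1) = 0" by simp
      then show ?thesis using True p(3) by (simp add: joinpaths_def)
    next
      case False
      then show ?thesis by (simp add: joinpaths_def)
    qed
  qed (use p in auto)
  then show ?thesis by (rule homotopic_paths_sym)
qed

lemma homotopic_reverse_join:
  assumes "p \<in> loops X a"
  shows "homotopic_paths X (reversepath p +++ p) (\<lambda>_. a)"
proof -
  have p: "continuous_on {0..1} p" "p ` {0..1} \<subseteq> X" "p 0 = a" "p 1 = a"
    using assms by (auto simp: loops_def pathstart_def pathfinish_def path_def path_image_def)
  define g where "g = (\<lambda>y::real \<times> real. 1 - (1 - fst y) * (1 - \<bar>1 - 2 * snd y\<bar>))"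
  have g: "g y \<in> {0..1}" if "y \<in> {0..1} \<times> {0..1}" for y
  proof -
    obtain t s where y: "y = (t, s)" by (cases y)
    have "\<bar>1 - 2 * s\<bar> \<le> 1" "0 \<le> t" "t \<le> 1"
      using that y by (auto simp: abs_le_iff)
    then have "0 \<le> (1 - t) * (1 - \<bar>1 - 2 * s\<bar>)" "(1 - t) * (1 - \<bar>1 - 2 * s\<bar>) \<le> 1 * 1"
      by (intro mult_nonneg_nonneg mult_mono; simp)+
    then show ?thesis by (simp add: g_def y)
  qed
  show ?thesis
    unfolding homotopic_paths
  proof (intro exI[of _ "p \<circ> g"] conjI ballI)
    have "continuous_on ({0..1} \<times> {0..1}) g"
      unfolding g_def by (intro continuous_intros)
    then show "continuous_on ({0..1} \<times> {0..1}) (p \<circ> g)"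
      using g by (intro continuous_on_compose continuous_on_subset[OF p(1)]) auto
    show "p \<circ> g \<in> {0..1} \<times> {0..1} \<rightarrow> X"
      using g p(2) by (auto simp: Pi_iff image_subset_iff)
    show "(p \<circ> g) (0, x) = (reversepath p +++ p) x" if "x \<in> {0..1}" for x
      using that by (auto simp: g_def joinpaths_def reversepath_def)
    show "(p \<circ> g) (1, x) = a" for x
      using p by (simp add: g_def)
    show "pathstart (p \<circ> g \<circ> Pair t) = pathstart (reversepath p +++ p)"
      "pathfinish (p \<circ> g \<circ> Pair t) = pathfinish (reversepath p +++ p)" for t
      using p by (auto simp: g_def pathstart_def pathfinish_def joinpaths_def reversepath_def)
  qed
qed

lemma group_fundamental_group:
  assumes "a \<in> X"
  shows "group (fundamental_group X a)"
proof (rule groupI)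
  let ?G = "fundamental_group X a"
  have car: "carrier ?G = homotopy_class X ` loops X a"
    and one: "\<one>\<^bsub>?G\<^esub> = homotopy_class X (\<lambda>_. a)"
    by (simp_all add: fundamental_group_def)
  show "x \<otimes>\<^bsub>?G\<^esub> y \<in> carrier ?G" if "x \<in> carrier ?G" "y \<in> carrier ?G" for x y
    using that unfolding car by (auto simp: mult_homotopy_class join_loops)
  show "\<one>\<^bsub>?G\<^esub> \<in> carrier ?G"
    unfolding car one using const_loop[OF assms] by blast
  show "x \<otimes>\<^bsub>?G\<^esub> y \<otimes>\<^bsub>?G\<^esub> z = x \<otimes>\<^bsub>?G\<^esub> (y \<otimes>\<^bsub>?G\<^esub> z)"
    if xyz: "x \<in> carrier ?G" "y \<in> carrier ?G" "z \<in> carrier ?G" for x y z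
  proof -
    obtain p q r where pqr: "p \<in> loops X a" "q \<in> loops X a" "r \<in> loops X a"
      and eq: "x = homotopy_class X p" "y = homotopy_class X q" "z = homotopy_class X r"
      using xyz unfolding car by blast
    have "homotopic_paths X (p +++ (q +++ r)) ((p +++ q) +++ r)"
      using pqr by (intro homotopic_paths_assoc) (auto simp: loops_def)
    then show ?thesis
      using pqr homotopy_class_eq_iff[of "p +++ (q +++ r)" X a "(p +++ q) +++ r"]
      by (simp add: eq mult_homotopy_class join_loops)
  qed
  show "\<one>\<^bsub>?G\<^esub> \<otimes>\<^bsub>?G\<^esub> x = x" if x: "x \<in> carrier ?G" for x
  proof -
    obtain p where p: "p \<in> loops X a" "x = homotopy_class X p"
      using x unfolding car by blast
    then show ?thesis
      using homotopic_const_join[OF p(1)] const_loop[OF assms]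
        homotopy_class_eq_iff[of "(\<lambda>_. a) +++ p" X a p]
      by (simp add: one mult_homotopy_class join_loops)
  qed
  show "\<exists>y\<in>carrier ?G. y \<otimes>\<^bsub>?G\<^esub> x = \<one>\<^bsub>?G\<^esub>" if x: "x \<in> carrier ?G" for x
  proof -
    obtain p where p: "p \<in> loops X a" "x = homotopy_class X p"
      using x unfolding car by blast
    have "homotopy_class X (reversepath p) \<otimes>\<^bsub>?G\<^esub> x = \<one>\<^bsub>?G\<^esub>"
      using p reverse_loop[OF p(1)] homotopic_reverse_join[OF p(1)]
        homotopy_class_eq_iff[of "reversepath p +++ p" X a "\<lambda>_. a"]
      by (simp add: one mult_homotopy_class join_loops)
    then show ?thesis
      unfolding car using reverse_loop[OF p(1)] by blast
  qed
qed


section \<open>Double branched covers of links in the 3-sphere\<close>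

type_synonym R3 = "complex \<times> real"
type_synonym R4 = "R3 \<times> real"

abbreviation S3 :: "R4 set" where
  "S3 \<equiv> sphere 0 1"

text \<open>Away from \<open>L\<close> the map \<open>p\<close> is a two-sheeted covering.  Near each point of \<open>L\<close> it is,
  in charts that flatten \<open>L\<close> to the axis \<open>{0} \<times> \<real>\<close> of \<open>\<complex> \<times> \<real>\<close>, the map
  \<open>(z, t) \<mapsto> (z\<^sup>2, t)\<close>; in particular every meridian of \<open>L\<close> lifts to a non-closed path,
  which determines \<open>X\<close> up to homeomorphism over the sphere.\<close>

definition double_branched_cover :: "'a::topological_space set \<Rightarrow> ('a \<Rightarrow> R4) \<Rightarrow> R4 set \<Rightarrow> bool" where
  "double_branched_cover X p L \<longleftrightarrow>
     continuous_on X p \<and> p ` X \<subseteq> S3 \<and>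
     covering_space (X \<inter> p -` (S3 - L)) p (S3 - L) \<and>
     (\<forall>x\<in>S3 - L. card (X \<inter> p -` {x}) = 2) \<and>
     (\<forall>x\<in>L. \<exists>U f f' g g'.
        openin (top_of_set S3) U \<and> x \<in> U \<and>
        homeomorphism U (UNIV :: (complex \<times> real) set) f f' \<and>
        f ` (U \<inter> L) = {0} \<times> UNIV \<and>
        homeomorphism (X \<inter> p -` U) (UNIV :: (complex \<times> real) set) g g' \<and>
        (\<forall>y\<in>X \<inter> p -` U. f (p y) = ((fst (g y))\<^sup>2, snd (g y))))"

definition ambient_isotopic :: "'a::topological_space set \<Rightarrow> 'a set \<Rightarrow> 'a set \<Rightarrow> bool" where
  "ambient_isotopic S A B \<longleftrightarrow>
     (\<exists>H :: real \<times> 'a \<Rightarrow> 'a.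
        continuous_on ({0..1} \<times> S) H \<and>
        (\<forall>t\<in>{0..1}. \<exists>h. homeomorphism S S (\<lambda>x. H (t, x)) h) \<and>
        (\<forall>x\<in>S. H (0, x) = x) \<and>
        (\<lambda>x. H (1, x)) ` A = B)"

text \<open>Inverse of the stereographic projection from the north pole \<open>(0, 1)\<close>.\<close>

definition inv_stereographic :: "R3 \<Rightarrow> R4" where
  "inv_stereographic x =
     ((2 / ((norm x)\<^sup>2 + 1)) *\<^sub>R x, ((norm x)\<^sup>2 - 1) / ((norm x)\<^sup>2 + 1))"


section \<open>Weighted plane graphs and their links\<close>

text \<open>Plane graphs are given by rotation systems.  Each edge consists of two darts interchanged
  by \<open>opp\<close>; a dart issues from a vertex, and \<open>rot\<close> sends it to the counterclockwise next dart
  at that vertex.  Thus the vertices are the orbits of \<open>rot\<close>, and multiple edges and loops cause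
  no trouble.  A signed plane graph is one whose weights are all \<open>1\<close> or \<open>-1\<close>.\<close>

record 'd plane_graph =
  darts :: "'d set"
  rot :: "'d \<Rightarrow> 'd"
  opp :: "'d \<Rightarrow> 'd"
  wt :: "'d \<Rightarrow> int"

text \<open>The dart \<open>(d, j)\<close> belongs to the \<open>j\<close>-th edge (counted from \<open>0\<close>) of the path that replaces
  the edge of \<open>d\<close>, and has the direction of \<open>d\<close>.  For \<open>j > 0\<close> it starts at a vertex of degree
  two, whose other dart points back along the path.  For \<open>j = 0\<close> it starts at an old vertex, and
  edges of weight \<open>0\<close> are contracted: if \<open>e\<close> is such an edge, the dart that follows it at the
  merged vertex is \<open>rot (opp e)\<close>.\<close>

definition signed_graph :: "'d plane_graph \<Rightarrow> ('d \<times> nat) plane_graph" where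
  "signed_graph G =
     (let len = (\<lambda>d. nat \<bar>wt G d\<bar>);
          skip = (\<lambda>d. rot G (opp G d));
          next = (\<lambda>d. (skip ^^ (LEAST m. wt G ((skip ^^ m) (rot G d)) \<noteq> 0)) (rot G d))
      in \<lparr>darts = {(d, j). d \<in> darts G \<and> j < len d},
          rot = (\<lambda>(d, j). if j = 0 then (next d, 0) else (opp G d, len d - j)),
          opp = (\<lambda>(d, j). (opp G d, len d - 1 - j)),
          wt = (\<lambda>(d, j). sgn (wt G d))\<rparr>)"

text \<open>A drawing of the medial diagram of a signed plane graph, scaled so that the crossings can
  be placed in disjoint unit discs.  The edge of a dart \<open>d\<close> has its crossing at \<open>c d\<close>, where it
  runs in direction \<open>u d\<close>; so the black corners there lie in the directions \<open>u d\<close> and \<open>- u d\<close>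
  (towards the ends of the edge) and the white ones in the directions \<open>\<i> * u d\<close> and
  \<open>- \<i> * u d\<close>, and the strands are the two diagonals.  For each dart \<open>d\<close> there is one corner,
  to the left of \<open>d\<close> and to the right of \<open>rot G d\<close>, at the vertex from which both issue;
  the arc \<open>\<alpha> d\<close> runs around this corner, joining the respective ends of strands.\<close>

definition medial_drawing ::
  "'d plane_graph \<Rightarrow> ('d \<Rightarrow> complex) \<Rightarrow> ('d \<Rightarrow> complex) \<Rightarrow> ('d \<Rightarrow> real \<Rightarrow> complex) \<Rightarrow> bool" where
  "medial_drawing G c u \<alpha> \<longleftrightarrow>
     (\<forall>d\<in>darts G. c (opp G d) = c d \<and> norm (u d) = 1 \<and> u (opp G d) = - u d) \<and>
     (\<forall>d\<in>darts G. \<forall>e\<in>darts G - {d, opp G d}. cball (c d) 1 \<inter> cball (c e) 1 = {}) \<and>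
     (\<forall>d\<in>darts G. arc (\<alpha> d) \<and>
        pathstart (\<alpha> d) = c d + u d * cis (3 * pi / 4) \<and>
        pathfinish (\<alpha> d) = c (rot G d) + u (rot G d) * cis (- 3 * pi / 4)) \<and>
     (\<forall>d\<in>darts G. \<forall>e\<in>darts G.
        path_image (\<alpha> d) \<inter> cball (c e) 1 \<subseteq> {pathstart (\<alpha> d), pathfinish (\<alpha> d)}) \<and>
     (\<forall>d\<in>darts G. \<forall>e\<in>darts G. d \<noteq> e \<longrightarrow> path_image (\<alpha> d) \<inter> path_image (\<alpha> e) = {})"

text \<open>Rotating \<open>over_dir\<close> counterclockwise by a right angle gives the direction of the under-strand,
  up to sign.  It sweeps out the direction \<open>u d\<close> if the sign is \<open>1\<close>, and \<open>\<i> * u d\<close> if it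
  is \<open>-1\<close>.\<close>

definition over_dir :: "'d plane_graph \<Rightarrow> ('d \<Rightarrow> complex) \<Rightarrow> 'd \<Rightarrow> complex" where
  "over_dir G u d = (if wt G d = 1 then u d * cis (- pi / 4) else u d * cis (pi / 4))"

definition medial_lift ::
  "'d plane_graph \<Rightarrow> ('d \<Rightarrow> complex) \<Rightarrow> ('d \<Rightarrow> complex) \<Rightarrow> ('d \<Rightarrow> real \<Rightarrow> complex) \<Rightarrow> R3 set" where
  "medial_lift G c u \<alpha> =
     (\<Union>d\<in>darts G. path_image (\<alpha> d) \<times> {0}) \<union>
     (\<Union>d\<in>darts G. {(c d + s *\<^sub>R (\<i> * over_dir G u d), 0) | s. s \<in> {-1..1}}) \<union>
     (\<Union>d\<in>darts G. {(c d + s *\<^sub>R over_dir G u d, 1 - \<bar>s\<bar>) | s. s \<in> {-1..1}})"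

text \<open>A link is determined by a diagram only up to isotopy, so this is a property of \<open>L\<close>.\<close>

definition link_of_weighted_graph :: "'d plane_graph \<Rightarrow> R4 set \<Rightarrow> bool" where
  "link_of_weighted_graph G L \<longleftrightarrow>
     (\<exists>c u \<alpha>. medial_drawing (signed_graph G) c u \<alpha> \<and>
        ambient_isotopic S3 (inv_stereographic ` medial_lift (signed_graph G) c u \<alpha>) L)"


section \<open>The wheel graphs\<close>

text \<open>The edges at index \<open>i\<close> join \<open>0\<close> to \<open>x\<^sub>i\<close>, \<open>0\<close> to \<open>y\<^sub>i\<close>, \<open>x\<^sub>i\<close> to \<open>y\<^sub>i\<close>, and
  \<open>y\<^sub>i\<close> to \<open>x\<^bsub>i+1\<^esub>\<close>; the flag of a dart says whether it has this direction or the opposite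
  one.  The rim is traversed counterclockwise.\<close>

datatype wheel_edge = Spoke_x nat | Spoke_y nat | Rim_xy nat | Rim_yx nat

type_synonym wheel_dart = "wheel_edge \<times> bool"

definition cyc_next :: "nat \<Rightarrow> nat \<Rightarrow> nat" where
  "cyc_next n i = (if i = n then 1 else i + 1)"

definition cyc_prev :: "nat \<Rightarrow> nat \<Rightarrow> nat" where
  "cyc_prev n i = (if i = 1 then n else i - 1)"

fun wheel_rot :: "nat \<Rightarrow> wheel_dart \<Rightarrow> wheel_dart" where
  \<comment> \<open>at \<open>0\<close>\<close>
  "wheel_rot n (Spoke_x i, True) = (Spoke_y i, True)"
| "wheel_rot n (Spoke_y i, True) = (Spoke_x (cyc_next n i), True)"
  \<comment> \<open>at \<open>x\<^sub>i\<close>, respectively \<open>x\<^bsub>i+1\<^esub>\<close> in the third line\<close>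
| "wheel_rot n (Rim_xy i, True) = (Spoke_x i, False)"
| "wheel_rot n (Spoke_x i, False) = (Rim_yx (cyc_prev n i), False)"
| "wheel_rot n (Rim_yx i, False) = (Rim_xy (cyc_next n i), True)"
  \<comment> \<open>at \<open>y\<^sub>i\<close>\<close>
| "wheel_rot n (Rim_yx i, True) = (Spoke_y i, False)"
| "wheel_rot n (Spoke_y i, False) = (Rim_xy i, False)"
| "wheel_rot n (Rim_xy i, False) = (Rim_yx i, True)"

fun wheel_wt :: "(nat \<Rightarrow> int) \<Rightarrow> wheel_edge \<Rightarrow> int" where
  "wheel_wt k (Spoke_x i) = - 2"
| "wheel_wt k (Spoke_y i) = 1"
| "wheel_wt k (Rim_xy i) = k i"
| "wheel_wt k (Rim_yx i) = 1"

definition wheel :: "nat \<Rightarrow> (nat \<Rightarrow> int) \<Rightarrow> wheel_dart plane_graph" where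
  "wheel n k =
     \<lparr>darts = (\<Union>i\<in>{1..n}. {Spoke_x i, Spoke_y i, Rim_xy i, Rim_yx i}) \<times> UNIV,
      rot = wheel_rot n,
      opp = (\<lambda>(e, b). (e, \<not> b)),
      wt = (\<lambda>(e, b). wheel_wt k e)\<rparr>"

text \<open>\<open>L\<close> is (a representative of) the link \<open>L(k\<^sub>1, \<dots>, k\<^sub>n)\<close>.\<close>

definition is_link_L :: "nat \<Rightarrow> (nat \<Rightarrow> int) \<Rightarrow> R4 set \<Rightarrow> bool" where
  "is_link_L n k L \<longleftrightarrow> link_of_weighted_graph (wheel n k) L"

end

theory Submission
  imports Defs "HOL-Complex_Analysis.Complex_Analysis"
begin

text \<open>
  Let \<open>X\<close> be the double cover of the 3-sphere branched along \<open>L\<close>, with \<open>L\<close> drawn over its diagram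
  in the plane. The points with no point of \<open>L\<close> above them form a contractible set, and so do
  those with no point of \<open>L\<close> below them; hence \<open>X\<close> has two sheets over each of these sets. Over
  a region of the diagram each upper sheet meets exactly one lower sheet. Paths from the base
  point to the sheets (\<^emph>\<open>frames\<close>) turn this gluing into an element of \<open>\<pi>\<^sub>1\<close> for every region
  and every upper sheet, called \<open>transition\<close>. Branching along a strand relates the four
  elements belonging to the two regions beside it (\<open>adjacent\<close>), and the cover of a small cone
  between the two strands of a crossing relates the four regions there (\<open>crossing_relation\<close>).
  Eliminating one of the two upper sheets leaves one relation for each edge of the plane graph:
  if \<open>b\<close>, \<open>b'\<close> belong to its tail and head and \<open>w\<close>, \<open>w'\<close> to the faces on its left and right,
  then \<open>b' = (w w'\<inverse>)\<^sup>\<plusminus>\<^sup>1 b\<close> with the sign of the edge (\<open>black_opp\<close>), so an edge of weight \<open>k\<close>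
  contributes the \<open>k\<close>-th power (\<open>vertex_opp\<close>). That the elements depend on the regions only
  uses the Jordan curve theorem: walking along an arc of the diagram one keeps the same region
  on each side (\<open>sides_of_arc\<close>).

  For the wheel let \<open>T\<^sub>m\<close> be the quotient of the elements of the triangle at the rim edge from
  \<open>x\<^sub>m\<close> to \<open>y\<^sub>m\<close> and of the outer face, \<open>v\<^sub>m\<close> the quotient of the two triangles at the spoke of
  \<open>x\<^sub>m\<close>, and \<open>y\<^sub>m\<close> that of the last vertex of this rim edge and the hub. The relations become
  \<open>y\<^sub>m = T\<^sub>m\<^sup>k v\<^sub>m\<^sup>2\<close>, \<open>v\<^bsub>m+1\<^esub> = T\<^bsub>m+1\<^esub> y\<^sub>m\<close> and \<open>y\<^sub>m T\<^sub>m = v\<^bsub>m+1\<^esub> T\<^bsub>m+1\<^esub>\<close>, with \<open>k\<close> the weight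
  of the rim edge and \<open>m\<close> cyclic. A left order on \<open>\<pi>\<^sub>1\<close> makes the group act monotonically on
  the cuts, that is on the initial segments of the order. Suppose that \<open>T\<^sub>0\<close> fixes a proper
  nonempty cut \<open>p\<close>. If \<open>v\<^sub>0\<close> moves \<open>p\<close> up, the relations carry this around the rim
  (\<open>rim_step\<close>): there are cuts \<open>b\<^sub>m \<supseteq> p\<close>, fixed by \<open>T\<^sub>m\<close> and moved up by \<open>v\<^sub>m\<close>, with \<open>b\<^sub>m\<close>
  strictly below \<open>W\<^sub>m p\<close> for \<open>m > 0\<close>, where the product \<open>W\<^sub>m\<close> satisfies \<open>W\<^sub>m v\<^sub>0\<^sup>2 = v\<^sub>m\<^sup>2\<close>.
  After a full turn \<open>W\<^sub>n = 1\<close>, a contradiction (\<open>no_upward_cut\<close>). If \<open>v\<^sub>0\<close> moves \<open>p\<close> down the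
  same argument applies to the reversed order. If \<open>v\<^sub>0\<close> fixes \<open>p\<close>, then all \<open>T\<^sub>m\<close> and \<open>v\<^sub>m\<close> do
  (\<open>all_fixed\<close>), hence the whole group, which is absurd because it acts transitively on itself.
  If \<open>T\<^sub>0\<close> fixes no such cut, it moves all elements in the same direction, say up; the
  relations then give \<open>g < T\<^sub>n g < T\<^bsub>n-1\<^esub> g < \<dots> < T\<^sub>0 g = T\<^sub>n g\<close> (\<open>no_everywhere_positive\<close>).

  A cut fixed by all \<open>T\<^sub>m\<close> and \<open>v\<^sub>m\<close> is fixed by the group because these elements generate \<open>\<pi>\<^sub>1\<close>,
  which is shown directly for subsets instead of words. Translates of the cut are attached to
  the four sheets so that they match over all regions (\<open>fixed_by_regions_imp_fixed\<close>), and this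
  flat family of subsets extends over the rest of \<open>X\<close> (\<open>good_everywhere_fixed\<close>). Carrying a
  subset along a loop both returns it unchanged and translates it by the class of the loop
  (\<open>flat_family_fixed\<close>).
\<close>

section \<open>Left orders and the relations around the rim\<close>

locale left_order = group G for G (structure) +
  fixes r :: "('a \<times> 'a) set"
  assumes lin: "linear_order_on (carrier G) r"
    and inv: "\<lbrakk>f \<in> carrier G; g \<in> carrier G; h \<in> carrier G\<rbrakk> \<Longrightarrow>
                (g, h) \<in> r \<longleftrightarrow> (f \<otimes> g, f \<otimes> h) \<in> r"
begin

text \<open>Subsets of the group are moved by left translation. The cuts among them are compared by
  inclusion; they complete the order, so that suprema of orbits exist.\<close>

definition act :: "'a \<Rightarrow> 'a set \<Rightarrow> 'a set" where
  "act g D = (\<otimes>) g ` D"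

definition cut :: "'a set \<Rightarrow> bool" where
  "cut D \<longleftrightarrow> D \<subseteq> carrier G \<and> (\<forall>g\<in>D. \<forall>h\<in>carrier G. (h, g) \<in> r \<longrightarrow> h \<in> D)"

lemma act_act: "\<lbrakk>g \<in> carrier G; h \<in> carrier G; D \<subseteq> carrier G\<rbrakk> \<Longrightarrow> act g (act h D) = act (g \<otimes> h) D"
  unfolding act_def image_image by (intro image_cong refl) (auto simp: m_assoc)

lemma act_one: "D \<subseteq> carrier G \<Longrightarrow> act \<one> D = D"
  unfolding act_def by (rule image_cong[of D D _ "\<lambda>x. x", simplified]) (auto simp: subset_iff)

lemma act_carrier: "\<lbrakk>g \<in> carrier G; D \<subseteq> carrier G\<rbrakk> \<Longrightarrow> act g D \<subseteq> carrier G"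
  by (auto simp: act_def)

lemma act_mono: "D \<subseteq> E \<Longrightarrow> act g D \<subseteq> act g E"
  by (auto simp: act_def)

lemma act_subset_iff:
  assumes "g \<in> carrier G" "D \<subseteq> carrier G" "E \<subseteq> carrier G"
  shows "act g D \<subseteq> act g E \<longleftrightarrow> D \<subseteq> E"
proof
  assume "act g D \<subseteq> act g E"
  then have "act (inv g) (act g D) \<subseteq> act (inv g) (act g E)" by (rule act_mono)
  then show "D \<subseteq> E" using assms by (simp add: act_act act_one)
qed (rule act_mono)

lemma act_psubset_iff:
  assumes "g \<in> carrier G" "D \<subseteq> carrier G" "E \<subseteq> carrier G"
  shows "act g D \<subset> act g E \<longleftrightarrow> D \<subset> E"
  using act_subset_iff[OF assms] act_subset_iff[OF assms(1,3,2)] by (simp add: less_le_not_le)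

lemma cut_sub: "cut D \<Longrightarrow> D \<subseteq> carrier G" by (simp add: cut_def)

lemma cut_act:
  assumes "cut D" "g \<in> carrier G" shows "cut (act g D)"
  unfolding cut_def
proof (intro conjI ballI impI)
  show "act g D \<subseteq> carrier G" using assms by (simp add: act_carrier cut_def)
  fix x h assume x: "x \<in> act g D" and h: "h \<in> carrier G" "(h, x) \<in> r"
  then obtain d where d: "d \<in> D" "x = g \<otimes> d" by (auto simp: act_def)
  have dc: "d \<in> carrier G" using d assms by (auto simp: cut_def)
  have "(g \<otimes> (inv g \<otimes> h), g \<otimes> d) \<in> r"
    using h d assms(2) by (simp add: m_assoc[symmetric])
  then have "(inv g \<otimes> h, d) \<in> r"
    using inv[of g "inv g \<otimes> h" d] h assms dc by simp
  then have "inv g \<otimes> h \<in> D" using d assms h by (auto simp: cut_def)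
  then have "g \<otimes> (inv g \<otimes> h) \<in> act g D" unfolding act_def by blast
  then show "h \<in> act g D" using h assms(2) by (simp add: m_assoc[symmetric])
qed

text \<open>An element in \<open>D\<close> but not in \<open>E\<close> lies above all of \<open>E\<close>.\<close>

lemma cut_linear:
  assumes "cut D" "cut E" shows "D \<subseteq> E \<or> E \<subseteq> D"
proof (rule ccontr)
  assume "\<not> ?thesis"
  then obtain d e where "d \<in> D" "d \<notin> E" "e \<in> E" "e \<notin> D" by blast
  note de = this
  then have "d \<in> carrier G" "e \<in> carrier G" "d \<noteq> e" using assms by (auto simp: cut_def)
  then have "(d, e) \<in> r \<or> (e, d) \<in> r"
    using lin unfolding linear_order_on_def total_on_def by blast
  then show False using assms de \<open>d \<in> carrier G\<close> \<open>e \<in> carrier G\<close> unfolding cut_def by blast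
qed

lemma cut_Union: "(\<And>D. D \<in> \<D> \<Longrightarrow> cut D) \<Longrightarrow> cut (\<Union>\<D>)"
  unfolding cut_def by (meson UnionE UnionI Union_least)

lemma act_UN: "act g (\<Union>m. D m) = (\<Union>m. act g (D m))"
  by (auto simp: act_def)

lemma act_inv_fixed: "\<lbrakk>g \<in> carrier G; D \<subseteq> carrier G; act g D = D\<rbrakk> \<Longrightarrow> act (inv g) D = D"
  using act_act[of "inv g" g D] by (simp add: act_one)

lemma act_nat_pow_fixed: "\<lbrakk>g \<in> carrier G; D \<subseteq> carrier G; act g D = D\<rbrakk> \<Longrightarrow> act (g [^] (m::nat)) D = D"
proof (induction m)
  case 0 then show ?case by (simp add: act_one)
next
  case (Suc m)
  then have "act (g [^] Suc m) D = act (g [^] m) (act g D)" by (subst act_act) auto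
  then show ?case using Suc by simp
qed

lemma act_int_pow_fixed:
  assumes "g \<in> carrier G" "D \<subseteq> carrier G" "act g D = D" shows "act (g [^] (m::int)) D = D"
proof (cases m)
  case (nonneg j) then show ?thesis using assms by (simp add: int_pow_int act_nat_pow_fixed)
next
  case (neg j)
  show ?thesis unfolding neg int_pow_neg[OF assms(1)] int_pow_int
    using assms by (intro act_inv_fixed act_nat_pow_fixed) auto
qed

text \<open>The least fixed cut above \<open>p\<close> is the supremum of the iterates of \<open>p\<close>; it stays below every
  \<open>q\<close> above \<open>p\<close> that \<open>t\<close> does not move up.\<close>

lemma next_fixed_point:
  assumes t: "t \<in> carrier G" and p: "cut p" and q: "cut q"
    and up: "p \<subseteq> act t p" and bd: "p \<subset> q" "act t q \<subseteq> q"
  obtains b where "cut b" "p \<subseteq> b" "b \<subseteq> q" "act t b = b"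
proof
  let ?c = "\<lambda>m. (act t ^^ m) p"
  have cut: "cut (?c m)" for m by (induction m) (use p t cut_act in auto)
  show "cut (\<Union>m. ?c m)" using cut by (intro cut_Union) auto
  show "p \<subseteq> (\<Union>m. ?c m)" using UN_upper[of 0 UNIV ?c] by simp
  have "?c m \<subseteq> q" for m
  proof (induction m)
    case 0 show ?case using bd by auto
  next
    case (Suc m) then show ?case using act_mono[of "?c m" q t] bd by auto
  qed
  then show "(\<Union>m. ?c m) \<subseteq> q" by blast
  have "act t (\<Union>m. ?c m) = (\<Union>m. ?c (Suc m))" by (simp add: act_UN)
  moreover have "p \<subseteq> ?c (Suc 0)" using up by simp
  then have "(\<Union>m. ?c (Suc m)) = (\<Union>m. ?c m)"
  proof (intro subset_antisym)
    show "(\<Union>m. ?c m) \<subseteq> (\<Union>m. ?c (Suc m))"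
    proof (intro UN_least)
      fix m show "?c m \<subseteq> (\<Union>m. ?c (Suc m))"
      proof (cases m)
        case 0
        then have "?c m \<subseteq> ?c (Suc 0)" using \<open>p \<subseteq> ?c (Suc 0)\<close> by simp
        then show ?thesis by blast
      next
        case (Suc j) then show ?thesis by blast
      qed
    qed
    show "(\<Union>m. ?c (Suc m)) \<subseteq> (\<Union>m. ?c m)" by (intro UN_least UN_upper) simp
  qed
  ultimately show "act t (\<Union>m. ?c m) = (\<Union>m. ?c m)" by simp
qed

lemma refl_r: "x \<in> carrier G \<Longrightarrow> (x, x) \<in> r"
  using lin unfolding linear_order_on_def partial_order_on_def preorder_on_def refl_on_def by blast

lemma trans_r: "(a, b) \<in> r \<Longrightarrow> (b, c) \<in> r \<Longrightarrow> (a, c) \<in> r"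
  using lin unfolding linear_order_on_def partial_order_on_def preorder_on_def trans_def by blast

lemma antisym_r: "(a, b) \<in> r \<Longrightarrow> (b, a) \<in> r \<Longrightarrow> a = b"
  using lin unfolding linear_order_on_def partial_order_on_def antisym_def by blast

lemma total_r: "a \<in> carrier G \<Longrightarrow> b \<in> carrier G \<Longrightarrow> (a, b) \<in> r \<or> (b, a) \<in> r"
  using lin refl_r unfolding linear_order_on_def total_on_def by (cases "a = b") auto

definition below :: "'a \<Rightarrow> 'a set" where
  "below x = {z \<in> carrier G. (z, x) \<in> r}"

lemma cut_below: "cut (below x)"
  unfolding cut_def below_def using trans_r by auto

lemma below_mono: "(x, z) \<in> r \<Longrightarrow> below x \<subseteq> below z"
  unfolding below_def using trans_r by auto

lemma act_below:
  assumes fx: "f \<in> carrier G" "x \<in> carrier G"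
  shows "act f (below x) = below (f \<otimes> x)"
proof
  show "act f (below x) \<subseteq> below (f \<otimes> x)" using fx inv by (auto simp: act_def below_def)
  show "below (f \<otimes> x) \<subseteq> act f (below x)"
  proof
    fix z assume z: "z \<in> below (f \<otimes> x)"
    then have zc: "z \<in> carrier G" by (simp add: below_def)
    have e: "z = f \<otimes> (inv f \<otimes> z)" using zc fx by (simp add: m_assoc[symmetric])
    then have "inv f \<otimes> z \<in> below x"
      using z zc fx inv[of f "inv f \<otimes> z" x] by (simp add: below_def)
    then show "z \<in> act f (below x)" unfolding act_def using e by blast
  qed
qed

lemma below_proper:
  assumes nontriv: "carrier G \<noteq> {\<one>}" and h: "h \<in> carrier G"
  shows "below h \<noteq> carrier G"
proof -
  obtain a where a: "a \<in> carrier G" "a \<noteq> \<one>" using nontriv one_closed by blast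
  obtain c where c: "c \<in> carrier G" "c \<noteq> \<one>" "(\<one>, c) \<in> r"
  proof (cases "(\<one>, a) \<in> r")
    case False
    then have "(a, \<one>) \<in> r" using total_r a by blast
    then have "(\<one>, inv a) \<in> r" using inv[of "inv a" a \<one>] a by simp
    then show ?thesis using that[of "inv a"] a by simp
  qed (use a that in blast)
  have "(h, h \<otimes> c) \<in> r" using inv[of h \<one> c] h c by simp
  moreover have "h \<otimes> c \<noteq> h" using h c by simp
  ultimately have "(h \<otimes> c, h) \<notin> r" using antisym_r by blast
  then show ?thesis using h c unfolding below_def by blast
qed

text \<open>Between an element that \<open>t\<close> moves up and a larger one that it moves down, the order must be
  cut by a fixed point of \<open>t\<close>.\<close>

lemma fixed_cut_between:
  assumes "carrier G \<noteq> {\<one>}" and t: "t \<in> carrier G"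
    and g: "g \<in> carrier G" "(g, t \<otimes> g) \<in> r" and h: "h \<in> carrier G" "(t \<otimes> h, h) \<in> r"
    and gh: "(g, h) \<in> r"
  obtains p where "cut p" "act t p = p" "p \<noteq> {}" "p \<noteq> carrier G"
proof -
  have up: "below g \<subseteq> act t (below g)" and dn: "act t (below h) \<subseteq> below h"
    using below_mono g h t by (simp_all add: act_below)
  have le: "below g \<subseteq> below h" using below_mono gh by blast
  obtain p where p: "cut p" "below g \<subseteq> p" "p \<subseteq> below h" "act t p = p"
  proof (cases "below g = below h")
    case True then show ?thesis using that[of "below g"] up dn cut_below by auto
  next
    case False
    then show ?thesis using next_fixed_point[OF t cut_below cut_below up _ dn] le that by blast
  qed
  moreover have "g \<in> p" using p(2) refl_r[OF g(1)] g(1) by (auto simp: below_def)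
  moreover have "p \<noteq> carrier G" using p(3) below_proper[OF assms(1) h(1)] by (auto simp: below_def)
  ultimately show ?thesis using that by blast
qed

text \<open>Passing from \<open>t\<close> to its inverse exchanges the directions, which reduces to the case \<open>g \<le> h\<close>.\<close>

lemma fixed_cut_exists:
  assumes nt: "carrier G \<noteq> {\<one>}" and t: "t \<in> carrier G"
    and g: "g \<in> carrier G" "(g, t \<otimes> g) \<in> r" and h: "h \<in> carrier G" "(t \<otimes> h, h) \<in> r"
  obtains p where "cut p" "act t p = p" "p \<noteq> {}" "p \<noteq> carrier G"
proof (cases "(g, h) \<in> r")
  case True
  then show ?thesis using fixed_cut_between[OF nt t g h] that by blast
next
  case False
  then have hg: "(h, g) \<in> r" using total_r g h by blast
  have h': "(h, inv t \<otimes> h) \<in> r" using inv[of "inv t" "t \<otimes> h" h] h t by (simp add: m_assoc[symmetric])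
  have g': "(inv t \<otimes> g, g) \<in> r" using inv[of "inv t" g "t \<otimes> g"] g t by (simp add: m_assoc[symmetric])
  obtain p where "cut p" "act (inv t) p = p" "p \<noteq> {}" "p \<noteq> carrier G"
    using fixed_cut_between[OF nt inv_closed[OF t] h(1) h' g(1) g' hg] by blast
  then show ?thesis using that act_inv_fixed[of "inv t" p] t cut_sub by auto
qed

text \<open>One step around the rim. Since \<open>y = T\<^sup>k v\<^sup>2\<close>, the cut \<open>y p\<close> lies above \<open>p\<close>. The relations
  give \<open>T' (y p) = v' p\<close> and \<open>y p = v' (T' p)\<close>, so \<open>T'\<close> moves \<open>p\<close> and \<open>y p\<close> in opposite
  directions, or fixes \<open>p\<close>. In the first case it has a fixed cut \<open>b\<close> between the two, and
  \<open>b < v' p \<le> v' b\<close>; in the second case \<open>b = p\<close>.\<close>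

lemma rim_step:
  assumes g: "T \<in> carrier G" "v \<in> carrier G" "T' \<in> carrier G" "v' \<in> carrier G" "y \<in> carrier G"
    and y: "y = T [^] (k::int) \<otimes> (v \<otimes> v)" and v': "v' = T' \<otimes> y" and yT: "y \<otimes> T = v' \<otimes> T'"
    and p: "cut p" "act T p = p" "p \<subset> act v p"
  obtains b where "cut b" "p \<subseteq> b" "act T' b = b" "b \<subset> act v' b" "b \<subset> act y p"
proof -
  note cs = cut_sub[OF p(1)] cut_act[OF p(1)]
  have sub [simp]: "p \<subseteq> carrier G" "\<And>g. g \<in> carrier G \<Longrightarrow> act g p \<subseteq> carrier G"
    using cs act_carrier by auto
  define r where "r = act y p"
  have r: "cut r" "r \<subseteq> carrier G" unfolding r_def using g p cut_act act_carrier by auto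
  have "act v p \<subset> act v (act v p)" using p g by (simp add: act_psubset_iff)
  then have "p \<subset> act (v \<otimes> v) p" using p g by (simp add: act_act)
  then have "act (T [^] k) p \<subset> act (T [^] k) (act (v \<otimes> v) p)"
    using g by (simp add: act_psubset_iff)
  then have pr: "p \<subset> r"
    unfolding r_def y using g p by (simp add: act_act act_int_pow_fixed)
  have Tr: "act T' r = act v' p" unfolding r_def v' using g by (simp add: act_act)
  have "r = act y (act T p)" unfolding r_def using p by simp
  also have "\<dots> = act v' (act T' p)" using g yT by (simp add: act_act)
  finally have r2: "r = act v' (act T' p)" .
  have vp: "p \<subset> act v' p"
  proof (rule ccontr)
    assume "\<not> p \<subset> act v' p"
    then have le: "act v' p \<subseteq> p" using cut_linear[OF p(1) cut_act[OF p(1) g(4)]] by blast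
    have "act v' (act v' p) \<subseteq> p" using act_mono[OF le, of v'] le by blast
    moreover have "v' \<otimes> v' = y \<otimes> (T \<otimes> y)"
    proof -
      have "v' \<otimes> v' = (v' \<otimes> T') \<otimes> y" unfolding v' using g by (simp add: m_assoc)
      then show ?thesis using yT[symmetric] g by (simp add: m_assoc)
    qed
    ultimately have "act y (act T r) \<subseteq> p" using g unfolding r_def by (simp add: act_act)
    moreover have "act T p \<subseteq> act T r" "p \<subseteq> act T r"
      using act_mono[of p r T] pr p(2) by auto
    ultimately have "act y p \<subseteq> p" using act_mono[of p "act T r" y] by blast
    then show False using pr unfolding r_def by blast
  qed
  consider "act T' p = p" | "act T' p \<subset> p" | "p \<subset> act T' p"
    using cut_linear[OF p(1) cut_act[OF p(1) g(3)]] by blast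
  then show ?thesis
  proof cases
    case 1
    with vp pr p show ?thesis by (intro that[of p]) (auto simp: r_def)
  next
    case 2
    have up: "r \<subset> act T' r" unfolding Tr using 2 g r2
      by (metis act_psubset_iff sub)
    have invT: "act (inv T') (act T' D) = D" if "D \<subseteq> carrier G" for D
      using that g by (simp add: act_act act_one)
    obtain b where b: "cut b" "p \<subseteq> b" "b \<subseteq> r" "act (inv T') b = b"
    proof (rule next_fixed_point[of "inv T'" p r])
      show "p \<subseteq> act (inv T') p" using act_mono[of "act T' p" p "inv T'"] 2 invT[of p] by auto
      show "act (inv T') r \<subseteq> r" using act_mono[of r "act T' r" "inv T'"] up invT[of r] r by auto
    qed (use g p r pr in auto)
    have Tb: "act T' b = b" using act_inv_fixed[of "inv T'" b] b g cut_sub by auto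
    have br: "b \<subset> r" using b Tb up by auto
    have "b \<subset> act v' p" using act_mono[of b r T'] br up unfolding Tb Tr by blast
    then have "b \<subset> act v' b" using act_mono[of p b v'] b by blast
    then show ?thesis using that[of b] b Tb br by (simp add: r_def)
  next
    case 3
    have dn: "act T' r \<subset> r" unfolding Tr using 3 g r2
      by (metis act_psubset_iff sub)
    obtain b where b: "cut b" "p \<subseteq> b" "b \<subseteq> r" "act T' b = b"
      using next_fixed_point[of T' p r] g p r pr 3 dn by blast
    have br: "b \<subset> r" using b dn by auto
    have "act T' b \<subset> act T' r" using act_psubset_iff[of T' b r] br r g cut_sub[OF b(1)] by auto
    then have "b \<subset> act v' p" using b Tr by auto
    then have "b \<subset> act v' b" using act_mono[of p b v'] b by blast
    then show ?thesis using that[of b] b br by (simp add: r_def)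
  qed
qed

end

text \<open>Indices count the steps around the rim; \<open>T' = T (Suc m)\<close> and so on, and step \<open>n\<close> closes up.\<close>

locale rim_relations = left_order +
  fixes n :: nat and k :: "nat \<Rightarrow> int" and T v y :: "nat \<Rightarrow> 'a"
  assumes n: "n \<ge> 1"
    and carr: "\<And>m. T m \<in> carrier G" "\<And>m. v m \<in> carrier G" "\<And>m. y m \<in> carrier G"
    and cyc: "T n = T 0" "v n = v 0"
    and y: "\<And>m. m < n \<Longrightarrow> y m = T m [^] k m \<otimes> (v m \<otimes> v m)"
    and v: "\<And>m. m < n \<Longrightarrow> v (Suc m) = T (Suc m) \<otimes> y m"
    and yT: "\<And>m. m < n \<Longrightarrow> y m \<otimes> T m = v (Suc m) \<otimes> T (Suc m)"
begin

text \<open>The product that compares the starting point of the walk around the rim with its position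
  after \<open>m\<close> steps; the closing condition makes \<open>W n\<close> trivial.\<close>

primrec W :: "nat \<Rightarrow> 'a" where
  "W 0 = \<one>"
| "W (Suc m) = y m \<otimes> T m \<otimes> T m [^] k m \<otimes> W m"

lemma W_carrier [simp]: "W m \<in> carrier G"
  by (induction m) (auto simp: carr)

lemma W_v: "m \<le> n \<Longrightarrow> W m \<otimes> (v 0 \<otimes> v 0) = v m \<otimes> v m"
proof (induction m)
  case 0 then show ?case by (simp add: carr)
next
  case (Suc m)
  have "W (Suc m) \<otimes> (v 0 \<otimes> v 0) = (y m \<otimes> T m) \<otimes> (T m [^] k m \<otimes> (W m \<otimes> (v 0 \<otimes> v 0)))"
    by (simp add: carr m_assoc)
  also have "\<dots> = (y m \<otimes> T m) \<otimes> (T m [^] k m \<otimes> (v m \<otimes> v m))" using Suc by simp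
  also have "\<dots> = (v (Suc m) \<otimes> T (Suc m)) \<otimes> y m"
    using Suc.prems y[of m] yT[of m] by simp
  also have "\<dots> = v (Suc m) \<otimes> v (Suc m)"
    using Suc.prems v[of m] by (simp add: carr m_assoc)
  finally show ?case .
qed

lemma W_n: "W n = \<one>"
  using W_v[of n] cyc l_cancel_one[of "v 0 \<otimes> v 0" "W n"] carr by simp

text \<open>The cut found after \<open>m\<close> steps lies between \<open>p\<close> and \<open>W m p\<close>, strictly below the latter as
  soon as \<open>m > 0\<close>, while \<open>W n p = p\<close>.\<close>

lemma no_upward_cut:
  assumes p: "cut p" "act (T 0) p = p" "p \<subset> act (v 0) p"
  shows False
proof -
  have "\<exists>b. cut b \<and> p \<subseteq> b \<and> act (T m) b = b \<and> b \<subset> act (v m) b \<and> (m > 0 \<longrightarrow> b \<subset> act (W m) p)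
           \<and> b \<subseteq> act (W m) p"
    if "m \<le> n" for m
    using that
  proof (induction m)
    case 0 show ?case using p by (auto intro!: exI[of _ p] simp: act_one cut_sub)
  next
    case (Suc m)
    then obtain b where b: "cut b" "p \<subseteq> b" "act (T m) b = b" "b \<subset> act (v m) b" "b \<subseteq> act (W m) p"
      by auto
    obtain c where c: "cut c" "b \<subseteq> c" "act (T (Suc m)) c = c" "c \<subset> act (v (Suc m)) c" "c \<subset> act (y m) b"
      using rim_step[OF carr(1) carr(2) carr(1) carr(2) carr(3) y v yT b(1,3,4)] Suc.prems
      by (metis Suc_le_lessD)
    have "act (y m \<otimes> T m \<otimes> T m [^] k m) b = act (y m) (act (T m) (act (T m [^] k m) b))"
      using cut_sub[OF b(1)] by (simp add: act_act carr m_assoc act_carrier)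
    also have "\<dots> = act (y m) b"
      using b cut_sub[OF b(1)] act_int_pow_fixed[of "T m" b "k m"] by (simp add: carr)
    finally have "c \<subset> act (y m \<otimes> T m \<otimes> T m [^] k m) b" using c by simp
    also have "\<dots> \<subseteq> act (y m \<otimes> T m \<otimes> T m [^] k m) (act (W m) p)" by (rule act_mono[OF b(5)])
    also have "\<dots> = act (W (Suc m)) p" using cut_sub[OF p(1)] by (simp add: act_act carr)
    finally show ?case using c b by blast
  qed
  from this[of n] n obtain b where "p \<subseteq> b" "b \<subset> act (W n) p" by auto
  then show False using cut_sub[OF p(1)] by (simp add: W_n act_one)
qed

text \<open>Descending induction: \<open>y\<^sub>m T\<^sub>m = T\<^bsub>m+1\<^esub> y\<^sub>m T\<^bsub>m+1\<^esub>\<close>, so if \<open>T\<^bsub>m+1\<^esub>\<close> moves everything up,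
  then \<open>T\<^sub>m g\<close> lies above \<open>T\<^bsub>m+1\<^esub> g\<close>.\<close>

lemma no_everywhere_positive:
  assumes "\<And>g. g \<in> carrier G \<Longrightarrow> (g, T n \<otimes> g) \<in> r - Id"
  shows False
proof -
  have tr: "(a, c) \<in> r - Id" if "(a, b) \<in> r - Id" "(b, c) \<in> r - Id" for a b c
    using that lin unfolding linear_order_on_def partial_order_on_def preorder_on_def trans_def antisym_def
    by blast
  have inv': "(f \<otimes> g, f \<otimes> h) \<in> r - Id" if "(g, h) \<in> r - Id" "f \<in> carrier G" "g \<in> carrier G" "h \<in> carrier G" for f g h
    using that inv[of f g h] by auto
  \<comment> \<open>the second conjunct compares with the start of the walk, to be contradicted by \<open>T n = T 0\<close>\<close>
  have "\<forall>g\<in>carrier G. (g, T (n - j) \<otimes> g) \<in> r - Id \<and> (j > 0 \<longrightarrow> (T n \<otimes> g, T (n - j) \<otimes> g) \<in> r - Id)" if "j \<le> n" for j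
    using that
  proof (induction j)
    case 0 show ?case using assms by auto
  next
    case (Suc j)
    define m where "m = n - Suc j"
    have m: "m < n" "n - j = Suc m" using Suc.prems by (auto simp: m_def)
    show ?case
    proof
      fix g assume g: "g \<in> carrier G"
      define h where "h = y m \<otimes> (T (Suc m) \<otimes> g)"
      have IH: "(x, T (Suc m) \<otimes> x) \<in> r - Id" if "x \<in> carrier G" for x
        using Suc m that by auto
      have "T m = inv (y m) \<otimes> (T (Suc m) \<otimes> (y m \<otimes> T (Suc m)))"
      proof -
        have "y m \<otimes> T m = T (Suc m) \<otimes> (y m \<otimes> T (Suc m))"
          using yT[OF m(1)] v[OF m(1)] by (simp add: carr m_assoc)
        then show ?thesis by (metis carr inv_solve_left m_closed)
      qed
      then have Tg: "T m \<otimes> g = inv (y m) \<otimes> (T (Suc m) \<otimes> h)"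
        unfolding h_def using g by (simp add: carr m_assoc)
      have hc: "h \<in> carrier G" using g by (simp add: h_def carr)
      have "inv (y m) \<otimes> h = T (Suc m) \<otimes> g"
        unfolding h_def using g carr by (simp add: m_assoc[symmetric])
      then have gt: "(T (Suc m) \<otimes> g, T m \<otimes> g) \<in> r - Id"
        using inv'[OF IH[OF hc], of "inv (y m)"] hc by (simp add: Tg carr)
      have "(g, T m \<otimes> g) \<in> r - Id" using tr[OF IH[OF g] gt] .
      moreover have "(T n \<otimes> g, T m \<otimes> g) \<in> r - Id"
      proof (cases "j = 0")
        case True then show ?thesis using gt m by simp
      next
        case False
        then have "(T n \<otimes> g, T (Suc m) \<otimes> g) \<in> r - Id" using Suc m g by auto
        then show ?thesis using gt tr by blast
      qed
      ultimately show "(g, T (n - Suc j) \<otimes> g) \<in> r - Id \<and> (0 < Suc j \<longrightarrow> (T n \<otimes> g, T (n - Suc j) \<otimes> g) \<in> r - Id)"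
        by (simp add: m_def)
    qed
  qed
  from this[of n] n have "(T n \<otimes> \<one>, T 0 \<otimes> \<one>) \<in> r - Id" by force
  then show False using cyc by simp
qed

text \<open>If \<open>T\<^sub>m\<close> and \<open>v\<^sub>m\<close> fix \<open>p\<close>, so do \<open>y\<^sub>m\<close> and \<open>v\<^bsub>m+1\<^esub>\<^sup>2 = y\<^sub>m T\<^sub>m y\<^sub>m\<close>. As cuts are linearly
  ordered, an element whose square fixes a cut fixes it as well.\<close>

lemma all_fixed:
  assumes p: "cut p" "act (T 0) p = p" "act (v 0) p = p" and m: "m \<le> n"
  shows "act (T m) p = p \<and> act (v m) p = p"
  using m
proof (induction m)
  case 0 then show ?case using p by simp
next
  case (Suc m)
  note pc = cut_sub[OF p(1)]
  have IH: "act (T m) p = p" "act (v m) p = p" and mn: "m < n" using Suc by auto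
  have yp: "act (y m) p = p"
    unfolding y[OF mn] using IH pc by (simp add: act_act[symmetric] carr act_int_pow_fixed)
  have vp: "act (v (Suc m)) p = p"
  proof -
    have c: "cut (act (v (Suc m)) p)" using cut_act p carr by blast
    have "v (Suc m) \<otimes> v (Suc m) = y m \<otimes> (T m \<otimes> y m)"
      using yT[OF mn] v[OF mn] carr by (metis m_assoc)
    then have vv: "act (v (Suc m)) (act (v (Suc m)) p) = p"
      using IH yp pc by (simp add: act_act carr) (simp add: act_act[symmetric] carr)
    then show ?thesis
      using cut_linear[OF p(1) c] act_mono[of p "act (v (Suc m)) p" "v (Suc m)"]
        act_mono[of "act (v (Suc m)) p" p "v (Suc m)"] by auto
  qed
  have "act (T (Suc m)) p = act (T (Suc m)) (act (y m) p)" using yp by simp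
  also have "\<dots> = act (v (Suc m)) p" using v[OF mn] pc by (simp add: act_act carr)
  finally show ?case using vp by simp
qed

lemma transitive_on_points:
  assumes D: "D \<subseteq> carrier G" "D \<noteq> {}" and fixed: "\<And>g. g \<in> carrier G \<Longrightarrow> act g D = D"
  shows "D = carrier G"
proof
  obtain d where d: "d \<in> D" using D by blast
  show "carrier G \<subseteq> D"
  proof
    fix g assume g: "g \<in> carrier G"
    have dc: "d \<in> carrier G" using d D by blast
    then have "(g \<otimes> inv d) \<otimes> d \<in> act (g \<otimes> inv d) D" unfolding act_def using d by blast
    then show "g \<in> D" using fixed[of "g \<otimes> inv d"] g dc by (simp add: m_assoc)
  qed
qed (rule D)

end

lemma (in left_order) left_order_converse: "left_order G (r\<inverse>)"
proof
  show "linear_order_on (carrier G) (r\<inverse>)" using lin by simp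
qed (use inv in auto)

lemma (in rim_relations) rim_relations_converse: "rim_relations G (r\<inverse>) n k T v y"
  using left_order_converse n carr cyc y v yT
  by (simp add: rim_relations_def rim_relations_axioms_def)

context rim_relations
begin

text \<open>The complement of a cut is a cut for the reversed order, which turns a cut that is moved
  down into one that is moved up.\<close>

lemma no_fixed_cut:
  assumes gen: "\<And>D. D \<subseteq> carrier G \<Longrightarrow> (\<And>m. m \<le> n \<Longrightarrow> act (T m) D = D \<and> act (v m) D = D) \<Longrightarrow>
      (\<And>g. g \<in> carrier G \<Longrightarrow> act g D = D)"
    and p: "cut p" "act (T 0) p = p" "p \<noteq> {}" "p \<noteq> carrier G"
  shows False
proof -
  interpret rev: rim_relations G "r\<inverse>" n k T v y by (rule rim_relations_converse)
  have pc: "p \<subseteq> carrier G" using p cut_sub by blast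
  have compl: "act g (carrier G - p) = carrier G - act g p" if g: "g \<in> carrier G" for g
  proof -
    have "act g (carrier G) = carrier G"
    proof
      show "carrier G \<subseteq> act g (carrier G)"
      proof
        fix x assume "x \<in> carrier G"
        then have "g \<otimes> (inv g \<otimes> x) \<in> act g (carrier G)" unfolding act_def using g by blast
        then show "x \<in> act g (carrier G)" using g \<open>x \<in> carrier G\<close> by (simp add: m_assoc[symmetric])
      qed
    qed (use g in \<open>auto simp: act_def\<close>)
    moreover have "inj_on ((\<otimes>) g) (carrier G)" using g by (auto intro!: inj_onI)
    ultimately show ?thesis unfolding act_def
      using inj_on_image_set_diff[of "(\<otimes>) g" "carrier G" "carrier G" p] pc by auto
  qed
  have revcut: "rev.cut (carrier G - p)"
    unfolding rev.cut_def
  proof (intro conjI ballI impI)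
    fix g h assume "g \<in> carrier G - p" "h \<in> carrier G" "(h, g) \<in> r\<inverse>"
    then show "h \<in> carrier G - p" using p(1) unfolding cut_def by blast
  qed blast
  consider "p \<subset> act (v 0) p" | "act (v 0) p \<subset> p" | "act (v 0) p = p"
    using cut_linear[OF p(1) cut_act[OF p(1) carr(2)[of 0]]] by blast
  then show False
  proof cases
    case 1
    then show False using no_upward_cut p by blast
  next
    case 2
    have "carrier G - p \<subset> rev.act (v 0) (carrier G - p)"
      using 2 pc by (subst compl) (auto simp: carr)
    moreover have "rev.act (T 0) (carrier G - p) = carrier G - p"
      using p by (subst compl) (auto simp: carr)
    ultimately show False using rev.no_upward_cut[OF revcut] by blast
  next
    case 3
    have "act g p = p" if "g \<in> carrier G" for g
      by (rule gen[OF pc all_fixed[OF p(1,2) 3] that])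
    then show False using transitive_on_points[OF pc p(3)] p(4) by blast
  qed
qed

theorem rim_relations_contradiction:
  assumes gen: "\<And>D. D \<subseteq> carrier G \<Longrightarrow> (\<And>m. m \<le> n \<Longrightarrow> act (T m) D = D \<and> act (v m) D = D) \<Longrightarrow>
      (\<And>g. g \<in> carrier G \<Longrightarrow> act g D = D)"
  shows "carrier G = {\<one>}"
proof (rule ccontr)
  assume nt: "carrier G \<noteq> {\<one>}"
  interpret rev: rim_relations G "r\<inverse>" n k T v y by (rule rim_relations_converse)
  have T: "T 0 \<in> carrier G" by (simp add: carr)
  have no: "\<not> ((g, T 0 \<otimes> g) \<in> r \<and> (T 0 \<otimes> h, h) \<in> r)" if gh: "g \<in> carrier G" "h \<in> carrier G" for g h
  proof
    assume "(g, T 0 \<otimes> g) \<in> r \<and> (T 0 \<otimes> h, h) \<in> r"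
    then obtain p where p: "cut p" "act (T 0) p = p" "p \<noteq> {}" "p \<noteq> carrier G"
      using fixed_cut_exists[OF nt T gh(1) _ gh(2)] by blast
    show False by (rule no_fixed_cut[OF gen p])
  qed
  have tot: "(g, T 0 \<otimes> g) \<in> r \<or> (T 0 \<otimes> g, g) \<in> r" if "g \<in> carrier G" for g
    using total_r that T by simp
  have neq: "T 0 \<otimes> g \<noteq> g" if "g \<in> carrier G" for g
    using no[OF that that] refl_r[OF that] by auto
  show False
  proof (cases "(\<one>, T 0 \<otimes> \<one>) \<in> r")
    case True
    then have "(g, T 0 \<otimes> g) \<in> r - Id" if "g \<in> carrier G" for g
      using that no[of \<one> g] tot[OF that] neq[OF that] by auto
    then show False using no_everywhere_positive cyc by auto
  next
    case False
    then have "(T 0 \<otimes> \<one>, \<one>) \<in> r" using tot by blast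
    then have "(T 0 \<otimes> g, g) \<in> r - Id" if "g \<in> carrier G" for g
      using that no[of g \<one>] tot[OF that] neq[OF that] by auto
    then show False using rev.no_everywhere_positive cyc by force
  qed
qed

end

text \<open>The relations of the wheel, in terms of group elements \<open>FT i\<close> and \<open>FU i\<close> of the triangular
  faces to the left of the spokes to \<open>x\<^sub>i\<close> and \<open>y\<^sub>i\<close>, \<open>FO\<close> of the outer face, \<open>bx i\<close> and
  \<open>by i\<close> of the rim vertices, and \<open>b0\<close> of the hub. Step \<open>m\<close> of the walk corresponds to index
  \<open>m + 1\<close> modulo \<open>n\<close>, and \<open>pidx m\<close> is the index before it. The last assumption expresses
  that the quotients of the face elements generate the group.\<close>

lemma (in group) wheel_relations_not_left_orderable:
  fixes n :: nat and k :: "nat \<Rightarrow> int" and FT FU bx "by" :: "nat \<Rightarrow> 'a" and FO b0 :: 'a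
  assumes n: "n \<ge> 1"
    and carr [simp]: "\<And>i. FT i \<in> carrier G" "\<And>i. FU i \<in> carrier G" "FO \<in> carrier G"
      "\<And>i. bx i \<in> carrier G" "\<And>i. by i \<in> carrier G" "b0 \<in> carrier G"
    and rim_xy: "\<And>i. i \<in> {1..n} \<Longrightarrow> by i = (FT i \<otimes> inv FO) [^] k i \<otimes> bx i"
    and rim_yx: "\<And>i. i \<in> {1..n} \<Longrightarrow> bx (cyc_next n i) = FU i \<otimes> inv FO \<otimes> by i"
    and spoke_x: "\<And>i. i \<in> {1..n} \<Longrightarrow> bx (cyc_next n i) = (FT (cyc_next n i) \<otimes> inv FU i) [^] (- 2 :: int) \<otimes> b0"
    and spoke_y: "\<And>i. i \<in> {1..n} \<Longrightarrow> by i = FU i \<otimes> inv FT i \<otimes> b0"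
    and gen: "\<And>D. D \<subseteq> carrier G \<Longrightarrow>
        (\<And>i. i \<in> {1..n} \<Longrightarrow> (\<otimes>) (FT i \<otimes> inv FO) ` D = D \<and> (\<otimes>) (FU i \<otimes> inv FO) ` D = D) \<Longrightarrow>
        (\<And>g. g \<in> carrier G \<Longrightarrow> (\<otimes>) g ` D = D)"
  shows "\<not> left_orderable G"
proof
  assume "left_orderable G"
  then obtain r where nt: "carrier G \<noteq> {\<one>}" and lin: "linear_order_on (carrier G) r"
    and inv: "\<And>f g h. f \<in> carrier G \<Longrightarrow> g \<in> carrier G \<Longrightarrow> h \<in> carrier G \<Longrightarrow>
        (g, h) \<in> r \<longleftrightarrow> (f \<otimes> g, f \<otimes> h) \<in> r"
    unfolding left_orderable_def by blast
  interpret left_order G r using lin inv by unfold_locales auto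
  define idx where "idx m = (if m < n then Suc m else 1)" for m
  define pidx where "pidx m = (if m = 0 \<or> m \<ge> n then n else m)" for m
  have idx: "idx m \<in> {1..n}" "pidx m \<in> {1..n}" for m using n by (auto simp: idx_def pidx_def)
  have nx: "cyc_next n (pidx m) = idx m" if "m \<le> n" for m
    using n that by (auto simp: idx_def pidx_def cyc_next_def)
  have pidx_Suc: "pidx (Suc m) = idx m" if "m < n" for m
    using that by (auto simp: idx_def pidx_def)
  define T where "T m = FT (idx m) \<otimes> inv FO" for m
  define v where "v m = FU (pidx m) \<otimes> inv FT (idx m)" for m
  define y where "y m = by (idx m) \<otimes> inv b0" for m
  have Tc [simp]: "T m \<in> carrier G" and vc [simp]: "v m \<in> carrier G" and yc [simp]: "y m \<in> carrier G" for m
    by (simp_all add: T_def v_def y_def)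
  have cancel: "a \<otimes> inv b \<otimes> (b \<otimes> c) = a \<otimes> c"
    if "a \<in> carrier G" "b \<in> carrier G" "c \<in> carrier G" for a b c
  proof -
    have "inv b \<otimes> (b \<otimes> c) = c" using that m_assoc[of "inv b" b c] by simp
    then show ?thesis using that by (simp add: m_assoc)
  qed
  have yFF: "y m = FU (idx m) \<otimes> inv FT (idx m)" for m
    unfolding y_def spoke_y[OF idx(1)] by (simp add: m_assoc)
  have vv: "bx (idx m) = v m \<otimes> v m \<otimes> b0" if "m \<le> n" for m
  proof -
    define q where "q = FT (idx m) \<otimes> inv FU (pidx m)"
    have q: "q \<in> carrier G" by (simp add: q_def)
    have "bx (idx m) = q [^] (- 2 :: int) \<otimes> b0"
      using spoke_x[OF idx(2)[of m]] that by (simp add: nx q_def)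
    moreover have "q [^] (- 2 :: int) = inv (q \<otimes> q)"
      using int_pow_neg_int[OF q, of 2] by (simp add: numeral_2_eq_2 q)
    moreover have "inv q = v m" by (simp add: q_def v_def inv_mult_group)
    ultimately show ?thesis using q by (simp add: inv_mult_group)
  qed
  interpret rim_relations G r n "\<lambda>m. k (idx m)" T v y
  proof
    show "T n = T 0" "v n = v 0" using n by (simp_all add: T_def v_def idx_def pidx_def)
    fix m assume m: "m < n"
    show y1: "y m = T m [^] k (idx m) \<otimes> (v m \<otimes> v m)"
      unfolding y_def rim_xy[OF idx(1)] T_def[symmetric]
    proof -
      have "bx (idx m) \<otimes> inv b0 = v m \<otimes> v m" using vv[of m] m by (simp add: m_assoc)
      then show "T m [^] k (idx m) \<otimes> bx (idx m) \<otimes> inv b0 = T m [^] k (idx m) \<otimes> (v m \<otimes> v m)"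
        by (simp add: m_assoc)
    qed
    have U: "FU (idx m) \<otimes> inv FO = y m \<otimes> T m"
      unfolding yFF T_def by (simp add: cancel)
    have vT: "v (Suc m) \<otimes> T (Suc m) = FU (idx m) \<otimes> inv FO"
      unfolding v_def T_def pidx_Suc[OF m] by (simp add: cancel)
    show "y m \<otimes> T m = v (Suc m) \<otimes> T (Suc m)" using U vT by simp
    have "v (Suc m) \<otimes> v (Suc m) \<otimes> b0 = bx (cyc_next n (idx m))"
      using vv[of "Suc m"] m nx[of "Suc m"] by (simp add: pidx_Suc)
    also have "\<dots> = v (Suc m) \<otimes> T (Suc m) \<otimes> (y m \<otimes> b0)"
      unfolding rim_yx[OF idx(1)] vT by (simp add: y_def m_assoc)
    finally show "v (Suc m) = T (Suc m) \<otimes> y m" by (simp add: m_assoc) (simp add: m_assoc[symmetric])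
  qed (use n in auto)
  have "carrier G = {\<one>}"
  proof (rule rim_relations_contradiction)
    fix D g assume D: "D \<subseteq> carrier G" and fx: "\<And>m. m \<le> n \<Longrightarrow> act (T m) D = D \<and> act (v m) D = D"
      and g: "g \<in> carrier G"
    show "act g D = D" unfolding act_def
    proof (rule gen[OF D _ g])
      fix i assume i: "i \<in> {1..n}"
      have ii: "idx (i - 1) = i" using i by (auto simp: idx_def)
      have T: "FT i \<otimes> inv FO = T (i - 1)" by (simp only: T_def ii)
      have "pidx i = i" using i by (auto simp: pidx_def)
      then have U: "FU i \<otimes> inv FO = v i \<otimes> T i"
        unfolding v_def T_def by (simp add: cancel)
      have "act (v i \<otimes> T i) D = act (v i) (act (T i) D)" using D by (simp add: act_act)
      also have "\<dots> = D" using fx[of i] i by simp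
      finally have 1: "(\<otimes>) (v i \<otimes> T i) ` D = D" by (simp only: act_def)
      have "i - 1 \<le> n" using i by auto
      then have 2: "(\<otimes>) (T (i - 1)) ` D = D" using fx by (auto simp only: act_def)
      show "(\<otimes>) (FT i \<otimes> inv FO) ` D = D \<and> (\<otimes>) (FU i \<otimes> inv FO) ` D = D"
        by (simp only: T U 1 2)
    qed
  qed
  then show False using nt by blast
qed

section \<open>Winding numbers and the two sides of an arc\<close>

text \<open>Seen from a point left of its midpoint, closer to it than half the length of the segment,
  the segment subtends an angle between a right angle and a straight one.\<close>

lemma winding_number_linepath_left:
  fixes p q :: complex
  assumes "p \<noteq> q" "0 < s" "s < 1 / 2"
  defines "z \<equiv> midpoint p q + s *\<^sub>R (\<i> * (q - p))"
  shows "z \<notin> path_image (linepath p q)"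
    and "Re (winding_number (linepath p q) z) \<in> {1/4..<1/2}"
proof -
  have qz: "q - z = (q - p) * Complex (1/2) (- s)" and pz: "p - z = (q - p) * Complex (- 1/2) (- s)"
    by (auto simp: z_def midpoint_def complex_eq_iff field_simps)
  have Im: "0 < Im ((q - p) * cnj (q - z))"
  proof -
    have "(q - p) * cnj (q - z) = (q - p) * cnj (q - p) * Complex (1/2) s"
      unfolding qz by (simp add: complex_eq_iff field_simps)
    also have "\<dots> = of_real ((cmod (q - p))\<^sup>2) * Complex (1/2) s" by (simp only: complex_norm_square)
    finally show ?thesis using assms by simp
  qed
  have notin: "z \<notin> path_image (linepath p q)"
  proof
    assume "z \<in> path_image (linepath p q)"
    then obtain u where u: "z = (1 - u) *\<^sub>R p + u *\<^sub>R q" by (auto simp: in_segment)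
    then have "q - z = (q - p) * of_real (1 - u)" by (simp add: scaleR_conv_of_real algebra_simps)
    then have "(q - p) * (Complex (1/2) (- s) - of_real (1 - u)) = 0" using qz by (simp add: algebra_simps)
    then have "Complex (1/2) (- s) = of_real (1 - u)" using assms by simp
    then show False using assms by (simp add: complex_eq_iff)
  qed
  then show "z \<notin> path_image (linepath p q)" .
  define A where "A = winding_number (linepath p q) z"
  have pos: "0 < Re A" unfolding A_def by (rule winding_number_linepath_pos_lt[OF Im])
  have lt: "\<bar>Re A\<bar> < 1/2" unfolding A_def using notin by (intro winding_number_lt_half_linepath) simp
  have "q - z = exp (2 * pi * \<i> * A) * (p - z)"
    unfolding A_def using winding_number_exp_2pi[of "linepath p q" z] notin by simp
  then have "Complex (1/2) (- s) = exp (2 * pi * \<i> * A) * Complex (- 1/2) (- s)"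
    unfolding qz pz using assms(1) by simp
  moreover have "Complex (- 1/2) (- s) \<noteq> 0" by (simp add: complex_eq_iff)
  ultimately have "exp (2 * pi * \<i> * A) = Complex (1/2) (- s) / Complex (- 1/2) (- s)"
    by (simp add: eq_divide_eq)
  then have "Re (exp (2 * pi * \<i> * A)) = Re (Complex (1/2) (- s) / Complex (- 1/2) (- s))" by simp
  also have "\<dots> = (s\<^sup>2 - 1/4) / (1/4 + s\<^sup>2)" by (simp add: Re_divide power2_eq_square)
  also have "\<dots> \<le> 0"
  proof -
    have "s\<^sup>2 \<le> (1/2)\<^sup>2" using assms by (intro power_mono) auto
    then show ?thesis by (intro divide_nonpos_nonneg) (auto simp: power2_eq_square)
  qed
  finally have "Re (exp (2 * pi * \<i> * A)) \<le> 0" .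
  then have "cos (2 * pi * Re A) \<le> 0"
    by (simp add: Re_exp mult_le_0_iff)
  moreover have "cos (2 * pi * Re A) > 0" if "Re A < 1/4"
    using pos that by (intro cos_gt_zero) (auto simp: field_simps)
  ultimately have "1/4 \<le> Re A" by force
  then show "Re (winding_number (linepath p q) z) \<in> {1/4..<1/2}"
    using lt by (simp add: A_def)
qed

text \<open>The winding number of the rest \<open>R\<close> of the curve varies continuously near the midpoint, while
  that of the segment jumps by an amount between \<open>1/2\<close> and \<open>1\<close>; the total is an integer, so
  it jumps by one.\<close>

lemma winding_number_jump:
  fixes p q :: complex
  assumes pq: "p \<noteq> q" and R: "path R" "pathstart R = q" "pathfinish R = p" "midpoint p q \<notin> path_image R"
  obtains s0 where "0 < s0"
    "\<And>s. 0 < s \<Longrightarrow> s < s0 \<Longrightarrow>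
       midpoint p q + s *\<^sub>R (\<i> * (q - p)) \<notin> path_image (linepath p q +++ R) \<and>
       midpoint p q - s *\<^sub>R (\<i> * (q - p)) \<notin> path_image (linepath p q +++ R) \<and>
       winding_number (linepath p q +++ R) (midpoint p q + s *\<^sub>R (\<i> * (q - p))) =
       winding_number (linepath p q +++ R) (midpoint p q - s *\<^sub>R (\<i> * (q - p))) + 1"
proof -
  let ?m = "midpoint p q" and ?z = "\<lambda>s. midpoint p q + s *\<^sub>R (\<i> * (q - p))"
  have "open (- path_image R)" using closed_path_image[OF R(1)] by (simp add: open_Compl)
  then obtain e1 where e1: "e1 > 0" "ball ?m e1 \<subseteq> - path_image R"
    using R(4) by (meson ComplI open_contains_ball)
  have "continuous (at ?m) (winding_number R)" by (rule continuous_at_winding_number[OF R(1,4)])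
  then obtain e2 where e2: "e2 > 0" "\<And>w. dist w ?m < e2 \<Longrightarrow> dist (winding_number R w) (winding_number R ?m) < 1/4"
    unfolding continuous_at_eps_delta by (metis zero_less_divide_1_iff zero_less_numeral)
  define L where "L = cmod (q - p)"
  have L: "L > 0" using pq by (simp add: L_def)
  define s0 where "s0 = min (1/2) (min (e1 / L) (e2 / L))"
  show thesis
  proof (rule that[of s0])
    show "0 < s0" using e1 e2 L by (simp add: s0_def)
    fix s assume s: "0 < s" "s < s0"
    have d: "dist (?z t) ?m = \<bar>t\<bar> * L" for t by (simp add: dist_norm norm_mult L_def)
    have sL: "s * L < e1" "s * L < e2" "s < 1/2" using s L by (auto simp: s0_def field_simps)
    define z1 where "z1 = ?z s"
    define z2 where "z2 = midpoint p q - s *\<^sub>R (\<i> * (q - p))"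
    have d12: "dist z1 ?m < e1" "dist z2 ?m < e1" "dist z1 ?m < e2" "dist z2 ?m < e2"
      using d[of s] d[of "- s"] sL s by (simp_all add: z1_def z2_def)
    have R1: "z1 \<notin> path_image R" "z2 \<notin> path_image R"
      using e1(2) d12 by (auto simp: subset_iff dist_commute)
    have c: "dist (winding_number R z1) (winding_number R ?m) < 1/4"
      "dist (winding_number R z2) (winding_number R ?m) < 1/4"
      using e2(2) d12 by auto
    have l1: "z1 \<notin> path_image (linepath p q)" "Re (winding_number (linepath p q) z1) \<in> {1/4..<1/2}"
      unfolding z1_def using winding_number_linepath_left[OF pq s(1) sL(3)] by auto
    have zz: "z2 = midpoint q p + s *\<^sub>R (\<i> * (p - q))"
      by (simp add: midpoint_def algebra_simps z2_def)
    have l2': "z2 \<notin> path_image (linepath q p)" "Re (winding_number (linepath q p) z2) \<in> {1/4..<1/2}"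
      unfolding zz using winding_number_linepath_left[of q p s] pq s(1) sL(3) by auto
    have l2: "z2 \<notin> path_image (linepath p q)" using l2'(1) by (simp add: closed_segment_commute)
    have "winding_number (linepath q p) z2 = - winding_number (linepath p q) z2"
      using winding_number_reversepath[of "linepath p q" z2] l2 by simp
    then have l3: "Re (winding_number (linepath p q) z2) \<in> {- 1/2<..- 1/4}" using l2'(2) by simp
    let ?K = "linepath p q +++ R"
    have K: "path ?K" "pathfinish ?K = pathstart ?K" using R by auto
    have KI: "z1 \<notin> path_image ?K" "z2 \<notin> path_image ?K"
      using R1 l1(1) l2 R by (auto simp: path_image_join)
    have wn: "winding_number ?K z1 = winding_number (linepath p q) z1 + winding_number R z1"
      "winding_number ?K z2 = winding_number (linepath p q) z2 + winding_number R z2"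
      using R1 l1(1) l2 R by (auto intro!: winding_number_join)
    have "winding_number ?K z1 \<in> \<int>" "winding_number ?K z2 \<in> \<int>"
      using integer_winding_number[OF K KI(1)] integer_winding_number[OF K KI(2)] by auto
    then have "winding_number ?K z1 - winding_number ?K z2 \<in> \<int>" by auto
    then obtain j where j: "winding_number ?K z1 - winding_number ?K z2 = of_int j" by (auto elim: Ints_cases)
    have "\<bar>Re (winding_number R z1) - Re (winding_number R ?m)\<bar> < 1/4"
      "\<bar>Re (winding_number R z2) - Re (winding_number R ?m)\<bar> < 1/4"
      using c abs_Re_le_cmod[of "winding_number R z1 - winding_number R ?m"]
        abs_Re_le_cmod[of "winding_number R z2 - winding_number R ?m"] by (auto simp: dist_norm)
    moreover have "of_int j = Re (winding_number ?K z1) - Re (winding_number ?K z2)"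
      using arg_cong[OF j, of Re] by simp
    moreover have "Re (winding_number ?K z1) = Re (winding_number (linepath p q) z1) + Re (winding_number R z1)"
      "Re (winding_number ?K z2) = Re (winding_number (linepath p q) z2) + Re (winding_number R z2)"
      using wn by simp_all
    moreover have "1/4 \<le> Re (winding_number (linepath p q) z1)" "Re (winding_number (linepath p q) z1) < 1/2"
      "Re (winding_number (linepath p q) z2) \<le> - 1/4" "- 1/2 < Re (winding_number (linepath p q) z2)"
      using l1(2) l3 by (simp_all only: atLeastLessThan_iff greaterThanAtMost_iff)
    ultimately have "0 < (of_int j :: real) \<and> (of_int j :: real) < 2" by linarith
    then have "j = 1" by auto
    then have "winding_number ?K z1 = winding_number ?K z2 + 1" using j by (simp add: algebra_simps)
    then show "?z s \<notin> path_image ?K \<and> midpoint p q - s *\<^sub>R (\<i> * (q - p)) \<notin> path_image ?K \<and>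
       winding_number ?K (?z s) = winding_number ?K (midpoint p q - s *\<^sub>R (\<i> * (q - p))) + 1"
      unfolding z1_def[symmetric] z2_def[symmetric] using KI by blast
  qed
qed

text \<open>If \<open>S\<close> does not join the ends of \<open>A\<close>, then it splits into two compact parts, each meeting
  \<open>A\<close> in one end, and the theorem of Janiszewski applies twice. Otherwise close \<open>A\<close> up by an
  arc \<open>r\<close> in \<open>S\<close>; the intersection of the Jordan curve \<open>A +++ r\<close> with \<open>S\<close> is the arc \<open>r\<close>,
  which is connected, so the theorem reduces the claim to the complement of the curve.\<close>

lemma not_separated_by_arc_union:
  fixes S :: "complex set"
  assumes pieces: "finite \<P>" "\<And>P. P \<in> \<P> \<Longrightarrow> compact P \<and> path_connected P" "S = \<Union>\<P>"
    and A: "arc A" and AS: "path_image A \<inter> S = {pathstart A, pathfinish A}"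
    and xy: "x \<notin> path_image A" "y \<notin> path_image A" "connected_component (- S) x y"
    and side: "path_component S (pathfinish A) (pathstart A) \<Longrightarrow>
      \<exists>r. arc r \<and> path_image r \<subseteq> S \<and> pathstart r = pathfinish A \<and> pathfinish r = pathstart A \<and>
        (x \<in> inside (path_image (A +++ r)) \<longleftrightarrow> y \<in> inside (path_image (A +++ r)))"
  shows "connected_component (- (S \<union> path_image A)) x y"
proof -
  have compS: "compact S" unfolding pieces(3) using pieces(1,2) by (intro compact_Union) auto
  have compA: "compact (path_image A)" using A by (simp add: arc_imp_path compact_path_image)
  have xyS: "x \<notin> S" "y \<notin> S" using xy(3) connected_component_in by (metis ComplD)+
  have ends: "pathstart A \<in> S" "pathfinish A \<in> S" "pathstart A \<noteq> pathfinish A"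
    using AS arc_distinct_ends[OF A] by auto
  have xyA: "connected_component (- path_image A) x y"
    using connected_arc_complement[OF A] xy(1,2) by (auto simp: connected_iff_connected_component)
  show ?thesis
  proof (cases "path_component S (pathfinish A) (pathstart A)")
    case True
    then obtain r where r: "arc r" "path_image r \<subseteq> S" "pathstart r = pathfinish A" "pathfinish r = pathstart A"
      and sd: "x \<in> inside (path_image (A +++ r)) \<longleftrightarrow> y \<in> inside (path_image (A +++ r))"
      using side by blast
    let ?K = "path_image (A +++ r)"
    have K: "?K = path_image A \<union> path_image r" using r by (simp add: path_image_join)
    have "simple_path (A +++ r)"
      using r A AS by (intro simple_path_join_loop) auto
    from Jordan_inside_outside[OF this] r
    have J: "connected (inside ?K)" "connected (outside ?K)" by auto
    have io: "inside ?K \<union> outside ?K = - ?K" by (rule inside_Un_outside)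
    have "x \<in> - ?K" "y \<in> - ?K" unfolding K using xy(1,2) xyS r(2) by auto
    then have "(x \<in> inside ?K \<and> y \<in> inside ?K) \<or> (x \<in> outside ?K \<and> y \<in> outside ?K)"
      using sd io by blast
    then have "connected_component (- ?K) x y"
      unfolding connected_component_def using J io by blast
    moreover have "?K \<inter> S = path_image r"
    proof -
      have "pathfinish A \<in> path_image r" "pathstart A \<in> path_image r"
        using pathstart_in_path_image[of r] pathfinish_in_path_image[of r] r(3,4) by auto
      then have "path_image A \<inter> S \<subseteq> path_image r" unfolding AS by blast
      then show ?thesis unfolding K using r(2) by blast
    qed
    moreover have "compact ?K" unfolding K using compA r by (simp add: compact_Un compact_path_image arc_imp_path)
    ultimately have "connected_component (- (?K \<union> S)) x y"
      using Janiszewski[of ?K S x y] compS xy(3) r(1) by (simp add: compact_imp_closed connected_arc_image)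
    moreover have "?K \<union> S = S \<union> path_image A" unfolding K using r by auto
    ultimately show ?thesis by simp
  next
    case False
    define C where "C = path_component_set S (pathstart A)"
    define Z where "Z = \<Union>{P \<in> \<P>. P \<subseteq> C}"
    define Z' where "Z' = \<Union>{P \<in> \<P>. \<not> P \<subseteq> C}"
    have ZZ: "S = Z \<union> Z'" unfolding pieces(3) Z_def Z'_def by blast
    have comp: "compact Z" "compact Z'" unfolding Z_def Z'_def using pieces(1,2) by (auto intro!: compact_Union)
    have meet: "P \<subseteq> C" if "P \<in> \<P>" "w \<in> P" "w \<in> C" for P w
    proof -
      have "P \<subseteq> path_component_set S w"
        using that(1,2) pieces(2)[OF that(1)] unfolding pieces(3) by (intro path_component_maximal) auto
      also have "\<dots> = C" using that(3) unfolding C_def by (intro path_component_eq) simp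
      finally show ?thesis .
    qed
    have 1: "pathstart A \<in> C" using ends unfolding C_def by (simp add: path_component_refl)
    have 2: "pathfinish A \<notin> C" using False unfolding C_def by (auto dest: path_component_sym)
    have 3: "pathstart A \<in> Z" "pathfinish A \<in> Z'" "pathfinish A \<notin> Z" "pathstart A \<notin> Z'" "Z \<inter> Z' = {}"
      using 1 2 ends meet unfolding pieces(3) Z_def Z'_def by blast+
    have "path_image A \<inter> Z = {pathstart A}" using AS 3 unfolding ZZ by auto
    moreover have "connected_component (- Z) x y" "connected_component (- Z') x y"
      using xy(3) unfolding ZZ by (auto elim!: connected_component_of_subset)
    ultimately have "connected_component (- (path_image A \<union> Z)) x y"
      using Janiszewski[of "path_image A" Z x y] compA comp xyA by (simp add: compact_imp_closed)
    moreover have "(path_image A \<union> Z) \<inter> Z' = {pathfinish A}" using AS 3 unfolding ZZ by auto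
    ultimately have "connected_component (- ((path_image A \<union> Z) \<union> Z')) x y"
      using Janiszewski[of "path_image A \<union> Z" Z' x y] compA comp \<open>connected_component (- Z') x y\<close>
      by (simp add: compact_imp_closed compact_Un)
    moreover have "(path_image A \<union> Z) \<union> Z' = S \<union> path_image A" unfolding ZZ by auto
    ultimately show ?thesis by simp
  qed
qed

text \<open>A point moving along an arc of a diagram keeps the same region on its left, even if the rest
  \<open>S\<close> of the diagram is disconnected. The two ends of the arc are straight so that their
  left and right sides make sense; the sides match because the winding number of a closed
  curve through the arc has the same jump at both ends.\<close>

lemma sides_of_arc:
  fixes S :: "complex set"
  assumes pieces: "finite \<P>" "\<And>P. P \<in> \<P> \<Longrightarrow> compact P \<and> path_connected P" "S = \<Union>\<P>"
    and ends: "pathstart \<alpha> = z0" "pathfinish \<alpha> = z1"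
    and A: "arc (linepath m0 z0 +++ \<alpha> +++ linepath z1 m1)"
    and AS: "path_image (linepath m0 z0 +++ \<alpha> +++ linepath z1 m1) \<inter> S = {m0, m1}"
  obtains s0 where "0 < s0"
    "\<And>s. 0 < s \<Longrightarrow> s < s0 \<Longrightarrow>
      connected_component (- (S \<union> path_image (linepath m0 z0 +++ \<alpha> +++ linepath z1 m1)))
        (midpoint m0 z0 + s *\<^sub>R (\<i> * (z0 - m0))) (midpoint z1 m1 + s *\<^sub>R (\<i> * (m1 - z1)))"
    "\<And>s. 0 < s \<Longrightarrow> s < s0 \<Longrightarrow>
      connected_component (- (S \<union> path_image (linepath m0 z0 +++ \<alpha> +++ linepath z1 m1)))
        (midpoint m0 z0 - s *\<^sub>R (\<i> * (z0 - m0))) (midpoint z1 m1 - s *\<^sub>R (\<i> * (m1 - z1)))"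
proof -
  let ?l0 = "linepath m0 z0" and ?l1 = "linepath z1 m1"
  let ?A = "?l0 +++ \<alpha> +++ ?l1"
  let ?\<mu>0 = "midpoint m0 z0" and ?\<mu>1 = "midpoint z1 m1"
  let ?L0 = "\<lambda>s. ?\<mu>0 + s *\<^sub>R (\<i> * (z0 - m0))" and ?L1 = "\<lambda>s. ?\<mu>1 + s *\<^sub>R (\<i> * (m1 - z1))"
  let ?R0 = "\<lambda>s. ?\<mu>0 - s *\<^sub>R (\<i> * (z0 - m0))" and ?R1 = "\<lambda>s. ?\<mu>1 - s *\<^sub>R (\<i> * (m1 - z1))"
  have arcs: "arc ?l0" "arc \<alpha>" "arc ?l1" "path_image ?l0 \<inter> path_image (\<alpha> +++ ?l1) = {z0}"
    "path_image \<alpha> \<inter> path_image ?l1 = {z1}"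
    using A ends by (auto simp: arc_join_eq_alt)
  have ne: "m0 \<noteq> z0" "z1 \<noteq> m1" using arc_distinct_ends[OF arcs(1)] arc_distinct_ends[OF arcs(3)] by auto
  have path: "path \<alpha>" using arcs(2) by (rule arc_imp_path)
  have AI: "path_image ?A = path_image ?l0 \<union> path_image \<alpha> \<union> path_image ?l1"
    using ends by (simp add: path_image_join Un_assoc)
  have startA: "pathstart ?A = m0" "pathfinish ?A = m1" using ends by auto
  have m01: "m0 \<noteq> m1" using arc_distinct_ends[OF A] startA by simp
  have compS: "compact S" unfolding pieces(3) using pieces(1,2) by (intro compact_Union) auto
  have mid0: "?\<mu>0 \<in> path_image ?l0" "?\<mu>0 \<noteq> m0" "?\<mu>0 \<noteq> z0" using ne by auto
  have mid1: "?\<mu>1 \<in> path_image ?l1" "?\<mu>1 \<noteq> m1" "?\<mu>1 \<noteq> z1" using ne by auto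
  have m1l0: "m1 \<notin> path_image ?l0"
  proof
    assume "m1 \<in> path_image ?l0"
    moreover have "m1 \<in> path_image (\<alpha> +++ ?l1)" using ends by (simp add: path_image_join)
    ultimately have "m1 = z0" using arcs(4) by blast
    then have "m1 \<in> path_image \<alpha>" using pathstart_in_path_image[of \<alpha>] ends by simp
    then have "m1 \<in> path_image \<alpha> \<inter> path_image ?l1" by simp
    then have "m1 = z1" unfolding arcs(5) by simp
    then show False using ne by simp
  qed
  have m0l1: "m0 \<notin> path_image ?l1"
    using arcs(4) ends ne by (auto simp: path_image_join)
  have mu0: "?\<mu>0 \<notin> path_image (\<alpha> +++ ?l1)" "?\<mu>0 \<notin> S"
  proof -
    show "?\<mu>0 \<notin> path_image (\<alpha> +++ ?l1)" using arcs(4) mid0 by blast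
    have "?\<mu>0 \<in> path_image ?A" "?\<mu>0 \<noteq> m1" unfolding AI using mid0(1) m1l0 by blast+
    then show "?\<mu>0 \<notin> S" using AS mid0(2) by blast
  qed
  have mu1: "?\<mu>1 \<notin> path_image (?l0 +++ \<alpha>)" "?\<mu>1 \<notin> S"
  proof -
    have "path_image (?l0 +++ \<alpha>) \<inter> path_image ?l1 \<subseteq> {z1, z0}"
      using arcs(4,5) ends by (auto simp: path_image_join)
    moreover have "z0 \<in> path_image ?l1 \<Longrightarrow> z0 = z1"
      using arcs(5) ends pathstart_in_path_image[of \<alpha>] by auto
    ultimately show "?\<mu>1 \<notin> path_image (?l0 +++ \<alpha>)" using mid1 by blast
    have "?\<mu>1 \<in> path_image ?A" "?\<mu>1 \<noteq> m0" unfolding AI using mid1(1) m0l1 by blast+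
    then show "?\<mu>1 \<notin> S" using AS mid1(2) by blast
  qed
  have near: "\<exists>e>0. \<forall>s. 0 < s \<longrightarrow> s < e \<longrightarrow>
      midpoint p q + s *\<^sub>R (\<i> * (q - p)) \<notin> path_image ?A \<and> midpoint p q - s *\<^sub>R (\<i> * (q - p)) \<notin> path_image ?A \<and>
      connected_component (- S) (midpoint p q) (midpoint p q + s *\<^sub>R (\<i> * (q - p))) \<and>
      connected_component (- S) (midpoint p q) (midpoint p q - s *\<^sub>R (\<i> * (q - p)))"
    if pq: "p \<noteq> q" "path_image ?A = path_image (linepath p q) \<union> Q" "closed Q" "midpoint p q \<notin> Q" "midpoint p q \<notin> S"
    for p q Q
  proof -
    have "open (- (Q \<union> S))" using pq(3) compact_imp_closed[OF compS] by (intro open_Compl closed_Un)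
    then obtain e where e: "e > 0" "ball (midpoint p q) e \<subseteq> - (Q \<union> S)"
    proof -
      have "midpoint p q \<in> - (Q \<union> S)" using pq(4,5) by blast
      with \<open>open (- (Q \<union> S))\<close> show ?thesis using that unfolding open_contains_ball by blast
    qed
    show ?thesis
    proof (intro exI[of _ "min (1/2) (e / cmod (q - p))"] conjI allI impI)
      show "0 < min (1/2) (e / cmod (q - p))" using e pq by auto
      fix s assume s: "0 < s" "s < min (1/2) (e / cmod (q - p))"
      then have se: "s * cmod (q - p) < e" using pq(1) by (simp add: field_simps)
      let ?x = "midpoint p q + s *\<^sub>R (\<i> * (q - p))" and ?y = "midpoint p q - s *\<^sub>R (\<i> * (q - p))"
      have b: "?x \<in> ball (midpoint p q) e" "?y \<in> ball (midpoint p q) e" "midpoint p q \<in> ball (midpoint p q) e"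
        using se s e(1) by (simp_all add: dist_norm norm_mult)
      have bS: "ball (midpoint p q) e \<subseteq> - S" using e(2) by blast
      have "?x \<notin> path_image (linepath p q)" using winding_number_linepath_left(1)[OF pq(1)] s by auto
      then show "?x \<notin> path_image ?A" unfolding pq(2) using b e by blast
      have "?y = midpoint q p + s *\<^sub>R (\<i> * (p - q))" by (simp add: midpoint_def algebra_simps)
      then have "?y \<notin> path_image (linepath q p)" using winding_number_linepath_left(1)[of q p s] pq(1) s by auto
      then have "?y \<notin> path_image (linepath p q)" by (simp add: closed_segment_commute)
      then show "?y \<notin> path_image ?A" unfolding pq(2) using b e by blast
      show "connected_component (- S) (midpoint p q) ?x" "connected_component (- S) (midpoint p q) ?y"
        unfolding connected_component_def using b bS connected_ball by blast+
    qed
  qed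
  have "path_image ?A = path_image ?l0 \<union> path_image (\<alpha> +++ ?l1)" using ends by (simp add: path_image_join)
  from near[OF ne(1) this] obtain e0 where e0: "e0 > 0"
    "\<And>s. 0 < s \<Longrightarrow> s < e0 \<Longrightarrow> ?L0 s \<notin> path_image ?A \<and> ?R0 s \<notin> path_image ?A \<and>
       connected_component (- S) ?\<mu>0 (?L0 s) \<and> connected_component (- S) ?\<mu>0 (?R0 s)"
    using mu0 path ends by (auto simp: closed_path_image)
  have "path_image ?A = path_image ?l1 \<union> path_image (?l0 +++ \<alpha>)" using ends by (auto simp: path_image_join)
  from near[OF ne(2) this] obtain e1 where e1: "e1 > 0"
    "\<And>s. 0 < s \<Longrightarrow> s < e1 \<Longrightarrow> ?L1 s \<notin> path_image ?A \<and> ?R1 s \<notin> path_image ?A \<and>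
       connected_component (- S) ?\<mu>1 (?L1 s) \<and> connected_component (- S) ?\<mu>1 (?R1 s)"
    using mu1 path ends by (auto simp: closed_path_image)
  have mu01: "connected_component (- S) ?\<mu>0 ?\<mu>1"
    unfolding connected_component_def
  proof (intro exI conjI)
    let ?T = "path_image ?A - {pathstart ?A, pathfinish ?A}"
    show "connected ?T" using connected_simple_path_endless[OF arc_imp_simple_path[OF A]] .
    show "?T \<subseteq> - S" using AS startA by auto
    show "?\<mu>0 \<in> ?T" using mid0 m1l0 by (auto simp: AI startA)
    show "?\<mu>1 \<in> ?T" using mid1 m0l1 by (auto simp: AI startA)
  qed
  have main: "\<exists>s0>0. \<forall>s. 0 < s \<longrightarrow> s < s0 \<longrightarrow>
      (?L0 s \<in> inside (path_image (?A +++ r)) \<longleftrightarrow> ?L1 s \<in> inside (path_image (?A +++ r))) \<and>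
      (?R0 s \<in> inside (path_image (?A +++ r)) \<longleftrightarrow> ?R1 s \<in> inside (path_image (?A +++ r)))"
    if r: "arc r" "path_image r \<subseteq> S" "pathstart r = pathfinish ?A" "pathfinish r = pathstart ?A" for r
  proof -
    let ?K = "?A +++ r" and ?Q0 = "(\<alpha> +++ ?l1) +++ r" and ?Q1 = "r +++ (?l0 +++ \<alpha>)"
    have rp: "path r" using r(1) by (rule arc_imp_path)
    have r_ends: "pathstart r = m1" "pathfinish r = m0" using r startA by auto
    have sK: "simple_path ?K" using r A AS startA by (intro simple_path_join_loop) auto
    have cK: "pathfinish ?K = pathstart ?K" "path ?K" using r sK by (auto simp: simple_path_imp_path)
    have KI: "path_image ?K = path_image ?A \<union> path_image r" using r by (simp add: path_image_join)
    have Q0: "path ?Q0" "pathstart ?Q0 = z0" "pathfinish ?Q0 = m0" "?\<mu>0 \<notin> path_image ?Q0"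
      using path rp ends r_ends mu0 r(2) by (auto simp: path_image_join)
    have Q1: "path ?Q1" "pathstart ?Q1 = m1" "pathfinish ?Q1 = z1" "?\<mu>1 \<notin> path_image ?Q1"
      using path rp ends r_ends mu1 r(2) by (auto simp: path_image_join)
    have KI0: "path_image (?l0 +++ ?Q0) = path_image ?K" and KI1: "path_image (?l1 +++ ?Q1) = path_image ?K"
      using ends r_ends by (auto simp: path_image_join)
    have sum: "winding_number ?K x = winding_number ?l0 x + winding_number \<alpha> x + winding_number ?l1 x + winding_number r x"
      "winding_number (?l0 +++ ?Q0) x = winding_number ?l0 x + winding_number \<alpha> x + winding_number ?l1 x + winding_number r x"
      "winding_number (?l1 +++ ?Q1) x = winding_number ?l0 x + winding_number \<alpha> x + winding_number ?l1 x + winding_number r x"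
      if "x \<notin> path_image ?K" for x
    proof -
      have x: "x \<notin> path_image ?l0" "x \<notin> path_image \<alpha>" "x \<notin> path_image ?l1" "x \<notin> path_image r"
        using that unfolding KI AI by auto
      have pl: "path ?l0" "path ?l1" by auto
      have 1: "winding_number (\<alpha> +++ ?l1) x = winding_number \<alpha> x + winding_number ?l1 x"
        using x path ends by (intro winding_number_join) auto
      have 2: "winding_number ?A x = winding_number ?l0 x + winding_number (\<alpha> +++ ?l1) x"
        using x path ends by (intro winding_number_join) (auto simp: path_image_join)
      have 3: "winding_number ?K x = winding_number ?A x + winding_number r x"
        using x path ends rp r_ends that by (intro winding_number_join) (auto simp: path_image_join)
      have 4: "winding_number ?Q0 x = winding_number (\<alpha> +++ ?l1) x + winding_number r x"
        using x path ends rp r_ends by (intro winding_number_join) (auto simp: path_image_join)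
      have 5: "winding_number (?l0 +++ ?Q0) x = winding_number ?l0 x + winding_number ?Q0 x"
        using x path ends rp r_ends by (intro winding_number_join) (auto simp: path_image_join)
      have 6: "winding_number (?l0 +++ \<alpha>) x = winding_number ?l0 x + winding_number \<alpha> x"
        using x path ends by (intro winding_number_join) auto
      have 7: "winding_number ?Q1 x = winding_number r x + winding_number (?l0 +++ \<alpha>) x"
        using x path ends rp r_ends by (intro winding_number_join) (auto simp: path_image_join)
      have 8: "winding_number (?l1 +++ ?Q1) x = winding_number ?l1 x + winding_number ?Q1 x"
        using x path ends rp r_ends by (intro winding_number_join) (auto simp: path_image_join)
      show "winding_number ?K x = winding_number ?l0 x + winding_number \<alpha> x + winding_number ?l1 x + winding_number r x"
        "winding_number (?l0 +++ ?Q0) x = winding_number ?l0 x + winding_number \<alpha> x + winding_number ?l1 x + winding_number r x"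
        "winding_number (?l1 +++ ?Q1) x = winding_number ?l0 x + winding_number \<alpha> x + winding_number ?l1 x + winding_number r x"
        unfolding 3 2 5 4 8 7 6 1 by (simp_all add: algebra_simps)
    qed
    obtain t0 where t0: "0 < t0" "\<And>s. 0 < s \<Longrightarrow> s < t0 \<Longrightarrow> ?L0 s \<notin> path_image ?K \<and> ?R0 s \<notin> path_image ?K \<and>
        winding_number (?l0 +++ ?Q0) (?L0 s) = winding_number (?l0 +++ ?Q0) (?R0 s) + 1"
      using winding_number_jump[OF ne(1) Q0] unfolding KI0 by blast
    obtain t1 where t1: "0 < t1" "\<And>s. 0 < s \<Longrightarrow> s < t1 \<Longrightarrow> ?L1 s \<notin> path_image ?K \<and> ?R1 s \<notin> path_image ?K \<and>
        winding_number (?l1 +++ ?Q1) (?L1 s) = winding_number (?l1 +++ ?Q1) (?R1 s) + 1"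
      using winding_number_jump[OF ne(2) Q1] unfolding KI1 by blast
    have out: "winding_number ?K x = 0" if "x \<notin> path_image ?K" "x \<notin> inside (path_image ?K)" for x
      using that winding_number_zero_in_outside[OF cK(2,1)] inside_Un_outside[of "path_image ?K"] by blast
    have key: "(L \<in> inside (path_image ?K) \<longleftrightarrow> L' \<in> inside (path_image ?K)) \<and>
        (R \<in> inside (path_image ?K) \<longleftrightarrow> R' \<in> inside (path_image ?K))"
      if LR: "L \<notin> path_image ?K" "R \<notin> path_image ?K" "L' \<notin> path_image ?K" "R' \<notin> path_image ?K"
        "winding_number ?K L = winding_number ?K R + 1" "winding_number ?K L' = winding_number ?K R' + 1" for L R L' R'
    proof (rule simple_closed_path_winding_number_inside[OF sK])
      assume w: "\<And>z. z \<in> inside (path_image ?K) \<Longrightarrow> winding_number ?K z = 1"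
      show ?thesis
        using LR w[of L] w[of R] w[of L'] w[of R'] out[of L] out[of R] out[of L'] out[of R']
        by (cases "L \<in> inside (path_image ?K)"; cases "R \<in> inside (path_image ?K)";
            cases "L' \<in> inside (path_image ?K)"; cases "R' \<in> inside (path_image ?K)") simp_all
    next
      assume w: "\<And>z. z \<in> inside (path_image ?K) \<Longrightarrow> winding_number ?K z = - 1"
      show ?thesis
        using LR w[of L] w[of R] w[of L'] w[of R'] out[of L] out[of R] out[of L'] out[of R']
        by (cases "L \<in> inside (path_image ?K)"; cases "R \<in> inside (path_image ?K)";
            cases "L' \<in> inside (path_image ?K)"; cases "R' \<in> inside (path_image ?K)") simp_all
    qed
    show ?thesis
    proof (intro exI[of _ "min t0 t1"] conjI allI impI)
      show "0 < min t0 t1" using t0 t1 by simp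
      fix s assume s: "0 < s" "s < min t0 t1"
      have T: "?L0 s \<notin> path_image ?K \<and> ?R0 s \<notin> path_image ?K \<and>
        winding_number (?l0 +++ ?Q0) (?L0 s) = winding_number (?l0 +++ ?Q0) (?R0 s) + 1"
        "?L1 s \<notin> path_image ?K \<and> ?R1 s \<notin> path_image ?K \<and>
        winding_number (?l1 +++ ?Q1) (?L1 s) = winding_number (?l1 +++ ?Q1) (?R1 s) + 1"
        using t0(2)[of s] t1(2)[of s] s by simp_all
      have "winding_number ?K (?L0 s) = winding_number ?K (?R0 s) + 1"
        "winding_number ?K (?L1 s) = winding_number ?K (?R1 s) + 1"
        using T sum[of "?L0 s"] sum[of "?R0 s"] sum[of "?L1 s"] sum[of "?R1 s"] by metis+
      then have "(?L0 s \<in> inside (path_image ?K) \<longleftrightarrow> ?L1 s \<in> inside (path_image ?K)) \<and>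
        (?R0 s \<in> inside (path_image ?K) \<longleftrightarrow> ?R1 s \<in> inside (path_image ?K))"
        using key[of "?L0 s" "?R0 s" "?L1 s" "?R1 s"] T by blast
      then show "?L0 s \<in> inside (path_image ?K) \<longleftrightarrow> ?L1 s \<in> inside (path_image ?K)"
        "?R0 s \<in> inside (path_image ?K) \<longleftrightarrow> ?R1 s \<in> inside (path_image ?K)" by blast+
    qed
  qed
  have "\<exists>s0>0. \<forall>s. 0 < s \<longrightarrow> s < s0 \<longrightarrow> (path_component S (pathfinish ?A) (pathstart ?A) \<longrightarrow>
      (\<exists>r. arc r \<and> path_image r \<subseteq> S \<and> pathstart r = pathfinish ?A \<and> pathfinish r = pathstart ?A \<and>
        (?L0 s \<in> inside (path_image (?A +++ r)) \<longleftrightarrow> ?L1 s \<in> inside (path_image (?A +++ r))) \<and>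
        (?R0 s \<in> inside (path_image (?A +++ r)) \<longleftrightarrow> ?R1 s \<in> inside (path_image (?A +++ r)))))"
  proof (cases "path_component S (pathfinish ?A) (pathstart ?A)")
    case True
    then obtain p where p: "path p" "path_image p \<subseteq> S" "pathstart p = pathfinish ?A" "pathfinish p = pathstart ?A"
      by (auto simp: path_component_def)
    obtain r where r: "arc r" "path_image r \<subseteq> S" "pathstart r = pathfinish ?A" "pathfinish r = pathstart ?A"
      using path_contains_arc[OF p(1,3,4)] p(2) m01 startA by (metis order_trans)
    show ?thesis using main[OF r] r by blast
  next
    case False
    then show ?thesis by (intro exI[of _ 1]) simp
  qed
  then obtain t where t: "t > 0" and tr: "\<And>s. 0 < s \<Longrightarrow> s < t \<Longrightarrow> path_component S (pathfinish ?A) (pathstart ?A) \<Longrightarrow>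
      \<exists>r. arc r \<and> path_image r \<subseteq> S \<and> pathstart r = pathfinish ?A \<and> pathfinish r = pathstart ?A \<and>
        (?L0 s \<in> inside (path_image (?A +++ r)) \<longleftrightarrow> ?L1 s \<in> inside (path_image (?A +++ r))) \<and>
        (?R0 s \<in> inside (path_image (?A +++ r)) \<longleftrightarrow> ?R1 s \<in> inside (path_image (?A +++ r)))"
    by blast
  have AS': "path_image ?A \<inter> S = {pathstart ?A, pathfinish ?A}" using AS startA by simp
  show thesis
  proof (rule that[of "min t (min e0 e1)"])
    show "0 < min t (min e0 e1)" using t e0 e1 by simp
    fix s assume s: "0 < s" "s < min t (min e0 e1)"
    have E0: "?L0 s \<notin> path_image ?A" "?R0 s \<notin> path_image ?A"
       "connected_component (- S) ?\<mu>0 (?L0 s)" "connected_component (- S) ?\<mu>0 (?R0 s)"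
      using e0(2)[of s] s by simp_all
    have E1: "?L1 s \<notin> path_image ?A" "?R1 s \<notin> path_image ?A"
       "connected_component (- S) ?\<mu>1 (?L1 s)" "connected_component (- S) ?\<mu>1 (?R1 s)"
      using e1(2)[of s] s by simp_all
    have cc: "connected_component (- S) (?L0 s) (?L1 s)" "connected_component (- S) (?R0 s) (?R1 s)"
      using connected_component_trans[OF connected_component_trans[OF connected_component_sym[OF E0(3)] mu01] E1(3)]
        connected_component_trans[OF connected_component_trans[OF connected_component_sym[OF E0(4)] mu01] E1(4)] .
    have "s < t" using s by simp
    show "connected_component (- (S \<union> path_image ?A)) (?L0 s) (?L1 s)"
      by (rule not_separated_by_arc_union[OF pieces A AS' E0(1) E1(1) cc(1)])
        (assumption, drule tr[OF s(1) \<open>s < t\<close>], elim exE conjE, intro exI conjI, assumption+)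
    show "connected_component (- (S \<union> path_image ?A)) (?R0 s) (?R1 s)"
      by (rule not_separated_by_arc_union[OF pieces A AS' E0(2) E1(2) cc(2)])
        (assumption, drule tr[OF s(1) \<open>s < t\<close>], elim exE conjE, intro exI conjI, assumption+)
  qed
qed

section \<open>Medial diagrams\<close>

locale medial_diagram =
  fixes H :: "'d plane_graph" and c u :: "'d \<Rightarrow> complex" and \<alpha> :: "'d \<Rightarrow> real \<Rightarrow> complex"
  assumes finite_darts: "finite (darts H)"
    and rot_dart: "d \<in> darts H \<Longrightarrow> rot H d \<in> darts H"
    and opp_dart: "d \<in> darts H \<Longrightarrow> opp H d \<in> darts H"
    and opp_opp: "d \<in> darts H \<Longrightarrow> opp H (opp H d) = d"
    and wt_opp: "d \<in> darts H \<Longrightarrow> wt H (opp H d) = wt H d"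
    and drawing: "medial_drawing H c u \<alpha>"
begin

definition strand1 :: "'d \<Rightarrow> complex" where "strand1 d = u d * cis (pi / 4)"
definition strand2 :: "'d \<Rightarrow> complex" where "strand2 d = u d * cis (3 * pi / 4)"

text \<open>Coordinates at the crossing of \<open>d\<close> in which the strands are the axes: \<open>pt d 0 1\<close> is the
  initial point of \<open>\<alpha> d\<close>, and \<open>pt d (-1) 0\<close> is the end of the arc that arrives on the right
  of \<open>d\<close>.\<close>

definition pt :: "'d \<Rightarrow> real \<Rightarrow> real \<Rightarrow> complex" where
  "pt d s t = c d + s *\<^sub>R strand1 d + t *\<^sub>R strand2 d"

definition diagram :: "complex set" where
  "diagram = (\<Union>d\<in>darts H. path_image (\<alpha> d) \<union> range (pt d 0) \<inter> cball (c d) 1 \<union> range (\<lambda>s. pt d s 0) \<inter> cball (c d) 1)"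

lemma strand2_eq: "strand2 d = \<i> * strand1 d"
proof -
  have "cis (pi / 2) * cis (pi / 4) = cis (3 * pi / 4)" unfolding cis_mult by (simp add: field_simps)
  then show ?thesis by (simp add: strand1_def strand2_def cis_pi_half)
qed

lemma drawingD:
  assumes "d \<in> darts H"
  shows "c (opp H d) = c d" "norm (u d) = 1" "u (opp H d) = - u d"
    and "e \<in> darts H \<Longrightarrow> e \<noteq> d \<Longrightarrow> e \<noteq> opp H d \<Longrightarrow> cball (c d) 1 \<inter> cball (c e) 1 = {}"
    and "arc (\<alpha> d)" "pathstart (\<alpha> d) = pt d 0 1" "pathfinish (\<alpha> d) = pt (rot H d) (- 1) 0"
    and "e \<in> darts H \<Longrightarrow> path_image (\<alpha> d) \<inter> cball (c e) 1 \<subseteq> {pathstart (\<alpha> d), pathfinish (\<alpha> d)}"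
    and "e \<in> darts H \<Longrightarrow> d \<noteq> e \<Longrightarrow> path_image (\<alpha> d) \<inter> path_image (\<alpha> e) = {}"
proof -
  have cis: "cis (- 3 * pi / 4) = - cis (pi / 4)"
  proof -
    have "cis (- pi) * cis (pi / 4) = cis (- 3 * pi / 4)" unfolding cis_mult by (simp add: field_simps)
    moreover have "cis (- pi) = - 1" by (simp add: complex_eq_iff)
    ultimately show ?thesis by simp
  qed
  note D = drawing[unfolded medial_drawing_def]
  show "c (opp H d) = c d" "norm (u d) = 1" "u (opp H d) = - u d" using D assms by auto
  show "cball (c d) 1 \<inter> cball (c e) 1 = {}" if "e \<in> darts H" "e \<noteq> d" "e \<noteq> opp H d"
    using D assms that by blast
  show "arc (\<alpha> d)" using D assms by auto
  show "pathstart (\<alpha> d) = pt d 0 1" using D assms by (simp add: pt_def strand2_def)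
  show "pathfinish (\<alpha> d) = pt (rot H d) (- 1) 0"
    using D assms unfolding cis by (simp add: pt_def strand1_def)
  show "path_image (\<alpha> d) \<inter> cball (c e) 1 \<subseteq> {pathstart (\<alpha> d), pathfinish (\<alpha> d)}" if "e \<in> darts H"
    using D assms that by blast
  show "path_image (\<alpha> d) \<inter> path_image (\<alpha> e) = {}" if "e \<in> darts H" "d \<noteq> e"
    using D assms that by blast
qed

lemma norm_strand1: "d \<in> darts H \<Longrightarrow> norm (strand1 d) = 1"
  by (simp add: strand1_def norm_mult drawingD)

lemma pt_opp: "d \<in> darts H \<Longrightarrow> pt (opp H d) s t = pt d (- s) (- t)"
  by (simp add: pt_def strand1_def strand2_def drawingD)

lemma dist_pt: "d \<in> darts H \<Longrightarrow> dist (c d) (pt d s t) = sqrt (s\<^sup>2 + t\<^sup>2)"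
proof -
  assume d: "d \<in> darts H"
  have "pt d s t - c d = strand1 d * Complex s t"
    by (simp add: pt_def strand2_eq complex_eq_iff algebra_simps)
  then have "norm (pt d s t - c d) = norm (Complex s t)" using norm_strand1[OF d] by (simp add: norm_mult)
  then show ?thesis by (simp add: dist_norm norm_minus_commute complex_norm)
qed

lemma pt_eq_iff: "d \<in> darts H \<Longrightarrow> pt d s t = pt d s' t' \<longleftrightarrow> s = s' \<and> t = t'"
proof -
  assume d: "d \<in> darts H"
  have "pt d s t - pt d s' t' = strand1 d * Complex (s - s') (t - t')"
    by (simp add: pt_def strand2_eq complex_eq_iff algebra_simps)
  moreover have "strand1 d \<noteq> 0" using norm_strand1[OF d] by auto
  ultimately show ?thesis
    by (metis (no_types, lifting) Complex_eq_0 diff_self eq_iff_diff_eq_0 mult_eq_0_iff)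
qed

lemma pt_in_cball: "d \<in> darts H \<Longrightarrow> pt d s t \<in> cball (c d) 1 \<longleftrightarrow> s\<^sup>2 + t\<^sup>2 \<le> 1"
  by (simp add: dist_pt)

lemma pt_axis_in_cball [simp]: "d \<in> darts H \<Longrightarrow> pt d s 0 \<in> cball (c d) 1 \<longleftrightarrow> \<bar>s\<bar> \<le> 1"
  "d \<in> darts H \<Longrightarrow> pt d 0 s \<in> cball (c d) 1 \<longleftrightarrow> \<bar>s\<bar> \<le> 1"
  by (simp_all only: pt_in_cball) (simp_all add: abs_square_le_1)

lemma continuous_pt [continuous_intros]:
  "continuous_on A f \<Longrightarrow> continuous_on A g \<Longrightarrow> continuous_on A (\<lambda>x. pt d (f x) (g x))"
  unfolding pt_def by (intro continuous_intros)

lemma pt_linear: "pt d ((1 - r) * s + r * s') ((1 - r) * t + r * t') = (1 - r) *\<^sub>R pt d s t + r *\<^sub>R pt d s' t'"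
  by (simp add: pt_def algebra_simps)

text \<open>The arcs enter the disc only in end points of the diagonals.\<close>

lemma diagram_in_disc:
  assumes d: "d \<in> darts H" and st: "s\<^sup>2 + t\<^sup>2 \<le> 1"
  shows "pt d s t \<in> diagram \<longleftrightarrow> s = 0 \<or> t = 0"
proof
  assume "s = 0 \<or> t = 0"
  moreover have "pt d s t \<in> cball (c d) 1" using pt_in_cball d st by blast
  ultimately show "pt d s t \<in> diagram" unfolding diagram_def using d by blast
next
  assume "pt d s t \<in> diagram"
  moreover have x: "pt d s t \<in> cball (c d) 1" using pt_in_cball d st by blast
  ultimately obtain e where e: "e \<in> darts H"
    "pt d s t \<in> path_image (\<alpha> e) \<union> range (pt e 0) \<inter> cball (c e) 1 \<union> range (\<lambda>s. pt e s 0) \<inter> cball (c e) 1"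
    unfolding diagram_def by blast
  have strands: "s = 0 \<or> t = 0" if f: "f \<in> darts H" "pt d s t \<in> range (pt f 0) \<inter> cball (c f) 1 \<union> range (\<lambda>s. pt f s 0) \<inter> cball (c f) 1" for f
  proof -
    have "f = d \<or> f = opp H d" using drawingD(4)[OF d f(1)] f(2) x by blast
    then show ?thesis using f(2) d by (auto simp: pt_opp pt_eq_iff simp del: mem_cball)
  qed
  show "s = 0 \<or> t = 0"
  proof (cases "pt d s t \<in> path_image (\<alpha> e)")
    case False then show ?thesis using strands[OF e(1)] e(2) by blast
  next
    case True
    then have "pt d s t = pt e 0 1 \<or> pt d s t = pt (rot H e) (- 1) 0"
      using subsetD[OF drawingD(8)[OF e(1) d], of "pt d s t"] x unfolding drawingD(6,7)[OF e(1)] by blast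
    then show ?thesis
    proof
      assume "pt d s t = pt e 0 1"
      then have "pt d s t \<in> range (pt e 0) \<inter> cball (c e) 1" using e(1) by (simp del: mem_cball)
      then show ?thesis using strands[of e] e(1) by blast
    next
      assume "pt d s t = pt (rot H e) (- 1) 0"
      then have "pt d s t \<in> range (\<lambda>s. pt (rot H e) s 0) \<inter> cball (c (rot H e)) 1"
        using rot_dart[OF e(1)] by (simp del: mem_cball)
      then show ?thesis using strands[of "rot H e"] rot_dart[OF e(1)] by blast
    qed
  qed
qed

text \<open>The outer pieces prolong an arc half way towards the crossings at its ends, so that it ends
  straight. The inner pieces are what remains of the strands at a crossing.\<close>

definition outer2 :: "'d \<Rightarrow> complex set" where "outer2 d = closed_segment (pt d 0 (1/2)) (pt d 0 1)"
definition outer1 :: "'d \<Rightarrow> complex set" where "outer1 d = closed_segment (pt d (- 1) 0) (pt d (- 1/2) 0)"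
definition inner2 :: "'d \<Rightarrow> complex set" where "inner2 d = closed_segment (pt d 0 (- 1/2)) (pt d 0 (1/2))"
definition inner1 :: "'d \<Rightarrow> complex set" where "inner1 d = closed_segment (pt d (- 1/2) 0) (pt d (1/2) 0)"

lemma segment_pt1: "closed_segment (pt d a 0) (pt d b 0) = (\<lambda>s. pt d s 0) ` closed_segment a b"
proof -
  have "(1 - r) *\<^sub>R pt d a 0 + r *\<^sub>R pt d b 0 = pt d ((1 - r) *\<^sub>R a + r *\<^sub>R b) 0" for r
    using pt_linear[of d r a b 0 0] by simp
  then show ?thesis unfolding closed_segment_def by auto
qed

lemma segment_pt2: "closed_segment (pt d 0 a) (pt d 0 b) = pt d 0 ` closed_segment a b"
proof -
  have "(1 - r) *\<^sub>R pt d 0 a + r *\<^sub>R pt d 0 b = pt d 0 ((1 - r) *\<^sub>R a + r *\<^sub>R b)" for r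
    using pt_linear[of d r 0 0 a b] by simp
  then show ?thesis unfolding closed_segment_def by auto
qed

lemma pieces_eq:
  "outer2 d = pt d 0 ` {1/2..1}" "outer1 d = (\<lambda>s. pt d s 0) ` {- 1..- 1/2}"
  "inner2 d = pt d 0 ` {- 1/2..1/2}" "inner1 d = (\<lambda>s. pt d s 0) ` {- 1/2..1/2}"
  unfolding outer1_def outer2_def inner1_def inner2_def segment_pt1 segment_pt2
  by (simp_all add: closed_segment_eq_real_ivl)

lemma diagram_pieces:
  "diagram = (\<Union>d\<in>darts H. path_image (\<alpha> d) \<union> outer1 d \<union> outer2 d \<union> inner1 d \<union> inner2 d)"
proof
  show "(\<Union>d\<in>darts H. path_image (\<alpha> d) \<union> outer1 d \<union> outer2 d \<union> inner1 d \<union> inner2 d) \<subseteq> diagram"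
  proof (intro UN_least)
    fix d assume d: "d \<in> darts H"
    have "outer1 d \<union> inner1 d \<subseteq> range (\<lambda>s. pt d s 0) \<inter> cball (c d) 1"
      using d unfolding pieces_eq by (intro Un_least Int_greatest image_subsetI rangeI) (auto simp: abs_le_iff simp del: mem_cball)
    moreover have "outer2 d \<union> inner2 d \<subseteq> range (pt d 0) \<inter> cball (c d) 1"
      using d unfolding pieces_eq by (intro Un_least Int_greatest image_subsetI rangeI) (auto simp: abs_le_iff simp del: mem_cball)
    ultimately have "path_image (\<alpha> d) \<union> outer1 d \<union> outer2 d \<union> inner1 d \<union> inner2 d \<subseteq>
        path_image (\<alpha> d) \<union> range (pt d 0) \<inter> cball (c d) 1 \<union> range (\<lambda>s. pt d s 0) \<inter> cball (c d) 1"
      by blast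
    also have "\<dots> \<subseteq> diagram" unfolding diagram_def by (rule UN_upper[OF d])
    finally show "path_image (\<alpha> d) \<union> outer1 d \<union> outer2 d \<union> inner1 d \<union> inner2 d \<subseteq> diagram" .
  qed
  show "diagram \<subseteq> (\<Union>d\<in>darts H. path_image (\<alpha> d) \<union> outer1 d \<union> outer2 d \<union> inner1 d \<union> inner2 d)"
  proof
    fix x assume "x \<in> diagram"
    then obtain d where d: "d \<in> darts H"
      and x: "x \<in> path_image (\<alpha> d) \<union> range (pt d 0) \<inter> cball (c d) 1 \<union> range (\<lambda>s. pt d s 0) \<inter> cball (c d) 1"
      unfolding diagram_def by blast
    have "x \<in> path_image (\<alpha> d) \<or> x \<in> outer1 d \<union> outer2 d \<union> inner1 d \<union> inner2 d \<or> x \<in> outer1 (opp H d) \<union> outer2 (opp H d)"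
    proof (cases "x \<in> path_image (\<alpha> d)")
      case False
      then consider t where "x = pt d 0 t" "\<bar>t\<bar> \<le> 1" | s where "x = pt d s 0" "\<bar>s\<bar> \<le> 1"
        using x d by (auto simp del: mem_cball)
      then show ?thesis
      proof cases
        case 1
        consider "t \<in> {1/2..1}" | "t \<in> {- 1/2..1/2}" | "- t \<in> {1/2..1}" using 1 by fastforce
        then show ?thesis
        proof cases
          case 3
          then have "x \<in> outer2 (opp H d)" unfolding pieces_eq using 1 d by (auto simp: pt_opp image_iff intro!: bexI[of _ "- t"])
          then show ?thesis by blast
        qed (use 1 in \<open>auto simp: pieces_eq\<close>)
      next
        case 2
        consider "s \<in> {- 1..- 1/2}" | "s \<in> {- 1/2..1/2}" | "- s \<in> {- 1..- 1/2}" using 2 by fastforce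
        then show ?thesis
        proof cases
          case 3
          then have "x \<in> outer1 (opp H d)" unfolding pieces_eq using 2 d by (auto simp: pt_opp image_iff intro!: bexI[of _ "- s"])
          then show ?thesis by blast
        qed (use 2 in \<open>auto simp: pieces_eq\<close>)
      qed
    qed simp
    then show "x \<in> (\<Union>d\<in>darts H. path_image (\<alpha> d) \<union> outer1 d \<union> outer2 d \<union> inner1 d \<union> inner2 d)"
      using d opp_dart[OF d] by blast
  qed
qed

lemma quadrant_connected:
  assumes d: "d \<in> darts H" and n: "s\<^sup>2 + t\<^sup>2 \<le> 1" "s'\<^sup>2 + t'\<^sup>2 \<le> 1" and sg: "0 < s * s'" "0 < t * t'"
  shows "connected_component (- diagram) (pt d s t) (pt d s' t')"
proof -
  have nz: "(1 - r) * a + r * b \<noteq> 0" if "0 < a * b" "0 \<le> r" "r \<le> 1" for a b r :: real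
  proof -
    have pos: "(1 - r) * a + r * b > 0" if "0 < a" "0 < b" for a b :: real
    proof (cases "r = 0")
      case False
      then have "r * b > 0" using \<open>0 \<le> r\<close> that by simp
      moreover have "(1 - r) * a \<ge> 0" using \<open>r \<le> 1\<close> that by simp
      ultimately show ?thesis by simp
    qed (use that in simp)
    show ?thesis using pos[of a b] pos[of "- a" "- b"] that(1) by (auto simp: zero_less_mult_iff)
  qed
  have "closed_segment (pt d s t) (pt d s' t') \<subseteq> - diagram"
  proof
    fix x assume x: "x \<in> closed_segment (pt d s t) (pt d s' t')"
    then obtain r where r: "0 \<le> r" "r \<le> 1" and xr: "x = pt d ((1 - r) * s + r * s') ((1 - r) * t + r * t')"
      unfolding closed_segment_def pt_linear by blast
    have "closed_segment (pt d s t) (pt d s' t') \<subseteq> cball (c d) 1"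
      using pt_in_cball[OF d] n by (intro closed_segment_subset) (auto simp del: mem_cball)
    then have "x \<in> cball (c d) 1" using x by blast
    then have "((1 - r) * s + r * s')\<^sup>2 + ((1 - r) * t + r * t')\<^sup>2 \<le> 1" unfolding xr pt_in_cball[OF d] .
    from diagram_in_disc[OF d this] show "x \<in> - diagram" unfolding xr using nz sg r by simp
  qed
  then show ?thesis
    unfolding connected_component_def by (intro exI[of _ "closed_segment (pt d s t) (pt d s' t')"]) auto
qed

text \<open>Sample points of the black corner at the tail of \<open>d\<close> and of the white corner on the left of
  \<open>d\<close>.\<close>

definition tail_corner :: "'d \<Rightarrow> complex" where "tail_corner d = pt d (- 1/2) (1/2)"
definition left_corner :: "'d \<Rightarrow> complex" where "left_corner d = pt d (1/2) (1/2)"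

lemma arc_in_disc:
  assumes "d \<in> darts H" "e \<in> darts H" "x \<in> path_image (\<alpha> d)" "x \<in> cball (c e) 1"
  shows "x = pt d 0 1 \<or> x = pt (rot H d) (- 1) 0"
  using drawingD(8)[OF assms(1,2)] assms(3,4) drawingD(6,7)[OF assms(1)] by auto

lemma pieces_in_cball:
  assumes d: "d \<in> darts H"
  shows "outer1 d \<subseteq> cball (c d) 1" "outer2 d \<subseteq> cball (c d) 1" "inner1 d \<subseteq> cball (c d) 1" "inner2 d \<subseteq> cball (c d) 1"
  using d unfolding pieces_eq by (auto simp: abs_le_iff simp del: mem_cball)

lemma same_disc:
  assumes "d \<in> darts H" "e \<in> darts H" "x \<in> cball (c d) 1" "x \<in> cball (c e) 1"
  shows "e = d \<or> e = opp H d"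
  using drawingD(4)[OF assms(1,2)] assms(3,4) by blast

text \<open>The arc \<open>\<alpha> d\<close>, prolonged by two outer pieces, meets the rest of the diagram in its end
  points only. On one of its sides it has the corners at the common tail of \<open>d\<close> and
  \<open>rot H d\<close>, on the other side the white corners to the left of \<open>d\<close> and to the right of
  \<open>rot H d\<close>.\<close>

lemma corners_along_arc:
  assumes d: "d \<in> darts H"
  shows "connected_component (- diagram) (tail_corner d) (tail_corner (rot H d))"
    and "connected_component (- diagram) (left_corner d) (left_corner (opp H (rot H d)))"
proof -
  define e where "e = rot H d"
  have e: "e \<in> darts H" using rot_dart[OF d] by (simp add: e_def)
  define m0 z0 z1 m1 where "m0 = pt d 0 (1/2)" and "z0 = pt d 0 1" and "z1 = pt e (- 1) 0" and "m1 = pt e (- 1/2) 0"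
  have ends: "pathstart (\<alpha> d) = z0" "pathfinish (\<alpha> d) = z1"
    using drawingD(6,7)[OF d] by (auto simp: z0_def z1_def e_def)
  have o2: "path_image (linepath m0 z0) = outer2 d" by (simp add: m0_def z0_def outer2_def)
  have o1: "path_image (linepath z1 m1) = outer1 e" by (simp add: m1_def z1_def outer1_def)
  let ?A = "linepath m0 z0 +++ \<alpha> d +++ linepath z1 m1"
  have \<alpha>: "arc (\<alpha> d)" using drawingD(5)[OF d] .
  have AI: "path_image ?A = outer2 d \<union> path_image (\<alpha> d) \<union> outer1 e"
    using ends by (simp add: path_image_join o1[symmetric] o2[symmetric] Un_assoc)
  have z0z1: "z0 \<noteq> z1" using arc_distinct_ends[OF \<alpha>] ends by simp
  have disj: "x \<notin> outer1 f" if "x \<in> outer2 g" "f \<in> darts H" "g \<in> darts H" for x f g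
  proof
    assume "x \<in> outer1 f"
    moreover have "x \<in> cball (c f) 1" "x \<in> cball (c g) 1"
      using that calculation pieces_in_cball by blast+
    then have "f = g \<or> f = opp H g" using same_disc[of g f x] that by blast
    ultimately show False using that unfolding pieces_eq by (auto simp: pt_eq_iff pt_opp)
  qed
  have \<alpha>_o2: "path_image (\<alpha> d) \<inter> outer2 d = {z0}"
  proof
    show "path_image (\<alpha> d) \<inter> outer2 d \<subseteq> {z0}"
    proof
      fix x assume x: "x \<in> path_image (\<alpha> d) \<inter> outer2 d"
      then have "x \<in> cball (c d) 1" using pieces_in_cball[OF d] by blast
      then have "x = z0 \<or> x = z1" using arc_in_disc[OF d d] x by (auto simp: z0_def z1_def e_def)
      moreover have "x \<noteq> z1" using disj[of x d e] x e d by (auto simp: z1_def pieces_eq(2))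
      ultimately show "x \<in> {z0}" by blast
    qed
    show "{z0} \<subseteq> path_image (\<alpha> d) \<inter> outer2 d"
      using pathstart_in_path_image[of "\<alpha> d"] ends by (auto simp: z0_def pieces_eq)
  qed
  have \<alpha>_o1: "path_image (\<alpha> d) \<inter> outer1 e = {z1}"
  proof
    show "path_image (\<alpha> d) \<inter> outer1 e \<subseteq> {z1}"
    proof
      fix x assume x: "x \<in> path_image (\<alpha> d) \<inter> outer1 e"
      then have "x \<in> cball (c e) 1" using pieces_in_cball[OF e] by blast
      then have "x = z0 \<or> x = z1" using arc_in_disc[OF d e] x by (auto simp: z0_def z1_def e_def)
      moreover have "x \<noteq> z0" using disj[of x d e] x e d by (auto simp: z0_def pieces_eq(1))
      ultimately show "x \<in> {z1}" by blast
    qed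
    show "{z1} \<subseteq> path_image (\<alpha> d) \<inter> outer1 e"
      using pathfinish_in_path_image[of "\<alpha> d"] ends by (auto simp: z1_def pieces_eq)
  qed
  have o12: "outer2 d \<inter> outer1 e = {}" using disj d e by blast
  have "arc (linepath m0 z0)" "arc (linepath z1 m1)"
    using d e by (auto simp: m0_def z0_def m1_def z1_def pt_eq_iff)
  note l = this
  have I1: "path_image (\<alpha> d +++ linepath z1 m1) = path_image (\<alpha> d) \<union> outer1 e"
    using ends by (subst path_image_join) (auto simp only: o1 pathstart_linepath)
  have "arc (\<alpha> d +++ linepath z1 m1)"
    by (rule arc_join[OF \<alpha> l(2)]) (simp_all only: ends pathstart_linepath o1 \<alpha>_o1 subset_refl)
  then have arcA: "arc ?A"
  proof (rule arc_join[OF l(1)])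
    have "outer2 d \<inter> (path_image (\<alpha> d) \<union> outer1 e) = {z0}" using \<alpha>_o2 o12 by blast
    then show "path_image (linepath m0 z0) \<inter> path_image (\<alpha> d +++ linepath z1 m1) \<subseteq> {pathstart (\<alpha> d +++ linepath z1 m1)}"
      unfolding o2 I1 pathstart_join ends by simp
  qed (simp add: ends)
  define \<P> where "\<P> = (\<lambda>f. path_image (\<alpha> f)) ` (darts H - {d}) \<union> outer2 ` (darts H - {d}) \<union> outer1 ` (darts H - {e})
      \<union> inner1 ` darts H \<union> inner2 ` darts H"
  define S where "S = \<Union>\<P>"
  have finP: "finite \<P>" using finite_darts by (simp add: \<P>_def)
  have P: "compact Q \<and> path_connected Q" if Qin: "Q \<in> \<P>" for Q
  proof -
    have seg: "compact (closed_segment p q) \<and> path_connected (closed_segment p q)" for p q :: complex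
      by (simp add: convex_imp_path_connected)
    have \<alpha>f: "compact (path_image (\<alpha> f)) \<and> path_connected (path_image (\<alpha> f))" if "f \<in> darts H" for f
      using arc_imp_path[OF drawingD(5)[OF that]] by (simp add: compact_path_image path_connected_path_image)
    obtain f where "f \<in> darts H" "Q = path_image (\<alpha> f) \<or> Q = outer2 f \<or> Q = outer1 f \<or> Q = inner1 f \<or> Q = inner2 f"
      using Qin unfolding \<P>_def by blast
    then show ?thesis
      using seg \<alpha>f[of f] unfolding outer1_def outer2_def inner1_def inner2_def by (elim disjE) simp_all
  qed
  have SA: "S \<union> path_image ?A = diagram"
  proof -
    have S_eq: "S = (\<Union>f\<in>darts H - {d}. path_image (\<alpha> f)) \<union> (\<Union>f\<in>darts H - {d}. outer2 f)
        \<union> (\<Union>f\<in>darts H - {e}. outer1 f) \<union> (\<Union>f\<in>darts H. inner1 f) \<union> (\<Union>f\<in>darts H. inner2 f)"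
      unfolding S_def \<P>_def Union_Un_distrib by (rule refl)
    have split: "(\<Union>f\<in>darts H. g f) = g x \<union> (\<Union>f\<in>darts H - {x}. g f)"
      if "x \<in> darts H" for x and g :: "'d \<Rightarrow> complex set"
      using that by (metis UN_insert insert_Diff)
    show ?thesis
      unfolding AI S_eq diagram_pieces UN_Un_distrib split[OF d, of "\<lambda>f. path_image (\<alpha> f)"]
        split[OF d, of outer2] split[OF e, of outer1]
      by (simp only: Un_ac)
  qed
  have AS: "path_image ?A \<inter> S = {m0, m1}"
  proof
    have "m0 \<in> inner2 d" "m1 \<in> inner1 e" by (auto simp: m0_def m1_def pieces_eq)
    moreover have "inner2 d \<in> \<P>" "inner1 e \<in> \<P>" unfolding \<P>_def using d e by simp_all
    ultimately have "m0 \<in> S" "m1 \<in> S" unfolding S_def by blast+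
    moreover have "m0 \<in> outer2 d" "m1 \<in> outer1 e" by (auto simp: m0_def m1_def pieces_eq)
    ultimately show "{m0, m1} \<subseteq> path_image ?A \<inter> S" unfolding AI by simp
    show "path_image ?A \<inter> S \<subseteq> {m0, m1}"
    proof
      fix x assume "x \<in> path_image ?A \<inter> S"
      then have xA: "x \<in> outer2 d \<or> x \<in> path_image (\<alpha> d) \<or> x \<in> outer1 e" and xS: "x \<in> S" unfolding AI by auto
      obtain f where f: "f \<in> darts H"
        and xf: "(f \<noteq> d \<and> x \<in> path_image (\<alpha> f)) \<or> (f \<noteq> d \<and> x \<in> outer2 f) \<or> (f \<noteq> e \<and> x \<in> outer1 f) \<or> x \<in> inner1 f \<or> x \<in> inner2 f"
        using xS unfolding S_def \<P>_def by blast
      \<comment> \<open>the arc only meets pieces inside discs in its two end points, which lie in the two outer segments\<close>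
      have xA': "x \<in> outer2 d \<or> x \<in> outer1 e"
      proof (rule ccontr)
        assume n: "\<not> ?thesis"
        then have xa: "x \<in> path_image (\<alpha> d)" using xA by blast
        have "x \<notin> path_image (\<alpha> f)" if "f \<noteq> d" using drawingD(9)[OF d f] that xa by blast
        then have "x \<in> cball (c f) 1" using xf pieces_in_cball[OF f] by blast
        then have "x = z0 \<or> x = z1" using arc_in_disc[OF d f xa] by (auto simp: z0_def z1_def e_def)
        then show False using n by (auto simp: z0_def z1_def pieces_eq)
      qed
      have xc: "x \<in> outer2 d \<and> x \<in> cball (c d) 1 \<or> x \<in> outer1 e \<and> x \<in> cball (c e) 1"
        using xA' pieces_in_cball[OF d] pieces_in_cball[OF e] by blast
      have not_\<alpha>: False if g: "f \<noteq> d" "x \<in> path_image (\<alpha> f)"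
      proof -
        have rf: "rot H f \<in> darts H" using rot_dart[OF f] .
        have "x = pt f 0 1 \<or> x = pt (rot H f) (- 1) 0" using arc_in_disc[OF f _ g(2)] xc d e by blast
        then show False
        proof
          assume x: "x = pt f 0 1"
          have xo2: "x \<in> outer2 f" by (simp add: x pieces_eq(1))
          then have xo: "x \<in> outer2 f" "x \<in> cball (c f) 1" using pieces_in_cball[OF f] by blast+
          then have xd: "x \<in> outer2 d" "x \<in> cball (c d) 1" using disj[of x f e] xc f e by blast+
          then have "f = opp H d" using same_disc[OF d f] xo g by blast
          then show False using xd(1) d unfolding x by (auto simp: pieces_eq pt_opp pt_eq_iff)
        next
          assume x: "x = pt (rot H f) (- 1) 0"
          have xo1: "x \<in> outer1 (rot H f)" by (simp add: x pieces_eq(2))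
          then have xo: "x \<in> outer1 (rot H f)" "x \<in> cball (c (rot H f)) 1"
            using pieces_in_cball[OF rf] by blast+
          then have xe: "x \<in> outer1 e" "x \<in> cball (c e) 1" using disj[of x d "rot H f"] xc rf d by blast+
          then have "rot H f = e \<or> rot H f = opp H e" using same_disc[OF e rf] xo by blast
          then show False
          proof
            assume "rot H f = e"
            then have "x = pathfinish (\<alpha> d)" using x ends by (simp add: z1_def)
            then have "x \<in> path_image (\<alpha> d)" by (simp add: pathfinish_in_path_image)
            then show False using drawingD(9)[OF d f] g by blast
          next
            assume "rot H f = opp H e"
            then show False using xe(1) e unfolding x by (auto simp: pieces_eq pt_opp pt_eq_iff)
          qed
        qed
      qed
      consider "f \<noteq> d" "x \<in> outer2 f" | "f \<noteq> e" "x \<in> outer1 f" | "x \<in> inner1 f" | "x \<in> inner2 f"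
        using xf not_\<alpha> by blast
      then show "x \<in> {m0, m1}"
      proof cases
        case 1
        then have "x \<in> outer2 d" "x \<in> cball (c d) 1" "x \<in> cball (c f) 1"
          using disj[of x f e] xc f e pieces_in_cball[OF f] by blast+
        moreover from this have "f = opp H d" using same_disc[OF d f] 1 by blast
        ultimately show ?thesis using 1 d by (auto simp: pieces_eq pt_opp pt_eq_iff)
      next
        case 2
        then have "x \<in> outer1 e" "x \<in> cball (c e) 1" "x \<in> cball (c f) 1"
          using disj[of x d f] xc f d pieces_in_cball[OF f] by blast+
        moreover from this have "f = opp H e" using same_disc[OF e f] 2 by blast
        ultimately show ?thesis using 2 e by (auto simp: pieces_eq pt_opp pt_eq_iff)
      next
        case 3
        then have xf: "x \<in> cball (c f) 1" using pieces_in_cball[OF f] by blast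
        from xc show ?thesis
        proof
          assume x: "x \<in> outer2 d \<and> x \<in> cball (c d) 1"
          then have "f = d \<or> f = opp H d" using same_disc[OF d f] xf by blast
          then show ?thesis using conjunct1[OF x] 3 d by (auto simp: pieces_eq pt_opp pt_eq_iff)
        next
          assume x: "x \<in> outer1 e \<and> x \<in> cball (c e) 1"
          then have fe: "f = e \<or> f = opp H e" using same_disc[OF e f] xf by blast
          obtain s where s: "x = pt e s 0" "- 1 \<le> s" "s \<le> - 1/2" using conjunct1[OF x] by (auto simp: pieces_eq)
          have "- 1/2 \<le> s" using fe 3 e unfolding s(1) by (auto simp: pieces_eq pt_opp pt_eq_iff)
          then have "s = - 1/2" using s by simp
          then have "x = m1" using s(1) by (simp only: m1_def)
          then show ?thesis by blast
        qed
      next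
        case 4
        then have xf: "x \<in> cball (c f) 1" using pieces_in_cball[OF f] by blast
        from xc show ?thesis
        proof
          assume x: "x \<in> outer1 e \<and> x \<in> cball (c e) 1"
          then have "f = e \<or> f = opp H e" using same_disc[OF e f] xf by blast
          then show ?thesis using conjunct1[OF x] 4 e by (auto simp: pieces_eq pt_opp pt_eq_iff)
        next
          assume x: "x \<in> outer2 d \<and> x \<in> cball (c d) 1"
          then have fd: "f = d \<or> f = opp H d" using same_disc[OF d f] xf by blast
          obtain s where s: "x = pt d 0 s" "1/2 \<le> s" "s \<le> 1" using conjunct1[OF x] by (auto simp: pieces_eq)
          have "s \<le> 1/2" using fd 4 d unfolding s(1) by (auto simp: pieces_eq pt_opp pt_eq_iff)
          then have "s = 1/2" using s by simp
          then have "x = m0" using s(1) by (simp only: m0_def)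
          then show ?thesis by blast
        qed
      qed
    qed
  qed
  obtain s0 where s0: "0 < s0"
    "\<And>s. 0 < s \<Longrightarrow> s < s0 \<Longrightarrow> connected_component (- diagram)
        (midpoint m0 z0 + s *\<^sub>R (\<i> * (z0 - m0))) (midpoint z1 m1 + s *\<^sub>R (\<i> * (m1 - z1)))"
    "\<And>s. 0 < s \<Longrightarrow> s < s0 \<Longrightarrow> connected_component (- diagram)
        (midpoint m0 z0 - s *\<^sub>R (\<i> * (z0 - m0))) (midpoint z1 m1 - s *\<^sub>R (\<i> * (m1 - z1)))"
    using sides_of_arc[OF finP P S_def ends arcA AS] unfolding SA by blast
  define s where "s = min (1/2) (s0 / 2)"
  have s: "0 < s" "s < s0" "s \<le> 1/2" using s0(1) by (auto simp: s_def)
  have e12: "strand2 f = \<i> * strand1 f" "\<i> * strand2 f = - strand1 f" for f by (simp_all add: strand2_eq)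
  have p0: "midpoint m0 z0 + s *\<^sub>R (\<i> * (z0 - m0)) = pt d (- s / 2) (3/4)"
    "midpoint m0 z0 - s *\<^sub>R (\<i> * (z0 - m0)) = pt d (s / 2) (3/4)"
    by (simp_all add: m0_def z0_def pt_def midpoint_def e12(1) complex_eq_iff field_simps)
  have p1: "midpoint z1 m1 + s *\<^sub>R (\<i> * (m1 - z1)) = pt e (- 3/4) (s / 2)"
    "midpoint z1 m1 - s *\<^sub>R (\<i> * (m1 - z1)) = pt e (- 3/4) (- s / 2)"
    by (simp_all add: m1_def z1_def pt_def midpoint_def e12(1) complex_eq_iff field_simps)
  have sq: "s\<^sup>2 \<le> 1/4" using power_mono[of s "1/2" 2] s by (simp add: power2_eq_square)
  have q: "connected_component (- diagram) (pt f a b) (pt f a' b')"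
    if "f \<in> darts H" "0 < a * a'" "0 < b * b'" "a\<^sup>2 + b\<^sup>2 \<le> 1" "a'\<^sup>2 + b'\<^sup>2 \<le> 1" for f a b a' b'
    using quadrant_connected[of f a b a' b'] that by blast
  note tr = connected_component_trans
  show "connected_component (- diagram) (tail_corner d) (tail_corner (rot H d))"
    unfolding tail_corner_def e_def[symmetric]
  proof (rule tr[OF _ tr])
    show "connected_component (- diagram) (pt d (- 1 / 2) (1 / 2)) (pt d (- s / 2) (3/4))"
      using s sq by (intro q d) (auto simp: power2_eq_square)
    show "connected_component (- diagram) (pt d (- s / 2) (3/4)) (pt e (- 3/4) (s / 2))"
      using s0(2)[OF s(1,2)] unfolding p0 p1 .
    show "connected_component (- diagram) (pt e (- 3/4) (s / 2)) (pt e (- 1 / 2) (1 / 2))"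
      using s sq by (intro q e) (auto simp: power2_eq_square)
  qed
  show "connected_component (- diagram) (left_corner d) (left_corner (opp H (rot H d)))"
    unfolding left_corner_def e_def[symmetric] pt_opp[OF e]
  proof (rule tr[OF _ tr])
    show "connected_component (- diagram) (pt d (1 / 2) (1 / 2)) (pt d (s / 2) (3/4))"
      using s sq by (intro q d) (auto simp: power2_eq_square)
    show "connected_component (- diagram) (pt d (s / 2) (3/4)) (pt e (- 3/4) (- s / 2))"
      using s0(3)[OF s(1,2)] unfolding p0 p1 .
    show "connected_component (- diagram) (pt e (- 3/4) (- s / 2)) (pt e (- (1 / 2)) (- (1 / 2)))"
      using s sq by (intro q e) (auto simp: power2_eq_square)
  qed
qed

end

section \<open>Frames and flat families\<close>

definition paths_between :: "'a::topological_space set \<Rightarrow> 'a \<Rightarrow> 'a \<Rightarrow> (real \<Rightarrow> 'a) set" where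
  "paths_between X x y = {p. path p \<and> path_image p \<subseteq> X \<and> pathstart p = x \<and> pathfinish p = y}"

lemma paths_between_join:
  "p \<in> paths_between X x y \<Longrightarrow> q \<in> paths_between X y z \<Longrightarrow> p +++ q \<in> paths_between X x z"
  by (auto simp: paths_between_def path_image_join)

lemma paths_between_reverse: "p \<in> paths_between X x y \<Longrightarrow> reversepath p \<in> paths_between X y x"
  by (auto simp: paths_between_def)

lemma paths_between_loops: "paths_between X a a = loops X a"
  by (auto simp: paths_between_def loops_def)

lemma homotopic_join_reverse:
  assumes "p \<in> paths_between X x y"
  shows "homotopic_paths X (p +++ reversepath p) (\<lambda>_. x)"
proof -
  have p: "continuous_on {0..1} p" "p ` {0..1} \<subseteq> X" "p 0 = x"
    using assms by (auto simp: paths_between_def pathstart_def pathfinish_def path_def path_image_def)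
  define g where "g = (\<lambda>y::real \<times> real. (1 - fst y) * (1 - \<bar>1 - 2 * snd y\<bar>))"
  have g: "g y \<in> {0..1}" if "y \<in> {0..1} \<times> {0..1}" for y
  proof -
    obtain t s where y: "y = (t, s)" by (cases y)
    have "\<bar>1 - 2 * s\<bar> \<le> 1" "0 \<le> t" "t \<le> 1"
      using that y by (auto simp: abs_le_iff)
    then have "0 \<le> (1 - t) * (1 - \<bar>1 - 2 * s\<bar>)" "(1 - t) * (1 - \<bar>1 - 2 * s\<bar>) \<le> 1 * 1"
      by (intro mult_nonneg_nonneg mult_mono; simp)+
    then show ?thesis by (simp add: g_def y)
  qed
  show ?thesis
    unfolding homotopic_paths
  proof (intro exI[of _ "p \<circ> g"] conjI ballI)
    have "continuous_on ({0..1} \<times> {0..1}) g"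
      unfolding g_def by (intro continuous_intros)
    then show "continuous_on ({0..1} \<times> {0..1}) (p \<circ> g)"
      using g by (intro continuous_on_compose continuous_on_subset[OF p(1)]) auto
    show "p \<circ> g \<in> {0..1} \<times> {0..1} \<rightarrow> X"
      using g p(2) by (auto simp: Pi_iff image_subset_iff)
    show "(p \<circ> g) (0, s) = (p +++ reversepath p) s" if "s \<in> {0..1}" for s
      using that by (auto simp: g_def joinpaths_def reversepath_def)
    show "(p \<circ> g) (1, s) = x" for s
      using p by (simp add: g_def)
    show "pathstart (p \<circ> g \<circ> Pair t) = pathstart (p +++ reversepath p)"
      "pathfinish (p \<circ> g \<circ> Pair t) = pathfinish (p +++ reversepath p)" for t
      using p by (auto simp: g_def pathstart_def pathfinish_def joinpaths_def reversepath_def)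
  qed
qed

lemma homotopic_join_const:
  assumes "p \<in> paths_between X x y"
  shows "homotopic_paths X (p +++ (\<lambda>_. y)) p"
proof -
  have p: "path p" "path_image p \<subseteq> X" "p 1 = y"
    using assms by (auto simp: paths_between_def pathfinish_def)
  have "homotopic_paths X p (p +++ (\<lambda>_. y))"
  proof (rule homotopic_paths_reparametrize[where f = "\<lambda>t. min 1 (2 * t)"])
    show "continuous_on {0..1} (\<lambda>t::real. min 1 (2 * t))"
      by (intro continuous_intros)
    show "(p +++ (\<lambda>_. y)) t = p (min 1 (2 * t))" if "t \<in> {0..1}" for t
    proof (cases "t \<le> 1 / 2")
      case True
      then show ?thesis by (simp add: joinpaths_def min_absorb2)
    next
      case False
      then show ?thesis using p(3) by (simp add: joinpaths_def min_absorb1)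
    qed
  qed (use p in auto)
  then show ?thesis by (rule homotopic_paths_sym)
qed

lemma homotopic_cancel:
  assumes p: "p \<in> paths_between X x z" and q: "q \<in> paths_between X y z" and r: "r \<in> paths_between X z w"
  shows "homotopic_paths X ((p +++ reversepath q) +++ (q +++ r)) (p +++ r)"
proof -
  note D = paths_between_def
  have rq: "homotopic_paths X (reversepath q +++ q) (\<lambda>_. z)"
    using homotopic_join_reverse[OF paths_between_reverse[OF q]] by simp
  have "homotopic_paths X ((p +++ reversepath q) +++ (q +++ r)) (((p +++ reversepath q) +++ q) +++ r)"
    using p q r by (intro homotopic_paths_assoc) (auto simp: D path_image_join)
  also have "homotopic_paths X \<dots> ((p +++ (reversepath q +++ q)) +++ r)"
    using p q r by (intro homotopic_paths_join homotopic_paths_sym[OF homotopic_paths_assoc]) (auto simp: D)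
  also have "homotopic_paths X \<dots> ((p +++ (\<lambda>_. z)) +++ r)"
    using p q r by (intro homotopic_paths_join rq) (auto simp: D)
  also have "homotopic_paths X \<dots> (p +++ r)"
    using p q r by (intro homotopic_paths_join homotopic_join_const[OF p]) (auto simp: D pathfinish_def joinpaths_def)
  finally show ?thesis .
qed

text \<open>For two paths with the same ends this is the class of the loop along \<open>p\<close> and back along \<open>q\<close>.\<close>

definition path_quotient :: "'a::topological_space set \<Rightarrow> (real \<Rightarrow> 'a) \<Rightarrow> (real \<Rightarrow> 'a) \<Rightarrow> (real \<Rightarrow> 'a) set" where
  "path_quotient X p q = homotopy_class X (p +++ reversepath q)"

locale based_space =
  fixes X :: "'a::topological_space set" and a :: 'a
  assumes base: "a \<in> X"
begin

abbreviation fg ("\<pi>") where "\<pi> \<equiv> fundamental_group X a"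
abbreviation fg_mult (infixl "\<cdot>" 70) where "x \<cdot> y \<equiv> x \<otimes>\<^bsub>\<pi>\<^esub> y"
abbreviation fg_inv ("inv\<pi> _" [81] 80) where "inv\<pi> x \<equiv> inv\<^bsub>\<pi>\<^esub> x"
abbreviation "quot \<equiv> path_quotient X"
abbreviation "P \<equiv> paths_between X"

sublocale group \<pi>
  by (rule group_fundamental_group[OF base])

lemma quot_loop: "p \<in> P a x \<Longrightarrow> q \<in> P a x \<Longrightarrow> p +++ reversepath q \<in> loops X a"
  unfolding paths_between_loops[symmetric] by (rule paths_between_join[OF _ paths_between_reverse])

lemma quot_carrier [simp]: "p \<in> P a x \<Longrightarrow> q \<in> P a x \<Longrightarrow> quot p q \<in> carrier \<pi>"
  using quot_loop by (auto simp: path_quotient_def fundamental_group_def)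

lemma quot_mult:
  assumes "p \<in> P a x" "q \<in> P a x" "r \<in> P a x"
  shows "quot p q \<cdot> quot q r = quot p r"
proof -
  have "homotopic_paths X ((p +++ reversepath q) +++ (q +++ reversepath r)) (p +++ reversepath r)"
    using assms by (intro homotopic_cancel) (auto intro: paths_between_reverse)
  then show ?thesis
    unfolding path_quotient_def mult_homotopy_class[OF quot_loop[OF assms(1,2)] quot_loop[OF assms(2,3)]]
    using homotopy_class_eq_iff[OF join_loops[OF quot_loop[OF assms(1,2)] quot_loop[OF assms(2,3)]]]
    by blast
qed

lemma quot_self: "p \<in> P a x \<Longrightarrow> quot p p = \<one>\<^bsub>\<pi>\<^esub>"
  using quot_mult[of p x p p] quot_carrier[of p x p] l_cancel_one[of "quot p p" "quot p p"] by blast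

lemma quot_inv: "p \<in> P a x \<Longrightarrow> q \<in> P a x \<Longrightarrow> inv\<pi> quot p q = quot q p"
  using quot_mult[of q x p q] quot_self[of q x] inv_equality[of "quot q p" "quot p q"]
    quot_carrier[of p x q] quot_carrier[of q x p] by simp

lemma quot_cong:
  assumes "p \<in> P a x" "q \<in> P a x" "homotopic_paths X p p'" "homotopic_paths X q q'"
  shows "quot p q = quot p' q'"
proof -
  have "homotopic_paths X (p +++ reversepath q) (p' +++ reversepath q')"
    using assms by (intro homotopic_paths_join) (auto simp: paths_between_def homotopic_paths_reversepath)
  then show ?thesis
    unfolding path_quotient_def using homotopy_class_eq_iff[OF quot_loop[OF assms(1,2)]] by blast
qed

lemma quot_join:
  assumes "p \<in> P a x" "q \<in> P a x" "r \<in> P x y"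
  shows "quot (p +++ r) (q +++ r) = quot p q"
proof -
  have "homotopic_paths X ((p +++ reversepath (reversepath r)) +++ (reversepath r +++ reversepath q)) (p +++ reversepath q)"
    using assms by (intro homotopic_cancel) (auto intro: paths_between_reverse)
  moreover have "reversepath (q +++ r) = reversepath r +++ reversepath q"
    using assms by (intro reversepath_joinpaths) (auto simp: paths_between_def)
  ultimately have "homotopic_paths X ((p +++ r) +++ reversepath (q +++ r)) (p +++ reversepath q)"
    by simp
  then show ?thesis
    unfolding path_quotient_def
    using homotopy_class_eq_iff[OF quot_loop[OF paths_between_join[OF assms(1,3)] paths_between_join[OF assms(2,3)]]]
    by blast
qed

lemma quot_loop_join:
  assumes "l \<in> loops X a" "p \<in> P a x"
  shows "quot (l +++ p) p = homotopy_class X l"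
proof -
  have l: "l \<in> P a a" using assms by (simp add: paths_between_loops)
  have "homotopic_paths X ((l +++ p) +++ reversepath p) (l +++ (p +++ reversepath p))"
    using l assms(2) by (intro homotopic_paths_sym[OF homotopic_paths_assoc]) (auto simp: paths_between_def)
  also have "homotopic_paths X \<dots> (l +++ (\<lambda>_. a))"
    using l assms(2) by (intro homotopic_paths_join homotopic_join_reverse) (auto simp: paths_between_def)
  also have "homotopic_paths X \<dots> l" using homotopic_join_const[OF l] .
  finally show ?thesis
    unfolding path_quotient_def
    using homotopy_class_eq_iff[OF quot_loop[OF paths_between_join[OF l assms(2)] assms(2)]] by blast
qed

text \<open>A choice of paths from the base point to the points of \<open>A\<close> that is carried along by paths in
  \<open>A\<close>. It makes \<open>A\<close> look like a single point: in a set where all paths with equal ends are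
  homotopic in \<open>X\<close>, one path to it determines a frame.\<close>

definition frame :: "'a set \<Rightarrow> ('a \<Rightarrow> real \<Rightarrow> 'a) \<Rightarrow> bool" where
  "frame A \<phi> \<longleftrightarrow> (\<forall>x\<in>A. \<phi> x \<in> P a x) \<and>
     (\<forall>d x y. d \<in> paths_between A x y \<longrightarrow> homotopic_paths X (\<phi> x +++ d) (\<phi> y))"

lemma paths_between_mono: "A \<subseteq> B \<Longrightarrow> paths_between A x y \<subseteq> paths_between B x y"
  by (auto simp: paths_between_def)

lemma frame_path: "frame A \<phi> \<Longrightarrow> x \<in> A \<Longrightarrow> \<phi> x \<in> P a x"
  by (simp add: frame_def)

lemma paths_between_ends: "d \<in> paths_between A x y \<Longrightarrow> x \<in> A \<and> y \<in> A"
  unfolding paths_between_def by auto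

lemma frame_quot:
  assumes "frame A \<phi>" "A \<subseteq> X" "d \<in> paths_between A x y" "p \<in> P a x"
  shows "quot (p +++ d) (\<phi> y) = quot p (\<phi> x)"
proof -
  have xy: "x \<in> A" "y \<in> A" using paths_between_ends[OF assms(3)] by auto
  have d: "d \<in> P x y" using assms(3) paths_between_mono[OF assms(2)] by blast
  have "quot (p +++ d) (\<phi> y) = quot (p +++ d) (\<phi> x +++ d)"
  proof (rule quot_cong)
    show "homotopic_paths X (p +++ d) (p +++ d)"
      using paths_between_join[OF assms(4) d] by (simp add: paths_between_def)
    show "homotopic_paths X (\<phi> y) (\<phi> x +++ d)"
      using assms unfolding frame_def by (blast intro: homotopic_paths_sym)
  qed (use paths_between_join[OF assms(4) d] frame_path[OF assms(1)] xy in auto)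
  also have "\<dots> = quot p (\<phi> x)" using assms d xy by (intro quot_join) (auto simp: frame_path)
  finally show ?thesis .
qed

lemma frame_quot_frame:
  assumes "frame A \<phi>" "A \<subseteq> X" "frame B \<psi>" "B \<subseteq> X" "d \<in> paths_between (A \<inter> B) x y"
  shows "quot (\<phi> x) (\<psi> x) = quot (\<phi> y) (\<psi> y)"
proof -
  have d: "d \<in> paths_between A x y" "d \<in> paths_between B x y" "d \<in> P x y"
    using assms(2,5) unfolding paths_between_def by auto
  have xy: "x \<in> A" "y \<in> A" "x \<in> B" "y \<in> B" using paths_between_ends[OF assms(5)] by auto
  have "quot (\<phi> x) (\<psi> x) = quot (\<phi> x +++ d) (\<psi> y)"
    using frame_quot[OF assms(3,4) d(2)] frame_path[OF assms(1)] xy by simp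
  also have "\<dots> = quot (\<phi> y) (\<psi> y)"
  proof (rule quot_cong)
    show "homotopic_paths X (\<phi> x +++ d) (\<phi> y)"
      using assms(1) d unfolding frame_def by blast
    show "\<phi> x +++ d \<in> P a y" by (rule paths_between_join[OF frame_path[OF assms(1) xy(1)] d(3)])
    show "\<psi> y \<in> P a y" using frame_path[OF assms(3)] xy by blast
    then show "homotopic_paths X (\<psi> y) (\<psi> y)" by (simp add: paths_between_def)
  qed
  finally show ?thesis .
qed

text \<open>Join the base point to one point of \<open>A\<close> and go on inside \<open>A\<close>; the choice of the second path
  does not matter.\<close>

lemma frame_exists:
  assumes "A \<subseteq> X" "path_connected X" "path_connected A"
    and sc: "\<And>p q x y. p \<in> paths_between A x y \<Longrightarrow> q \<in> paths_between A x y \<Longrightarrow> homotopic_paths X p q"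
  obtains \<phi> where "frame A \<phi>"
proof (cases "A = {}")
  case True
  then have "frame A (\<lambda>_ _. a)" unfolding frame_def using paths_between_ends by blast
  then show ?thesis by (rule that)
next
  case False
  then obtain x0 where x0: "x0 \<in> A" by blast
  then obtain e where e: "e \<in> P a x0"
    using assms(1) base assms(2)[unfolded path_connected_def] unfolding paths_between_def by blast
  have "\<exists>q. q \<in> paths_between A x0 x" if "x \<in> A" for x
    using that assms(3) x0 unfolding path_connected_def paths_between_def by blast
  then obtain q where q: "\<And>x. x \<in> A \<Longrightarrow> q x \<in> paths_between A x0 x" by metis
  have qX: "q x \<in> P x0 x" if "x \<in> A" for x using q[OF that] paths_between_mono[OF assms(1)] by blast
  show ?thesis
  proof (rule that[of "\<lambda>x. e +++ q x"], unfold frame_def, intro conjI ballI allI impI)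
    show "e +++ q x \<in> P a x" if "x \<in> A" for x using paths_between_join[OF e qX[OF that]] .
    fix d x y assume d: "d \<in> paths_between A x y"
    have xy: "x \<in> A" "y \<in> A" using paths_between_ends[OF d] by auto
    have dX: "d \<in> P x y" using d paths_between_mono[OF assms(1)] by blast
    have "homotopic_paths X ((e +++ q x) +++ d) (e +++ (q x +++ d))"
      using e qX[OF xy(1)] dX
      by (intro homotopic_paths_sym[OF homotopic_paths_assoc]) (auto simp: paths_between_def)
    also have "homotopic_paths X \<dots> (e +++ q y)"
    proof (intro homotopic_paths_join)
      show "homotopic_paths X (q x +++ d) (q y)"
        by (rule sc[OF paths_between_join[OF q[OF xy(1)] d] q[OF xy(2)]])
    qed (use e qX[OF xy(1)] in \<open>auto simp: paths_between_def\<close>)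
    finally show "homotopic_paths X ((e +++ q x) +++ d) (e +++ q y)" .
  qed
qed

definition trans :: "(real \<Rightarrow> 'a) set \<Rightarrow> (real \<Rightarrow> 'a) set set \<Rightarrow> (real \<Rightarrow> 'a) set set" where
  "trans g D = (\<cdot>) g ` D"

lemma trans_trans: "\<lbrakk>g \<in> carrier \<pi>; h \<in> carrier \<pi>; D \<subseteq> carrier \<pi>\<rbrakk> \<Longrightarrow> trans g (trans h D) = trans (g \<cdot> h) D"
  unfolding trans_def image_image by (intro image_cong refl) (auto simp: m_assoc)

lemma trans_one: "D \<subseteq> carrier \<pi> \<Longrightarrow> trans \<one>\<^bsub>\<pi>\<^esub> D = D"
  unfolding trans_def by (rule image_cong[of D D _ "\<lambda>x. x", simplified]) (auto simp: subset_iff)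

lemma trans_carrier: "\<lbrakk>g \<in> carrier \<pi>; D \<subseteq> carrier \<pi>\<rbrakk> \<Longrightarrow> trans g D \<subseteq> carrier \<pi>"
  by (auto simp: trans_def)

lemma trans_quot:
  assumes "p \<in> P a x" "q \<in> P a x" "r \<in> P a x" "D \<subseteq> carrier \<pi>"
  shows "trans (quot p q) (trans (quot q r) D) = trans (quot p r) D"
  using assms quot_carrier[of p x q] quot_carrier[of q x r] by (simp add: trans_trans quot_mult)

definition compatible :: "'a set \<times> ('a \<Rightarrow> real \<Rightarrow> 'a) \<times> (real \<Rightarrow> 'a) set set \<Rightarrow>
    'a set \<times> ('a \<Rightarrow> real \<Rightarrow> 'a) \<times> (real \<Rightarrow> 'a) set set \<Rightarrow> bool" where
  "compatible s t = (case s of (A, \<phi>, D) \<Rightarrow> case t of (B, \<psi>, E) \<Rightarrow>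
     \<forall>x\<in>A \<inter> B. D = trans (quot (\<phi> x) (\<psi> x)) E)"

text \<open>A flat family attaches subsets of the fundamental group to framed open sets such that, where
  two of these overlap, the subsets differ by the quotient of the two frames. It is a
  locally constant family of subsets, written in local trivialisations.\<close>

definition flat_family :: "('a set \<times> ('a \<Rightarrow> real \<Rightarrow> 'a) \<times> (real \<Rightarrow> 'a) set set) set \<Rightarrow> bool" where
  "flat_family F \<longleftrightarrow>
     (\<forall>(A, \<phi>, D)\<in>F. openin (top_of_set X) A \<and> frame A \<phi> \<and> D \<subseteq> carrier \<pi>) \<and>
     (\<forall>s\<in>F. \<forall>t\<in>F. compatible s t)"

lemma flat_familyD:
  assumes "flat_family F" "(A, \<phi>, D) \<in> F"
  shows "openin (top_of_set X) A" "A \<subseteq> X" "frame A \<phi>" "D \<subseteq> carrier \<pi>"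
  using assms openin_imp_subset[of euclidean X A] unfolding flat_family_def by auto

lemma flat_family_compatible:
  assumes "flat_family F" "(A, \<phi>, D) \<in> F" "(B, \<psi>, E) \<in> F" "x \<in> A" "x \<in> B"
  shows "D = trans (quot (\<phi> x) (\<psi> x)) E"
  using assms unfolding flat_family_def compatible_def by fastforce

lemma compatible_sym:
  assumes "frame A \<phi>" "frame B \<psi>" "E \<subseteq> carrier \<pi>" and c: "compatible (A, \<phi>, D) (B, \<psi>, E)"
  shows "compatible (B, \<psi>, E) (A, \<phi>, D)"
  unfolding compatible_def
proof (clarify)
  fix x assume x: "x \<in> B" "x \<in> A"
  then have D: "D = trans (quot (\<phi> x) (\<psi> x)) E" using c by (simp add: compatible_def)
  note p = frame_path[OF assms(1) x(2)] frame_path[OF assms(2) x(1)]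
  show "E = trans (quot (\<psi> x) (\<phi> x)) D"
    unfolding D trans_quot[OF p(2,1,2) assms(3)] using quot_self[OF p(2)] trans_one[OF assms(3)] by simp
qed

text \<open>The condition \<open>Q t\<close> says that the subset has been carried correctly along the part of \<open>d\<close> up
  to time \<open>t\<close>. Near each time the path stays in one member of the family, whose frame
  carries the condition along.\<close>

lemma flat_family_transport:
  assumes F: "flat_family F" and d: "d \<in> paths_between (\<Union>(fst ` F)) x y"
    and A: "(A, \<phi>, D) \<in> F" "x \<in> A" and B: "(B, \<psi>, E) \<in> F" "y \<in> B"
  shows "D = trans (quot (\<phi> x +++ d) (\<psi> y)) E"
proof -
  have dX: "d \<in> P x y"
  proof -
    have "\<Union>(fst ` F) \<subseteq> X" using flat_familyD(2)[OF F] by force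
    from paths_between_mono[OF this] d show ?thesis by blast
  qed
  then have path: "path d" "path_image d \<subseteq> X" "d 0 = x" "d 1 = y"
    by (auto simp: paths_between_def pathstart_def pathfinish_def)
  define sub where "sub s t = d \<circ> linepath s t" for s t
  have seg: "closed_segment s t \<subseteq> {0..1}" if "s \<in> {0..1}" "t \<in> {0..1}" for s t :: real
    using that by (intro closed_segment_subset) auto
  have contd: "continuous_on {0..1} d" "d ` {0..1} \<subseteq> X" using path by (auto simp: path_def path_image_def)
  have sub: "sub s t \<in> P (d s) (d t)" if "s \<in> {0..1}" "t \<in> {0..1}" for s t
    using path_continuous_image[of "linepath s t" d] continuous_on_subset[OF contd(1) seg[OF that]] contd(2) seg[OF that]
    by (auto simp: paths_between_def sub_def path_image_compose pathstart_compose pathfinish_compose)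
  have sub_join: "homotopic_paths X (sub r s +++ sub s t) (sub r t)"
    if "r \<in> {0..1}" "s \<in> {0..1}" "t \<in> {0..1}" for r s t
  proof -
    have "homotopic_paths {0..1} (linepath r s +++ linepath s t) (linepath r t)"
      using that seg[of r s] seg[of s t] seg[of r t]
      by (intro simply_connected_eq_homotopic_paths[THEN iffD1, THEN conjunct2, rule_format] convex_imp_simply_connected)
        (auto simp: path_image_join)
    then have "homotopic_paths X (d \<circ> (linepath r s +++ linepath s t)) (d \<circ> linepath r t)"
      using contd by (intro homotopic_paths_continuous_image) auto
    then show ?thesis by (simp add: sub_def path_compose_join)
  qed
  have \<phi>x: "\<phi> x \<in> P a x" using frame_path[OF flat_familyD(3)[OF F A(1)] A(2)] .
  have head: "\<phi> x +++ sub 0 t \<in> P a (d t)" if "t \<in> {0..1}" for t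
    using paths_between_join[OF \<phi>x] sub[of 0 t] that path(3) by auto
  define Q where "Q t \<longleftrightarrow> (\<forall>B \<psi> E. (B, \<psi>, E) \<in> F \<longrightarrow> d t \<in> B \<longrightarrow>
      D = trans (quot (\<phi> x +++ sub 0 t) (\<psi> (d t))) E)" for t
  have "Q 1"
  proof (rule connected_induction_simple[of "{0..1::real}" 0 1 Q])
    show "Q 0" unfolding Q_def
    proof (intro allI impI)
      fix B \<psi> E assume B: "(B, \<psi>, E) \<in> F" "d 0 \<in> B"
      have hx: "homotopic_paths X (\<phi> x) (\<phi> x +++ sub 0 0)"
        using homotopic_paths_sym[OF homotopic_join_const[OF \<phi>x]] path(3)
        by (simp add: sub_def linepath_refl comp_def)
      have "quot (\<phi> x) (\<psi> (d 0)) = quot (\<phi> x +++ sub 0 0) (\<psi> (d 0))"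
        using frame_path[OF flat_familyD(3)[OF F B(1)] B(2)] path(3)
        by (intro quot_cong[OF \<phi>x _ hx]) (auto simp: paths_between_def)
      then show "D = trans (quot (\<phi> x +++ sub 0 0) (\<psi> (d 0))) E"
        using flat_family_compatible[OF F A(1) B(1)] A(2) B(2) path(3) by simp
    qed
    fix t0 assume t0: "t0 \<in> {0..1::real}"
    then have "d t0 \<in> path_image d" by (auto simp: path_image_def)
    then have "d t0 \<in> \<Union>(fst ` F)" using d unfolding paths_between_def by blast
    then obtain C \<kappa> c where C: "(C, \<kappa>, c) \<in> F" "d t0 \<in> C" by force
    have op: "openin (top_of_set {0..1}) ({0..1} \<inter> d -` C)"
      using continuous_openin_preimage[of "{0..1}" d X C] path flat_familyD(1)[OF F C(1)]
      by (auto simp: path_def path_image_def)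
    then obtain e where e: "e > 0" "\<And>t. t \<in> {0..1} \<Longrightarrow> dist t t0 < e \<Longrightarrow> d t \<in> C"
    proof -
      have "t0 \<in> {0..1} \<inter> d -` C" using t0 C(2) by auto
      then obtain e where "e > 0" "\<And>t. t \<in> {0..1} \<Longrightarrow> dist t t0 < e \<Longrightarrow> t \<in> {0..1} \<inter> d -` C"
        using op unfolding openin_euclidean_subtopology_iff by metis
      then show ?thesis using that by blast
    qed
    let ?T = "{0..1} \<inter> ball t0 e"
    show "\<exists>T. openin (top_of_set {0..1}) T \<and> t0 \<in> T \<and> (\<forall>x\<in>T. \<forall>y\<in>T. Q x \<longrightarrow> Q y)"
    proof (intro exI[of _ ?T] conjI ballI impI)
      show "openin (top_of_set {0..1}) ?T" by (simp add: openin_open_Int)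
      show "t0 \<in> ?T" using t0 e by auto
      fix s t assume s: "s \<in> ?T" and t: "t \<in> ?T" and Qs: "Q s"
      have st: "s \<in> {0..1}" "t \<in> {0..1}" using s t by auto
      have "closed_segment s t \<subseteq> ?T"
        using s t by (intro closed_segment_subset convex_Int) auto
      moreover have "d u \<in> C" if "u \<in> ?T" for u using that e(2)[of u] by (auto simp: dist_commute)
      ultimately have "d ` closed_segment s t \<subseteq> C" by blast
      then have subC: "sub s t \<in> paths_between C (d s) (d t)"
        using sub[OF st] st by (simp add: paths_between_def sub_def path_image_compose)
      have inC: "d s \<in> C" "d t \<in> C" using paths_between_ends[OF subC] by auto
      note fC = flat_familyD[OF F C(1)]
      have "D = trans (quot (\<phi> x +++ sub 0 s) (\<kappa> (d s))) c"
        using Qs C(1) inC unfolding Q_def by blast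
      also have "quot (\<phi> x +++ sub 0 s) (\<kappa> (d s)) = quot ((\<phi> x +++ sub 0 s) +++ sub s t) (\<kappa> (d t))"
        using frame_quot[OF fC(3,2) subC head[OF st(1)]] by simp
      also have "\<dots> = quot (\<phi> x +++ sub 0 t) (\<kappa> (d t))"
      proof (rule quot_cong)
        show "(\<phi> x +++ sub 0 s) +++ sub s t \<in> P a (d t)"
          using paths_between_join[OF head[OF st(1)] sub[OF st]] .
        show 1: "\<kappa> (d t) \<in> P a (d t)" using frame_path[OF fC(3) inC(2)] .
        show "homotopic_paths X (\<kappa> (d t)) (\<kappa> (d t))" using 1 by (simp add: paths_between_def)
        have "homotopic_paths X ((\<phi> x +++ sub 0 s) +++ sub s t) (\<phi> x +++ (sub 0 s +++ sub s t))"
          using \<phi>x sub[of 0 s] sub[OF st] st path(3)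
          by (intro homotopic_paths_sym[OF homotopic_paths_assoc]) (auto simp: paths_between_def)
        also have "homotopic_paths X \<dots> (\<phi> x +++ sub 0 t)"
          using \<phi>x path st by (intro homotopic_paths_join sub_join) (auto simp: paths_between_def pathstart_compose sub_def)
        finally show "homotopic_paths X ((\<phi> x +++ sub 0 s) +++ sub s t) (\<phi> x +++ sub 0 t)" .
      qed
      finally have Dc: "D = trans (quot (\<phi> x +++ sub 0 t) (\<kappa> (d t))) c" .
      show "Q t" unfolding Q_def
      proof (intro allI impI)
        fix B \<psi> E assume B: "(B, \<psi>, E) \<in> F" "d t \<in> B"
        note fB = flat_familyD[OF F B(1)]
        show "D = trans (quot (\<phi> x +++ sub 0 t) (\<psi> (d t))) E"
          unfolding Dc flat_family_compatible[OF F C(1) B(1) inC(2) B(2)]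
          by (rule trans_quot[OF head[OF st(2)] frame_path[OF fC(3) inC(2)] frame_path[OF fB(3) B(2)] fB(4)])
      qed
    qed
  qed auto
  moreover have "sub 0 1 = d" by (simp add: sub_def linepath_def fun_eq_iff)
  ultimately show ?thesis using B path(4) unfolding Q_def by auto
qed

text \<open>Carried along a loop, the subset is translated by the class of the loop, but it comes back
  to itself.\<close>

theorem flat_family_fixed:
  assumes F: "flat_family F" and cover: "\<Union>(fst ` F) = X" and pc: "path_connected X"
    and A: "(A, \<phi>, D) \<in> F" "A \<noteq> {}" and g: "g \<in> carrier \<pi>"
  shows "trans g D = D"
proof -
  obtain x where x: "x \<in> A" using A by blast
  note fA = flat_familyD[OF F A(1)]
  have \<phi>x: "\<phi> x \<in> P a x" using frame_path[OF fA(3) x] .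
  obtain l where l: "l \<in> loops X a" "g = homotopy_class X l"
    using g by (auto simp: fundamental_group_def)
  have lP: "l \<in> P a a" using l by (simp add: paths_between_loops)
  \<comment> \<open>conjugate the loop so that it is based in \<open>A\<close>\<close>
  define m where "m = reversepath (\<phi> x) +++ (l +++ \<phi> x)"
  have m: "m \<in> P x x" unfolding m_def
    using paths_between_join[OF paths_between_reverse[OF \<phi>x] paths_between_join[OF lP \<phi>x]] .
  have "D = trans (quot (\<phi> x +++ m) (\<phi> x)) D"
    using flat_family_transport[OF F _ A(1) x A(1) x] m cover by simp
  also have "quot (\<phi> x +++ m) (\<phi> x) = quot (l +++ \<phi> x) (\<phi> x)"
  proof (rule quot_cong)
    have "homotopic_paths X (\<phi> x +++ m) ((\<phi> x +++ reversepath (\<phi> x)) +++ (l +++ \<phi> x))"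
      unfolding m_def using \<phi>x lP paths_between_join[OF lP \<phi>x]
      by (intro homotopic_paths_assoc) (auto simp: paths_between_def)
    also have "homotopic_paths X \<dots> ((\<lambda>_. a) +++ (l +++ \<phi> x))"
      using \<phi>x lP paths_between_join[OF lP \<phi>x]
      by (intro homotopic_paths_join homotopic_join_reverse) (auto simp: paths_between_def)
    also have "homotopic_paths X \<dots> (((\<lambda>_. a) +++ l) +++ \<phi> x)"
      using \<phi>x lP const_loop[OF base]
      by (intro homotopic_paths_assoc) (auto simp: paths_between_def loops_def pathfinish_def)
    also have "homotopic_paths X \<dots> (l +++ \<phi> x)"
      using \<phi>x lP l by (intro homotopic_paths_join homotopic_const_join) (auto simp: paths_between_def)
    finally show "homotopic_paths X (\<phi> x +++ m) (l +++ \<phi> x)" .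
    show "\<phi> x +++ m \<in> P a x" using paths_between_join[OF \<phi>x m] .
    show "\<phi> x \<in> P a x" "homotopic_paths X (\<phi> x) (\<phi> x)" using \<phi>x by (auto simp: paths_between_def)
  qed
  also have "\<dots> = g" using quot_loop_join[OF l(1) \<phi>x] l(2) by simp
  finally show ?thesis by simp
qed

text \<open>A flat family extends over a framed set \<open>V\<close> whose part covered already is path connected:
  the subset for \<open>V\<close> is forced at one covered point, and transport shows that it is right at
  the others. On the overlap of two new sets the condition is inherited along paths that
  lead to covered points.\<close>

theorem flat_family_extend:
  fixes \<V> :: "('a set \<times> ('a \<Rightarrow> real \<Rightarrow> 'a)) set"
  assumes F: "flat_family F"
    and V: "\<And>V \<kappa>. (V, \<kappa>) \<in> \<V> \<Longrightarrow> openin (top_of_set X) V \<and> frame V \<kappa>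
        \<and> path_connected (V \<inter> \<Union>(fst ` F)) \<and> V \<inter> \<Union>(fst ` F) \<noteq> {}"
    and VV: "\<And>V \<kappa> V' \<kappa>' x. (V, \<kappa>) \<in> \<V> \<Longrightarrow> (V', \<kappa>') \<in> \<V> \<Longrightarrow> x \<in> V \<Longrightarrow> x \<in> V' \<Longrightarrow>
        \<exists>d y. d \<in> paths_between (V \<inter> V') x y \<and> y \<in> \<Union>(fst ` F)"
  obtains F' where "flat_family F'" "F \<subseteq> F'" "fst ` F' = fst ` F \<union> fst ` \<V>"
proof -
  let ?X0 = "\<Union>(fst ` F)"
  have "\<exists>u. u \<subseteq> carrier \<pi> \<and> (\<forall>s\<in>F. compatible (V, \<kappa>, u) s)" if VF: "(V, \<kappa>) \<in> \<V>" for V \<kappa>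
  proof -
    have fV: "openin (top_of_set X) V" "frame V \<kappa>" "path_connected (V \<inter> ?X0)" "V \<inter> ?X0 \<noteq> {}" "V \<subseteq> X"
      using V[OF VF] openin_imp_subset[of euclidean X V] by auto
    obtain x0 A \<phi> D where x0: "x0 \<in> V" "x0 \<in> A" and A: "(A, \<phi>, D) \<in> F" using fV(4) by force
    note fA = flat_familyD[OF F A]
    note p0 = frame_path[OF fV(2) x0(1)] frame_path[OF fA(3) x0(2)]
    \<comment> \<open>the only possible value at \<open>x0\<close>\<close>
    define u where "u = trans (quot (\<kappa> x0) (\<phi> x0)) D"
    have u: "u \<subseteq> carrier \<pi>" unfolding u_def using p0 fA(4) by (intro trans_carrier quot_carrier)
    have "compatible (V, \<kappa>, u) (B, \<psi>, E)" if B: "(B, \<psi>, E) \<in> F" for B \<psi> E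
      unfolding compatible_def
    proof clarify
      fix x assume x: "x \<in> V" "x \<in> B"
      note fB = flat_familyD[OF F B]
      have "x \<in> V \<inter> ?X0" "x0 \<in> V \<inter> ?X0" using x B x0 A by force+
      then obtain d where d: "d \<in> paths_between (V \<inter> ?X0) x0 x"
        using fV(3) unfolding path_connected_def paths_between_def by blast
      have dV: "d \<in> paths_between V x0 x" and dF: "d \<in> paths_between ?X0 x0 x" and dX: "d \<in> P x0 x"
        using d fV(5) by (auto simp: paths_between_def)
      have "D = trans (quot (\<phi> x0 +++ d) (\<psi> x)) E"
        by (rule flat_family_transport[OF F dF A x0(2) B x(2)])
      then have "u = trans (quot (\<kappa> x0) (\<phi> x0)) (trans (quot (\<phi> x0 +++ d) (\<psi> x)) E)"
        by (simp add: u_def)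
      also have "quot (\<kappa> x0) (\<phi> x0) = quot (\<kappa> x0 +++ d) (\<phi> x0 +++ d)"
        using quot_join[OF p0 dX] by simp
      also have "quot (\<kappa> x0 +++ d) (\<phi> x0 +++ d) = quot (\<kappa> x) (\<phi> x0 +++ d)"
      proof (rule quot_cong)
        show "homotopic_paths X (\<kappa> x0 +++ d) (\<kappa> x)" using fV(2) dV unfolding frame_def by blast
        show "\<kappa> x0 +++ d \<in> P a x" by (rule paths_between_join[OF p0(1) dX])
        show 1: "\<phi> x0 +++ d \<in> P a x" by (rule paths_between_join[OF p0(2) dX])
        show "homotopic_paths X (\<phi> x0 +++ d) (\<phi> x0 +++ d)" using 1 by (simp add: paths_between_def)
      qed
      finally show "u = trans (quot (\<kappa> x) (\<psi> x)) E"
        using trans_quot[OF frame_path[OF fV(2) x(1)] paths_between_join[OF p0(2) dX] frame_path[OF fB(3) x(2)] fB(4)]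
        by simp
    qed
    then show ?thesis using u by auto
  qed
  then obtain u where u: "\<And>V \<kappa>. (V, \<kappa>) \<in> \<V> \<Longrightarrow> u V \<kappa> \<subseteq> carrier \<pi>"
    "\<And>V \<kappa> s. (V, \<kappa>) \<in> \<V> \<Longrightarrow> s \<in> F \<Longrightarrow> compatible (V, \<kappa>, u V \<kappa>) s"
    by metis
  define F' where "F' = F \<union> (\<lambda>(V, \<kappa>). (V, \<kappa>, u V \<kappa>)) ` \<V>"
  have uu: "compatible (V, \<kappa>, u V \<kappa>) (V', \<kappa>', u V' \<kappa>')" if VF: "(V, \<kappa>) \<in> \<V>" "(V', \<kappa>') \<in> \<V>" for V \<kappa> V' \<kappa>'
    unfolding compatible_def
  proof clarify
    fix x assume x: "x \<in> V" "x \<in> V'"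
    obtain d y where d: "d \<in> paths_between (V \<inter> V') x y" and y: "y \<in> ?X0" using VV[OF VF x] by blast
    then obtain B \<psi> E where B: "(B, \<psi>, E) \<in> F" "y \<in> B" by force
    have yV: "y \<in> V" "y \<in> V'" using paths_between_ends[OF d] by auto
    have fV: "frame V \<kappa>" "V \<subseteq> X" "frame V' \<kappa>'" "V' \<subseteq> X"
      using V[OF VF(1)] V[OF VF(2)] openin_imp_subset[of euclidean X V] openin_imp_subset[of euclidean X V'] by auto
    note fB = flat_familyD[OF F B(1)]
    have 1: "u V \<kappa> = trans (quot (\<kappa> y) (\<psi> y)) E" "u V' \<kappa>' = trans (quot (\<kappa>' y) (\<psi> y)) E"
      using u(2)[OF VF(1) B(1)] u(2)[OF VF(2) B(1)] yV B(2) by (auto simp: compatible_def)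
    note ps = frame_path[OF fV(1) yV(1)] frame_path[OF fV(3) yV(2)] frame_path[OF fB(3) B(2)]
    have "u V \<kappa> = trans (quot (\<kappa> y) (\<kappa>' y)) (u V' \<kappa>')"
      unfolding 1 trans_quot[OF ps fB(4)] by (rule refl)
    also have "quot (\<kappa> y) (\<kappa>' y) = quot (\<kappa> x) (\<kappa>' x)"
      using frame_quot_frame[OF fV d] by simp
    finally show "u V \<kappa> = trans (quot (\<kappa> x) (\<kappa>' x)) (u V' \<kappa>')" .
  qed
  have "flat_family F'"
    unfolding flat_family_def
  proof (intro conjI ballI)
    fix s assume s: "s \<in> F'"
    then show "case s of (A, \<phi>, D) \<Rightarrow> openin (top_of_set X) A \<and> frame A \<phi> \<and> D \<subseteq> carrier \<pi>"
    proof (cases "s \<in> F")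
      case True then show ?thesis using F unfolding flat_family_def by blast
    next
      case False
      then obtain V \<kappa> where "(V, \<kappa>) \<in> \<V>" "s = (V, \<kappa>, u V \<kappa>)" using s unfolding F'_def by auto
      then show ?thesis using V[of V \<kappa>] u(1)[of V \<kappa>] by simp
    qed
    fix t assume t: "t \<in> F'"
    consider "s \<in> F" "t \<in> F" | V \<kappa> where "(V, \<kappa>) \<in> \<V>" "s = (V, \<kappa>, u V \<kappa>)" "t \<in> F"
      | V \<kappa> where "(V, \<kappa>) \<in> \<V>" "t = (V, \<kappa>, u V \<kappa>)" "s \<in> F"
      | V \<kappa> V' \<kappa>' where "(V, \<kappa>) \<in> \<V>" "(V', \<kappa>') \<in> \<V>" "s = (V, \<kappa>, u V \<kappa>)" "t = (V', \<kappa>', u V' \<kappa>')"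
      using s t unfolding F'_def by auto
    then show "compatible s t"
    proof cases
      case 1 then show ?thesis using F unfolding flat_family_def by blast
    next
      case 2 then show ?thesis using u(2) by simp
    next
      case 3
      obtain A \<phi> D where s3: "s = (A, \<phi>, D)" by (cases s)
      show ?thesis unfolding 3(2) s3
        using compatible_sym[of V \<kappa> A \<phi> D "u V \<kappa>"] u(2)[OF 3(1,3)] V[OF 3(1)]
          flat_familyD[OF F, of A \<phi> D] 3(3) s3 by simp
    next
      case 4 then show ?thesis using uu by simp
    qed
  qed
  moreover have "fst ` F' = fst ` F \<union> fst ` \<V>"
    unfolding F'_def image_Un image_image by (simp add: case_prod_beta)
  ultimately show ?thesis using that[of F'] by (simp add: F'_def)
qed

end

section \<open>Lifting to covering spaces\<close>

lemma covering_space_evenly: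
  assumes "covering_space C p B" "b \<in> B"
  obtains W v where "b \<in> W" "openin (top_of_set B) W" "\<Union>v = C \<inter> p -` W"
    "\<forall>u\<in>v. openin (top_of_set C) u" "pairwise disjnt v" "\<forall>u\<in>v. \<exists>q. homeomorphism u W p q"
proof -
  have "\<forall>x\<in>B. \<exists>W. x \<in> W \<and> openin (top_of_set B) W \<and> (\<exists>v. \<Union>v = C \<inter> p -` W \<and>
      (\<forall>u\<in>v. openin (top_of_set C) u) \<and> pairwise disjnt v \<and> (\<forall>u\<in>v. \<exists>q. homeomorphism u W p q))"
    using assms(1) unfolding covering_space_def by (elim conjE)
  from bspec[OF this assms(2)] show ?thesis using that by (elim exE conjE) 
qed

lemma covering_space_slice:
  assumes "covering_space C p B" "\<xi> \<in> C"
  obtains W v u q where "p \<xi> \<in> W" "openin (top_of_set B) W" "\<Union>v = C \<inter> p -` W" "u \<in> v" "\<xi> \<in> u"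
    "\<forall>u\<in>v. openin (top_of_set C) u" "pairwise disjnt v" "homeomorphism u W p q"
proof -
  have "p \<xi> \<in> B" using assms covering_space_imp_surjective by blast
  then obtain W v where W: "p \<xi> \<in> W" "openin (top_of_set B) W" "\<Union>v = C \<inter> p -` W"
    "\<forall>u\<in>v. openin (top_of_set C) u" "pairwise disjnt v" "\<forall>u\<in>v. \<exists>q. homeomorphism u W p q"
    by (rule covering_space_evenly[OF assms(1)])
  have "\<xi> \<in> \<Union>v" using W assms by auto
  then obtain u where u: "u \<in> v" "\<xi> \<in> u" by blast
  obtain q where q: "homeomorphism u W p q" using bspec[OF W(6) u(1)] by (elim exE)
  show ?thesis by (rule that[OF W(1-3) u W(4,5) q])
qed

lemma covering_lift_unique:
  fixes g1 g2 :: "'t::topological_space \<Rightarrow> 'a::topological_space" and p :: "'a \<Rightarrow> 'b::topological_space"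
  assumes cov: "covering_space C p B" and T: "connected T"
    and g1: "continuous_on T g1" "g1 ` T \<subseteq> C" and g2: "continuous_on T g2" "g2 ` T \<subseteq> C"
    and eq: "\<And>t. t \<in> T \<Longrightarrow> p (g1 t) = p (g2 t)" and a: "a \<in> T" "g1 a = g2 a" and b: "b \<in> T"
  shows "g1 b = g2 b"
proof (rule connected_induction_simple[OF T a(1) b, of "\<lambda>t. g1 t = g2 t"])
  fix t assume t: "t \<in> T"
  then obtain W v u1 q where S: "p (g1 t) \<in> W" "\<Union>v = C \<inter> p -` W" "u1 \<in> v" "g1 t \<in> u1"
    "\<forall>u\<in>v. openin (top_of_set C) u" "pairwise disjnt v" "homeomorphism u1 W p q"
  proof -
    have "g1 t \<in> C" using g1(2) t by blast
    from covering_space_slice[OF cov this] show ?thesis using that by metis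
  qed
  have "g2 t \<in> \<Union>v" using S(1,2) eq[OF t] g2(2) t by auto
  then obtain u2 where u2: "u2 \<in> v" "g2 t \<in> u2" by blast
  let ?T = "(T \<inter> g1 -` u1) \<inter> (T \<inter> g2 -` u2)"
  have "openin (top_of_set T) ?T"
  proof (rule openin_Int)
    show "openin (top_of_set T) (T \<inter> g1 -` u1)"
      by (rule continuous_openin_preimage[OF g1(1) _ bspec[OF S(5) S(3)]]) (use g1(2) in blast)
    show "openin (top_of_set T) (T \<inter> g2 -` u2)"
      by (rule continuous_openin_preimage[OF g2(1) _ bspec[OF S(5) u2(1)]]) (use g2(2) in blast)
  qed
  moreover have "t \<in> ?T" using t S(4) u2 by auto
  moreover have "g1 y = g2 y" if xy: "x \<in> ?T" "y \<in> ?T" "g1 x = g2 x" for x y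
  proof -
    have "u1 = u2" using xy S(3,6) u2(1) unfolding pairwise_def disjnt_def by auto
    then have "g1 y \<in> u1" "g2 y \<in> u1" using xy by auto
    then have "q (p (g1 y)) = g1 y" "q (p (g2 y)) = g2 y" using S(7) unfolding homeomorphism_def by simp_all
    moreover have "p (g1 y) = p (g2 y)" using eq xy by auto
    ultimately show ?thesis by metis
  qed
  ultimately show "\<exists>T'. openin (top_of_set T) T' \<and> t \<in> T' \<and> (\<forall>x\<in>T'. \<forall>y\<in>T'. g1 x = g2 x \<longrightarrow> g1 y = g2 y)"
    by (intro exI[of _ ?T] conjI ballI impI)
qed (rule a(2))

text \<open>Tube lemma: the lift of the path \<open>K (_, s)\<close> is built over short pieces of time, each of them
  inside an evenly covered set, and it extends at each step over a neighbourhood of \<open>s\<close>.\<close>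

lemma local_lift:
  fixes K :: "real \<times> 's::topological_space \<Rightarrow> 'b::topological_space" and p :: "'a::topological_space \<Rightarrow> 'b"
  assumes cov: "covering_space C p B" and S: "open S" "s \<in> S"
    and K: "continuous_on ({0..1} \<times> S) K" "K ` ({0..1} \<times> S) \<subseteq> B"
    and \<xi>: "\<xi> \<in> C" "\<And>s. s \<in> S \<Longrightarrow> K (0, s) = p \<xi>"
  shows "\<exists>N k. open N \<and> s \<in> N \<and> N \<subseteq> S \<and> continuous_on ({0..1} \<times> N) k \<and> k ` ({0..1} \<times> N) \<subseteq> C \<and>
    (\<forall>n\<in>N. k (0, n) = \<xi>) \<and> (\<forall>x\<in>{0..1} \<times> N. p (k x) = K x)"
proof -
  define L where "L t N k \<longleftrightarrow> open N \<and> s \<in> N \<and> N \<subseteq> S \<and> continuous_on ({0..t} \<times> N) k \<and> k ` ({0..t} \<times> N) \<subseteq> C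
     \<and> (\<forall>n\<in>N. k (0, n) = \<xi>) \<and> (\<forall>x\<in>{0..t} \<times> N. p (k x) = K x)" for t N k
  have "\<exists>N k. L 1 N k"
  proof (rule connected_induction_simple[of "{0..1::real}" 0 1 "\<lambda>t. \<exists>N k. L t N k"])
    show "\<exists>N k. L 0 N k" using S \<xi> by (intro exI[of _ S] exI[of _ "\<lambda>_. \<xi>"]) (auto simp: L_def)
    fix t0 assume t0: "t0 \<in> {0..1::real}"
    then have "K (t0, s) \<in> B" using K(2) S by auto
    then obtain W v where W: "K (t0, s) \<in> W" "openin (top_of_set B) W" "\<Union>v = C \<inter> p -` W"
      "\<forall>u\<in>v. openin (top_of_set C) u" "pairwise disjnt v" "\<forall>u\<in>v. \<exists>q. homeomorphism u W p q"
      by (rule covering_space_evenly[OF cov])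
    have "openin (top_of_set ({0..1} \<times> S)) (({0..1} \<times> S) \<inter> K -` W)"
      using continuous_openin_preimage[OF K(1) _ W(2)] K(2) by auto
    then obtain O1 where O1: "open O1" "({0..1} \<times> S) \<inter> K -` W = ({0..1} \<times> S) \<inter> O1"
      by (auto simp: openin_open)
    have "(t0, s) \<in> O1" using O1(2) W(1) t0 S by auto
    then obtain I N0 where IN: "open I" "open N0" "t0 \<in> I" "s \<in> N0" "I \<times> N0 \<subseteq> O1"
      using open_prod_elim[OF O1(1)] by (metis mem_Sigma_iff)
    obtain e where e: "e > 0" "ball t0 e \<subseteq> I" using IN(1,3) open_contains_ball by blast
    have KW: "K (t, n) \<in> W" if "t \<in> {0..1}" "t \<in> ball t0 e" "n \<in> N0 \<inter> S" for t n
      using that e(2) IN(5) O1(2) by blast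
    show "\<exists>T. openin (top_of_set {0..1}) T \<and> t0 \<in> T \<and>
        (\<forall>x\<in>T. \<forall>y\<in>T. (\<exists>N k. L x N k) \<longrightarrow> (\<exists>N k. L y N k))"
    proof (intro exI[of _ "{0..1} \<inter> ball t0 e"] conjI ballI impI)
      show "openin (top_of_set {0..1}) ({0..1} \<inter> ball t0 e)" by (simp add: openin_open_Int)
      show "t0 \<in> {0..1} \<inter> ball t0 e" using t0 e by auto
      fix x y assume x: "x \<in> {0..1} \<inter> ball t0 e" and y: "y \<in> {0..1} \<inter> ball t0 e" and "\<exists>N k. L x N k"
      then obtain N k where k: "L x N k" by (elim exE)
      have kk: "open N" "s \<in> N" "N \<subseteq> S" "continuous_on ({0..x} \<times> N) k" "k ` ({0..x} \<times> N) \<subseteq> C"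
        "\<forall>n\<in>N. k (0, n) = \<xi>" "\<forall>z\<in>{0..x} \<times> N. p (k z) = K z"
        using k unfolding L_def by simp_all
      show "\<exists>N k. L y N k"
      proof (cases "y \<le> x")
        case True
        then have sub: "{0..y} \<times> N \<subseteq> {0..x} \<times> N" by auto
        have "L y N k" unfolding L_def
          using kk(1-3,6) continuous_on_subset[OF kk(4) sub] order_trans[OF image_mono[OF sub, of k] kk(5)] kk(7) True
          by (intro conjI) auto
        then show ?thesis by (intro exI)
      next
        case False
        have ks: "k (x, s) \<in> \<Union>v" 
        proof -
          have xs: "(x, s) \<in> {0..x} \<times> N" using kk(2) x by auto
          have "p (k (x, s)) \<in> W" using bspec[OF kk(7) xs] KW[of x s] x IN(4) S by auto
          moreover have "k (x, s) \<in> C" using kk(5) xs by blast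
          ultimately show ?thesis unfolding W(3) by simp
        qed
        then obtain u q where u: "u \<in> v" "k (x, s) \<in> u" "homeomorphism u W p q" using W(6) by blast
        have contx: "continuous_on N (\<lambda>n. k (x, n))"
          using x by (intro continuous_on_compose2[OF kk(4)] continuous_intros) auto
        have "openin (top_of_set N) (N \<inter> (\<lambda>n. k (x, n)) -` u)"
          by (rule continuous_openin_preimage[OF contx _ bspec[OF W(4) u(1)]]) (use kk(5) x in auto)
        then have oN1: "open (N \<inter> (\<lambda>n. k (x, n)) -` u)"
          using kk(1) openin_open_trans by blast
        define N1 where "N1 = (N \<inter> (\<lambda>n. k (x, n)) -` u) \<inter> N0"
        have N1: "open N1" "s \<in> N1" "N1 \<subseteq> N" "N1 \<subseteq> N0" "N1 \<subseteq> S" "\<And>n. n \<in> N1 \<Longrightarrow> k (x, n) \<in> u"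
          using oN1 IN u(2) kk unfolding N1_def by auto
        define k' where "k' = (\<lambda>z. if fst z \<le> x then k z else q (K z))"
        have KW': "K (t, n) \<in> W" if "t \<in> {x..y}" "n \<in> N1" for t n
        proof (rule KW)
          show "t \<in> {0..1}" using that x y by auto
          show "t \<in> ball t0 e" using that x y by (auto simp: dist_real_def abs_if split: if_splits)
        qed (use that N1 in auto)
        have q: "continuous_on W q" "q ` W \<subseteq> u" "\<And>w. w \<in> W \<Longrightarrow> p (q w) = w" "\<And>z. z \<in> u \<Longrightarrow> q (p z) = z"
          using u(3) unfolding homeomorphism_def by auto
        have uC: "u \<subseteq> C" using u(1) W(3) by blast
        have "continuous_on ({0..y} \<times> N1) k'"
          unfolding k'_def
        proof (rule continuous_on_cases_le[where h = fst and a = x])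
          show "continuous_on {z \<in> {0..y} \<times> N1. fst z \<le> x} k"
            by (rule continuous_on_subset[OF kk(4)]) (use N1(3) in auto)
          show "continuous_on {z \<in> {0..y} \<times> N1. x \<le> fst z} (\<lambda>z. q (K z))"
          proof (rule continuous_on_compose2[OF q(1)])
            show "continuous_on {z \<in> {0..y} \<times> N1. x \<le> fst z} K"
              using N1(5) y by (intro continuous_on_subset[OF K(1)]) auto
            show "K ` {z \<in> {0..y} \<times> N1. x \<le> fst z} \<subseteq> W" using KW' by auto
          qed
          show "continuous_on ({0..y} \<times> N1) fst" by (intro continuous_intros)
          fix z assume z: "z \<in> {0..y} \<times> N1" "fst z = x"
          then obtain n where n: "z = (x, n)" "n \<in> N1" by (cases z) auto
          have "K z = p (k z)" using kk(7) n N1(3) x by auto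
          then show "k z = q (K z)" using q(4) N1(6) n by simp
        qed
        moreover have "k' z \<in> C \<and> p (k' z) = K z" if z: "z \<in> {0..y} \<times> N1" for z
        proof (cases "fst z \<le> x")
          case True
          then have "z \<in> {0..x} \<times> N" using z N1(3) by (cases z) auto
          then show ?thesis using kk(5,7) True unfolding k'_def by auto
        next
          case False
          then have "K z \<in> W" using KW'[of "fst z" "snd z"] z by auto
          then show ?thesis using q uC False unfolding k'_def by auto
        qed
        moreover have "k' (0, n) = \<xi>" if "n \<in> N1" for n
          using kk(6) that N1(3) x unfolding k'_def by auto
        ultimately have "L y N1 k'" unfolding L_def using N1 by (intro conjI ballI image_subsetI) simp_all
        then show ?thesis by (intro exI)
      qed
    qed
  qed auto
  then show ?thesis unfolding L_def .
qed

text \<open>Lift each path \<open>K (_, s)\<close> from \<open>\<xi>\<close> and take the end point. The local lifts agree because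
  lifts of paths are unique.\<close>

lemma lift_along_contraction:
  fixes K :: "real \<times> 's::topological_space \<Rightarrow> 'b::topological_space" and p :: "'a::topological_space \<Rightarrow> 'b"
  assumes cov: "covering_space C p B" and S: "open S"
    and K: "continuous_on ({0..1} \<times> S) K" "K ` ({0..1} \<times> S) \<subseteq> B"
    and \<xi>: "\<xi> \<in> C" "\<And>s. s \<in> S \<Longrightarrow> K (0, s) = p \<xi>"
  obtains g where "continuous_on S g" "g ` S \<subseteq> C" "\<And>s. s \<in> S \<Longrightarrow> p (g s) = K (1, s)"
    "\<And>s. s \<in> S \<Longrightarrow> (\<And>t. t \<in> {0..1} \<Longrightarrow> K (t, s) = p \<xi>) \<Longrightarrow> g s = \<xi>"
proof -
  define good where "good s N k \<longleftrightarrow> open N \<and> s \<in> N \<and> N \<subseteq> S \<and> continuous_on ({0..1} \<times> N) k \<and> k ` ({0..1} \<times> N) \<subseteq> C \<and>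
    (\<forall>n\<in>N. k (0, n) = \<xi>) \<and> (\<forall>x\<in>{0..1} \<times> N. p (k x) = K x)" for s N k
  have "\<forall>s\<in>S. \<exists>N k. good s N k"
  proof (rule ballI)
    fix s assume "s \<in> S"
    from local_lift[OF cov S this K \<xi>] show "\<exists>N k. good s N k" unfolding good_def .
  qed
  then have some: "\<forall>s\<in>S. good s (fst (SOME y. good s (fst y) (snd y))) (snd (SOME y. good s (fst y) (snd y)))"
    by (intro ballI someI_ex[where P = "\<lambda>y. good s (fst y) (snd y)" for s]) (metis fst_conv snd_conv)
  define N k where "N = (\<lambda>s. fst (SOME y. good s (fst y) (snd y)))" and "k = (\<lambda>s. snd (SOME y. good s (fst y) (snd y)))"
  have good: "\<forall>s\<in>S. good s (N s) (k s)" using some unfolding N_def k_def .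
  have Nk: "open (N s)" "s \<in> N s" "N s \<subseteq> S" "continuous_on ({0..1} \<times> N s) (k s)"
    "k s ` ({0..1} \<times> N s) \<subseteq> C" "\<forall>n\<in>N s. k s (0, n) = \<xi>" "\<forall>x\<in>{0..1} \<times> N s. p (k s x) = K x"
    if s: "s \<in> S" for s
    using bspec[OF good s] unfolding good_def by simp_all
  have cont1: "continuous_on {0..1} (\<lambda>t. k s (t, n))" if s: "s \<in> S" "n \<in> N s" for s n
    using s(2) by (intro continuous_on_compose2[OF Nk(4)[OF s(1)]] continuous_intros) auto
  have val: "k s (t, n) \<in> C" "p (k s (t, n)) = K (t, n)" "k s (0, n) = \<xi>" if s: "s \<in> S" "n \<in> N s" "t \<in> {0..1}" for s n t
  proof -
    have tn: "(t, n) \<in> {0..1} \<times> N s" using s by simp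
    show "k s (t, n) \<in> C" using subsetD[OF Nk(5)[OF s(1)] imageI[OF tn]] .
    show "p (k s (t, n)) = K (t, n)" using bspec[OF Nk(7)[OF s(1)] tn] .
    show "k s (0, n) = \<xi>" using bspec[OF Nk(6)[OF s(1)] s(2)] .
  qed
  have agree: "k s (1, n) = k n (1, n)" if s: "s \<in> S" "n \<in> N s" for s n
  proof -
    have n: "n \<in> S" "n \<in> N n" using Nk(3)[OF s(1)] s(2) Nk(2)[of n] by auto
    show ?thesis
    proof (rule covering_lift_unique[OF cov, of "{0..1}" "\<lambda>t. k s (t, n)" "\<lambda>t. k n (t, n)" 0 1])
      show "k s (0, n) = k n (0, n)" using val(3)[OF s, of 0] val(3)[OF n, of 0] by simp
    qed (use val(1,2)[OF s] val(1,2)[OF n] cont1[OF s] cont1[OF n] in \<open>auto simp: image_subset_iff\<close>)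
  qed
  show ?thesis
  proof (rule that[of "\<lambda>s. k s (1, s)"])
    have "continuous_on (N s) (\<lambda>s. k s (1, s))" if s: "s \<in> S" for s
    proof (rule continuous_on_eq)
      show "continuous_on (N s) (\<lambda>n. k s (1, n))"
        by (intro continuous_on_compose2[OF Nk(4)[OF s]] continuous_intros) auto
    qed (use agree[OF s] in simp)
    then have "continuous_on (\<Union>s\<in>S. N s) (\<lambda>s. k s (1, s))" using Nk(1) by (intro continuous_on_open_UN)
    moreover have "(\<Union>s\<in>S. N s) = S" using Nk(2,3) by auto
    ultimately show "continuous_on S (\<lambda>s. k s (1, s))" by simp
    show "(\<lambda>s. k s (1, s)) ` S \<subseteq> C" using val(1) Nk(2) by auto
    show "p (k s (1, s)) = K (1, s)" if "s \<in> S" for s using val(2) Nk(2) that by simp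
    fix s assume s: "s \<in> S" "\<And>t. t \<in> {0..1} \<Longrightarrow> K (t, s) = p \<xi>"
    have ss: "s \<in> N s" using Nk(2)[OF s(1)] .
    show "k s (1, s) = \<xi>"
    proof (rule covering_lift_unique[OF cov, of "{0..1}" "\<lambda>t. k s (t, s)" "\<lambda>t. \<xi>" 0 1])
      show "k s (0, s) = \<xi>" using val(3)[OF s(1) ss, of 0] by simp
    qed (use val(1,2)[OF s(1) ss] cont1[OF s(1) ss] s(2) \<xi>(1) in \<open>auto simp: image_subset_iff\<close>)
  qed
qed

lemma open_section:
  fixes g :: "'b::topological_space \<Rightarrow> 'a::topological_space"
  assumes cov: "covering_space C p B" and S: "openin (top_of_set B) S"
    and g: "continuous_on S g" "g ` S \<subseteq> C" "\<And>s. s \<in> S \<Longrightarrow> p (g s) = s"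
  shows "openin (top_of_set C) (g ` S)"
proof (subst openin_subopen, intro ballI)
  fix \<xi> assume "\<xi> \<in> g ` S"
  then obtain s where s: "s \<in> S" "\<xi> = g s" by blast
  have "\<xi> \<in> C" using s g by auto
  then obtain W v u q where W: "p \<xi> \<in> W" "openin (top_of_set B) W" "\<Union>v = C \<inter> p -` W" "u \<in> v" "\<xi> \<in> u"
    "\<forall>u\<in>v. openin (top_of_set C) u" "pairwise disjnt v" "homeomorphism u W p q"
    by (rule covering_space_slice[OF cov])
  have pC: "continuous_on C p" "p ` C \<subseteq> B" using covering_space_imp_continuous[OF cov] covering_space_imp_surjective[OF cov] by auto
  have uC: "u \<subseteq> C" using W by blast
  let ?S' = "S \<inter> g -` u"
  have "openin (top_of_set S) ?S'"
    by (rule continuous_openin_preimage[OF g(1) _ bspec[OF W(6) W(4)]]) (use g(2) in blast)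
  then have "openin (top_of_set B) ?S'" using S openin_trans by blast
  then have "openin (top_of_set C) (C \<inter> p -` ?S')"
    by (rule continuous_openin_preimage[OF pC(1), rotated]) (use pC(2) in blast)
  then have op: "openin (top_of_set C) (u \<inter> (C \<inter> p -` ?S'))" using bspec[OF W(6) W(4)] by (rule openin_Int[rotated])
  have in1: "\<xi> \<in> u \<inter> (C \<inter> p -` ?S')" using s g W(5) uC by auto
  have "u \<inter> (C \<inter> p -` ?S') \<subseteq> g ` S"
  proof
    fix \<eta> assume \<eta>: "\<eta> \<in> u \<inter> (C \<inter> p -` ?S')"
    then have "g (p \<eta>) \<in> u" "p (g (p \<eta>)) = p \<eta>" "p \<eta> \<in> S" using g by auto
    then have "g (p \<eta>) = \<eta>" proof -
      have "q (p (g (p \<eta>))) = g (p \<eta>)" "q (p \<eta>) = \<eta>"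
        using \<eta> W(8) \<open>g (p \<eta>) \<in> u\<close> unfolding homeomorphism_def by simp_all
      then show ?thesis using \<open>p (g (p \<eta>)) = p \<eta>\<close> by metis
    qed
    then show "\<eta> \<in> g ` S" using \<open>p \<eta> \<in> S\<close> imageI[of "p \<eta>" S g] by simp
  qed
  with op in1 show "\<exists>T. openin (top_of_set C) T \<and> \<xi> \<in> T \<and> T \<subseteq> g ` S" by (intro exI conjI)
qed

section \<open>Links projected to the plane\<close>

text \<open>The base point stays fixed during the contraction, so that a section obtained by lifting
  along it has a prescribed value there.\<close>

definition contraction :: "R3 set \<Rightarrow> R3 \<Rightarrow> (real \<times> R3 \<Rightarrow> R3) \<Rightarrow> bool" where
  "contraction S s0 h \<longleftrightarrow> open S \<and> s0 \<in> S \<and> continuous_on ({0..1} \<times> S) h \<and> h ` ({0..1} \<times> S) \<subseteq> S \<and>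
     (\<forall>s\<in>S. h (0, s) = s0 \<and> h (1, s) = s) \<and> (\<forall>t\<in>{0..1}. h (t, s0) = s0)"

lemma contraction_simply_connected:
  assumes "contraction S s0 h" shows "simply_connected S"
proof (rule contractible_imp_simply_connected)
  have c: "continuous_on ({0..1} \<times> S) h" "h ` ({0..1} \<times> S) \<subseteq> S"
    and e: "\<forall>s\<in>S. h (0, s) = s0" "\<forall>s\<in>S. h (1, s) = s"
    using assms by (auto simp: contraction_def)
  have "continuous_map (prod_topology (top_of_set {0..1}) (top_of_set S)) (top_of_set S) h"
    unfolding prod_topology_subtopology_eu continuous_map_subtopology_eu using c by blast
  then have "homotopic_with_canon (\<lambda>x. True) S S (\<lambda>x. s0) id"
    using e by (subst homotopic_with) auto
  then show "contractible S" unfolding contractible_def using homotopic_with_symD by blast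
qed

lemma convex_contraction:
  assumes "open S" "convex S" "s0 \<in> S"
  shows "\<exists>h. contraction S s0 h"
proof -
  let ?h = "\<lambda>w. (1 - fst w) *\<^sub>R s0 + fst w *\<^sub>R snd w :: R3"
  have "?h w \<in> S" if "w \<in> {0..1} \<times> S" for w
    using assms(2,3) that by (intro convexD) auto
  then have 1: "?h ` ({0..1} \<times> S) \<subseteq> S" by blast
  have 2: "continuous_on ({0..1} \<times> S) ?h" by (intro continuous_intros)
  have 3: "?h (t, s0) = s0" for t by (simp flip: scaleR_left_distrib)
  have "contraction S s0 ?h"
    unfolding contraction_def using assms(1,3) 1 2 3 by (intro conjI ballI) simp_all
  then show ?thesis by (rule exI[of _ ?h])
qed

text \<open>A link \<open>LK\<close> in \<open>\<complex> \<times> \<real>\<close> in general position over the plane: \<open>Ctr\<close> is the set of crossings,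
  where the two strands pass at heights \<open>0\<close> and \<open>1\<close>; elsewhere there is at most one point
  above each point of the plane. The open cone with tip \<open>(k, 1)\<close> over the unit disc around
  \<open>k\<close> is free of the link.\<close>

locale projected_link =
  fixes LK :: "R3 set" and Ctr :: "complex set"
  assumes compact_LK: "compact LK" and finite_Ctr: "finite Ctr"
    and column: "\<lbrakk>(x, z) \<in> LK; (x, z') \<in> LK; z \<noteq> z'\<rbrakk> \<Longrightarrow> x \<in> Ctr"
    and column_Ctr: "x \<in> Ctr \<Longrightarrow> (x, z) \<in> LK \<longleftrightarrow> z = 0 \<or> z = 1"
    and cone_LK: "\<lbrakk>k \<in> Ctr; 0 < z; norm (x - k) + z < 1\<rbrakk> \<Longrightarrow> (x, z) \<notin> LK"
    and far_Ctr: "\<lbrakk>k \<in> Ctr; k' \<in> Ctr; k \<noteq> k'\<rbrakk> \<Longrightarrow> 2 \<le> dist k k'"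
begin

definition proj :: "complex set" where "proj = fst ` LK"
definition upper :: "R3 set" where "upper = {(x, z). \<forall>z'\<ge>z. (x, z') \<notin> LK}"
definition lower :: "R3 set" where "lower = {(x, z). \<forall>z'\<le>z. (x, z') \<notin> LK}"
definition cone :: "complex \<Rightarrow> R3 set" where "cone k = {(x, z). 0 < z \<and> norm (x - k) + z < 1}"

lemma upper_lower_disjoint_LK: "upper \<inter> LK = {}" "lower \<inter> LK = {}"
  by (auto simp: upper_def lower_def)

lemma off_proj: "x \<notin> proj \<Longrightarrow> (x, z) \<in> upper" "x \<notin> proj \<Longrightarrow> (x, z) \<in> lower"
  by (force simp: proj_def upper_def lower_def)+

lemma proj_if_upper_lower: "(x, z) \<in> upper \<Longrightarrow> (x, z) \<in> lower \<Longrightarrow> x \<notin> proj"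
  unfolding proj_def upper_def lower_def by auto (meson linorder_le_cases)

lemma closed_proj: "closed proj"
  unfolding proj_def by (intro compact_imp_closed compact_continuous_image continuous_intros compact_LK)

text \<open>The points from which no point of the link is visible in direction \<open>\<sigma>\<close>; the signs \<open>1\<close> and
  \<open>- 1\<close> give the parts above and below the link.\<close>

definition clear :: "real \<Rightarrow> R3 set" where "clear \<sigma> = {(x, z). \<forall>t\<ge>0. (x, z + \<sigma> * t) \<notin> LK}"

lemma upper_eq_clear: "upper = clear 1"
proof -
  have "z + (z' - z) = z'" for z z' :: real by simp
  then show ?thesis unfolding upper_def clear_def by (auto, metis diff_ge_0_iff_ge)
qed

lemma lower_eq_clear: "lower = clear (- 1)"
proof -
  have "z - (z - z') = z'" for z z' :: real by simp
  then show ?thesis unfolding lower_def clear_def by (auto, metis diff_ge_0_iff_ge)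
qed

text \<open>The complement is the set of differences of the link and a closed ray.\<close>

lemma open_clear: "open (clear \<sigma>)"
proof -
  let ?C = "{0} \<times> (\<lambda>t. \<sigma> * t) ` {0..} :: R3 set"
  have "- clear \<sigma> = (\<Union>x\<in>LK. \<Union>y\<in>?C. {x - y})"
  proof (intro Set.set_eqI iffI)
    fix w assume "w \<in> - clear \<sigma>"
    then obtain x z t where "w = (x, z)" "0 \<le> t" "(x, z + \<sigma> * t) \<in> LK" by (auto simp: clear_def)
    then have "w = (x, z + \<sigma> * t) - (0, \<sigma> * t)" "(0, \<sigma> * t) \<in> ?C" by auto
    then show "w \<in> (\<Union>x\<in>LK. \<Union>y\<in>?C. {x - y})" using \<open>(x, z + \<sigma> * t) \<in> LK\<close> by blast
  next
    fix w assume "w \<in> (\<Union>x\<in>LK. \<Union>y\<in>?C. {x - y})"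
    then show "w \<in> - clear \<sigma>" by (force simp: clear_def)
  qed
  moreover have "closed ((\<lambda>t. \<sigma> * t) ` {0..})"
    using closed_scaling[of "{0..} :: real set" \<sigma>] by simp
  then have "closed (\<Union>x\<in>LK. \<Union>y\<in>?C. {x - y})"
    by (intro compact_closed_differences compact_LK closed_Times) auto
  ultimately show ?thesis by (simp add: open_closed)
qed

lemma open_upper: "open upper" and open_lower: "open lower"
  by (simp_all add: upper_eq_clear lower_eq_clear open_clear)

text \<open>A point with link both above and below lies strictly between the two strands of a crossing.\<close>

lemma covers: "- LK \<subseteq> upper \<union> lower \<union> (\<Union>k\<in>Ctr. cone k)"
proof
  fix w assume w: "w \<in> - LK"
  obtain x z where xz: "w = (x, z)" by (cases w)
  show "w \<in> upper \<union> lower \<union> (\<Union>k\<in>Ctr. cone k)"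
  proof (rule ccontr)
    assume n: "\<not> ?thesis"
    then obtain z1 z2 where z: "z1 \<ge> z" "(x, z1) \<in> LK" "z2 \<le> z" "(x, z2) \<in> LK"
      unfolding xz upper_def lower_def by auto
    then have "z1 \<noteq> z" "z2 \<noteq> z" using w xz by auto
    then have zz: "z2 < z" "z < z1" using z by auto
    then have x: "x \<in> Ctr" using column[OF z(2,4)] by auto
    then have "z1 = 1" "z2 = 0" using column_Ctr[OF x] z zz by force+
    then have "w \<in> cone x" using zz by (simp add: cone_def xz)
    then show False using n x by blast
  qed
qed

lemma link_bound: "\<exists>R>2. LK \<subseteq> ball 0 R \<and> (\<Union>k\<in>Ctr. cone k) \<subseteq> ball 0 R"
proof -
  have "bounded (LK \<union> Ctr \<times> {0})" using compact_imp_bounded[OF compact_LK] finite_Ctr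
    by (simp add: bounded_Times finite_imp_bounded)
  then obtain r where r: "0 < r" "LK \<union> Ctr \<times> {0} \<subseteq> ball 0 r"
    using bounded_subset_ballD[of "LK \<union> Ctr \<times> {0}" 0] by metis
  have 1: "w \<in> ball 0 (r + 2)" if "k \<in> Ctr" "w \<in> cone k" for k w
  proof -
    obtain x z where w: "w = (x, z)" by (cases w)
    have 1: "norm ((k, 0) :: R3) < r" using r(2) \<open>k \<in> Ctr\<close> by (auto simp del: norm_Pair1 norm_Pair2)
    have 2: "norm ((x, z) - (k, 0) :: R3) \<le> norm (x - k) + norm z"
      using norm_Pair_le[of "x - k" z] by simp
    have 3: "norm ((x, z) :: R3) \<le> norm ((k, 0) :: R3) + norm ((x, z) - (k, 0) :: R3)"
      using norm_triangle_sub[of "(x, z) :: R3" "(k, 0)"] by (simp only:)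
    have 4: "norm (x - k) + norm z < 1" using that(2) by (auto simp: cone_def w)
    have "norm ((x, z) :: R3) < r + 2" using 1 2 3 4 by linarith
    then show ?thesis by (simp only: w mem_ball_0)
  qed
  have "LK \<subseteq> ball 0 (r + 2)" using r by auto
  moreover have "(\<Union>k\<in>Ctr. cone k) \<subseteq> ball 0 (r + 2)" using 1 by blast
  ultimately show ?thesis using r(1) by (intro exI[of _ "r + 2"]) auto
qed

text \<open>Move a point away from the link to a fixed height beyond it, and then horizontally to the
  axis; the contraction runs in the opposite direction.\<close>

lemma clear_contraction:
  assumes \<sigma>: "\<sigma> * \<sigma> = 1"
  shows "\<exists>s0 h. contraction (clear \<sigma>) s0 h"
proof -
  obtain R where R: "R > 2" "LK \<subseteq> ball 0 R" using link_bound by metis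
  have \<sigma>1: "\<bar>\<sigma>\<bar> = 1" using \<sigma> by (simp add: abs_square_eq_1 flip: power2_eq_square)
  have beyond: "(x, z) \<in> clear \<sigma>" if "\<sigma> * z \<ge> R" for x z
  proof -
    have "(x, z + \<sigma> * t) \<notin> LK" if "t \<ge> 0" for t
    proof
      assume "(x, z + \<sigma> * t) \<in> LK"
      then have "\<bar>\<sigma> * (z + \<sigma> * t)\<bar> < R"
        using subsetD[OF R(2)] norm_snd_le[of "z + \<sigma> * t" x] \<sigma>1 by (force simp: abs_mult)
      moreover have "\<sigma> * (z + \<sigma> * t) = \<sigma> * z + t" using \<sigma> by algebra
      ultimately show False using \<open>\<sigma> * z \<ge> R\<close> that by linarith
    qed
    then show ?thesis by (auto simp: clear_def)
  qed
  define h where "h = (\<lambda>w :: real \<times> R3. ((min (2 * fst w) 1) *\<^sub>R fst (snd w),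
    \<sigma> * R + max (2 * fst w - 1) 0 * (snd (snd w) - \<sigma> * R)))"
  have hU: "h (t, x, z) \<in> clear \<sigma>" if t: "0 \<le> t" "t \<le> 1" and u: "(x, z) \<in> clear \<sigma>" for t x z
  proof (cases "t \<le> 1/2")
    case True
    then show ?thesis unfolding h_def using \<sigma> by (intro beyond) (simp add: max_def flip: mult.assoc)
  next
    case False
    define z' where "z' = \<sigma> * R + (2 * t - 1) * (z - \<sigma> * R)"
    have h: "h (t, x, z) = (x, z')" using False by (simp add: h_def z'_def)
    have z': "\<sigma> * z' = R + (2 * t - 1) * (\<sigma> * z - R)" unfolding z'_def using \<sigma> by algebra
    show ?thesis
    proof (cases "\<sigma> * z \<ge> R")
      case True
      then show ?thesis unfolding h by (intro beyond) (use False z' in auto)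
    next
      case f: False
      have "(2 * t - 1) * (R - \<sigma> * z) \<le> 1 * (R - \<sigma> * z)" using f t False by (intro mult_right_mono) auto
      then have s: "0 \<le> \<sigma> * z' - \<sigma> * z" using z' by (simp add: algebra_simps)
      have e: "z' = z + \<sigma> * (\<sigma> * z' - \<sigma> * z)" using \<sigma> by algebra
      have "z' + \<sigma> * r = z + \<sigma> * ((\<sigma> * z' - \<sigma> * z) + r)" for r using e by (simp add: algebra_simps)
      then show ?thesis using u s unfolding h clear_def by auto
    qed
  qed
  have "contraction (clear \<sigma>) (0, \<sigma> * R) h"
    unfolding contraction_def
  proof (intro conjI)
    show "continuous_on ({0..1} \<times> clear \<sigma>) h" unfolding h_def by (intro continuous_intros)
    show "(0, \<sigma> * R) \<in> clear \<sigma>" using \<sigma> by (intro beyond) (simp flip: mult.assoc)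
    show "h ` ({0..1} \<times> clear \<sigma>) \<subseteq> clear \<sigma>" using hU by force
    show "\<forall>s\<in>clear \<sigma>. h (0, s) = (0, \<sigma> * R) \<and> h (1, s) = s" by (auto simp: h_def zero_prod_def)
    show "\<forall>t\<in>{0..1}. h (t, 0, \<sigma> * R) = (0, \<sigma> * R)" by (auto simp: h_def)
  qed (rule open_clear)
  then show ?thesis by blast
qed

lemma upper_contraction: "\<exists>s0 h. contraction upper s0 h"
  and lower_contraction: "\<exists>s0 h. contraction lower s0 h"
  unfolding upper_eq_clear lower_eq_clear by (rule clear_contraction; simp)+

lemma open_cone: "open (cone k)"
proof -
  have "cone k = {w. 0 < snd w} \<inter> {w. norm (fst w - k) + snd w < 1}" by (auto simp: cone_def)
  moreover have "open ({w. 0 < snd w} \<inter> {w :: R3. norm (fst w - k) + snd w < 1})"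
    by (intro open_Int open_Collect_less continuous_intros)
  ultimately show ?thesis by simp
qed

lemma convex_cone: "convex (cone k)"
proof (rule convexI)
  fix w w' :: R3 and u v :: real
  assume w: "w \<in> cone k" "w' \<in> cone k" and uv: "0 \<le> u" "0 \<le> v" "u + v = 1"
  obtain x z x' z' where e: "w = (x, z)" "w' = (x', z')" by (cases w, cases w')
  have n: "0 < z" "0 < z'" "norm (x - k) + z < 1" "norm (x' - k) + z' < 1" using w e by (auto simp: cone_def)
  have "u *\<^sub>R x + v *\<^sub>R x' - k = u *\<^sub>R (x - k) + v *\<^sub>R (x' - k)"
    using uv(3) by (simp add: algebra_simps) (metis scaleR_left_distrib scaleR_one add.commute)
  then have "norm (u *\<^sub>R x + v *\<^sub>R x' - k) \<le> u * norm (x - k) + v * norm (x' - k)"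
    using norm_triangle_ineq[of "u *\<^sub>R (x - k)" "v *\<^sub>R (x' - k)"] uv by simp
  then have "norm (u *\<^sub>R x + v *\<^sub>R x' - k) + (u * z + v * z') \<le> u * (norm (x - k) + z) + v * (norm (x' - k) + z')"
    by (simp add: algebra_simps)
  also have "\<dots> < 1" using convex_bound_lt[of "norm (x - k) + z" 1 "norm (x' - k) + z'" u v] n uv by simp
  finally have 1: "norm (u *\<^sub>R x + v *\<^sub>R x' - k) + (u * z + v * z') < 1" .
  have "0 < u * z + v * z'"
  proof (cases "u = 0")
    case False
    then have "u * z > 0" "v * z' \<ge> 0" using uv n by auto
    then show ?thesis by simp
  qed (use uv n in auto)
  then show "u *\<^sub>R w + v *\<^sub>R w' \<in> cone k" using 1 by (simp add: e cone_def)
qed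

text \<open>Move down to a common small height and around the axis in a punctured disc.\<close>

lemma path_connected_punctured_cone: "path_connected (cone k - {k} \<times> UNIV)"
proof -
  have "\<exists>g. path g \<and> path_image g \<subseteq> cone k - {k} \<times> UNIV \<and> pathstart g = w \<and> pathfinish g = w'"
    if w: "w \<in> cone k - {k} \<times> UNIV" "w' \<in> cone k - {k} \<times> UNIV" for w w'
  proof -
    obtain x z x' z' where e: "w = (x, z)" "w' = (x', z')" by (cases w, cases w')
    have n: "0 < z" "0 < z'" "norm (x - k) + z < 1" "norm (x' - k) + z' < 1" "x \<noteq> k" "x' \<noteq> k"
      using w e by (auto simp: cone_def)
    define \<delta> where "\<delta> = min z z'"
    have \<delta>: "0 < \<delta>" "\<delta> \<le> z" "\<delta> \<le> z'" using n by (auto simp: \<delta>_def)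
    have "path_connected (ball k (1 - \<delta>) - {k})" by (rule path_connected_punctured_ball) simp
    moreover have "x \<in> ball k (1 - \<delta>) - {k}" "x' \<in> ball k (1 - \<delta>) - {k}"
      using n \<delta> by (auto simp: dist_norm norm_minus_commute)
    ultimately obtain g where g: "path g" "path_image g \<subseteq> ball k (1 - \<delta>) - {k}" "pathstart g = x" "pathfinish g = x'"
      unfolding path_connected_def by blast
    let ?a = "linepath (x, z) (x, \<delta>)" and ?b = "\<lambda>t. (g t, \<delta>)" and ?c = "linepath (x', \<delta>) (x', z')"
    have seg: "path_image (linepath (y, r) (y, r')) \<subseteq> {y} \<times> closed_segment r r'" for y :: complex and r r' :: real
    proof
      fix w assume "w \<in> path_image (linepath (y, r) (y, r'))"
      then obtain v where v: "0 \<le> v" "v \<le> 1" "w = (1 - v) *\<^sub>R (y, r) + v *\<^sub>R (y, r')"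
        unfolding path_image_linepath closed_segment_def by blast
      then have "w = (y, (1 - v) *\<^sub>R r + v *\<^sub>R r')" by (simp flip: scaleR_left_distrib)
      then show "w \<in> {y} \<times> closed_segment r r'" using v unfolding closed_segment_def by blast
    qed
    have in1: "closed_segment z \<delta> \<subseteq> {\<delta>..z}" "closed_segment \<delta> z' \<subseteq> {\<delta>..z'}"
      using \<delta> by (auto simp: closed_segment_eq_real_ivl)
    have low: "{y} \<times> {\<delta>..r} \<subseteq> cone k - {k} \<times> UNIV" if "norm (y - k) + r < 1" "y \<noteq> k" for y r
      using that \<delta> by (auto simp: cone_def)
    have a: "path_image ?a \<subseteq> cone k - {k} \<times> UNIV"
      using order_trans[OF seg[of x z \<delta>] order_trans[OF Sigma_mono[OF order_refl in1(1)] low[OF n(3,5)]]] .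
    have c: "path_image ?c \<subseteq> cone k - {k} \<times> UNIV"
      using order_trans[OF seg[of x' \<delta> z'] order_trans[OF Sigma_mono[OF order_refl in1(2)] low[OF n(4,6)]]] .
    have b: "path_image ?b \<subseteq> cone k - {k} \<times> UNIV"
    proof
      fix w assume "w \<in> path_image ?b"
      then obtain t where t: "t \<in> {0..1}" "w = (g t, \<delta>)" unfolding path_image_def by blast
      then have "g t \<in> path_image g" unfolding path_image_def by blast
      then have "g t \<in> ball k (1 - \<delta>) - {k}" using subsetD[OF g(2)] by blast
      then show "w \<in> cone k - {k} \<times> UNIV" using \<delta> t(2) by (simp add: cone_def dist_norm norm_minus_commute)
    qed
    have pb: "path ?b" using g(1) unfolding path_def by (intro continuous_intros)
    have sb: "pathstart ?b = (x, \<delta>)" "pathfinish ?b = (x', \<delta>)" using g by (auto simp: pathstart_def pathfinish_def)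
    let ?j = "?a +++ ?b +++ ?c"
    have "path ?j" using pb sb by simp
    moreover have "path_image ?j \<subseteq> cone k - {k} \<times> UNIV"
      using a b c by (meson path_image_join_subset order_trans Un_least)
    moreover have "pathstart ?j = w" "pathfinish ?j = w'" by (simp_all add: e)
    ultimately show ?thesis by (intro exI[of _ ?j] conjI)
  qed
  then show ?thesis unfolding path_connected_def by blast
qed

end

section \<open>Sheets of the branched cover\<close>

lemma simply_connected_paths_homotopic:
  fixes S :: "'b::real_normed_vector set"
  assumes "simply_connected S" "p \<in> paths_between S x y" "q \<in> paths_between S x y"
  shows "homotopic_paths S p q"
  using assms unfolding simply_connected_eq_homotopic_paths paths_between_def by auto

text \<open>The image of a simply connected set under a section inherits the homotopies of paths.\<close>

lemma section_paths_homotopic: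
  fixes g :: "'b::real_normed_vector \<Rightarrow> 'a::topological_space"
  assumes S: "simply_connected S" and g: "continuous_on S g" "g ` S \<subseteq> X"
    and q: "continuous_on (g ` S) q" "\<And>s. s \<in> S \<Longrightarrow> q (g s) = s"
    and d: "d \<in> paths_between (g ` S) x y" "d' \<in> paths_between (g ` S) x y"
  shows "homotopic_paths X d d'"
proof -
  have qd: "q \<circ> c \<in> paths_between S (q x) (q y)" "homotopic_paths X c (g \<circ> (q \<circ> c))"
    if c: "c \<in> paths_between (g ` S) x y" for c
  proof -
    have cc: "path c" "path_image c \<subseteq> g ` S" "pathstart c = x" "pathfinish c = y"
      using c by (auto simp: paths_between_def)
    have "path (q \<circ> c)" using path_continuous_image[OF cc(1)] continuous_on_subset[OF q(1) cc(2)] by blast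
    moreover have "path_image (q \<circ> c) \<subseteq> S" using cc(2) q(2) by (auto simp: path_image_compose)
    ultimately show "q \<circ> c \<in> paths_between S (q x) (q y)" using cc
      by (simp add: paths_between_def pathstart_compose pathfinish_compose)
    show "homotopic_paths X c (g \<circ> (q \<circ> c))"
    proof (rule homotopic_paths_eq)
      show "path_image c \<subseteq> X" using cc(2) g(2) by (rule order_trans)
      fix t :: real assume "t \<in> {0..1}"
      then have "c t \<in> g ` S" using cc(2) by (auto simp: path_image_def)
      then show "c t = (g \<circ> (q \<circ> c)) t" using q(2) by auto
    qed (rule cc(1))
  qed
  have "homotopic_paths S (q \<circ> d) (q \<circ> d')"
    using simply_connected_paths_homotopic[OF S qd(1)[OF d(1)] qd(1)[OF d(2)]] .
  then have "homotopic_paths X (g \<circ> (q \<circ> d)) (g \<circ> (q \<circ> d'))"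
    by (rule homotopic_paths_continuous_image[OF _ g(1)]) (use g(2) in blast)
  from homotopic_paths_trans[OF homotopic_paths_trans[OF qd(2)[OF d(1)] this] homotopic_paths_sym[OF qd(2)[OF d(2)]]]
  show ?thesis .
qed

lemma openin_chart_image:
  fixes F :: "R3 \<Rightarrow> R4"
  assumes "homeomorphism UNIV (S3 - {N}) F F'" "open S"
  shows "openin (top_of_set S3) (F ` S)"
proof -
  have "openin (top_of_set (S3 - {N})) (F ` S)"
    by (rule homeomorphism_imp_open_map[OF assms(1)]) (simp add: assms(2))
  moreover have "openin (top_of_set S3) (S3 - {N})" by (rule openin_delete[OF openin_subtopology_self])
  ultimately show ?thesis by (rule openin_trans)
qed

lemma chart_inj: "homeomorphism UNIV T F F' \<Longrightarrow> F s = F t \<longleftrightarrow> s = t"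
  by (metis homeomorphism_apply1 UNIV_I)

lemma chart_range: "homeomorphism UNIV T F F' \<Longrightarrow> F s \<in> T"
  using homeomorphism_image1 by blast

lemma chart_inv_cont: "homeomorphism S T F F' \<Longrightarrow> T' \<subseteq> T \<Longrightarrow> continuous_on T' F'"
  unfolding homeomorphism_def by (elim conjE) (rule continuous_on_subset)

locale branched_cover =
  fixes X :: "'a::topological_space set" and p :: "'a \<Rightarrow> R4" and L :: "R4 set"
  assumes dbc: "double_branched_cover X p L" and closed_L: "closed L"
begin

lemma p_cont: "continuous_on X p" and p_S3: "p ` X \<subseteq> S3"
  and cover: "covering_space (X \<inter> p -` (S3 - L)) p (S3 - L)"
  and fibre: "\<And>x. x \<in> S3 - L \<Longrightarrow> card (X \<inter> p -` {x}) = 2"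
  using dbc unfolding double_branched_cover_def by auto

lemma openin_preimage: "openin (top_of_set S3) U \<Longrightarrow> openin (top_of_set X) (X \<inter> p -` U)"
  using continuous_openin_preimage[OF p_cont] p_S3 by (auto simp: image_subset_iff_funcset)

lemma openin_complement: "openin (top_of_set S3) (S3 - L)"
proof -
  have "S3 - L = S3 \<inter> (- L)" by auto
  then show ?thesis using closed_L by (metis openin_open open_Compl)
qed

lemma openin_unbranched: "openin (top_of_set X) (X \<inter> p -` (S3 - L))"
  by (rule openin_preimage[OF openin_complement])

text \<open>The two sheets of the cover over \<open>F ` S\<close>, as sections in the coordinates given by the chart
  \<open>F\<close>. They are numbered by truth values, so that negation exchanges them.\<close>

definition sheets :: "(R3 \<Rightarrow> R4) \<Rightarrow> R3 set \<Rightarrow> (bool \<Rightarrow> R3 \<Rightarrow> 'a) \<Rightarrow> bool" where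
  "sheets F S g \<longleftrightarrow> (\<forall>b. continuous_on S (g b)) \<and> (\<forall>b. \<forall>s\<in>S. g b s \<in> X \<and> p (g b s) = F s) \<and>
     (\<forall>s\<in>S. g True s \<noteq> g False s) \<and> (\<forall>s\<in>S. \<forall>x\<in>X. p x = F s \<longrightarrow> (\<exists>b. x = g b s))"

text \<open>Lift along the contraction from either point over \<open>s0\<close>; as fibres have two points, the two
  lifts fill the cover over \<open>F ` S\<close>.\<close>

lemma sheets_exist:
  assumes F: "homeomorphism UNIV (S3 - {N}) F F'" and h: "contraction S s0 h" and FL: "F ` S \<inter> L = {}"
  shows "\<exists>g. sheets F S g"
proof -
  have S: "open S" "s0 \<in> S" and h1: "continuous_on ({0..1} \<times> S) h" "h ` ({0..1} \<times> S) \<subseteq> S"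
    and h2: "\<And>s. s \<in> S \<Longrightarrow> h (0, s) = s0" "\<And>s. s \<in> S \<Longrightarrow> h (1, s) = s" "\<And>t. t \<in> {0..1} \<Longrightarrow> h (t, s0) = s0"
    using h unfolding contraction_def by auto
  have conn: "connected S" using contraction_simply_connected[OF h] by (rule simply_connected_imp_connected)
  have Fi: "F s \<in> S3 - L" if "s \<in> S" for s
    using homeomorphism_image1[OF F] FL that by blast
  have Fc: "continuous_on UNIV F" using F by (simp add: homeomorphism_def)
  let ?C = "X \<inter> p -` (S3 - L)"
  let ?K = "F \<circ> h"
  have K: "continuous_on ({0..1} \<times> S) ?K" "?K ` ({0..1} \<times> S) \<subseteq> S3 - L"
  proof -
    show "continuous_on ({0..1} \<times> S) ?K"
      by (rule continuous_on_compose[OF h1(1) continuous_on_subset[OF Fc]]) simp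
    show "?K ` ({0..1} \<times> S) \<subseteq> S3 - L" using h1(2) Fi unfolding image_comp[symmetric] by blast
  qed
  have lift: "\<exists>g. continuous_on S g \<and> g ` S \<subseteq> ?C \<and> (\<forall>s\<in>S. p (g s) = F s) \<and> g s0 = \<xi>"
    if \<xi>: "\<xi> \<in> X" "p \<xi> = F s0" for \<xi>
  proof -
    have a: "\<xi> \<in> ?C" using \<xi> Fi[OF S(2)] by simp
    have b: "?K (0, s) = p \<xi>" if "s \<in> S" for s using h2(1)[OF that] \<xi> by simp
    obtain g where g: "continuous_on S g" "g ` S \<subseteq> ?C" "\<And>s. s \<in> S \<Longrightarrow> p (g s) = ?K (1, s)"
      "\<And>s. s \<in> S \<Longrightarrow> (\<And>t. t \<in> {0..1} \<Longrightarrow> ?K (t, s) = p \<xi>) \<Longrightarrow> g s = \<xi>"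
      using lift_along_contraction[OF cover S(1) K a b] by metis
    have "g s0 = \<xi>" by (rule g(4)[OF S(2)]) (simp add: h2(3) \<xi>)
    moreover have "\<forall>s\<in>S. p (g s) = F s" using g(3) h2(2) by simp
    ultimately show ?thesis using g(1,2) by blast
  qed
  obtain \<xi>0 \<xi>1 where x: "X \<inter> p -` {F s0} = {\<xi>0, \<xi>1}" "\<xi>0 \<noteq> \<xi>1"
    using fibre[OF Fi[OF S(2)]] by (meson card_2_iff)
  then have xi: "\<xi>0 \<in> X" "p \<xi>0 = F s0" "\<xi>1 \<in> X" "p \<xi>1 = F s0" by blast+
  obtain g0 where g0: "continuous_on S g0" "g0 ` S \<subseteq> ?C" "\<forall>s\<in>S. p (g0 s) = F s" "g0 s0 = \<xi>0"
    using lift[OF xi(1,2)] by blast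
  obtain g1 where g1: "continuous_on S g1" "g1 ` S \<subseteq> ?C" "\<forall>s\<in>S. p (g1 s) = F s" "g1 s0 = \<xi>1"
    using lift[OF xi(3,4)] by blast
  have ne: "g0 s \<noteq> g1 s" if s: "s \<in> S" for s
  proof
    assume "g0 s = g1 s"
    then have "g0 s0 = g1 s0"
      using covering_lift_unique[OF cover conn g0(1,2) g1(1,2) _ s _ S(2)] g0(3) g1(3) by simp
    then show False using x(2) g0(4) g1(4) by simp
  qed
  have all: "x = g0 s \<or> x = g1 s" if s: "s \<in> S" "x \<in> X" "p x = F s" for s x
  proof -
    have c: "card (X \<inter> p -` {F s}) = 2" by (rule fibre[OF Fi[OF s(1)]])
    then have "finite (X \<inter> p -` {F s})" by (intro card_ge_0_finite) (simp only: zero_less_numeral)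
    moreover have "{g0 s, g1 s} \<subseteq> X \<inter> p -` {F s}" proof -
      have "g0 s \<in> ?C" "g1 s \<in> ?C" using s(1) g0(2) g1(2) by blast+
      then show ?thesis using s(1) g0(3) g1(3) by simp
    qed
    ultimately have "{g0 s, g1 s} = X \<inter> p -` {F s}"
      by (rule card_subset_eq) (simp add: c ne[OF s(1)])
    moreover have "x \<in> X \<inter> p -` {F s}" using s by simp
    ultimately show ?thesis by blast
  qed
  have "sheets F S (\<lambda>b. if b then g0 else g1)"
    unfolding sheets_def
  proof (intro conjI allI ballI impI)
    fix s x assume "s \<in> S" "x \<in> X" "p x = F s"
    from all[OF this] show "\<exists>b. x = (if b then g0 else g1) s"
    proof
      assume "x = g0 s" then show ?thesis by (intro exI[of _ True]) simp
    next
      assume "x = g1 s" then show ?thesis by (intro exI[of _ False]) simp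
    qed
  next
    fix b s assume s: "s \<in> S"
    have "g0 s \<in> X" "g1 s \<in> X" using s g0(2) g1(2) by auto
    then show "(if b then g0 else g1) s \<in> X" "p ((if b then g0 else g1) s) = F s"
      using s g0(3) g1(3) by auto
  qed (use g0(1) g1(1) ne in auto)
  then show ?thesis by (intro exI)
qed

context
  fixes F :: "R3 \<Rightarrow> R4" and F' N S g
  assumes F: "homeomorphism UNIV (S3 - {N}) F F'" and sh: "sheets F S g" and FL: "F ` S \<inter> L = {}"
begin

lemma sheets_cont: "continuous_on S (g b)" and sheets_X: "s \<in> S \<Longrightarrow> g b s \<in> X"
  and sheets_p: "s \<in> S \<Longrightarrow> p (g b s) = F s" and sheets_ne: "s \<in> S \<Longrightarrow> g b s = g c s \<longleftrightarrow> b = c"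
  and sheets_all: "s \<in> S \<Longrightarrow> x \<in> X \<Longrightarrow> p x = F s \<Longrightarrow> \<exists>b. x = g b s"
  using sh unfolding sheets_def by (auto, (cases b; cases c; force)+)

lemma sheets_inj: "s \<in> S \<Longrightarrow> t \<in> S \<Longrightarrow> g b s = g c t \<longleftrightarrow> s = t \<and> b = c"
  using sheets_p[of s b] sheets_p[of t c] chart_inj[OF F] sheets_ne by metis

lemma sheets_openin:
  assumes "open S'" "S' \<subseteq> S"
  shows "openin (top_of_set X) (g b ` S')"
proof -
  have FS: "openin (top_of_set (S3 - L)) (F ` S')"
  proof -
    have "F ` S' \<subseteq> S3 - L" using FL assms homeomorphism_image1[OF F] by blast
    then show ?thesis using openin_chart_image[OF F assms(1)] openin_subset_trans by blast
  qed
  have inv: "F' (F s) = s" for s using homeomorphism_apply1[OF F] by simp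
  have "continuous_on (F ` S') (g b \<circ> F')"
  proof (rule continuous_on_compose)
    show "continuous_on (F ` S') F'"
      by (rule chart_inv_cont[OF F]) (use chart_range[OF F] in blast)
    have "F' ` F ` S' = S'" using inv by (simp add: image_comp)
    then show "continuous_on (F' ` F ` S') (g b)" using continuous_on_subset[OF sheets_cont assms(2)] by simp
  qed
  moreover have "(g b \<circ> F') ` F ` S' \<subseteq> X \<inter> p -` (S3 - L)"
  proof
    fix y assume "y \<in> (g b \<circ> F') ` F ` S'"
    then obtain s where s: "s \<in> S'" "y = g b s" using inv by auto
    then have "s \<in> S" "F s \<notin> L" using assms FL by blast+
    then show "y \<in> X \<inter> p -` (S3 - L)" using s sheets_X sheets_p chart_range[OF F, of s] by simp
  qed
  moreover have "p ((g b \<circ> F') y) = y" if "y \<in> F ` S'" for y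
    using that inv sheets_p assms by auto
  ultimately have "openin (top_of_set (X \<inter> p -` (S3 - L))) ((g b \<circ> F') ` F ` S')"
    by (rule open_section[OF cover FS])
  moreover have "(g b \<circ> F') ` F ` S' = g b ` S'" using inv by (simp add: image_comp)
  ultimately show ?thesis using openin_trans openin_unbranched by metis
qed

lemma sheets_path_connected: "path_connected S' \<Longrightarrow> S' \<subseteq> S \<Longrightarrow> path_connected (g b ` S')"
  by (rule path_connected_continuous_image[OF continuous_on_subset[OF sheets_cont]])

lemma sheets_homotopic:
  assumes "simply_connected S" "d \<in> paths_between (g b ` S) x y" "d' \<in> paths_between (g b ` S) x y"
  shows "homotopic_paths X d d'"
proof (rule section_paths_homotopic[OF assms(1) sheets_cont _ _ _ assms(2,3), where q = "F' \<circ> p"])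
  show "g b ` S \<subseteq> X" using sheets_X by blast
  show "(F' \<circ> p) (g b s) = s" if "s \<in> S" for s using sheets_p[OF that] homeomorphism_apply1[OF F] by simp
  show "continuous_on (g b ` S) (F' \<circ> p)"
  proof (rule continuous_on_compose)
    show "continuous_on (g b ` S) p" using continuous_on_subset[OF p_cont] sheets_X by blast
    show "continuous_on (p ` g b ` S) F'"
    proof (rule chart_inv_cont[OF F], rule subsetI)
      fix y assume "y \<in> p ` g b ` S"
      then obtain s where "s \<in> S" "y = p (g b s)" by blast
      then show "y \<in> S3 - {N}" using chart_range[OF F] sheets_p by simp
    qed
  qed
qed

end

end

section \<open>The colouring of the complement of the projection\<close>

text \<open>Two charts of the sphere, missing one point each: \<open>e\<close> carries \<open>LK\<close> to the branch set, and
  \<open>f\<close> covers the point at infinity of \<open>e\<close>.\<close>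

locale link_cover = projected_link LK Ctr + branched_cover X p L
  for LK :: "R3 set" and Ctr :: "complex set" and X :: "'a::topological_space set" and p :: "'a \<Rightarrow> R4" and L :: "R4 set" +
  fixes e f :: "R3 \<Rightarrow> R4" and e' f' :: "R4 \<Rightarrow> R3" and ninf zinf :: R4
  assumes e: "homeomorphism UNIV (S3 - {ninf}) e e'" and e_LK: "e ` LK = L"
    and f: "homeomorphism UNIV (S3 - {zinf}) f f'" and f_0: "f 0 = ninf"
    and f_inversion: "\<And>w. w \<noteq> 0 \<Longrightarrow> f w = e ((1 / (norm w)\<^sup>2) *\<^sub>R w)"
    and proj_off_Ctr: "\<exists>q. q \<in> proj \<and> q \<notin> Ctr"
begin

lemma e_inj: "e v = e w \<longleftrightarrow> v = w" by (rule chart_inj[OF e])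

lemma e_in_L: "e w \<in> L \<longleftrightarrow> w \<in> LK"
proof -
  have "inj e" by (rule injI) (simp only: e_inj)
  then show ?thesis unfolding e_LK[symmetric] by (rule inj_image_mem_iff)
qed

lemma e_S3: "e w \<in> S3" using chart_range[OF e, of w] by blast

lemma S3_cases: "y \<in> S3 \<Longrightarrow> y = ninf \<or> (\<exists>w. y = e w)"
  using homeomorphism_image1[OF e] by blast

lemma upper_or_lower:
  assumes "x \<notin> Ctr" "(x, z) \<notin> LK" shows "(x, z) \<in> upper \<or> (x, z) \<in> lower"
proof (rule ccontr)
  assume "\<not> ?thesis"
  then obtain z1 z2 where z: "z1 \<ge> z" "(x, z1) \<in> LK" "z2 \<le> z" "(x, z2) \<in> LK"
    unfolding upper_def lower_def by auto
  then have "z1 = z2" using column[OF z(2,4)] assms(1) by blast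
  then show False using z assms(2) by auto
qed

lemma e_upper: "e ` upper \<inter> L = {}" and e_lower: "e ` lower \<inter> L = {}"
  and e_cone: "k \<in> Ctr \<Longrightarrow> e ` cone k \<inter> L = {}"
proof -
  have *: "e ` S \<inter> L = {}" if "S \<inter> LK = {}" for S
  proof (rule ccontr)
    assume "e ` S \<inter> L \<noteq> {}"
    then obtain w where "w \<in> S" "e w \<in> L" by blast
    then show False using e_in_L that by blast
  qed
  show "e ` upper \<inter> L = {}" "e ` lower \<inter> L = {}" using * upper_lower_disjoint_LK by auto
  show "e ` cone k \<inter> L = {}" if "k \<in> Ctr" using cone_LK[OF that] by (intro *) (auto simp: cone_def)
qed

definition upper_sheet :: "bool \<Rightarrow> R3 \<Rightarrow> 'a" where "upper_sheet = (SOME g. sheets e upper g)"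
definition lower_sheet :: "bool \<Rightarrow> R3 \<Rightarrow> 'a" where "lower_sheet = (SOME g. sheets e lower g)"

lemma upper_sheet: "sheets e upper upper_sheet"
proof -
  obtain s0 h where "contraction upper s0 h" using upper_contraction by blast
  from someI_ex[OF sheets_exist[OF e this e_upper]] show ?thesis unfolding upper_sheet_def .
qed

lemma lower_sheet: "sheets e lower lower_sheet"
proof -
  obtain s0 h where "contraction lower s0 h" using lower_contraction by blast
  from someI_ex[OF sheets_exist[OF e this e_lower]] show ?thesis unfolding lower_sheet_def .
qed

lemmas upper_sheet_cont = sheets_cont[OF e upper_sheet e_upper] and lower_sheet_cont = sheets_cont[OF e lower_sheet e_lower]
lemmas upper_sheet_X = sheets_X[OF e upper_sheet e_upper] and lower_sheet_X = sheets_X[OF e lower_sheet e_lower]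
lemmas upper_sheet_p = sheets_p[OF e upper_sheet e_upper] and lower_sheet_p = sheets_p[OF e lower_sheet e_lower]
lemmas upper_sheet_all = sheets_all[OF e upper_sheet e_upper] and lower_sheet_all = sheets_all[OF e lower_sheet e_lower]
lemmas upper_sheet_inj = sheets_inj[OF e upper_sheet e_upper] and lower_sheet_inj = sheets_inj[OF e lower_sheet e_lower]
lemmas upper_sheet_openin = sheets_openin[OF e upper_sheet e_upper] and lower_sheet_openin = sheets_openin[OF e lower_sheet e_lower]

text \<open>Over a point off the projection the upper and the lower sheets coincide in pairs; the colour
  says whether they do so with equal numbers. It agrees with the checkerboard colouring of
  the diagram, up to exchanging the colours.\<close>

definition colour :: "complex \<Rightarrow> bool" where "colour x \<longleftrightarrow> upper_sheet True (x, 0) = lower_sheet True (x, 0)"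

lemma upper_sheet_unbranched: "w \<in> upper \<Longrightarrow> upper_sheet i w \<in> X \<inter> p -` (S3 - L)"
proof -
  assume w: "w \<in> upper"
  then have "e w \<notin> L" using e_upper by blast
  then show ?thesis using upper_sheet_X[OF w, of i] upper_sheet_p[OF w, of i] e_S3[of w] by (simp del: mem_sphere_0)
qed

lemma lower_sheet_unbranched: "w \<in> lower \<Longrightarrow> lower_sheet i w \<in> X \<inter> p -` (S3 - L)"
proof -
  assume w: "w \<in> lower"
  then have "e w \<notin> L" using e_lower by blast
  then show ?thesis using lower_sheet_X[OF w, of i] lower_sheet_p[OF w, of i] e_S3[of w] by (simp del: mem_sphere_0)
qed

text \<open>Both sheets lift the same map, so uniqueness of lifts applies.\<close>

lemma sheets_agree_connected:
  assumes T: "connected T" "T \<subseteq> upper \<inter> lower" and v: "v \<in> T" "upper_sheet i v = lower_sheet j v" and w: "w \<in> T"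
  shows "upper_sheet i w = lower_sheet j w"
proof (rule covering_lift_unique[OF cover T(1), where ?g1.0 = "upper_sheet i" and ?g2.0 = "lower_sheet j" and a = v])
  have T2: "T \<subseteq> upper" "T \<subseteq> lower" using T(2) by auto
  show "continuous_on T (upper_sheet i)" using continuous_on_subset[OF upper_sheet_cont T2(1)] .
  show "continuous_on T (lower_sheet j)" using continuous_on_subset[OF lower_sheet_cont T2(2)] .
  show "upper_sheet i ` T \<subseteq> X \<inter> p -` (S3 - L)" using upper_sheet_unbranched T2 by blast
  show "lower_sheet j ` T \<subseteq> X \<inter> p -` (S3 - L)" using lower_sheet_unbranched T2 by blast
  show "p (upper_sheet i t) = p (lower_sheet j t)" if "t \<in> T" for t 
    using upper_sheet_p[OF subsetD[OF T2(1) that]] lower_sheet_p[OF subsetD[OF T2(2) that]] by (simp only:)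
qed (use v w in auto)

lemma agree_at_0:
  assumes x: "x \<notin> proj" shows "upper_sheet i (x, 0) = lower_sheet j (x, 0) \<longleftrightarrow> j = (i = colour x)"
proof -
  note u = off_proj[OF x, of 0]
  have a: "\<exists>j. upper_sheet i (x, 0) = lower_sheet j (x, 0)" for i
    using lower_sheet_all[OF u(2) upper_sheet_X[OF u(1)]] upper_sheet_p[OF u(1)] by simp
  have inj: "upper_sheet i (x, 0) = upper_sheet i' (x, 0) \<longleftrightarrow> i = i'" "lower_sheet i (x, 0) = lower_sheet i' (x, 0) \<longleftrightarrow> i = i'" for i i'
    using upper_sheet_inj[OF u(1) u(1)] lower_sheet_inj[OF u(2) u(2)] by auto
  obtain j1 j2 where j: "upper_sheet True (x, 0) = lower_sheet j1 (x, 0)" "upper_sheet False (x, 0) = lower_sheet j2 (x, 0)" using a by metis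
  then have "j1 \<noteq> j2" using inj(1) by metis
  moreover have "colour x \<longleftrightarrow> j1" unfolding colour_def j using inj(2) by simp
  ultimately show ?thesis using j inj(2) by (cases i) auto
qed

lemma sheets_agree:
  assumes x: "x \<notin> proj" shows "upper_sheet i (x, z) = lower_sheet j (x, z) \<longleftrightarrow> j = (i = colour x)"
proof -
  have c: "connected ({x} \<times> (UNIV :: real set))" by (intro connected_Times) auto
  have s: "{x} \<times> UNIV \<subseteq> upper \<inter> lower" using off_proj[OF x] by auto
  have "upper_sheet i (x, z) = lower_sheet j (x, z) \<longleftrightarrow> upper_sheet i (x, 0) = lower_sheet j (x, 0)"
    using sheets_agree_connected[OF c s, of "(x, z)" i j "(x, 0)"]
      sheets_agree_connected[OF c s, of "(x, 0)" i j "(x, z)"] by auto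
  then show ?thesis using agree_at_0[OF x] by simp
qed

lemma colour_connected:
  assumes T: "connected T" "T \<inter> proj = {}" and x: "x \<in> T" "y \<in> T"
  shows "colour x = colour y"
proof -
  have c: "connected (T \<times> {0 :: real})" by (intro connected_Times T) auto
  have s: "T \<times> {0} \<subseteq> upper \<inter> lower" using off_proj T(2) by blast
  have n: "x \<notin> proj" "y \<notin> proj" using T x by auto
  show ?thesis
    using sheets_agree_connected[OF c s, of "(x, 0)" True "colour x" "(y, 0)"] x agree_at_0[OF n(1)] agree_at_0[OF n(2)]
    by simp
qed

lemma branch_chart:
  assumes "y \<in> L"
  obtains U \<phi> \<phi>' g \<gamma> where "openin (top_of_set S3) U" "y \<in> U"
    "homeomorphism U (UNIV :: R3 set) \<phi> \<phi>'" "\<phi> ` (U \<inter> L) = {0} \<times> UNIV"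
    "homeomorphism (X \<inter> p -` U) (UNIV :: R3 set) g \<gamma>"
    "\<forall>x\<in>X \<inter> p -` U. \<phi> (p x) = ((fst (g x))\<^sup>2, snd (g x))"
proof -
  have "\<forall>x\<in>L. \<exists>U f f' g g'.
        openin (top_of_set S3) U \<and> x \<in> U \<and>
        homeomorphism U (UNIV :: (complex \<times> real) set) f f' \<and>
        f ` (U \<inter> L) = {0} \<times> UNIV \<and>
        homeomorphism (X \<inter> p -` U) (UNIV :: (complex \<times> real) set) g g' \<and>
        (\<forall>y\<in>X \<inter> p -` U. f (p y) = ((fst (g y))\<^sup>2, snd (g y)))"
    using dbc unfolding double_branched_cover_def by (elim conjE)
  from bspec[OF this assms] show ?thesis using that by (elim exE conjE)
qed

lemma small_ball_off_Ctr:
  assumes "q \<notin> Ctr" "0 < r"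
  obtains s where "0 < s" "s \<le> r" "ball q s \<inter> Ctr = {}"
proof -
  have "open (- Ctr)" using finite_imp_closed[OF finite_Ctr] by (simp add: open_Compl)
  then obtain s where s: "0 < s" "ball q s \<subseteq> - Ctr" using assms(1) by (meson ComplI openE)
  then have "ball q (min r s) \<inter> Ctr = {}" by auto
  then show ?thesis using that[of "min r s"] assms(2) s(1) by simp
qed

text \<open>If only one colour occurred near a point of the projection, then over a neighbourhood of a
  vertical line the upper and lower sheets would fit together to two disjoint sections. In
  the branched chart a meridian would then have closed lifts, while \<open>z \<mapsto> z\<^sup>2\<close> makes its lift
  \<open>c\<close> go from one point of a fibre to the other.\<close>

lemma both_colours:
  assumes q: "q \<in> proj" "q \<notin> Ctr" and r: "0 < r"
  shows "\<exists>x\<in>ball q r - proj. \<exists>y\<in>ball q r - proj. colour x \<noteq> colour y"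
proof (rule ccontr)
  assume no: "\<not> ?thesis"
  obtain s where s: "0 < s" "s \<le> r" "ball q s \<inter> Ctr = {}" using small_ball_off_Ctr[OF q(2) r] .
  have sr: "ball q s \<subseteq> ball q r" using s(2) by (rule subset_ball)
  obtain \<kappa> where \<kappa>: "\<And>x. x \<in> ball q s \<Longrightarrow> x \<notin> proj \<Longrightarrow> colour x = \<kappa>"
  proof (cases "ball q s \<subseteq> proj")
    case False
    then obtain x0 where "x0 \<in> ball q s" "x0 \<notin> proj" by blast
    then show ?thesis using that[of "colour x0"] no sr by blast
  qed blast
  obtain z0 where z0: "(q, z0) \<in> LK" using q(1) by (auto simp: proj_def)
  define B where "B = ball q s \<times> (UNIV :: real set)"
  have oB: "open B" unfolding B_def by (intro open_Times) auto
  have yL: "e (q, z0) \<in> L" using z0 e_in_L by blast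
  obtain U \<phi> \<phi>' g \<gamma> where U: "openin (top_of_set S3) U" "e (q, z0) \<in> U"
    and \<phi>: "homeomorphism U (UNIV :: R3 set) \<phi> \<phi>'" "\<phi> ` (U \<inter> L) = {0} \<times> UNIV"
    and g: "homeomorphism (X \<inter> p -` U) (UNIV :: R3 set) g \<gamma>"
    and sq: "\<forall>x\<in>X \<inter> p -` U. \<phi> (p x) = ((fst (g x))\<^sup>2, snd (g x))"
    using branch_chart[OF yL] .
  have \<gamma>U: "\<gamma> w \<in> X" "p (\<gamma> w) \<in> U" "g (\<gamma> w) = w" for w
    using homeomorphism_image2[OF g] homeomorphism_apply2[OF g] by auto
  have \<phi>\<gamma>: "\<phi> (p (\<gamma> w)) = ((fst w)\<^sup>2, snd w)" for w using sq \<gamma>U[of w] by simp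
  have \<gamma>c: "continuous_on UNIV \<gamma>" "\<gamma> ` UNIV \<subseteq> X" using g \<gamma>U by (auto simp: homeomorphism_def)
  have "\<phi> (e (q, z0)) \<in> {0} \<times> UNIV" using \<phi>(2) U(2) yL by blast
  then obtain t0 where t0: "\<phi> (e (q, z0)) = (0, t0)" by auto
  have p0: "p (\<gamma> (0, t0)) = e (q, z0)"
  proof -
    have "\<phi> (p (\<gamma> (0, t0))) = \<phi> (e (q, z0))" using \<phi>\<gamma>[of "(0, t0)"] t0 by simp
    then show ?thesis using homeomorphism_apply1[OF \<phi>(1)] \<gamma>U(2) U(2) by metis
  qed
  have "continuous_on UNIV (p \<circ> \<gamma>)"
    using continuous_on_compose[OF \<gamma>c(1) continuous_on_subset[OF p_cont \<gamma>c(2)]] .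
  moreover have "openin (top_of_set S3) (e ` B)" by (rule openin_chart_image[OF e oB])
  moreover have "(p \<circ> \<gamma>) \<in> UNIV \<rightarrow> S3" using \<gamma>U(1) p_S3 by (auto simp del: mem_sphere_0)
  ultimately have "openin (top_of_set UNIV) (UNIV \<inter> (p \<circ> \<gamma>) -` (e ` B))"
    using continuous_openin_preimage by blast
  then have "open ((p \<circ> \<gamma>) -` (e ` B))" by simp
  moreover have "(0, t0) \<in> (p \<circ> \<gamma>) -` (e ` B)" using p0 s(1) by (simp add: B_def)
  ultimately obtain \<delta> where \<delta>: "0 < \<delta>" "ball (0, t0) \<delta> \<subseteq> (p \<circ> \<gamma>) -` (e ` B)" by (meson openE)
  \<comment> \<open>half a turn around the branch set upstairs, which covers a full meridian\<close>
  define c where "c = (\<lambda>s :: real. \<gamma> (of_real (\<delta> / 2) * cis (pi * s), t0))"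
  have cB: "\<exists>w\<in>B. p (c s) = e w" for s
  proof -
    have "dist (0, t0) (of_real (\<delta> / 2) * cis (pi * s) :: complex, t0) = \<delta> / 2"
      using \<delta>(1) by (simp add: dist_Pair_Pair norm_mult)
    then have "(of_real (\<delta> / 2) * cis (pi * s), t0) \<in> ball (0, t0) \<delta>" using \<delta>(1) by simp
    then show ?thesis using \<delta>(2) unfolding c_def by fastforce
  qed
  have cX: "c s \<in> X" for s using \<gamma>U by (simp add: c_def)
  have cL: "p (c s) \<notin> L" for s
  proof
    assume "p (c s) \<in> L"
    then have "\<phi> (p (c s)) \<in> {0} \<times> UNIV" using \<phi>(2) \<gamma>U(2) unfolding c_def by blast
    then show False using \<phi>\<gamma> \<delta>(1) by (simp add: c_def)
  qed
  have c01: "p (c 0) = p (c 1)"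
  proof -
    have "\<phi> (p (c 0)) = \<phi> (p (c 1))" by (simp add: c_def \<phi>\<gamma>)
    then show ?thesis using homeomorphism_apply1[OF \<phi>(1)] \<gamma>U(2) unfolding c_def by metis
  qed
  have cne: "c 0 \<noteq> c 1"
  proof
    assume "c 0 = c 1"
    then have "g (c 0) = g (c 1)" by simp
    then show False using \<delta>(1) by (simp add: c_def \<gamma>U(3))
  qed
  \<comment> \<open>the two sections over the vertical neighbourhood \<open>B\<close>\<close>
  define A where "A b = upper_sheet b ` (upper \<inter> B) \<union> lower_sheet (b = \<kappa>) ` (lower \<inter> B)" for b
  have oA: "openin (top_of_set X) (A b)" for b unfolding A_def
    by (intro openin_Un upper_sheet_openin lower_sheet_openin open_Int open_upper open_lower oB) auto
  have fit: "\<xi> = \<eta> \<longleftrightarrow> b = b'" if \<xi>: "\<xi> \<in> A b" "\<eta> \<in> A b'" and eq: "p \<xi> = p \<eta>" for b b' \<xi> \<eta>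
  proof -
    have mix: "upper_sheet b u = lower_sheet (b' = \<kappa>) v \<longleftrightarrow> b = b'"
      if "u \<in> upper" "v \<in> lower" "v \<in> B" "p (upper_sheet b u) = p (lower_sheet (b' = \<kappa>) v)" for b b' u v
    proof -
      have uv: "u = v" using that upper_sheet_p lower_sheet_p e_inj by simp
      obtain x z where xz: "v = (x, z)" by (cases v)
      have xp: "x \<notin> proj" using that(1,2) proj_if_upper_lower unfolding uv xz by blast
      have "x \<in> ball q s" using that(3) by (simp add: B_def xz)
      then have "colour x = \<kappa>" using \<kappa> xp by blast
      then show ?thesis unfolding uv xz sheets_agree[OF xp] by auto
    qed
    consider u v where "u \<in> upper" "v \<in> upper" "\<xi> = upper_sheet b u" "\<eta> = upper_sheet b' v"
      | u v where "u \<in> upper" "v \<in> lower" "v \<in> B" "\<xi> = upper_sheet b u" "\<eta> = lower_sheet (b' = \<kappa>) v"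
      | u v where "v \<in> upper" "u \<in> lower" "u \<in> B" "\<eta> = upper_sheet b' v" "\<xi> = lower_sheet (b = \<kappa>) u"
      | u v where "u \<in> lower" "v \<in> lower" "\<xi> = lower_sheet (b = \<kappa>) u" "\<eta> = lower_sheet (b' = \<kappa>) v"
      using \<xi> unfolding A_def by blast
    then show ?thesis
    proof cases
      case 1
      then have "u = v" using eq upper_sheet_p e_inj by simp
      then show ?thesis using upper_sheet_inj[OF 1(1,2)] 1(3,4) by simp
    next
      case 2 then show ?thesis using mix[of u v b b'] eq by simp
    next
      case 3 then show ?thesis using mix[of v u b' b] eq by auto
    next
      case 4
      then have "u = v" using eq lower_sheet_p e_inj by simp
      then show ?thesis using lower_sheet_inj[OF 4(1,2), of "b = \<kappa>" "b' = \<kappa>"] 4(3,4) by auto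
    qed
  qed
  have disj: "A True \<inter> A False = {}" using fit[where b = True and b' = False] by blast
  have cA: "c s \<in> A True \<union> A False" for s
  proof -
    obtain w where w: "w \<in> B" "p (c s) = e w" using cB by blast
    obtain x z where xz: "w = (x, z)" by (cases w)
    have "x \<notin> Ctr" using w(1) s(3) by (auto simp: B_def xz)
    moreover have "(x, z) \<notin> LK" using cL[of s] w(2) e_in_L xz by metis
    ultimately consider "w \<in> upper" | "w \<in> lower" using upper_or_lower xz by blast
    then show ?thesis
    proof cases
      case 1
      then obtain b where "c s = upper_sheet b w" using upper_sheet_all[OF 1 cX w(2)] by blast
      then show ?thesis using 1 w(1) unfolding A_def by (cases b) auto
    next
      case 2
      then obtain j where j: "c s = lower_sheet j w" using lower_sheet_all[OF 2 cX w(2)] by blast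
      have "j = ((j = \<kappa>) = \<kappa>)" by auto
      then have "c s \<in> A (j = \<kappa>)" using j 2 w(1) unfolding A_def by auto
      then show ?thesis by (cases "j = \<kappa>") auto
    qed
  qed
  have con: "connected (range c)"
    unfolding c_def by (intro connected_continuous_image continuous_on_compose2[OF \<gamma>c(1)] continuous_intros) auto
  have "\<exists>b. c 0 \<in> A b \<and> c 1 \<in> A b"
  proof (rule ccontr)
    assume n: "\<not> ?thesis"
    have o: "openin (top_of_set (range c)) (range c \<inter> A b)" for b
    proof -
      obtain T where "open T" "A b = X \<inter> T" using oA[of b] by (auto simp: openin_open)
      then have "range c \<inter> A b = range c \<inter> T" using cX by blast
      then show ?thesis using \<open>open T\<close> by (auto simp: openin_open)
    qed
    have "range c \<inter> A True = {} \<or> range c \<inter> A False = {}"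
      using con o[of True] o[of False] cA disj unfolding connected_openin by blast
    then show False using n cA[of 0] cA[of 1] by blast
  qed
  then obtain b where "c 0 \<in> A b" "c 1 \<in> A b" by blast
  from fit[OF this c01] cne show False by simp
qed

end

section \<open>Simply connected pieces of the cover\<close>

context based_space
begin

lemma quot_along:
  assumes A: "frame A \<phi>" "A \<subseteq> X" and B: "frame B \<psi>" "B \<subseteq> X"
    and T: "path_connected T" "continuous_on T h" "h ` T \<subseteq> A \<inter> B" and vw: "v \<in> T" "w \<in> T"
  shows "quot (\<phi> (h v)) (\<psi> (h v)) = quot (\<phi> (h w)) (\<psi> (h w))"
proof -
  obtain d where d: "path d" "path_image d \<subseteq> T" "pathstart d = v" "pathfinish d = w"
    using T(1) vw unfolding path_connected_def by blast
  have "h \<circ> d \<in> paths_between (A \<inter> B) (h v) (h w)"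
    using d T(3) path_continuous_image[OF d(1) continuous_on_subset[OF T(2) d(2)]]
    by (auto simp: paths_between_def path_image_compose pathstart_compose pathfinish_compose)
  from frame_quot_frame[OF A B this] show ?thesis .
qed

end

context link_cover
begin

text \<open>The connected open sets on which frames exist. It is enough that paths are homotopic in the
  whole of \<open>X\<close>.\<close>

definition piece :: "'a set \<Rightarrow> bool" where
  "piece V \<longleftrightarrow> openin (top_of_set X) V \<and> path_connected V \<and>
     (\<forall>x y. \<forall>d\<in>paths_between V x y. \<forall>d'\<in>paths_between V x y. homotopic_paths X d d')"

lemma piece_sheet:
  assumes F: "homeomorphism UNIV (S3 - {N}) F F'" and g: "sheets F S g" and FL: "F ` S \<inter> L = {}"
    and S: "open S" "simply_connected S"
  shows "piece (g b ` S)"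
  unfolding piece_def
proof (intro conjI allI ballI)
  show "openin (top_of_set X) (g b ` S)" by (rule sheets_openin[OF F g FL S(1) order_refl])
  show "path_connected (g b ` S)"
    by (rule sheets_path_connected[OF F g FL simply_connected_imp_path_connected[OF S(2)] order_refl])
  show "homotopic_paths X d d'" if "d \<in> paths_between (g b ` S) x y" "d' \<in> paths_between (g b ` S) x y" for x y d d'
    by (rule sheets_homotopic[OF F g FL S(2) that])
qed

lemma simply_connected_upper: "simply_connected upper" and simply_connected_lower: "simply_connected lower"
  using upper_contraction lower_contraction contraction_simply_connected by blast+

lemma piece_upper_sheet: "piece (upper_sheet i ` upper)"
  by (rule piece_sheet[OF e upper_sheet e_upper open_upper simply_connected_upper])

lemma piece_lower_sheet: "piece (lower_sheet i ` lower)"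
  by (rule piece_sheet[OF e lower_sheet e_lower open_lower simply_connected_lower])

definition cone_sheet :: "complex \<Rightarrow> bool \<Rightarrow> R3 \<Rightarrow> 'a" where "cone_sheet k = (SOME g. sheets e (cone k) g)"

lemma cone_sheet: "k \<in> Ctr \<Longrightarrow> sheets e (cone k) (cone_sheet k)"
proof -
  assume k: "k \<in> Ctr"
  have "(k, 1/2) \<in> cone k" by (simp add: cone_def)
  then obtain h where "contraction (cone k) (k, 1/2) h"
    using convex_contraction[OF open_cone convex_cone] by blast
  from someI_ex[OF sheets_exist[OF e this e_cone[OF k]]] show ?thesis unfolding cone_sheet_def .
qed

lemma piece_cone_sheet: "k \<in> Ctr \<Longrightarrow> piece (cone_sheet k b ` cone k)"
  using piece_sheet[OF e cone_sheet e_cone open_cone convex_imp_simply_connected[OF convex_cone]] by blast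

text \<open>In the other chart small points correspond to large ones, and far out every point is above
  or below the link.\<close>

lemma near_infinity: "\<exists>r>0. \<forall>w. w \<noteq> 0 \<and> norm w < r \<longrightarrow> (\<exists>v\<in>upper \<union> lower. f w = e v)"
proof -
  obtain R where R: "R > 2" "LK \<subseteq> ball 0 R" "(\<Union>k\<in>Ctr. cone k) \<subseteq> ball 0 R" using link_bound by metis
  have "\<exists>v\<in>upper \<union> lower. f w = e v" if w: "w \<noteq> 0" "norm w < 1 / R" for w
  proof -
    let ?v = "(1 / (norm w)\<^sup>2) *\<^sub>R w"
    have "norm ?v = 1 / norm w" using w(1) by (simp add: power2_eq_square)
    also have "\<dots> > R" using w R(1) by (simp add: field_simps)
    finally have "?v \<notin> ball 0 R" by simp
    then have "?v \<in> - LK" "?v \<notin> (\<Union>k\<in>Ctr. cone k)" using R(2,3) by blast+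
    then have "?v \<in> upper \<union> lower" using covers by blast
    then show ?thesis using f_inversion[OF w(1)] by blast
  qed
  then show ?thesis using R(1) by (intro exI[of _ "1 / R"]) auto
qed

definition infinity_radius :: real where "infinity_radius = (SOME r. 0 < r \<and> (\<forall>w. w \<noteq> 0 \<and> norm w < r \<longrightarrow> (\<exists>v\<in>upper \<union> lower. f w = e v)))"

lemma infinity_radius: "0 < infinity_radius" "w \<noteq> 0 \<Longrightarrow> w \<in> ball 0 infinity_radius \<Longrightarrow> \<exists>v\<in>upper \<union> lower. f w = e v"
proof -
  note r = someI_ex[OF near_infinity, folded infinity_radius_def]
  show "0 < infinity_radius" using r by (rule conjunct1)
  show "\<exists>v\<in>upper \<union> lower. f w = e v" if "w \<noteq> 0" "w \<in> ball 0 infinity_radius"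
    using conjunct2[OF r, rule_format, of w] that by simp
qed

lemma ninf_not_e: "ninf \<noteq> e w" using chart_range[OF e, of w] by blast

lemma f_ball: "f ` ball 0 infinity_radius \<inter> L = {}"
proof (rule ccontr)
  assume "f ` ball 0 infinity_radius \<inter> L \<noteq> {}"
  then obtain w where w: "w \<in> ball 0 infinity_radius" "f w \<in> L" by blast
  show False
  proof (cases "w = 0")
    case True
    then have "ninf \<in> e ` LK" using w(2) f_0 e_LK by simp
    then show False using ninf_not_e by blast
  next
    case False
    then obtain v where "v \<in> upper \<union> lower" "f w = e v" using infinity_radius(2) w(1) by blast
    then show False using w(2) e_upper e_lower by blast
  qed
qed

definition infinity_sheet :: "bool \<Rightarrow> R3 \<Rightarrow> 'a" where "infinity_sheet = (SOME g. sheets f (ball 0 infinity_radius) g)"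

lemma infinity_sheet: "sheets f (ball 0 infinity_radius) infinity_sheet"
proof -
  have "0 \<in> ball 0 infinity_radius" using infinity_radius(1) by simp
  then obtain h where "contraction (ball 0 infinity_radius) 0 h"
    using convex_contraction[OF open_ball convex_ball] by blast
  from someI_ex[OF sheets_exist[OF f this f_ball]] show ?thesis unfolding infinity_sheet_def .
qed

lemma piece_infinity_sheet: "piece (infinity_sheet b ` ball 0 infinity_radius)"
  by (rule piece_sheet[OF f infinity_sheet f_ball open_ball convex_imp_simply_connected[OF convex_ball]])

lemma piece_chart:
  assumes "openin (top_of_set S3) U" "homeomorphism (X \<inter> p -` U) (UNIV :: R3 set) g \<gamma>"
  shows "piece (X \<inter> p -` U)"
  unfolding piece_def
proof (intro conjI allI ballI)
  have im: "\<gamma> ` UNIV = X \<inter> p -` U" using homeomorphism_image2[OF assms(2)] .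
  have c: "continuous_on UNIV \<gamma>" "continuous_on (X \<inter> p -` U) g" using assms(2) by (auto simp: homeomorphism_def)
  show "openin (top_of_set X) (X \<inter> p -` U)" by (rule openin_preimage[OF assms(1)])
  show "path_connected (X \<inter> p -` U)"
    using path_connected_continuous_image[OF c(1) convex_imp_path_connected[OF convex_UNIV]] unfolding im .
  show "homotopic_paths X d d'" if "d \<in> paths_between (X \<inter> p -` U) x y" "d' \<in> paths_between (X \<inter> p -` U) x y" for x y d d'
  proof (rule section_paths_homotopic[of UNIV \<gamma> X g d x y d', unfolded im])
    show "simply_connected (UNIV :: R3 set)" by (rule convex_imp_simply_connected[OF convex_UNIV])
    show "g (\<gamma> s) = s" for s using homeomorphism_apply2[OF assms(2)] by blast
  qed (use c that in auto)
qed

text \<open>The unbranched part of the cover is the union of the four sheets, of the lifts of the axes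
  of the cones, and of the points over infinity.\<close>

definition sheet_part :: "'a set" where "sheet_part = (\<Union>i. upper_sheet i ` upper \<union> lower_sheet i ` lower)"
definition unbranched_part :: "'a set" where "unbranched_part = X \<inter> p -` (S3 - L)"

lemma sheet_part_iff: "x \<in> sheet_part \<longleftrightarrow> x \<in> X \<and> (\<exists>w\<in>upper \<union> lower. p x = e w)"
proof
  assume "x \<in> sheet_part"
  then consider i w where "w \<in> upper" "x = upper_sheet i w" | i w where "w \<in> lower" "x = lower_sheet i w"
    unfolding sheet_part_def by blast
  then show "x \<in> X \<and> (\<exists>w\<in>upper \<union> lower. p x = e w)"
  proof cases
    case 1
    then show ?thesis using upper_sheet_X[OF 1(1)] upper_sheet_p[OF 1(1)] by blast
  next
    case 2
    then show ?thesis using lower_sheet_X[OF 2(1)] lower_sheet_p[OF 2(1)] by blast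
  qed
next
  assume "x \<in> X \<and> (\<exists>w\<in>upper \<union> lower. p x = e w)"
  then obtain w where x: "x \<in> X" and "w \<in> upper \<or> w \<in> lower" and w: "p x = e w" by blast
  from this(2) show "x \<in> sheet_part"
  proof
    assume u: "w \<in> upper"
    obtain i where "x = upper_sheet i w" using upper_sheet_all[OF u x w] by blast
    then show "x \<in> sheet_part" using u unfolding sheet_part_def by blast
  next
    assume u: "w \<in> lower"
    obtain i where "x = lower_sheet i w" using lower_sheet_all[OF u x w] by blast
    then show "x \<in> sheet_part" using u unfolding sheet_part_def by blast
  qed
qed

lemma sheet_part_unbranched: "sheet_part \<subseteq> unbranched_part"
proof
  fix x assume "x \<in> sheet_part"
  then consider i w where "w \<in> upper" "x = upper_sheet i w" | i w where "w \<in> lower" "x = lower_sheet i w"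
    unfolding sheet_part_def by blast
  then show "x \<in> unbranched_part"
    by cases (simp_all only: unbranched_part_def upper_sheet_unbranched lower_sheet_unbranched)
qed

lemma cone_in_upper_lower:
  assumes "k \<in> Ctr" "w \<in> cone k"
  shows "w \<in> upper \<union> lower \<longleftrightarrow> w \<notin> {k} \<times> UNIV"
proof -
  obtain x z where w: "w = (x, z)" by (cases w)
  have "0 < z" "norm (x - k) + z < 1" using assms(2) unfolding w cone_def by auto
  moreover have "z < 1" using calculation(2) norm_ge_zero[of "x - k"] by linarith
  ultimately have z: "0 < z" "norm (x - k) + z < 1" "z < 1" by auto
  show ?thesis
  proof (cases "x = k")
    case True
    have "(k, 0) \<in> LK" "(k, 1) \<in> LK" using column_Ctr[OF assms(1)] by auto
    then have "w \<notin> upper" "w \<notin> lower" unfolding w True upper_def lower_def using z by force+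
    then show ?thesis using w True by simp
  next
    case False
    have "x \<notin> Ctr"
    proof
      assume "x \<in> Ctr"
      then have "2 \<le> dist x k" using far_Ctr[OF _ assms(1)] False by blast
      then show False using z by (simp add: dist_norm)
    qed
    then have "w \<in> upper \<or> w \<in> lower" unfolding w by (rule upper_or_lower) (use cone_LK[OF assms(1) z(1,2)] in blast)
    then show ?thesis using w False by simp
  qed
qed

lemma cone_sheet_Int_sheet_part: "k \<in> Ctr \<Longrightarrow> cone_sheet k b ` cone k \<inter> sheet_part = cone_sheet k b ` (cone k - {k} \<times> UNIV)"
proof -
  assume k: "k \<in> Ctr"
  note X = sheets_X[OF e cone_sheet[OF k] e_cone[OF k]] and p = sheets_p[OF e cone_sheet[OF k] e_cone[OF k]]
  have *: "cone_sheet k b w \<in> sheet_part \<longleftrightarrow> w \<notin> {k} \<times> UNIV" if "w \<in> cone k" for w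
    unfolding sheet_part_iff p[OF that] e_inj cone_in_upper_lower[OF k that, symmetric] by (simp add: X[OF that])
  then show ?thesis by (intro equalityI subsetI) (elim IntE imageE, use * in simp, use * in fastforce)
qed

lemma infinity_sheet_Int_sheet_part: "infinity_sheet b ` ball 0 infinity_radius \<inter> sheet_part = infinity_sheet b ` (ball 0 infinity_radius - {0})"
proof -
  note X = sheets_X[OF f infinity_sheet f_ball] and p = sheets_p[OF f infinity_sheet f_ball]
  have *: "infinity_sheet b w \<in> sheet_part \<longleftrightarrow> w \<noteq> 0" if "w \<in> ball 0 infinity_radius" for w
  proof (cases "w = 0")
    case True
    then show ?thesis unfolding sheet_part_iff p[OF that] f_0 using ninf_not_e f_0 by auto
  next
    case False
    then show ?thesis unfolding sheet_part_iff p[OF that] using X[OF that] infinity_radius(2)[OF False that] by blast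
  qed
  then show ?thesis by blast
qed

lemma unbranched_part_cases:
  assumes "x \<in> unbranched_part" "x \<notin> sheet_part"
  shows "(\<exists>k\<in>Ctr. \<exists>b. x \<in> cone_sheet k b ` cone k) \<or> (\<exists>b. x \<in> infinity_sheet b ` ball 0 infinity_radius)"
proof -
  have x: "x \<in> X" "p x \<in> S3" "p x \<notin> L" using assms(1) by (auto simp: unbranched_part_def)
  show ?thesis
  proof (cases "p x = ninf")
    case True
    then have "\<exists>b. x = infinity_sheet b 0" using sheets_all[OF f infinity_sheet f_ball _ x(1), of 0] infinity_radius(1) f_0 by simp
    then show ?thesis using infinity_radius(1) by force
  next
    case False
    then obtain w where w: "p x = e w" using S3_cases[OF x(2)] by blast
    then have "w \<in> - LK" "w \<notin> upper \<union> lower" using x assms(2) e_in_L sheet_part_iff by auto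
    then obtain k where k: "k \<in> Ctr" "w \<in> cone k" using covers by blast
    then show ?thesis using sheets_all[OF e cone_sheet[OF k(1)] e_cone[OF k(1)] k(2) x(1) w] by blast
  qed
qed

lemma chart_unbranched:
  assumes "homeomorphism U (UNIV :: R3 set) \<phi> \<phi>'" "\<phi> ` (U \<inter> L) = {0} \<times> UNIV" "U \<subseteq> S3"
    and g: "homeomorphism (X \<inter> p -` U) (UNIV :: R3 set) g \<gamma>"
    and sq: "\<forall>x\<in>X \<inter> p -` U. \<phi> (p x) = ((fst (g x))\<^sup>2, snd (g x))"
  shows "(X \<inter> p -` U) \<inter> unbranched_part = \<gamma> ` {w. fst w \<noteq> 0}"
proof -
  have im: "\<gamma> ` UNIV = X \<inter> p -` U" using homeomorphism_image2[OF g] .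
  have "\<gamma> w \<in> unbranched_part \<longleftrightarrow> fst w \<noteq> 0" for w
  proof -
    have \<gamma>: "\<gamma> w \<in> X" "p (\<gamma> w) \<in> U" using im by auto
    have "\<phi> (p (\<gamma> w)) = ((fst w)\<^sup>2, snd w)" using sq \<gamma> homeomorphism_apply2[OF g, of w] by auto
    moreover have "p (\<gamma> w) \<in> L \<longleftrightarrow> \<phi> (p (\<gamma> w)) \<in> {0} \<times> UNIV"
    proof
      assume "\<phi> (p (\<gamma> w)) \<in> {0} \<times> UNIV"
      then obtain y where "y \<in> U" "y \<in> L" "\<phi> (p (\<gamma> w)) = \<phi> y" unfolding assms(2)[symmetric] by blast
      then show "p (\<gamma> w) \<in> L" using homeomorphism_apply1[OF assms(1)] \<gamma>(2) by metis
    qed (use assms(2) \<gamma> in blast)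
    ultimately show ?thesis using \<gamma> assms(3) by (auto simp: unbranched_part_def)
  qed
  then show ?thesis unfolding im[symmetric] by auto
qed

lemma path_component_piece:
  assumes "piece V" "x \<in> V" "y \<in> V" shows "path_component X x y"
proof -
  have "V \<subseteq> X" "path_connected V" using assms(1) openin_imp_subset unfolding piece_def by blast+
  then show ?thesis using assms(2,3) path_component_of_subset path_connected_component by metis
qed

text \<open>Points over the link are joined to the unbranched part in a chart, and the four sheets are
  joined by passing over regions of both colours, which exist because the projection is not
  just a set of crossings.\<close>

lemma path_connected_X: "path_connected X"
proof -
  let ?r = "path_component X"
  have tr: "?r x z" if "?r x y" "?r y z" for x y z using path_component_trans[OF that] .
  have sy: "?r x y" if "?r y x" for x y using path_component_sym[OF that] .
  obtain q where q: "q \<in> proj" "q \<notin> Ctr" using proj_off_Ctr by blast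
  obtain x y where xy: "x \<notin> proj" "y \<notin> proj" "colour x \<noteq> colour y" using both_colours[OF q, of 1] by auto
  have up: "(x, 0) \<in> upper" "(y, 0) \<in> upper" and lo: "(x, 0) \<in> lower" "(y, 0) \<in> lower" using off_proj xy by auto
  have pp: "?r (upper_sheet i v) (upper_sheet i w)" if "v \<in> upper" "w \<in> upper" for i v w
    by (rule path_component_piece[OF piece_upper_sheet[of i]]) (use that in auto)
  have mm: "?r (lower_sheet i v) (lower_sheet i w)" if "v \<in> lower" "w \<in> lower" for i v w
    by (rule path_component_piece[OF piece_lower_sheet[of i]]) (use that in auto)
  let ?o = "upper_sheet True (x, 0)"
  have ag: "upper_sheet i (x, 0) = lower_sheet (i = colour x) (x, 0)" "upper_sheet i (y, 0) = lower_sheet (i = colour y) (y, 0)" for i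
    using sheets_agree xy by auto
  have xg: "?r ?o (lower_sheet (True = colour x) (x, 0))" using pp[OF up(1) up(1), of True] ag(1)[of True] by simp
  have yg: "?r ?o (lower_sheet (True = colour y) (y, 0))" using pp[OF up, of True] ag(2)[of True] by simp
  have om: "?r ?o (lower_sheet j w)" if w: "w \<in> lower" for j w
  proof (cases "j = (True = colour x)")
    case True
    show ?thesis unfolding True by (rule tr[OF xg mm[OF lo(1) w]])
  next
    case False
    then have j: "j = (True = colour y)" using xy(3) by auto
    show ?thesis unfolding j by (rule tr[OF yg mm[OF lo(2) w]])
  qed
  have op: "?r ?o (upper_sheet i w)" if w: "w \<in> upper" for i w
  proof -
    have "?r ?o (upper_sheet i (x, 0))" using om[OF lo(1), of "i = colour x"] ag(1)[of i] by simp
    from tr[OF this pp[OF up(1) w]] show ?thesis .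
  qed
  have o0: "?r ?o \<xi>" if "\<xi> \<in> sheet_part" for \<xi> using that om op unfolding sheet_part_def by auto
  have ext: "?r ?o \<xi>" if V: "piece V" "\<xi> \<in> V" "V \<inter> Z \<noteq> {}" and Z: "\<And>\<zeta>. \<zeta> \<in> Z \<Longrightarrow> ?r ?o \<zeta>" for \<xi> V Z
  proof -
    obtain \<zeta> where z: "\<zeta> \<in> V" "\<zeta> \<in> Z" using V(3) by blast
    from tr[OF Z[OF z(2)] path_component_piece[OF V(1) z(1) V(2)]] show ?thesis .
  qed
  have o1: "?r ?o \<xi>" if x1: "\<xi> \<in> unbranched_part" for \<xi>
  proof (cases "\<xi> \<in> sheet_part")
    case False
    from unbranched_part_cases[OF x1 this] show ?thesis
    proof (elim disjE bexE exE)
      fix k b assume k: "k \<in> Ctr" and b: "\<xi> \<in> cone_sheet k b ` cone k"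
      have "(k + 1/2, 1/4) \<in> cone k - {k} \<times> UNIV" by (simp add: cone_def)
      then have "cone_sheet k b ` cone k \<inter> sheet_part \<noteq> {}" unfolding cone_sheet_Int_sheet_part[OF k] by blast
      from ext[OF piece_cone_sheet[OF k] b this o0] show ?thesis .
    next
      fix b assume b: "\<xi> \<in> infinity_sheet b ` ball 0 infinity_radius"
      have "(of_real (infinity_radius / 2), 0) \<in> ball 0 infinity_radius - {0 :: R3}" using infinity_radius(1) by (simp add: zero_prod_def dist_Pair_Pair)
      then have "infinity_sheet b ` ball 0 infinity_radius \<inter> sheet_part \<noteq> {}" unfolding infinity_sheet_Int_sheet_part by blast
      from ext[OF piece_infinity_sheet b this o0] show ?thesis .
    qed
  qed (rule o0)
  have "?r ?o \<xi>" if x: "\<xi> \<in> X" for \<xi>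
  proof (cases "p \<xi> \<in> L")
    case True
    obtain U \<phi> \<phi>' g \<gamma> where U: "openin (top_of_set S3) U" "p \<xi> \<in> U"
      and \<phi>: "homeomorphism U (UNIV :: R3 set) \<phi> \<phi>'" "\<phi> ` (U \<inter> L) = {0} \<times> UNIV"
      and g: "homeomorphism (X \<inter> p -` U) (UNIV :: R3 set) g \<gamma>"
      and sq: "\<forall>x\<in>X \<inter> p -` U. \<phi> (p x) = ((fst (g x))\<^sup>2, snd (g x))"
      using branch_chart[OF True] .
    have "U \<subseteq> S3" using openin_imp_subset[OF U(1)] .
    from chart_unbranched[OF \<phi> this g sq] have "(X \<inter> p -` U) \<inter> unbranched_part \<noteq> {}" by force
    moreover have "\<xi> \<in> X \<inter> p -` U" using x U(2) by simp
    ultimately show ?thesis using ext[OF piece_chart[OF U(1) g] _ _ o1] by blast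
  next
    case False
    then have "\<xi> \<in> unbranched_part" using x p_S3 by (auto simp: unbranched_part_def)
    then show ?thesis by (rule o1)
  qed
  then show ?thesis unfolding path_connected_component using tr[OF sy] by blast
qed

end

section \<open>Transitions between sheets and the relations at the crossings\<close>

lemma (in group) inv_cancel:
  assumes "g \<in> carrier G" "h \<in> carrier G"
  shows "inv g \<otimes> (g \<otimes> h) = h" "g \<otimes> (inv g \<otimes> h) = h"
  using assms by (simp_all flip: m_assoc)

locale based_link_cover =
  link_cover LK Ctr X p L e f e' f' ninf zinf + based_space X a
  for LK :: "R3 set" and Ctr :: "complex set" and X :: "'a::topological_space set" and p :: "'a \<Rightarrow> R4" and L :: "R4 set"
    and e f e' f' ninf zinf and a
begin

lemma piece_sub: "piece V \<Longrightarrow> V \<subseteq> X"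
  unfolding piece_def using openin_imp_subset by blast

lemma piece_frame: "piece V \<Longrightarrow> \<exists>\<phi>. frame V \<phi>"
proof -
  assume V: "piece V"
  obtain \<phi> where "frame V \<phi>"
    by (rule frame_exists[OF piece_sub[OF V] path_connected_X]) (use V in \<open>auto simp: piece_def\<close>)
  then show ?thesis by (intro exI)
qed

definition upper_frame :: "bool \<Rightarrow> 'a \<Rightarrow> real \<Rightarrow> 'a" where "upper_frame i = (SOME \<phi>. frame (upper_sheet i ` upper) \<phi>)"
definition lower_frame :: "bool \<Rightarrow> 'a \<Rightarrow> real \<Rightarrow> 'a" where "lower_frame i = (SOME \<phi>. frame (lower_sheet i ` lower) \<phi>)"

lemma upper_frame: "frame (upper_sheet i ` upper) (upper_frame i)"
  unfolding upper_frame_def by (rule someI_ex[OF piece_frame[OF piece_upper_sheet]])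

lemma lower_frame: "frame (lower_sheet i ` lower) (lower_frame i)"
  unfolding lower_frame_def by (rule someI_ex[OF piece_frame[OF piece_lower_sheet]])

lemmas upper_sheet_sub = piece_sub[OF piece_upper_sheet] and lower_sheet_sub = piece_sub[OF piece_lower_sheet]

text \<open>The element of \<open>\<pi>\<^sub>1\<close> belonging to upper sheet \<open>i\<close> and the region of \<open>x\<close>: the quotient of the
  frame of the upper sheet by that of the lower sheet which it meets there.\<close>

definition transition :: "bool \<Rightarrow> complex \<Rightarrow> (real \<Rightarrow> 'a) set" where
  "transition i x = quot (upper_frame i (upper_sheet i (x, 0))) (lower_frame (i = colour x) (upper_sheet i (x, 0)))"

lemma sheets_path_connected_quot:
  assumes T: "path_connected T" "T \<subseteq> upper \<inter> lower" and v: "v \<in> T" "upper_sheet i v = lower_sheet j v" and w: "w \<in> T"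
  shows "quot (upper_frame i (upper_sheet i v)) (lower_frame j (upper_sheet i v)) = quot (upper_frame i (upper_sheet i w)) (lower_frame j (upper_sheet i w))"
proof (rule quot_along[OF upper_frame upper_sheet_sub lower_frame lower_sheet_sub T(1) _ _ v(1) w])
  show "continuous_on T (upper_sheet i)" using continuous_on_subset[OF upper_sheet_cont] T(2) by blast
  show "upper_sheet i ` T \<subseteq> upper_sheet i ` upper \<inter> lower_sheet j ` lower"
  proof
    fix x assume "x \<in> upper_sheet i ` T"
    then obtain t where t: "t \<in> T" "x = upper_sheet i t" by blast
    have "upper_sheet i t = lower_sheet j t" by (rule sheets_agree_connected[OF path_connected_imp_connected[OF T(1)] T(2) v t(1)])
    then have "x = lower_sheet j t" using t(2) by simp
    moreover have "t \<in> upper" "t \<in> lower" using t(1) T(2) by auto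
    ultimately show "x \<in> upper_sheet i ` upper \<inter> lower_sheet j ` lower" using t(2) imageI[of t upper "upper_sheet i"] imageI[of t lower "lower_sheet j"] by simp
  qed
qed

lemma transition_eq:
  assumes x: "x \<notin> proj"
  shows "transition i x = quot (upper_frame i (upper_sheet i (x, z))) (lower_frame (i = colour x) (upper_sheet i (x, z)))"
  unfolding transition_def
proof (rule sheets_path_connected_quot)
  show "path_connected ({x} \<times> (UNIV :: real set))" by (intro convex_imp_path_connected convex_Times) auto
  show "{x} \<times> UNIV \<subseteq> upper \<inter> lower" using off_proj[OF x] by auto
  show "upper_sheet i (x, 0) = lower_sheet (i = colour x) (x, 0)" using sheets_agree[OF x] by simp
qed auto

lemma transition_connected:
  assumes T: "path_connected T" "T \<inter> proj = {}" and x: "x \<in> T" "y \<in> T"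
  shows "transition i x = transition i y"
proof -
  have "connected T" by (rule path_connected_imp_connected[OF T(1)])
  then have c: "colour x = colour y" using colour_connected T(2) x by blast
  show ?thesis unfolding transition_def c
  proof (rule sheets_path_connected_quot)
    show "path_connected (T \<times> {0 :: real})" by (rule path_connected_Times[OF T(1)]) simp
    show "T \<times> {0} \<subseteq> upper \<inter> lower" using off_proj T(2) by blast
    have "x \<notin> proj" using T(2) x by blast
    then show "upper_sheet i (x, 0) = lower_sheet (i = colour y) (x, 0)" using sheets_agree c by simp
  qed (use x in auto)
qed

lemma upper_sheet_path: "w \<in> upper \<Longrightarrow> upper_frame i (upper_sheet i w) \<in> P a (upper_sheet i w)" by (rule frame_path[OF upper_frame]) blast
lemma lower_sheet_path: "w \<in> lower \<Longrightarrow> lower_frame i (lower_sheet i w) \<in> P a (lower_sheet i w)" by (rule frame_path[OF lower_frame]) blast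

lemma transition_carrier [simp]:
  assumes x: "x \<notin> proj" shows "transition i x \<in> carrier \<pi>"
proof -
  have "upper_sheet i (x, 0) = lower_sheet (i = colour x) (x, 0)" using sheets_agree[OF x] by simp
  then have "lower_frame (i = colour x) (upper_sheet i (x, 0)) \<in> P a (upper_sheet i (x, 0))"
    using lower_sheet_path[OF off_proj(2)[OF x], of "i = colour x" 0] by simp
  then show ?thesis unfolding transition_def by (rule quot_carrier[OF upper_sheet_path[OF off_proj(1)[OF x]]])
qed

text \<open>Near a point of the projection other than a crossing, the two sheets above and the two
  sheets below all meet one simply connected set, the part of the cover over a neighbourhood
  of the link. Here \<open>A i\<close> and \<open>E j\<close> compare its frame with those of the sheets.\<close>

lemma local_form:
  assumes q: "q \<in> proj" "q \<notin> Ctr"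
  shows "\<exists>s>0. \<exists>A E. (\<forall>i. A i \<in> carrier \<pi> \<and> E i \<in> carrier \<pi>) \<and>
    (\<forall>x\<in>ball q s - proj. \<forall>i. transition i x = A i \<cdot> inv\<pi> (E (i = colour x)))"
proof -
  obtain z0 where z0: "(q, z0) \<in> LK" using q(1) by (auto simp: proj_def)
  have yL: "e (q, z0) \<in> L" using z0 e_in_L by blast
  obtain U \<phi> \<phi>' g \<gamma> where U: "openin (top_of_set S3) U" "e (q, z0) \<in> U"
    and g: "homeomorphism (X \<inter> p -` U) (UNIV :: R3 set) g \<gamma>"
    using branch_chart[OF yL] by metis
  let ?V = "X \<inter> p -` U"
  have V: "piece ?V" by (rule piece_chart[OF U(1) g])
  obtain \<psi> where \<psi>: "frame ?V \<psi>" using piece_frame[OF V] by blast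
  have Vsub: "?V \<subseteq> X" by blast
  have "openin (top_of_set UNIV) (UNIV \<inter> e -` U)"
  proof (rule continuous_openin_preimage[OF _ _ U(1)])
    show "continuous_on UNIV e" using e by (simp add: homeomorphism_def)
    show "e \<in> UNIV \<rightarrow> S3" using e_S3 by blast
  qed
  then have "open (e -` U)" by simp
  then obtain \<delta> where \<delta>: "0 < \<delta>" "ball (q, z0) \<delta> \<subseteq> e -` U" using U(2) by (meson openE vimageI)
  define \<eta> where "\<eta> = \<delta> / 2"
  have \<eta>: "0 < \<eta>" "\<eta> < \<delta>" using \<delta>(1) by (auto simp: \<eta>_def)
  \<comment> \<open>the part of the link away from the point \<open>(q, z0)\<close> does not project near \<open>q\<close>\<close>
  let ?K = "LK \<inter> (UNIV \<times> (- {z0 - \<eta><..<z0 + \<eta>}))"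
  have "closed ((UNIV :: complex set) \<times> (- {z0 - \<eta><..<z0 + \<eta>}))"
    by (intro closed_Times closed_Compl) auto
  then have "compact ?K" by (rule compact_Int_closed[OF compact_LK])
  then have "closed (fst ` ?K)" by (intro compact_imp_closed compact_continuous_image continuous_intros)
  moreover have "q \<notin> fst ` ?K"
  proof
    assume "q \<in> fst ` ?K"
    then obtain z where z: "(q, z) \<in> LK" "z \<notin> {z0 - \<eta><..<z0 + \<eta>}" by auto
    then have "z = z0" using column[OF z(1) z0] q(2) by blast
    then show False using z(2) \<eta> by simp
  qed
  ultimately obtain s1 where s1: "0 < s1" "ball q s1 \<subseteq> - fst ` ?K"
    by (meson ComplI openE open_Compl)
  define s where "s = min s1 \<eta>"
  have s: "0 < s" "s \<le> s1" "s \<le> \<eta>" using s1 \<eta> by (auto simp: s_def)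
  have inU: "e (x, z) \<in> U" if "x \<in> ball q s" "\<bar>z - z0\<bar> \<le> \<eta>" for x z
  proof -
    have "dist (q, z0) (x, z) \<le> dist q x + dist z0 z"
      unfolding dist_Pair_Pair by (rule sqrt_sum_squares_le_sum) auto
    also have "\<dots> < \<delta>" using that s by (simp add: dist_real_def \<eta>_def abs_minus_commute)
    finally show ?thesis using \<delta>(2) by auto
  qed
  have near: "\<bar>z - z0\<bar> < \<eta>" if "x \<in> ball q s" "(x, z) \<in> LK" for x z
  proof (rule ccontr)
    assume "\<not> \<bar>z - z0\<bar> < \<eta>"
    then have "(x, z) \<in> ?K" using that(2) by auto
    then have "x \<in> fst ` ?K" by force
    moreover have "x \<in> ball q s1" using that(1) s(2) by simp
    ultimately show False using s1(2) by blast
  qed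
  have up: "(x, z0 + \<eta>) \<in> upper" if "x \<in> ball q s" for x
    using near[OF that] unfolding upper_def by force
  have lo: "(x, z0 - \<eta>) \<in> lower" if "x \<in> ball q s" for x
    using near[OF that] unfolding lower_def by force
  have qs: "q \<in> ball q s" using s(1) by simp
  define A where "A i = quot (upper_frame i (upper_sheet i (q, z0 + \<eta>))) (\<psi> (upper_sheet i (q, z0 + \<eta>)))" for i
  define E where "E j = quot (lower_frame j (lower_sheet j (q, z0 - \<eta>))) (\<psi> (lower_sheet j (q, z0 - \<eta>)))" for j
  have gpV: "upper_sheet i (x, z) \<in> ?V" if "x \<in> ball q s" "\<bar>z - z0\<bar> \<le> \<eta>" "(x, z) \<in> upper" for i x z
    using upper_sheet_X[OF that(3)] upper_sheet_p[OF that(3)] inU[OF that(1,2)] by simp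
  have gmV: "lower_sheet i (x, z) \<in> ?V" if "x \<in> ball q s" "\<bar>z - z0\<bar> \<le> \<eta>" "(x, z) \<in> lower" for i x z
    using lower_sheet_X[OF that(3)] lower_sheet_p[OF that(3)] inU[OF that(1,2)] by simp
  have \<psi>P: "\<psi> y \<in> P a y" if "y \<in> ?V" for y by (rule frame_path[OF \<psi> that])
  have Ac: "A i \<in> carrier \<pi>" for i unfolding A_def
    by (rule quot_carrier[OF upper_sheet_path[OF up[OF qs]] \<psi>P[OF gpV[OF qs _ up[OF qs]]]]) (use \<eta> in simp)
  have Ec: "E i \<in> carrier \<pi>" for i unfolding E_def
    by (rule quot_carrier[OF lower_sheet_path[OF lo[OF qs]] \<psi>P[OF gmV[OF qs _ lo[OF qs]]]]) (use \<eta> in simp)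
  have bp: "path_connected (ball q s \<times> {z})" for z :: real
    by (intro path_connected_Times convex_imp_path_connected convex_ball) auto
  have A: "quot (upper_frame i (upper_sheet i (x, z0 + \<eta>))) (\<psi> (upper_sheet i (x, z0 + \<eta>))) = A i" if x: "x \<in> ball q s" for i x
    unfolding A_def
  proof (rule quot_along[OF upper_frame upper_sheet_sub \<psi> Vsub bp])
    have sub: "ball q s \<times> {z0 + \<eta>} \<subseteq> upper" using up by blast
    show "continuous_on (ball q s \<times> {z0 + \<eta>}) (upper_sheet i)" by (rule continuous_on_subset[OF upper_sheet_cont sub])
    show "upper_sheet i ` (ball q s \<times> {z0 + \<eta>}) \<subseteq> upper_sheet i ` upper \<inter> ?V"
    proof (rule Int_greatest[OF image_mono[OF sub]])
      show "upper_sheet i ` (ball q s \<times> {z0 + \<eta>}) \<subseteq> ?V" 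
      proof
        fix y assume "y \<in> upper_sheet i ` (ball q s \<times> {z0 + \<eta>})"
        then obtain x where "x \<in> ball q s" "y = upper_sheet i (x, z0 + \<eta>)" by blast
        then show "y \<in> ?V" using gpV[OF _ _ up] \<eta> by simp
      qed
    qed
  qed (use x qs in auto)
  have E: "quot (lower_frame i (lower_sheet i (x, z0 - \<eta>))) (\<psi> (lower_sheet i (x, z0 - \<eta>))) = E i" if x: "x \<in> ball q s" for i x
    unfolding E_def
  proof (rule quot_along[OF lower_frame lower_sheet_sub \<psi> Vsub bp])
    have sub: "ball q s \<times> {z0 - \<eta>} \<subseteq> lower" using lo by blast
    show "continuous_on (ball q s \<times> {z0 - \<eta>}) (lower_sheet i)" by (rule continuous_on_subset[OF lower_sheet_cont sub])
    show "lower_sheet i ` (ball q s \<times> {z0 - \<eta>}) \<subseteq> lower_sheet i ` lower \<inter> ?V"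
    proof (rule Int_greatest[OF image_mono[OF sub]])
      show "lower_sheet i ` (ball q s \<times> {z0 - \<eta>}) \<subseteq> ?V"
      proof
        fix y assume "y \<in> lower_sheet i ` (ball q s \<times> {z0 - \<eta>})"
        then obtain x where "x \<in> ball q s" "y = lower_sheet i (x, z0 - \<eta>)" by blast
        then show "y \<in> ?V" using gmV[OF _ _ lo] \<eta> by simp
      qed
    qed
  qed (use x qs in auto)
  have "transition i x = A i \<cdot> inv\<pi> (E (i = colour x))" if x: "x \<in> ball q s" "x \<notin> proj" for i x
  proof -
    let ?j = "i = colour x" and ?w = "(x, z0 + \<eta>)" and ?w' = "(x, z0 - \<eta>)"
    have ag: "upper_sheet i (x, z) = lower_sheet ?j (x, z)" for z using sheets_agree[OF x(2)] by simp
    have pp: "upper_frame i (upper_sheet i ?w) \<in> P a (upper_sheet i ?w)" by (rule upper_sheet_path[OF up[OF x(1)]])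
    have mm: "lower_frame ?j (upper_sheet i ?w) \<in> P a (upper_sheet i ?w)" unfolding ag by (rule lower_sheet_path[OF off_proj(2)[OF x(2)]])
    have ps: "\<psi> (upper_sheet i ?w) \<in> P a (upper_sheet i ?w)" by (rule \<psi>P[OF gpV[OF x(1) _ up[OF x(1)]]]) (use \<eta> in simp)
    have v: "quot (lower_frame ?j (lower_sheet ?j ?w)) (\<psi> (lower_sheet ?j ?w)) = quot (lower_frame ?j (lower_sheet ?j ?w')) (\<psi> (lower_sheet ?j ?w'))"
    proof (rule quot_along[OF lower_frame lower_sheet_sub \<psi> Vsub, where T = "{x} \<times> {z0 - \<eta>..z0 + \<eta>}" and h = "lower_sheet ?j"])
      show "path_connected ({x} \<times> {z0 - \<eta>..z0 + \<eta>})" by (intro convex_imp_path_connected convex_Times) auto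
      have sub: "{x} \<times> {z0 - \<eta>..z0 + \<eta>} \<subseteq> lower" using off_proj[OF x(2)] by blast
      show "continuous_on ({x} \<times> {z0 - \<eta>..z0 + \<eta>}) (lower_sheet ?j)" by (rule continuous_on_subset[OF lower_sheet_cont sub])
      show "lower_sheet ?j ` ({x} \<times> {z0 - \<eta>..z0 + \<eta>}) \<subseteq> lower_sheet ?j ` lower \<inter> ?V"
      proof (rule Int_greatest[OF image_mono[OF sub]])
        show "lower_sheet ?j ` ({x} \<times> {z0 - \<eta>..z0 + \<eta>}) \<subseteq> ?V"
        proof
          fix y assume "y \<in> lower_sheet ?j ` ({x} \<times> {z0 - \<eta>..z0 + \<eta>})"
          then obtain z where "z \<in> {z0 - \<eta>..z0 + \<eta>}" "y = lower_sheet ?j (x, z)" by blast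
          then show "y \<in> ?V" using gmV[OF x(1) _ off_proj(2)[OF x(2)], of z] by (simp add: abs_le_iff)
        qed
      qed
    qed (use \<eta> in auto)
    have "transition i x = quot (upper_frame i (upper_sheet i ?w)) (\<psi> (upper_sheet i ?w)) \<cdot> quot (\<psi> (upper_sheet i ?w)) (lower_frame ?j (upper_sheet i ?w))"
      unfolding transition_eq[OF x(2), of i "z0 + \<eta>"] quot_mult[OF pp ps mm] ..
    also have "quot (\<psi> (upper_sheet i ?w)) (lower_frame ?j (upper_sheet i ?w)) = inv\<pi> quot (lower_frame ?j (upper_sheet i ?w)) (\<psi> (upper_sheet i ?w))"
      by (rule quot_inv[OF mm ps, symmetric])
    also have "quot (lower_frame ?j (upper_sheet i ?w)) (\<psi> (upper_sheet i ?w)) = E ?j" unfolding ag v by (rule E[OF x(1)])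
    finally show ?thesis unfolding A[OF x(1)] .
  qed
  then show ?thesis using s(1) Ac Ec by (intro exI[of _ s] conjI exI[of _ A] exI[of _ E]) auto
qed

text \<open>Of the elements \<open>A i\<close> and \<open>E j\<close> in the local form the two colours use the same ones, in
  different pairs, so that they cancel.\<close>

lemma adjacent:
  assumes q: "q \<in> proj" "q \<notin> Ctr"
  shows "\<exists>s>0. \<forall>x\<in>ball q s - proj. \<forall>y\<in>ball q s - proj. colour x \<noteq> colour y \<longrightarrow>
    (\<forall>i. transition i x \<cdot> inv\<pi> transition (\<not> i) y \<cdot> transition (\<not> i) x \<cdot> inv\<pi> transition i y = \<one>\<^bsub>\<pi>\<^esub>)"
proof -
  obtain s A E where s: "s > 0" and AE: "\<And>i. A i \<in> carrier \<pi>" "\<And>i. E i \<in> carrier \<pi>"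
    and transition: "\<And>x i. x \<in> ball q s - proj \<Longrightarrow> transition i x = A i \<cdot> inv\<pi> (E (i = colour x))"
    using local_form[OF q] by metis
  have alg: "(g \<cdot> inv\<pi> h) \<cdot> inv\<pi> (g' \<cdot> inv\<pi> h) \<cdot> (g' \<cdot> inv\<pi> h') \<cdot> inv\<pi> (g \<cdot> inv\<pi> h') = \<one>\<^bsub>\<pi>\<^esub>"
    if "g \<in> carrier \<pi>" "h \<in> carrier \<pi>" "g' \<in> carrier \<pi>" "h' \<in> carrier \<pi>" for g h g' h'
    using that by (simp add: inv_mult_group m_assoc inv_cancel)
  show ?thesis
  proof (intro exI[of _ s] conjI s ballI impI allI)
    fix x y i assume x: "x \<in> ball q s - proj" and y: "y \<in> ball q s - proj" and c: "colour x \<noteq> colour y"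
    have eq: "((\<not> i) = colour y) = (i = colour x)" "((\<not> i) = colour x) = (i = colour y)" using c by auto
    show "transition i x \<cdot> inv\<pi> transition (\<not> i) y \<cdot> transition (\<not> i) x \<cdot> inv\<pi> transition i y = \<one>\<^bsub>\<pi>\<^esub>"
      unfolding transition[OF x] transition[OF y] eq by (rule alg[OF AE(1) AE(2) AE(1) AE(2)])
  qed
qed

text \<open>In the coordinates \<open>k + Complex s t * v\<close> the over-strand runs along the first axis and the
  under-strand along the second one.\<close>

definition crossing_at :: "complex \<Rightarrow> complex \<Rightarrow> bool" where
  "crossing_at k v \<longleftrightarrow> k \<in> Ctr \<and> norm v = 1 \<and> (\<forall>s t z. norm (Complex s t) < 1 \<longrightarrow>
     ((k + Complex s t * v, z) \<in> LK \<longleftrightarrow> s = 0 \<and> z = 0 \<or> t = 0 \<and> z = 1 - \<bar>s\<bar>))"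

lemma crossing_proj:
  assumes "crossing_at k v" "norm (Complex s t) < 1"
  shows "k + Complex s t * v \<in> proj \<longleftrightarrow> s = 0 \<or> t = 0"
proof -
  have "k + Complex s t * v \<in> proj \<longleftrightarrow> (\<exists>z. (k + Complex s t * v, z) \<in> LK)" unfolding proj_def by force
  also have "\<dots> \<longleftrightarrow> (\<exists>z. s = 0 \<and> z = 0 \<or> t = 0 \<and> z = 1 - \<bar>s\<bar>)"
    using assms unfolding crossing_at_def by simp
  finally show ?thesis by auto
qed

definition corner :: "complex \<Rightarrow> complex \<Rightarrow> real \<Rightarrow> real \<Rightarrow> complex" where
  "corner k v s t = k + Complex (s / 2) (t / 2) * v"

lemma half_corner: "\<bar>s\<bar> \<le> 1 \<Longrightarrow> \<bar>t\<bar> \<le> 1 \<Longrightarrow> norm (Complex (s / 2) (t / 2)) < 3/4"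
proof -
  assume "\<bar>s\<bar> \<le> 1" "\<bar>t\<bar> \<le> 1"
  then have "s\<^sup>2 \<le> 1" "t\<^sup>2 \<le> 1" by (simp_all add: abs_square_le_1)
  then have "(s / 2)\<^sup>2 + (t / 2)\<^sup>2 \<le> 1 / 2" by (simp add: power_divide)
  also have "\<dots> < (3/4)\<^sup>2" by (simp add: power2_eq_square)
  finally have "sqrt ((s / 2)\<^sup>2 + (t / 2)\<^sup>2) < 3/4" by (intro real_less_lsqrt) auto
  then show ?thesis by (simp add: complex_norm)
qed

lemma corner_off_proj:
  assumes "crossing_at k v" "\<bar>s\<bar> \<le> 1" "\<bar>t\<bar> \<le> 1" "s \<noteq> 0" "t \<noteq> 0"
  shows "corner k v s t \<notin> proj"
  using crossing_proj[OF assms(1), of "s / 2" "t / 2"] half_corner[OF assms(2,3)] assms(4,5) by (simp add: corner_def)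

lemma quadrant_path_connected:
  "path_connected ((\<lambda>z. k + z * v) ` {z. 0 < \<sigma> * Re z \<and> 0 < \<tau> * Im z \<and> norm z < 1})"
proof (intro path_connected_continuous_image convex_imp_path_connected continuous_intros)
  have "{z. 0 < \<sigma> * Re z \<and> 0 < \<tau> * Im z \<and> norm z < 1} =
      {z. inner (of_real \<sigma>) z > 0} \<inter> {z. inner (of_real \<tau> * \<i>) z > 0} \<inter> ball 0 1"
    by (auto simp: inner_complex_def)
  also have "convex \<dots>" by (intro convex_Int convex_halfspace_gt convex_ball)
  finally show "convex {z. 0 < \<sigma> * Re z \<and> 0 < \<tau> * Im z \<and> norm z < 1}" .
qed

lemma quadrant:
  assumes c: "crossing_at k v" and st: "s \<noteq> 0" "t \<noteq> 0" "norm (Complex s t) < 1"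
  shows "colour (k + Complex s t * v) = colour (corner k v (sgn s) (sgn t))"
    "transition i (k + Complex s t * v) = transition i (corner k v (sgn s) (sgn t))"
proof -
  let ?T = "(\<lambda>z. k + z * v) ` {z. 0 < sgn s * Re z \<and> 0 < sgn t * Im z \<and> norm z < 1}"
  have pc: "path_connected ?T" by (rule quadrant_path_connected)
  have d: "?T \<inter> proj = {}"
  proof (rule ccontr)
    assume "?T \<inter> proj \<noteq> {}"
    then obtain z where z: "0 < sgn s * Re z" "0 < sgn t * Im z" "norm z < 1" "k + z * v \<in> proj" by blast
    then show False using crossing_proj[OF c, of "Re z" "Im z"] by auto
  qed
  have pos: "0 < sgn s * s" "0 < sgn t * t" using st by (auto simp: sgn_if)
  have "Complex s t \<in> {z. 0 < sgn s * Re z \<and> 0 < sgn t * Im z \<and> norm z < 1}" using pos st(3) by simp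
  then have 1: "k + Complex s t * v \<in> ?T" by (rule imageI)
  have pos: "0 < sgn s * (sgn s / 2)" "0 < sgn t * (sgn t / 2)" using st by (auto simp: sgn_if)
  have "norm (Complex (sgn s / 2) (sgn t / 2)) < 1" using half_corner[of "sgn s" "sgn t"] st by (simp add: abs_sgn_eq)
  then have "Complex (sgn s / 2) (sgn t / 2) \<in> {z. 0 < sgn s * Re z \<and> 0 < sgn t * Im z \<and> norm z < 1}" using pos by simp
  then have 2: "corner k v (sgn s) (sgn t) \<in> ?T"
    unfolding corner_def by (rule imageI)
  show "colour (k + Complex s t * v) = colour (corner k v (sgn s) (sgn t))"
    by (rule colour_connected[OF path_connected_imp_connected[OF pc] d 1 2])
  show "transition i (k + Complex s t * v) = transition i (corner k v (sgn s) (sgn t))"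
    by (rule transition_connected[OF pc d 1 2])
qed

lemma crossing_ball:
  assumes "crossing_at k v" "x \<in> ball (k + w * v) r"
  shows "\<exists>s t. x = k + Complex s t * v \<and> norm (Complex s t - w) < r"
proof -
  have v: "norm v = 1" using assms(1) by (simp add: crossing_at_def)
  then have v0: "v \<noteq> 0" by auto
  let ?z = "(x - k) / v"
  have "norm (?z - w) = norm ((?z - w) * v)" by (simp add: norm_mult v)
  also have "(?z - w) * v = x - (k + w * v)" using v0 by (simp add: field_simps)
  finally have "norm (?z - w) < r" using assms(2) by (simp add: dist_norm norm_minus_commute)
  moreover have "x = k + ?z * v" using v0 by simp
  ultimately show ?thesis by (intro exI[of _ "Re ?z"] exI[of _ "Im ?z"]) simp
qed

lemma strand_point:
  assumes c: "crossing_at k v" and w: "norm (Complex c1 c2) < 1" "c1 = 0 \<or> c2 = 0" "Complex c1 c2 \<noteq> 0"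
  shows "k + Complex c1 c2 * v \<in> proj" "k + Complex c1 c2 * v \<notin> Ctr"
proof -
  show "k + Complex c1 c2 * v \<in> proj" using crossing_proj[OF c w(1)] w(2) by blast
  have k: "k \<in> Ctr" "norm v = 1" using c by (auto simp: crossing_at_def)
  show "k + Complex c1 c2 * v \<notin> Ctr"
  proof
    assume "k + Complex c1 c2 * v \<in> Ctr"
    then have "2 \<le> dist (k + Complex c1 c2 * v) k" by (rule far_Ctr[OF _ k(1)]) (use w(3) k(2) in auto)
    then show False using w(1) k(2) by (simp add: dist_norm norm_mult)
  qed
qed

text \<open>These two relations between points off the projection record what is known if they lie in
  one region, or in two regions that share a strand.\<close>

definition same_side :: "complex \<Rightarrow> complex \<Rightarrow> bool" where
  "same_side x y \<longleftrightarrow> colour x = colour y \<and> (\<forall>i. transition i x = transition i y)"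

definition adjacent_sides :: "complex \<Rightarrow> complex \<Rightarrow> bool" where
  "adjacent_sides x y \<longleftrightarrow> colour x \<noteq> colour y \<and>
    (\<forall>i. transition i x \<cdot> inv\<pi> transition (\<not> i) y \<cdot> transition (\<not> i) x \<cdot> inv\<pi> transition i y = \<one>\<^bsub>\<pi>\<^esub>) \<and>
    (\<forall>i. transition i y \<cdot> inv\<pi> transition (\<not> i) x \<cdot> transition (\<not> i) y \<cdot> inv\<pi> transition i x = \<one>\<^bsub>\<pi>\<^esub>)"

lemma adjacent_sides_sym: "adjacent_sides x y \<Longrightarrow> adjacent_sides y x"
  by (simp add: adjacent_sides_def)

lemma adjacent_sides_cong: "same_side x x' \<Longrightarrow> same_side y y' \<Longrightarrow> adjacent_sides x y \<Longrightarrow> adjacent_sides x' y'"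
  by (simp add: adjacent_sides_def same_side_def)

lemma adjacent_sidesI:
  assumes q: "q \<in> proj" "q \<notin> Ctr" and r: "0 < r"
    and sides: "\<And>x. x \<in> ball q r - proj \<Longrightarrow> same_side x x1 \<or> same_side x x2"
  shows "adjacent_sides x1 x2"
proof -
  obtain s where s: "s > 0" and adj: "\<And>x y i. x \<in> ball q s - proj \<Longrightarrow> y \<in> ball q s - proj \<Longrightarrow> colour x \<noteq> colour y \<Longrightarrow>
      transition i x \<cdot> inv\<pi> transition (\<not> i) y \<cdot> transition (\<not> i) x \<cdot> inv\<pi> transition i y = \<one>\<^bsub>\<pi>\<^esub>"
    using adjacent[OF q] by metis
  have "0 < min r s" using r s by simp
  then obtain x y where xy: "x \<in> ball q (min r s) - proj" "y \<in> ball q (min r s) - proj" "colour x \<noteq> colour y"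
    using both_colours[OF q] by blast
  then have b: "x \<in> ball q s - proj" "y \<in> ball q s - proj" "x \<in> ball q r - proj" "y \<in> ball q r - proj" by auto
  have a: "adjacent_sides x y"
    unfolding adjacent_sides_def using adj[OF b(1,2) xy(3)] adj[OF b(2,1) xy(3)[symmetric]] xy(3) by blast
  from sides[OF b(3)] show ?thesis
  proof
    assume x1: "same_side x x1"
    then have "\<not> same_side y x1" using xy(3) by (simp add: same_side_def)
    then have "same_side y x2" using sides[OF b(4)] by blast
    then show ?thesis by (rule adjacent_sides_cong[OF x1 _ a])
  next
    assume x2: "same_side x x2"
    then have "\<not> same_side y x2" using xy(3) by (simp add: same_side_def)
    then have "same_side y x1" using sides[OF b(4)] by blast
    then show ?thesis by (rule adjacent_sides_sym[OF adjacent_sides_cong[OF x2 _ a]])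
  qed
qed

text \<open>Test the relation of the two sides of a strand half way between the crossing and the
  boundary of the disc.\<close>

lemma adjacent_corners:
  assumes c: "crossing_at k v" and \<sigma>: "\<bar>\<sigma>\<bar> = 1"
  shows "adjacent_sides (corner k v \<sigma> 1) (corner k v \<sigma> (-1))" "adjacent_sides (corner k v 1 \<sigma>) (corner k v (-1) \<sigma>)"
proof -
  have main: "adjacent_sides x1 x2" if z: "norm (Complex c1 c2) = 1/2" "c1 = 0 \<or> c2 = 0"
    and sides: "\<And>s t. \<bar>s - c1\<bar> < 1/4 \<Longrightarrow> \<bar>t - c2\<bar> < 1/4 \<Longrightarrow> s \<noteq> 0 \<Longrightarrow> t \<noteq> 0 \<Longrightarrow>
      corner k v (sgn s) (sgn t) \<in> {x1, x2}" for c1 c2 x1 x2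
  proof -
    let ?z = "Complex c1 c2"
    have z1: "norm ?z < 1" using z(1) by simp
    have "?z \<noteq> 0" by (rule notI) (use z(1) in \<open>simp only: norm_zero\<close>)
    note q = strand_point[OF c z1 z(2) this]
    show ?thesis
    proof (rule adjacent_sidesI[OF q, of "1/4"])
      fix x assume x: "x \<in> ball (k + ?z * v) (1/4) - proj"
      obtain s t where st: "x = k + Complex s t * v" "norm (Complex s t - ?z) < 1/4"
        using crossing_ball[OF c] x by blast
      have n: "norm (Complex s t) < 1" using norm_triangle_ineq[of "Complex s t - ?z" ?z] st(2) z(1) by simp
      have "\<bar>s - c1\<bar> < 1/4" "\<bar>t - c2\<bar> < 1/4"
        using abs_Re_le_cmod[of "Complex s t - ?z"] abs_Im_le_cmod[of "Complex s t - ?z"] st(2) by simp_all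
      moreover have nz: "s \<noteq> 0" "t \<noteq> 0" using crossing_proj[OF c n] x st(1) by auto
      ultimately have "corner k v (sgn s) (sgn t) \<in> {x1, x2}" using sides by blast
      moreover have "same_side x (corner k v (sgn s) (sgn t))"
        unfolding same_side_def st(1) using quadrant[OF c nz n] by blast
      ultimately show "same_side x x1 \<or> same_side x x2" by auto
    qed simp
  qed
  show "adjacent_sides (corner k v \<sigma> 1) (corner k v \<sigma> (-1))"
    by (rule main[of "\<sigma> / 2" 0]) (use \<sigma> in \<open>auto simp: cmod_def abs_if sgn_if split: if_splits\<close>)
  show "adjacent_sides (corner k v 1 \<sigma>) (corner k v (-1) \<sigma>)"
    by (rule main[of 0 "\<sigma> / 2"]) (use \<sigma> in \<open>auto simp: cmod_def abs_if sgn_if split: if_splits\<close>)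
qed

lemma any_sheets_agree:
  assumes g: "sheets e S g" "e ` S \<inter> L = {}" and h: "sheets e S' h" "e ` S' \<inter> L = {}"
    and T: "connected T" "T \<subseteq> S" "T \<subseteq> S'" and v: "v \<in> T" "g i v = h j v" and w: "w \<in> T"
  shows "g i w = h j w"
proof (rule covering_lift_unique[OF cover T(1), where ?g1.0 = "g i" and ?g2.0 = "h j" and a = v])
  show "continuous_on T (g i)" using continuous_on_subset[OF sheets_cont[OF e g] T(2)] .
  show "continuous_on T (h j)" using continuous_on_subset[OF sheets_cont[OF e h] T(3)] .
  have un: "k i t \<in> X \<inter> p -` (S3 - L)" if "sheets e R k" "e ` R \<inter> L = {}" "t \<in> R" for k R i t
  proof -
    have "e t \<notin> L" using that(2,3) by blast
    then show ?thesis using sheets_X[OF e that] sheets_p[OF e that] e_S3[of t] by (simp del: mem_sphere_0)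
  qed
  show "g i ` T \<subseteq> X \<inter> p -` (S3 - L)" using un[OF g] T(2) by blast
  show "h j ` T \<subseteq> X \<inter> p -` (S3 - L)" using un[OF h] T(3) by blast
  show "p (g i t) = p (h j t)" if "t \<in> T" for t
    using sheets_p[OF e g subsetD[OF T(2) that]] sheets_p[OF e h subsetD[OF T(3) that]] by (simp only:)
qed (use v w in auto)

text \<open>At a small height inside the cone between the strands the link is only seen upwards when
  \<open>t = 0\<close> and only downwards when \<open>s = 0\<close>. So the quotient \<open>\<theta>p\<close> of the frames of an upper
  sheet and of the sheet of the cone does not change when \<open>s\<close> crosses \<open>0\<close>, and likewise \<open>\<theta>m\<close>
  for lower sheets when \<open>t\<close> does. Going around the axis of the cone inside one sheet of it,
  one meets upper sheets \<open>i\<close>, \<open>\<not> i\<close> and lower sheets \<open>j\<close>, \<open>\<not> j\<close> in alternation, and the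
  transitions of the four corners multiply to \<open>1\<close>.\<close>

lemma crossing_relation:
  assumes c: "crossing_at k v"
  shows "inv\<pi> transition i (corner k v 1 1) \<cdot> transition i (corner k v (-1) 1) \<cdot>
    (inv\<pi> transition (\<not> i) (corner k v (-1) (-1)) \<cdot> transition (\<not> i) (corner k v 1 (-1))) = \<one>\<^bsub>\<pi>\<^esub>"
proof -
  have k: "k \<in> Ctr" "norm v = 1" using c by (auto simp: crossing_at_def)
  have lk: "(k + Complex s t * v, z) \<in> LK \<longleftrightarrow> s = 0 \<and> z = 0 \<or> t = 0 \<and> z = 1 - \<bar>s\<bar>" if "norm (Complex s t) < 1" for s t z
    using c that unfolding crossing_at_def by blast
  \<comment> \<open>at height \<open>1/8\<close> the square of the four corners lies inside the cone\<close>
  define pt where "pt s t = (corner k v s t, 1/8 :: real)" for s t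
  define I where "I = {-1..1 :: real}"
  have nrm: "norm (Complex (s / 2) (t / 2)) < 3/4" if "s \<in> I" "t \<in> I" for s t
    using that by (intro half_corner) (auto simp: I_def)
  have cone: "pt s t \<in> cone k" if "s \<in> I" "t \<in> I" for s t
    using nrm[OF that] by (simp add: pt_def cone_def corner_def norm_mult k(2))
  have up: "pt s t \<in> upper" if "s \<in> I" "t \<in> I" "t \<noteq> 0" for s t
  proof -
    have "norm (Complex (s / 2) (t / 2)) < 1" using nrm[OF that(1,2)] by simp
    from lk[OF this] show ?thesis using that(3) unfolding pt_def corner_def upper_def by auto
  qed
  have lo: "pt s t \<in> lower" if "s \<in> I" "t \<in> I" "s \<noteq> 0" for s t
  proof -
    have "norm (Complex (s / 2) (t / 2)) < 1" using nrm[OF that(1,2)] by simp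
    from lk[OF this] show ?thesis using that(1,3) unfolding pt_def corner_def lower_def I_def by auto
  qed
  note gcS = cone_sheet[OF k(1)] e_cone[OF k(1)]
  have "\<exists>\<zeta>. frame (cone_sheet k b ` cone k) \<zeta>" for b by (rule piece_frame[OF piece_cone_sheet[OF k(1)]])
  then obtain \<zeta> where \<zeta>: "\<And>b. frame (cone_sheet k b ` cone k) (\<zeta> b)" by metis
  have gcsub: "cone_sheet k b ` cone k \<subseteq> X" for b by (rule piece_sub[OF piece_cone_sheet[OF k(1)]])
  define \<theta>p where "\<theta>p i b w = quot (upper_frame i (cone_sheet k b w)) (\<zeta> b (cone_sheet k b w))" for i b w
  define \<theta>m where "\<theta>m j b w = quot (lower_frame j (cone_sheet k b w)) (\<zeta> b (cone_sheet k b w))" for j b w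
  have cI: "connected I" "path_connected I" unfolding I_def by (auto intro: convex_imp_path_connected)
  have cont1: "continuous_on I (\<lambda>s. pt s t)" and cont2: "continuous_on I (\<lambda>t. pt s t)" for s t
    unfolding pt_def corner_def Complex_eq by (intro continuous_intros; simp)+
  have pI: "1 \<in> I" "-1 \<in> I" by (auto simp: I_def)
  have move: "g i (h r') = cone_sheet k b (h r')"
      "quot (\<phi> (cone_sheet k b (h r))) (\<zeta> b (cone_sheet k b (h r))) = quot (\<phi> (cone_sheet k b (h r'))) (\<zeta> b (cone_sheet k b (h r')))"
    if g: "sheets e S g" "e ` S \<inter> L = {}" and \<phi>: "frame (g i ` S) \<phi>" "g i ` S \<subseteq> X"
      and h: "continuous_on I h" "\<And>r. r \<in> I \<Longrightarrow> h r \<in> S" "\<And>r. r \<in> I \<Longrightarrow> h r \<in> cone k"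
      and a: "g i (h r) = cone_sheet k b (h r)" and r: "r \<in> I" "r' \<in> I" for S g i b \<phi> h and r r' :: real
  proof -
    have T: "connected (h ` I)" "h ` I \<subseteq> S" "h ` I \<subseteq> cone k"
      using connected_continuous_image[OF h(1) cI(1)] h by blast+
    have ag: "g i (h r) = cone_sheet k b (h r)" if "r \<in> I" for r
      by (rule any_sheets_agree[OF g gcS T imageI[OF r(1)] a imageI[OF that]])
    then show "g i (h r') = cone_sheet k b (h r')" using r(2) by blast
    show "quot (\<phi> (cone_sheet k b (h r))) (\<zeta> b (cone_sheet k b (h r))) = quot (\<phi> (cone_sheet k b (h r'))) (\<zeta> b (cone_sheet k b (h r')))"
    proof (rule quot_along[OF \<phi> \<zeta> gcsub cI(2), where h = "\<lambda>r. cone_sheet k b (h r)"])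
      show "continuous_on I (\<lambda>r. cone_sheet k b (h r))"
        by (rule continuous_on_compose2[OF sheets_cont[OF e gcS] h(1) T(3)])
      show "(\<lambda>r. cone_sheet k b (h r)) ` I \<subseteq> g i ` S \<inter> cone_sheet k b ` cone k"
      proof (intro image_subsetI IntI)
        fix r assume r: "r \<in> I"
        show "cone_sheet k b (h r) \<in> g i ` S" unfolding ag[OF r, symmetric] using h(2)[OF r] by (rule imageI)
        show "cone_sheet k b (h r) \<in> cone_sheet k b ` cone k" using h(3)[OF r] by (rule imageI)
      qed
    qed (use r in auto)
  qed
  have moveP: "upper_sheet i (pt s' t) = cone_sheet k b (pt s' t)" "\<theta>p i b (pt s t) = \<theta>p i b (pt s' t)"
    if a: "upper_sheet i (pt s t) = cone_sheet k b (pt s t)" and t: "t \<in> I" "t \<noteq> 0" and s: "s \<in> I" "s' \<in> I" for i b s s' t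
    using move[OF upper_sheet e_upper upper_frame upper_sheet_sub cont1 _ _ a s] up[OF _ t] cone[OF _ t(1)]
    unfolding \<theta>p_def by blast+
  have moveM: "lower_sheet j (pt s t') = cone_sheet k b (pt s t')" "\<theta>m j b (pt s t) = \<theta>m j b (pt s t')"
    if a: "lower_sheet j (pt s t) = cone_sheet k b (pt s t)" and s: "s \<in> I" "s \<noteq> 0" and t: "t \<in> I" "t' \<in> I" for j b s t t'
    using move[OF lower_sheet e_lower lower_frame lower_sheet_sub cont2 _ _ a t] lo[OF s(1) _ s(2)] cone[OF s(1)]
    unfolding \<theta>m_def by blast+
  have split: "transition i (corner k v s t) = \<theta>p i b (pt s t) \<cdot> inv\<pi> \<theta>m j b (pt s t)"
      "\<theta>p i b (pt s t) \<in> carrier \<pi>" "\<theta>m j b (pt s t) \<in> carrier \<pi>" "lower_sheet j (pt s t) = cone_sheet k b (pt s t)"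
    if a: "upper_sheet i (pt s t) = cone_sheet k b (pt s t)" and st: "s \<in> I" "t \<in> I" "s \<noteq> 0" "t \<noteq> 0" and j: "j = (i = colour (corner k v s t))" for i j b s t
  proof -
    have x: "corner k v s t \<notin> proj" using st by (intro corner_off_proj[OF c]) (auto simp: I_def)
    have lower_sheet: "upper_sheet i (pt s t) = lower_sheet j (pt s t)" unfolding pt_def j using sheets_agree[OF x] by simp
    then show "lower_sheet j (pt s t) = cone_sheet k b (pt s t)" using a by simp
    have p1: "upper_frame i (cone_sheet k b (pt s t)) \<in> P a (cone_sheet k b (pt s t))" using upper_sheet_path[OF up[OF st(1,2,4)], of i] a by simp
    have p2: "lower_frame j (cone_sheet k b (pt s t)) \<in> P a (cone_sheet k b (pt s t))" using lower_sheet_path[OF lo[OF st(1,2,3)], of j] a lower_sheet by simp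
    have p3: "\<zeta> b (cone_sheet k b (pt s t)) \<in> P a (cone_sheet k b (pt s t))"
      by (rule frame_path[OF \<zeta>]) (use cone[OF st(1,2)] in blast)
    show "\<theta>p i b (pt s t) \<in> carrier \<pi>" "\<theta>m j b (pt s t) \<in> carrier \<pi>"
      unfolding \<theta>p_def \<theta>m_def using quot_carrier[OF p1 p3] quot_carrier[OF p2 p3] by auto
    have "transition i (corner k v s t) = quot (upper_frame i (cone_sheet k b (pt s t))) (lower_frame j (cone_sheet k b (pt s t)))"
      unfolding transition_eq[OF x, of i "1/8"] pt_def[symmetric] a j[symmetric] ..
    also have "\<dots> = \<theta>p i b (pt s t) \<cdot> inv\<pi> \<theta>m j b (pt s t)"
      unfolding \<theta>p_def \<theta>m_def quot_inv[OF p2 p3] quot_mult[OF p1 p3 p2] ..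
    finally show "transition i (corner k v s t) = \<theta>p i b (pt s t) \<cdot> inv\<pi> \<theta>m j b (pt s t)" .
  qed
  have c12: "colour (corner k v (-1) 1) \<longleftrightarrow> \<not> colour (corner k v 1 1)" using adjacent_corners(2)[OF c, of 1] by (auto simp: adjacent_sides_def)
  have c14: "colour (corner k v 1 (-1)) \<longleftrightarrow> \<not> colour (corner k v 1 1)" using adjacent_corners(1)[OF c, of 1] by (auto simp: adjacent_sides_def)
  have c13: "colour (corner k v (-1) (-1)) \<longleftrightarrow> colour (corner k v 1 1)" using adjacent_corners(1)[OF c, of "-1"] c12 by (auto simp: adjacent_sides_def)
  define j where "j \<longleftrightarrow> (i = colour (corner k v 1 1))"
  have "p (upper_sheet i (pt 1 1)) = e (pt 1 1)" using upper_sheet_p[OF up[OF pI(1) pI(1)]] by simp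
  then obtain b where b1: "upper_sheet i (pt 1 1) = cone_sheet k b (pt 1 1)"
    using sheets_all[OF e gcS cone[OF pI(1) pI(1)] upper_sheet_X[OF up[OF pI(1) pI(1)]]] by auto
  note m1 = split[OF b1 pI(1) pI(1) _ _ j_def]
  have b2: "upper_sheet i (pt (-1) 1) = cone_sheet k b (pt (-1) 1)" and t2: "\<theta>p i b (pt 1 1) = \<theta>p i b (pt (-1) 1)"
    using moveP[OF b1 pI(1) _ pI(1) pI(2)] by auto
  have j2: "(\<not> j) = (i = colour (corner k v (-1) 1))" unfolding j_def c12 by auto
  note m2 = split[OF b2 pI(2) pI(1) _ _ j2]
  have n3: "lower_sheet (\<not> j) (pt (-1) (-1)) = cone_sheet k b (pt (-1) (-1))" and t3: "\<theta>m (\<not> j) b (pt (-1) 1) = \<theta>m (\<not> j) b (pt (-1) (-1))"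
    using moveM[OF m2(4) pI(2) _ pI(1) pI(2)] by auto
  have j3: "(\<not> j) = ((\<not> i) = colour (corner k v (-1) (-1)))" unfolding j_def c13 by auto
  have b3: "upper_sheet (\<not> i) (pt (-1) (-1)) = cone_sheet k b (pt (-1) (-1))"
  proof -
    have x: "corner k v (-1) (-1) \<notin> proj" by (intro corner_off_proj[OF c]) auto
    have "upper_sheet (\<not> i) (pt (-1) (-1)) = lower_sheet (\<not> j) (pt (-1) (-1))" unfolding pt_def using sheets_agree[OF x] j3 by blast
    then show ?thesis using n3 by simp
  qed
  note m3 = split[OF b3 pI(2) pI(2) _ _ j3]
  have b4: "upper_sheet (\<not> i) (pt 1 (-1)) = cone_sheet k b (pt 1 (-1))" and t4: "\<theta>p (\<not> i) b (pt (-1) (-1)) = \<theta>p (\<not> i) b (pt 1 (-1))"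
    using moveP[OF b3 pI(2) _ pI(2) pI(1)] by auto
  have j4: "j = ((\<not> i) = colour (corner k v 1 (-1)))" unfolding j_def c14 by auto
  note m4 = split[OF b4 pI(1) pI(2) _ _ j4]
  have t1: "\<theta>m j b (pt 1 1) = \<theta>m j b (pt 1 (-1))"
    using moveM(2)[OF m1(4) pI(1) _ pI(1) pI(2)] by auto
  show ?thesis
    using m1(1-3) m2(1-3) m3(1-3) m4(1-3) t1 t2 t3 t4
    by (simp add: inv_mult_group m_assoc inv_cancel)
qed

end

section \<open>Subsets of the fundamental group spread over the cover\<close>

context based_link_cover
begin

definition some_frame :: "'a set \<Rightarrow> 'a \<Rightarrow> real \<Rightarrow> 'a" where "some_frame V = (SOME \<phi>. frame V \<phi>)"

lemma some_frame: "piece V \<Longrightarrow> frame V (some_frame V)"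
  unfolding some_frame_def by (rule someI_ex[OF piece_frame])

text \<open>Subsets \<open>Dp i\<close> for the upper and \<open>Dm j\<close> for the lower sheets match over \<open>x\<close>.\<close>

definition good :: "(bool \<Rightarrow> (real \<Rightarrow> 'a) set set) \<Rightarrow> (bool \<Rightarrow> (real \<Rightarrow> 'a) set set) \<Rightarrow> complex \<Rightarrow> bool" where
  "good Dp Dm x \<longleftrightarrow> (\<forall>i. Dp i = trans (transition i x) (Dm (i = colour x)))"

definition base_family where
  "base_family Dp Dm = range (\<lambda>i. (upper_sheet i ` upper, upper_frame i, Dp i)) \<union> range (\<lambda>j. (lower_sheet j ` lower, lower_frame j, Dm j))"

lemma base_family_flat:
  assumes D: "\<And>i. Dp i \<subseteq> carrier \<pi>" "\<And>j. Dm j \<subseteq> carrier \<pi>"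
    and good: "\<And>x. x \<notin> proj \<Longrightarrow> good Dp Dm x"
  shows "flat_family (base_family Dp Dm)"
proof -
  have pp: "compatible (upper_sheet i ` upper, upper_frame i, Dp i) (upper_sheet i' ` upper, upper_frame i', Dp i')" for i i'
    unfolding compatible_def split_conv
  proof
    fix x assume x: "x \<in> upper_sheet i ` upper \<inter> upper_sheet i' ` upper"
    then obtain w w' where w: "w \<in> upper" "w' \<in> upper" "x = upper_sheet i w" "x = upper_sheet i' w'" by blast
    then have "i = i'" using upper_sheet_inj[OF w(1,2), of i i'] by simp
    then show "Dp i = trans (quot (upper_frame i x) (upper_frame i' x)) (Dp i')"
      using quot_self[OF upper_sheet_path[OF w(1), of i]] trans_one[OF D(1)] w(3) by simp
  qed
  have mm: "compatible (lower_sheet i ` lower, lower_frame i, Dm i) (lower_sheet i' ` lower, lower_frame i', Dm i')" for i i'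
    unfolding compatible_def split_conv
  proof
    fix x assume x: "x \<in> lower_sheet i ` lower \<inter> lower_sheet i' ` lower"
    then obtain w w' where w: "w \<in> lower" "w' \<in> lower" "x = lower_sheet i w" "x = lower_sheet i' w'" by blast
    then have "i = i'" using lower_sheet_inj[OF w(1,2), of i i'] by simp
    then show "Dm i = trans (quot (lower_frame i x) (lower_frame i' x)) (Dm i')"
      using quot_self[OF lower_sheet_path[OF w(1), of i]] trans_one[OF D(2)] w(3) by simp
  qed
  have pm: "compatible (upper_sheet i ` upper, upper_frame i, Dp i) (lower_sheet j ` lower, lower_frame j, Dm j)" for i j
    unfolding compatible_def split_conv
  proof
    fix y assume y: "y \<in> upper_sheet i ` upper \<inter> lower_sheet j ` lower"
    then obtain w w' where w: "w \<in> upper" "w' \<in> lower" "y = upper_sheet i w" "y = lower_sheet j w'" by blast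
    have "e w = e w'" using upper_sheet_p[OF w(1), of i] lower_sheet_p[OF w(2), of j] w(3,4) by simp
    then have ww: "w' = w" using e_inj by simp
    obtain x z where xz: "w = (x, z)" by (cases w)
    have x: "x \<notin> proj" using w(1,2) proj_if_upper_lower unfolding ww xz by blast
    have "upper_sheet i (x, z) = lower_sheet j (x, z)" using w(3,4) unfolding ww xz by simp
    then have j: "j = (i = colour x)" using sheets_agree[OF x] by blast
    have "transition i x = quot (upper_frame i y) (lower_frame j y)" unfolding w(3) xz j by (rule transition_eq[OF x])
    moreover have "Dp i = trans (transition i x) (Dm j)" using good[OF x] unfolding good_def j by blast
    ultimately show "Dp i = trans (quot (upper_frame i y) (lower_frame j y)) (Dm j)" by simp
  qed
  have mp: "compatible (lower_sheet j ` lower, lower_frame j, Dm j) (upper_sheet i ` upper, upper_frame i, Dp i)" for i j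
    by (rule compatible_sym[OF upper_frame lower_frame D(2) pm])
  have o: "openin (top_of_set X) (upper_sheet i ` upper)" "openin (top_of_set X) (lower_sheet i ` lower)" for i
    using piece_upper_sheet piece_lower_sheet unfolding piece_def by blast+
  show ?thesis unfolding flat_family_def base_family_def
  proof (intro conjI ballI)
    fix s assume "s \<in> range (\<lambda>i. (upper_sheet i ` upper, upper_frame i, Dp i)) \<union> range (\<lambda>j. (lower_sheet j ` lower, lower_frame j, Dm j))"
    then show "case s of (A, \<phi>, D) \<Rightarrow> openin (top_of_set X) A \<and> frame A \<phi> \<and> D \<subseteq> carrier \<pi>"
      by (elim UnE rangeE) (simp_all only: split_conv o upper_frame lower_frame D simp_thms)
  next
    fix s t assume st: "s \<in> range (\<lambda>i. (upper_sheet i ` upper, upper_frame i, Dp i)) \<union> range (\<lambda>j. (lower_sheet j ` lower, lower_frame j, Dm j))"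
      "t \<in> range (\<lambda>i. (upper_sheet i ` upper, upper_frame i, Dp i)) \<union> range (\<lambda>j. (lower_sheet j ` lower, lower_frame j, Dm j))"
    from st show "compatible s t"
      by (elim UnE rangeE) (simp_all only: pp mm pm mp)
  qed
qed

lemma base_family_Union: "\<Union>(fst ` base_family Dp Dm) = sheet_part"
  unfolding base_family_def sheet_part_def by (auto simp: image_Un image_image)

lemma const_path: "x \<in> S \<Longrightarrow> (\<lambda>_. x) \<in> paths_between S x x"
  by (auto simp: paths_between_def path_def pathstart_def pathfinish_def path_image_def)

text \<open>Outside the four sheets, the sheets of the cones and those around infinity only contain
  lifts of the axes and of infinity, which are disjoint.\<close>

lemma extra_sheets_meet_in_sheet_part:
  assumes V: "V \<in> (\<Union>k\<in>Ctr. range (\<lambda>b. cone_sheet k b ` cone k)) \<union> range (\<lambda>b. infinity_sheet b ` ball 0 infinity_radius)"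
    and V': "V' \<in> (\<Union>k\<in>Ctr. range (\<lambda>b. cone_sheet k b ` cone k)) \<union> range (\<lambda>b. infinity_sheet b ` ball 0 infinity_radius)"
    and x: "x \<in> V" "x \<in> V'" "x \<notin> sheet_part"
  shows "V = V'"
proof -
  have C: "\<exists>z. p x = e (k, z) \<and> (k, z) \<in> cone k \<and> x = cone_sheet k b (k, z)" if kx: "k \<in> Ctr" "x \<in> cone_sheet k b ` cone k" for k b
  proof -
    obtain w where w: "w \<in> cone k" "x = cone_sheet k b w" using kx(2) by blast
    have "w \<in> {k} \<times> UNIV"
    proof (rule ccontr)
      assume "w \<notin> {k} \<times> UNIV"
      then have "x \<in> cone_sheet k b ` (cone k - {k} \<times> UNIV)" using w by blast
      then show False using cone_sheet_Int_sheet_part[OF kx(1), of b] x(3) by blast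
    qed
    then obtain z where "w = (k, z)" by auto
    then show ?thesis using w sheets_p[OF e cone_sheet[OF kx(1)] e_cone[OF kx(1)] w(1)] by blast
  qed
  have I: "x = infinity_sheet b 0 \<and> p x = ninf" if xb: "x \<in> infinity_sheet b ` ball 0 infinity_radius" for b
  proof -
    obtain w where w: "w \<in> ball 0 infinity_radius" "x = infinity_sheet b w" using xb by blast
    have "w = 0"
    proof (rule ccontr)
      assume "w \<noteq> 0"
      then have "x \<in> infinity_sheet b ` (ball 0 infinity_radius - {0})" using w by blast
      then show False using infinity_sheet_Int_sheet_part[of b] x(3) by blast
    qed
    then show ?thesis using w sheets_p[OF f infinity_sheet f_ball w(1)] f_0 by simp
  qed
  from V V' show ?thesis
  proof (elim UnE UN_E rangeE)
    fix k k' b b' assume k: "k \<in> Ctr" "k' \<in> Ctr" and VV: "V = cone_sheet k b ` cone k" "V' = cone_sheet k' b' ` cone k'"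
    obtain z where z1: "p x = e (k, z)" "(k, z) \<in> cone k" "x = cone_sheet k b (k, z)"
      using C[OF k(1) x(1)[unfolded VV]] by (elim exE conjE)
    obtain z' where z2: "p x = e (k', z')" "(k', z') \<in> cone k'" "x = cone_sheet k' b' (k', z')"
      using C[OF k(2) x(2)[unfolded VV]] by (elim exE conjE)
    note z = z1 z2(1,3)
    have kk: "k' = k" "z' = z" using z(1,4) e_inj by auto
    have "b = b'" using sheets_inj[OF e cone_sheet[OF k(1)] e_cone[OF k(1)] z(2) z(2), of b b'] z(3,5) kk by simp
    then show ?thesis using VV kk by simp
  next
    fix k b b' assume k: "k \<in> Ctr" and VV: "V = cone_sheet k b ` cone k" "V' = infinity_sheet b' ` ball 0 infinity_radius"
    have "\<exists>z. p x = e (k, z)" using C[OF k x(1)[unfolded VV]] by blast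
    moreover have "p x = ninf" using I[OF x(2)[unfolded VV]] by blast
    ultimately show ?thesis using ninf_not_e by metis
  next
    fix k b b' assume k: "k \<in> Ctr" and VV: "V' = cone_sheet k b ` cone k" "V = infinity_sheet b' ` ball 0 infinity_radius"
    have "\<exists>z. p x = e (k, z)" using C[OF k x(2)[unfolded VV]] by blast
    moreover have "p x = ninf" using I[OF x(1)[unfolded VV]] by blast
    ultimately show ?thesis using ninf_not_e by metis
  next
    fix b b' assume VV: "V = infinity_sheet b ` ball 0 infinity_radius" "V' = infinity_sheet b' ` ball 0 infinity_radius"
    have "infinity_sheet b 0 = infinity_sheet b' 0" using I[OF x(1)[unfolded VV]] I[OF x(2)[unfolded VV]] by simp
    then have "b = b'" using sheets_inj[OF f infinity_sheet f_ball, of 0 0 b b'] infinity_radius(1) by simp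
    then show ?thesis using VV by simp
  qed
qed

lemma path_connected_punctured_ball_R3: "path_connected (ball (0 :: R3) r - {0})"
  by (rule path_connected_punctured_ball) simp

text \<open>The sheets of the cones and of the ball around infinity are covered up to an axis or a
  point, whose complement is path connected.\<close>

lemma flat_family_unbranched_part:
  assumes F: "flat_family F" "\<Union>(fst ` F) = sheet_part"
  shows "\<exists>F'. flat_family F' \<and> F \<subseteq> F' \<and> \<Union>(fst ` F') = unbranched_part"
proof -
  define VS where "VS = (\<Union>k\<in>Ctr. range (\<lambda>b. cone_sheet k b ` cone k)) \<union> range (\<lambda>b. infinity_sheet b ` ball 0 infinity_radius)"
  define \<V> where "\<V> = (\<lambda>V. (V, some_frame V)) ` VS"
  have pc: "piece V \<and> path_connected (V \<inter> sheet_part) \<and> V \<inter> sheet_part \<noteq> {}" if V: "V \<in> VS" for V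
    using V unfolding VS_def
  proof (elim UnE UN_E rangeE)
    fix k b assume k: "k \<in> Ctr" and V: "V = cone_sheet k b ` cone k"
    have "(k + 1/2, 1/4) \<in> cone k - {k} \<times> UNIV" by (simp add: cone_def)
    then have "V \<inter> sheet_part \<noteq> {}" unfolding V cone_sheet_Int_sheet_part[OF k] by blast
    moreover have "path_connected (V \<inter> sheet_part)" unfolding V cone_sheet_Int_sheet_part[OF k]
      by (rule sheets_path_connected[OF e cone_sheet[OF k] e_cone[OF k] path_connected_punctured_cone]) blast
    ultimately show ?thesis using piece_cone_sheet[OF k, of b] V by blast
  next
    fix b assume V: "V = infinity_sheet b ` ball 0 infinity_radius"
    have "(of_real (infinity_radius / 2), 0) \<in> ball 0 infinity_radius - {0 :: R3}" using infinity_radius(1) by (simp add: zero_prod_def dist_Pair_Pair)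
    then have "V \<inter> sheet_part \<noteq> {}" unfolding V infinity_sheet_Int_sheet_part by blast
    moreover have "path_connected (V \<inter> sheet_part)" unfolding V infinity_sheet_Int_sheet_part
      by (rule sheets_path_connected[OF f infinity_sheet f_ball path_connected_punctured_ball_R3]) blast
    ultimately show ?thesis using piece_infinity_sheet[of b] V by blast
  qed
  obtain F' where F': "flat_family F'" "F \<subseteq> F'" "fst ` F' = fst ` F \<union> fst ` \<V>"
  proof (rule flat_family_extend[OF F(1), of \<V>])
    fix V \<kappa> assume "(V, \<kappa>) \<in> \<V>"
    then have V: "V \<in> VS" "\<kappa> = some_frame V" by (auto simp: \<V>_def)
    show "openin (top_of_set X) V \<and> frame V \<kappa> \<and> path_connected (V \<inter> \<Union>(fst ` F)) \<and> V \<inter> \<Union>(fst ` F) \<noteq> {}"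
      unfolding F(2) V(2) using pc[OF V(1)] some_frame[of V] by (auto simp: piece_def)
  next
    fix V \<kappa> V' \<kappa>' x assume "(V, \<kappa>) \<in> \<V>" "(V', \<kappa>') \<in> \<V>" and x: "x \<in> V" "x \<in> V'"
    then have V: "V \<in> VS" "V' \<in> VS" by (auto simp: \<V>_def)
    show "\<exists>d y. d \<in> paths_between (V \<inter> V') x y \<and> y \<in> \<Union>(fst ` F)"
    proof (cases "x \<in> sheet_part")
      case True
      then show ?thesis unfolding F(2) by (intro exI[of _ "\<lambda>_. x"] exI[of _ x] conjI const_path IntI x)
    next
      case False
      have VV: "V = V'" by (rule extra_sheets_meet_in_sheet_part[OF V[unfolded VS_def] x False])
      obtain y where y: "y \<in> V" "y \<in> sheet_part" using pc[OF V(1)] by blast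
      have "path_connected V" using pc[OF V(1)] by (simp add: piece_def)
      then obtain d where d: "path d" "path_image d \<subseteq> V" "pathstart d = x" "pathfinish d = y"
        using x(1) y(1) unfolding path_connected_def by blast
      then have "d \<in> paths_between (V \<inter> V') x y" unfolding VV[symmetric] by (simp add: paths_between_def)
      then show ?thesis unfolding F(2) using y(2) by (intro exI conjI)
    qed
  qed
  have "fst ` \<V> = VS" unfolding \<V>_def by (simp add: image_image)
  then have "\<Union>(fst ` F') = sheet_part \<union> \<Union>VS" unfolding F'(3) Union_Un_distrib F(2) by simp
  also have "\<dots> = unbranched_part"
  proof
    show "unbranched_part \<subseteq> sheet_part \<union> \<Union>VS"
    proof
      fix x assume x: "x \<in> unbranched_part"
      show "x \<in> sheet_part \<union> \<Union>VS"
      proof (cases "x \<in> sheet_part")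
        case False
        from unbranched_part_cases[OF x this] have "\<exists>V\<in>VS. x \<in> V" unfolding VS_def by blast
        then show ?thesis by blast
      qed blast
    qed
    have "cone_sheet k b ` cone k \<subseteq> unbranched_part" if k: "k \<in> Ctr" for k b
    proof
      fix y assume "y \<in> cone_sheet k b ` cone k"
      then obtain w where w: "w \<in> cone k" "y = cone_sheet k b w" by blast
      have "e w \<notin> L" using w(1) e_cone[OF k] by blast
      then show "y \<in> unbranched_part" unfolding unbranched_part_def w(2)
        using sheets_X[OF e cone_sheet[OF k] e_cone[OF k] w(1)] sheets_p[OF e cone_sheet[OF k] e_cone[OF k] w(1)] e_S3[of w] by (simp del: mem_sphere_0)
    qed
    moreover have "infinity_sheet b ` ball 0 infinity_radius \<subseteq> unbranched_part" for b
    proof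
      fix y assume "y \<in> infinity_sheet b ` ball 0 infinity_radius"
      then obtain w where w: "w \<in> ball 0 infinity_radius" "y = infinity_sheet b w" by blast
      have "f w \<notin> L" using w(1) f_ball by blast
      moreover have "f w \<in> S3" using chart_range[OF f, of w] by blast
      ultimately show "y \<in> unbranched_part" unfolding unbranched_part_def w(2)
        using sheets_X[OF f infinity_sheet f_ball w(1)] sheets_p[OF f infinity_sheet f_ball w(1)] by (simp del: mem_sphere_0)
    qed
    ultimately show "sheet_part \<union> \<Union>VS \<subseteq> unbranched_part" unfolding VS_def by (intro Un_least Union_least sheet_part_unbranched) (elim UnE UN_E rangeE, simp_all only:)
  qed
  finally show ?thesis using F'(1,2) by blast
qed

definition is_chart :: "R4 set \<Rightarrow> bool" where
  "is_chart U \<longleftrightarrow> (\<exists>\<phi> \<phi>' g \<gamma>. openin (top_of_set S3) U \<and>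
    homeomorphism U (UNIV :: R3 set) \<phi> \<phi>' \<and> \<phi> ` (U \<inter> L) = {0} \<times> UNIV \<and>
    homeomorphism (X \<inter> p -` U) (UNIV :: R3 set) g \<gamma> \<and>
    (\<forall>x\<in>X \<inter> p -` U. \<phi> (p x) = ((fst (g x))\<^sup>2, snd (g x))))"

lemma is_chartE:
  assumes "is_chart U"
  obtains g \<gamma> where "homeomorphism (X \<inter> p -` U) (UNIV :: R3 set) g \<gamma>" "(X \<inter> p -` U) \<inter> unbranched_part = \<gamma> ` {w. fst w \<noteq> 0}"
    "piece (X \<inter> p -` U)"
proof -
  obtain \<phi> \<phi>' g \<gamma> where U: "openin (top_of_set S3) U"
    and \<phi>: "homeomorphism U (UNIV :: R3 set) \<phi> \<phi>'" "\<phi> ` (U \<inter> L) = {0} \<times> UNIV"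
    and g: "homeomorphism (X \<inter> p -` U) (UNIV :: R3 set) g \<gamma>"
    and sq: "\<forall>x\<in>X \<inter> p -` U. \<phi> (p x) = ((fst (g x))\<^sup>2, snd (g x))"
    using assms unfolding is_chart_def by (elim exE conjE)
  show ?thesis
    by (rule that[OF g chart_unbranched[OF \<phi> openin_imp_subset[OF U] g sq] piece_chart[OF U g]])
qed

lemma path_connected_off_axis: "path_connected {w :: R3. fst w \<noteq> 0}"
proof -
  have "{w :: R3. fst w \<noteq> 0} = (- {0}) \<times> UNIV" by auto
  moreover have "path_connected (- {0 :: complex})" by (rule path_connected_punctured_universe) simp
  ultimately show ?thesis by (simp add: path_connected_Times)
qed

text \<open>In the charts around the branch set, the part covered already is the complement of the axis.\<close>

lemma flat_family_branched:
  assumes F: "flat_family F" "\<Union>(fst ` F) = unbranched_part"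
  shows "\<exists>F'. flat_family F' \<and> F \<subseteq> F' \<and> \<Union>(fst ` F') = X"
proof -
  define \<V> where "\<V> = (\<lambda>U. (X \<inter> p -` U, some_frame (X \<inter> p -` U))) ` Collect is_chart"
  obtain F' where F': "flat_family F'" "F \<subseteq> F'" "fst ` F' = fst ` F \<union> fst ` \<V>"
  proof (rule flat_family_extend[OF F(1), of \<V>])
    fix V \<kappa> assume "(V, \<kappa>) \<in> \<V>"
    then obtain U where U: "is_chart U" "V = X \<inter> p -` U" "\<kappa> = some_frame V" by (auto simp: \<V>_def)
    obtain g \<gamma> where g: "homeomorphism V (UNIV :: R3 set) g \<gamma>" and VX: "V \<inter> unbranched_part = \<gamma> ` {w. fst w \<noteq> 0}" and V: "piece V"
      using is_chartE[OF U(1)] unfolding U(2) .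
    have "path_connected (V \<inter> unbranched_part)" unfolding VX using g path_connected_off_axis
      by (intro path_connected_continuous_image) (auto simp: homeomorphism_def intro: continuous_on_subset)
    moreover have "V \<inter> unbranched_part \<noteq> {}" unfolding VX by (auto intro: exI[of _ 1])
    ultimately show "openin (top_of_set X) V \<and> frame V \<kappa> \<and> path_connected (V \<inter> \<Union>(fst ` F)) \<and> V \<inter> \<Union>(fst ` F) \<noteq> {}"
      unfolding F(2) U(3) using V some_frame[OF V] by (auto simp: piece_def)
  next
    fix V \<kappa> V' \<kappa>' x assume "(V, \<kappa>) \<in> \<V>" "(V', \<kappa>') \<in> \<V>" and x: "x \<in> V" "x \<in> V'"
    then obtain U U' where U: "is_chart U" "V = X \<inter> p -` U" and U': "is_chart U'" "V' = X \<inter> p -` U'" by (auto simp: \<V>_def)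
    obtain g \<gamma> where g: "homeomorphism V (UNIV :: R3 set) g \<gamma>" and VX: "V \<inter> unbranched_part = \<gamma> ` {w. fst w \<noteq> 0}"
      using is_chartE[OF U(1)] unfolding U(2) .
    have oV': "openin (top_of_set X) V'" using is_chartE[OF U'(1)] unfolding U'(2) piece_def by metis
    have \<gamma>c: "continuous_on UNIV \<gamma>" "\<gamma> ` UNIV = V" using g by (auto simp: homeomorphism_def)
    have "openin (top_of_set UNIV) (UNIV \<inter> \<gamma> -` V')"
      by (rule continuous_openin_preimage[OF \<gamma>c(1) _ oV']) (use \<gamma>c(2) U(2) in blast)
    then have o: "open (\<gamma> -` V')" by simp
    obtain t0 t where t: "x = \<gamma> (t0, t)" using x(1) \<gamma>c(2) by auto
    show "\<exists>d y. d \<in> paths_between (V \<inter> V') x y \<and> y \<in> \<Union>(fst ` F)"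
    proof (cases "x \<in> unbranched_part")
      case True
      then show ?thesis unfolding F(2) by (intro exI[of _ "\<lambda>_. x"] exI[of _ x] conjI const_path IntI x)
    next
      case False
      have t00: "t0 = 0"
      proof (rule ccontr)
        assume "t0 \<noteq> 0"
        then have "x \<in> \<gamma> ` {w. fst w \<noteq> 0}" unfolding t by (intro imageI) simp
        then show False using VX False by blast
      qed
      have "(0, t) \<in> \<gamma> -` V'" using x(2) unfolding t t00 by simp
      then obtain \<delta> where \<delta>: "0 < \<delta>" "ball (0, t) \<delta> \<subseteq> \<gamma> -` V'" using o by (meson openE)
      define h where "h = (\<lambda>s :: real. (of_real (s * (\<delta> / 2)), t) :: R3)"
      have hb: "h s \<in> ball (0, t) \<delta>" if "s \<in> {0..1}" for s
      proof -
        have "dist (0, t) (h s) = s * (\<delta> / 2)" using that \<delta>(1) unfolding h_def by (simp add: dist_Pair_Pair norm_mult)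
        also have "\<dots> \<le> 1 * (\<delta> / 2)" using that \<delta>(1) by (intro mult_right_mono) auto
        finally show ?thesis using \<delta>(1) by simp
      qed
      have ch: "continuous_on {0..1} h" unfolding h_def by (intro continuous_intros)
      have "path (\<gamma> \<circ> h)" unfolding path_def by (rule continuous_on_compose[OF ch continuous_on_subset[OF \<gamma>c(1)]]) simp
      moreover have "path_image (\<gamma> \<circ> h) \<subseteq> V \<inter> V'"
      proof
        fix y assume "y \<in> path_image (\<gamma> \<circ> h)"
        then obtain s where s: "s \<in> {0..1}" "y = \<gamma> (h s)" unfolding path_image_def by auto
        have "h s \<in> \<gamma> -` V'" using hb[OF s(1)] \<delta>(2) by blast
        then show "y \<in> V \<inter> V'" using s(2) \<gamma>c(2) by auto
      qed
      moreover have "pathstart (\<gamma> \<circ> h) = x" by (simp add: pathstart_def h_def t t00)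
      ultimately have "\<gamma> \<circ> h \<in> paths_between (V \<inter> V') x (\<gamma> (h 1))" by (simp add: paths_between_def pathfinish_def)
      moreover have "\<gamma> (h 1) \<in> unbranched_part"
      proof -
        have "\<gamma> (h 1) \<in> \<gamma> ` {w. fst w \<noteq> 0}" by (intro imageI) (use \<delta>(1) in \<open>simp add: h_def\<close>)
        then show ?thesis using VX by blast
      qed
      ultimately show ?thesis unfolding F(2) by blast
    qed
  qed
  have "fst ` \<V> = (\<lambda>U. X \<inter> p -` U) ` Collect is_chart" unfolding \<V>_def by (simp add: image_image)
  then have "\<Union>(fst ` F') = unbranched_part \<union> (\<Union>U\<in>Collect is_chart. X \<inter> p -` U)"
    unfolding F'(3) Union_Un_distrib F(2) by simp
  also have "\<dots> = X"
  proof
    show "unbranched_part \<union> (\<Union>U\<in>Collect is_chart. X \<inter> p -` U) \<subseteq> X" by (auto simp: unbranched_part_def)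
    show "X \<subseteq> unbranched_part \<union> (\<Union>U\<in>Collect is_chart. X \<inter> p -` U)"
    proof
      fix x assume x: "x \<in> X"
      show "x \<in> unbranched_part \<union> (\<Union>U\<in>Collect is_chart. X \<inter> p -` U)"
      proof (cases "p x \<in> L")
        case True
        obtain U \<phi> \<phi>' g \<gamma> where U: "openin (top_of_set S3) U" "p x \<in> U"
          and \<phi>: "homeomorphism U (UNIV :: R3 set) \<phi> \<phi>'" "\<phi> ` (U \<inter> L) = {0} \<times> UNIV"
          and g: "homeomorphism (X \<inter> p -` U) (UNIV :: R3 set) g \<gamma>"
          and sq: "\<forall>x\<in>X \<inter> p -` U. \<phi> (p x) = ((fst (g x))\<^sup>2, snd (g x))"
          using branch_chart[OF True] .
        have "is_chart U" unfolding is_chart_def using U(1) \<phi> g sq by (intro exI conjI)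
        then show ?thesis using x U(2) by blast
      next
        case False
        moreover have "p x \<in> S3" using p_S3 x by blast
        ultimately show ?thesis using x by (simp add: unbranched_part_def del: mem_sphere_0)
      qed
    qed
  qed
  finally show ?thesis using F'(1,2) by blast
qed

theorem good_everywhere_fixed:
  assumes D: "\<And>i. Dp i \<subseteq> carrier \<pi>" "\<And>j. Dm j \<subseteq> carrier \<pi>"
    and good: "\<And>x. x \<notin> proj \<Longrightarrow> good Dp Dm x" and g: "g \<in> carrier \<pi>"
  shows "trans g (Dp i) = Dp i"
proof -
  obtain F1 where F1: "flat_family F1" "base_family Dp Dm \<subseteq> F1" "\<Union>(fst ` F1) = unbranched_part"
    using flat_family_unbranched_part[OF base_family_flat[OF D good] base_family_Union] by metis
  obtain F2 where F2: "flat_family F2" "F1 \<subseteq> F2" "\<Union>(fst ` F2) = X" using flat_family_branched[OF F1(1,3)] by metis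
  have "(upper_sheet i ` upper, upper_frame i, Dp i) \<in> F2" using F1(2) F2(2) unfolding base_family_def by blast
  moreover have "upper_sheet i ` upper \<noteq> {}" using upper_contraction by (auto simp: contraction_def)
  ultimately show ?thesis by (rule flat_family_fixed[OF F2(1,3) path_connected_X _ _ g])
qed

end

section \<open>Spreading along the strands\<close>

context based_link_cover
begin

context
  fixes Dp Dm :: "bool \<Rightarrow> (real \<Rightarrow> 'a) set set"
begin

text \<open>Unlike \<open>good\<close> this makes sense also for points on the projection, so that it can be spread
  along strands.\<close>

definition good_near :: "complex \<Rightarrow> bool" where
  "good_near y \<longleftrightarrow> (\<exists>r>0. \<forall>x\<in>ball y r - proj. good Dp Dm x)"

lemma good_cong: "colour x = colour y \<Longrightarrow> (\<And>i. transition i x = transition i y) \<Longrightarrow> good Dp Dm x \<longleftrightarrow> good Dp Dm y"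
  by (simp add: good_def)

text \<open>By the local form matching depends on the colour only, and both colours occur near every
  point of the strand.\<close>

lemma good_near_spreads:
  assumes q: "q \<in> proj" "q \<notin> Ctr"
  shows "\<exists>s>0. \<forall>y\<in>ball q s. y \<in> proj \<longrightarrow> y \<notin> Ctr \<longrightarrow> good_near y \<longrightarrow> (\<forall>x\<in>ball q s - proj. good Dp Dm x)"
proof -
  obtain s A E where s: "s > 0"
    and transition: "\<And>x i. x \<in> ball q s - proj \<Longrightarrow> transition i x = A i \<cdot> inv\<pi> (E (i = colour x))"
    using local_form[OF q] by metis
  show ?thesis
  proof (intro exI[of _ s] conjI s ballI impI)
    fix y x assume y: "y \<in> ball q s" "y \<in> proj" "y \<notin> Ctr" "good_near y" and x: "x \<in> ball q s - proj"
    obtain r where r: "r > 0" "\<And>x. x \<in> ball y r \<Longrightarrow> x \<notin> proj \<Longrightarrow> good Dp Dm x"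
      using y(4) unfolding good_near_def by blast
    have "open (ball q s \<inter> ball y r)" "y \<in> ball q s \<inter> ball y r" using y(1) r(1) by auto
    then obtain r' where r': "r' > 0" "ball y r' \<subseteq> ball q s \<inter> ball y r" by (meson openE)
    obtain x1 x2 where x12: "x1 \<in> ball y r' - proj" "x2 \<in> ball y r' - proj" "colour x1 \<noteq> colour x2"
      using both_colours[OF y(2,3) r'(1)] by blast
    have g: "x1 \<in> ball q s - proj" "x2 \<in> ball q s - proj" "good Dp Dm x1" "good Dp Dm x2"
      using x12 r'(2) r(2) by auto
    have eq: "good Dp Dm x" if "x' \<in> ball q s - proj" "good Dp Dm x'" "colour x = colour x'" for x'
      using good_cong[OF that(3)] transition[OF x] transition[OF that(1)] that(2,3) by simp
    have "colour x = colour x1 \<or> colour x = colour x2" using x12(3) by auto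
    then show "good Dp Dm x" using eq[OF g(1,3)] eq[OF g(2,4)] by blast
  qed
qed

lemma good_near_ball: "(\<And>x. x \<in> ball q s \<Longrightarrow> x \<notin> proj \<Longrightarrow> good Dp Dm x) \<Longrightarrow> y \<in> ball q s \<Longrightarrow> good_near y"
proof -
  assume h: "\<And>x. x \<in> ball q s \<Longrightarrow> x \<notin> proj \<Longrightarrow> good Dp Dm x" and y: "y \<in> ball q s"
  obtain r where r: "r > 0" "ball y r \<subseteq> ball q s" using openE[OF open_ball y] by blast
  show "good_near y" unfolding good_near_def using r h by (intro exI[of _ r]) auto
qed

lemma good_near_connected:
  assumes T: "connected T" "T \<subseteq> proj - Ctr" and y: "y \<in> T" "good_near y" and y': "y' \<in> T"
  shows "good_near y'"
proof (rule connected_induction_simple[where P = good_near, OF T(1) y(1) y' y(2)])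
  fix q assume q: "q \<in> T"
  then have q': "q \<in> proj" "q \<notin> Ctr" using T(2) by auto
  obtain s where s: "s > 0" "\<And>y x. y \<in> ball q s \<Longrightarrow> y \<in> proj \<Longrightarrow> y \<notin> Ctr \<Longrightarrow> good_near y \<Longrightarrow> x \<in> ball q s - proj \<Longrightarrow> good Dp Dm x"
    using good_near_spreads[OF q'] by metis
  show "\<exists>U. openin (top_of_set T) U \<and> q \<in> U \<and> (\<forall>x\<in>U. \<forall>y\<in>U. good_near x \<longrightarrow> good_near y)"
  proof (intro exI[of _ "T \<inter> ball q s"] conjI ballI impI)
    fix x y assume xy: "x \<in> T \<inter> ball q s" "y \<in> T \<inter> ball q s" "good_near x"
    then have "x \<in> ball q s" "x \<in> proj" "x \<notin> Ctr" using T(2) by auto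
    from s(2)[OF this xy(3)] have h: "\<And>z. z \<in> ball q s - proj \<Longrightarrow> good Dp Dm z" .
    show "good_near y" by (rule good_near_ball[of q s]) (use h xy(2) in auto)
  qed (use q s(1) in auto)
qed

text \<open>Apart from the crossings the plane is connected, and away from the projection matching is
  locally constant.\<close>

lemma good_near_everywhere:
  assumes "\<And>q. q \<in> proj \<Longrightarrow> q \<notin> Ctr \<Longrightarrow> good_near q" and x: "x \<notin> proj"
  shows "good Dp Dm x"
proof -
  have Cp: "k \<in> Ctr \<Longrightarrow> k \<in> proj" for k
    using column_Ctr[of k 0] unfolding proj_def by force
  obtain q0 where q0: "q0 \<in> proj" "q0 \<notin> Ctr" using proj_off_Ctr by blast
  have "path_connected (- Ctr)"
    by (rule path_connected_complement_countable) (use finite_Ctr in \<open>auto intro: countable_finite\<close>)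
  then have con: "connected (- Ctr)" by (rule path_connected_imp_connected)
  have x': "x \<in> - Ctr" using x Cp by blast
  have "good_near x"
  proof (rule connected_induction_simple[where P = good_near, OF con _ x' assms(1)[OF q0]])
    show "q0 \<in> - Ctr" using q0 by simp
    fix q assume q: "q \<in> - Ctr"
    show "\<exists>U. openin (top_of_set (- Ctr)) U \<and> q \<in> U \<and> (\<forall>x\<in>U. \<forall>y\<in>U. good_near x \<longrightarrow> good_near y)"
    proof (cases "q \<in> proj")
      case True
      then obtain r where r: "r > 0" "\<And>x. x \<in> ball q r - proj \<Longrightarrow> good Dp Dm x"
        using assms(1) q unfolding good_near_def by blast
      show ?thesis
      proof (intro exI[of _ "- Ctr \<inter> ball q r"] conjI ballI impI)
        show "good_near y" if "y \<in> - Ctr \<inter> ball q r" for y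
          by (rule good_near_ball[of q r]) (use r(2) that in auto)
      qed (use q r(1) in auto)
    next
      case False
      have "open (- proj)" using closed_proj by (simp add: open_Compl)
      then obtain r where r: "r > 0" "ball q r \<subseteq> - proj" using False by (meson ComplI openE)
      have same: "good Dp Dm y \<longleftrightarrow> good Dp Dm y'" if "y \<in> ball q r" "y' \<in> ball q r" for y y'
      proof (rule good_cong)
        have pc: "path_connected (ball q r)" by (intro convex_imp_path_connected convex_ball)
        have d: "ball q r \<inter> proj = {}" using r(2) by blast
        show "colour y = colour y'" by (rule colour_connected[OF path_connected_imp_connected[OF pc] d that])
        show "transition i y = transition i y'" for i by (rule transition_connected[OF pc d that])
      qed
      show ?thesis
      proof (intro exI[of _ "- Ctr \<inter> ball q r"] conjI ballI impI)
        fix y y' assume y: "y \<in> - Ctr \<inter> ball q r" "y' \<in> - Ctr \<inter> ball q r" "good_near y"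
        have "y \<notin> proj" using y(1) r(2) by blast
        then have "good Dp Dm y" using y(3) unfolding good_near_def by (metis DiffI centre_in_ball)
        then have "good Dp Dm z" if "z \<in> ball q r" for z using same[of y z] y(1) that by blast
        then show "good_near y'" by (intro good_near_ball[of q r]) (use y(2) in auto)
      qed (use q r(1) in auto)
    qed
  qed
  then show ?thesis using x unfolding good_near_def by (metis DiffI centre_in_ball)
qed

lemma good_near_strands:
  assumes c: "crossing_at k v"
    and g: "\<And>s t. s \<in> {1, -1} \<Longrightarrow> t \<in> {1, -1} \<Longrightarrow> good Dp Dm (corner k v s t)"
    and y: "y \<in> ball k 1"
  shows "good_near y"
proof (rule good_near_ball[OF _ y])
  fix x assume x: "x \<in> ball k 1" "x \<notin> proj"
  obtain s t where st: "x = k + Complex s t * v" "norm (Complex s t) < 1"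
    using crossing_ball[OF c, of x 0 1] x(1) by auto
  have n: "s \<noteq> 0" "t \<noteq> 0" using crossing_proj[OF c st(2)] x(2) st(1) by auto
  have "good Dp Dm x \<longleftrightarrow> good Dp Dm (corner k v (sgn s) (sgn t))"
    unfolding st(1) by (rule good_cong) (rule quadrant[OF c n st(2)])+
  then show "good Dp Dm x" using g[of "sgn s" "sgn t"] n by (auto simp: sgn_if)
qed

end

end

section \<open>The lift of a medial diagram\<close>

context medial_diagram
begin

abbreviation "lift \<equiv> medial_lift H c u \<alpha>"

text \<open>The strands at a crossing, parametrised with the unit vector \<open>over_dir\<close> and its rotation by
  a right angle.\<close>

definition under :: "'d \<Rightarrow> real \<Rightarrow> complex" where "under d s = (if wt H d = 1 then pt d s 0 else pt d 0 s)"
definition over :: "'d \<Rightarrow> real \<Rightarrow> complex" where "over d s = (if wt H d = 1 then pt d 0 (- s) else pt d s 0)"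

lemma over_dir_eq: "over_dir H u d = (if wt H d = 1 then - strand2 d else strand1 d)"
proof -
  have "- pi / 4 + pi = 3 * pi / 4" by simp
  then have "cis (3 * pi / 4) = cis (- pi / 4) * cis pi" unfolding cis_mult by (simp only:)
  then have "cis (3 * pi / 4) = - cis (- pi / 4)" by (simp only: cis_pi mult_minus_right mult_1_right)
  then show ?thesis by (simp only: over_dir_def strand1_def strand2_def mult_minus_right minus_minus)
qed

lemma over_eq: "c d + s *\<^sub>R over_dir H u d = over d s"
  and under_eq: "c d + s *\<^sub>R (\<i> * over_dir H u d) = under d s"
  by (auto simp: over_dir_eq over_def under_def pt_def strand2_eq)

lemma lift_iff:
  "(x, z) \<in> lift \<longleftrightarrow> (z = 0 \<and> (\<exists>d\<in>darts H. x \<in> path_image (\<alpha> d))) \<or>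
    (z = 0 \<and> (\<exists>d\<in>darts H. \<exists>s\<in>{-1..1}. x = under d s)) \<or> (\<exists>d\<in>darts H. \<exists>s\<in>{-1..1}. x = over d s \<and> z = 1 - \<bar>s\<bar>)"
  unfolding medial_lift_def over_eq under_eq by blast

lemma over_in_lift: "d \<in> darts H \<Longrightarrow> \<bar>s\<bar> \<le> 1 \<Longrightarrow> (over d s, 1 - \<bar>s\<bar>) \<in> lift"
proof -
  assume d: "d \<in> darts H" and s: "\<bar>s\<bar> \<le> 1"
  have "s \<in> {-1..1}" using s by (simp add: abs_le_iff)
  then show ?thesis unfolding lift_iff using d by blast
qed

lemma under_in_lift: "d \<in> darts H \<Longrightarrow> \<bar>s\<bar> \<le> 1 \<Longrightarrow> (under d s, 0) \<in> lift"
proof -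
  assume d: "d \<in> darts H" and s: "\<bar>s\<bar> \<le> 1"
  have "s \<in> {-1..1}" using s by (simp add: abs_le_iff)
  then show ?thesis unfolding lift_iff using d by blast
qed

lemma under_opp: "d \<in> darts H \<Longrightarrow> under (opp H d) s = under d (- s)"
  and over_opp: "d \<in> darts H \<Longrightarrow> over (opp H d) s = over d (- s)"
  by (auto simp: under_def over_def pt_opp wt_opp)

lemma over_under_in_cball: "d \<in> darts H \<Longrightarrow> over d s \<in> cball (c d) 1 \<longleftrightarrow> \<bar>s\<bar> \<le> 1"
  "d \<in> darts H \<Longrightarrow> under d s \<in> cball (c d) 1 \<longleftrightarrow> \<bar>s\<bar> \<le> 1"
  by (auto simp: over_def under_def simp del: mem_cball)

lemma opp_centre: "d \<in> darts H \<Longrightarrow> c (opp H d) = c d"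
  by (rule drawingD(1))

text \<open>The part of the link over the disc of a crossing.\<close>

definition crossing :: "'d \<Rightarrow> R3 set" where
  "crossing d = (\<lambda>s. (under d s, 0)) ` {-1..1} \<union> (\<lambda>s. (over d s, 1 - \<bar>s\<bar>)) ` {-1..1}"

lemma crossing_opp: 
  assumes d: "d \<in> darts H" shows "crossing (opp H d) = crossing d"
proof -
  have m: "uminus ` {-1..1} = {-1..1 :: real}" by simp
  have "(\<lambda>s. (under (opp H d) s, 0 :: real)) ` {-1..1} = (\<lambda>s. (under d s, 0)) ` uminus ` {-1..1}"
    unfolding image_image by (simp add: under_opp[OF d])
  moreover have "(\<lambda>s. (over (opp H d) s, 1 - \<bar>s\<bar>)) ` {-1..1} = (\<lambda>s. (over d s, 1 - \<bar>s\<bar>)) ` uminus ` {-1..1}"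
    unfolding image_image by (simp add: over_opp[OF d])
  ultimately show ?thesis unfolding crossing_def m by simp
qed

lemma axis_ends_crossing:
  assumes d: "d \<in> darts H" shows "(pt d 0 1, 0) \<in> crossing d" "(pt d (- 1) 0, 0) \<in> crossing d"
proof -
  have s: "1 \<in> {-1..1 :: real}" "-1 \<in> {-1..1 :: real}" by auto
  have u: "(under d 1, 0) \<in> crossing d" "(under d (-1), 0) \<in> crossing d" "(over d 1, 0) \<in> crossing d" "(over d (-1), 0) \<in> crossing d"
    unfolding crossing_def using imageI[OF s(1), of "\<lambda>s. (under d s, 0 :: real)"] imageI[OF s(2), of "\<lambda>s. (under d s, 0 :: real)"]
      imageI[OF s(1), of "\<lambda>s. (over d s, 1 - \<bar>s\<bar>)"] imageI[OF s(2), of "\<lambda>s. (over d s, 1 - \<bar>s\<bar>)"] by simp_all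
  show "(pt d 0 1, 0) \<in> crossing d" "(pt d (- 1) 0, 0) \<in> crossing d"
    using u unfolding over_def under_def by (cases "wt H d = 1"; simp)+
qed

lemma lift_in_disc:
  assumes d: "d \<in> darts H" and x: "x \<in> cball (c d) 1"
  shows "(x, z) \<in> lift \<longleftrightarrow> (x, z) \<in> crossing d"
proof
  assume "(x, z) \<in> crossing d"
  then show "(x, z) \<in> lift" unfolding crossing_def lift_iff using d by auto
next
  assume "(x, z) \<in> lift"
  then consider (arc) d' where "z = 0" "d' \<in> darts H" "x \<in> path_image (\<alpha> d')"
    | (cr) d' where "d' \<in> darts H" "(x, z) \<in> crossing d'" "x \<in> cball (c d') 1"
    unfolding lift_iff crossing_def using over_under_in_cball by (fastforce simp: abs_le_iff)
  then show "(x, z) \<in> crossing d"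
  proof cases
    case cr
    then show ?thesis using same_disc[OF d cr(1) x cr(3)] crossing_opp[OF d] by auto
  next
    case arc
    have *: "(x, z) \<in> crossing d" if d'': "d'' \<in> darts H" "x \<in> cball (c d'') 1" "(x, z) \<in> crossing d''" for d''
      using same_disc[OF d d''(1) x d''(2)] crossing_opp[OF d] d''(3) by auto
    from arc_in_disc[OF arc(2) d arc(3) x] show ?thesis
    proof
      assume "x = pt d' 0 1"
      then show ?thesis using arc(1,2) axis_ends_crossing(1)[OF arc(2)]
        by (intro *[of d']) (auto simp del: mem_cball)
    next
      assume "x = pt (rot H d') (- 1) 0"
      then show ?thesis using arc(1) rot_dart[OF arc(2)] axis_ends_crossing(2)[of "rot H d'"]
        by (intro *[of "rot H d'"]) (auto simp del: mem_cball)
    qed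
  qed
qed

lemma compact_lift: "compact lift"
proof -
  have "lift = (\<Union>d\<in>darts H. path_image (\<alpha> d) \<times> {0}) \<union> (\<Union>d\<in>darts H. crossing d)"
    unfolding medial_lift_def over_eq under_eq crossing_def by auto
  moreover have "compact (path_image (\<alpha> d) \<times> {0 :: real})" if "d \<in> darts H" for d
    by (intro compact_Times compact_path_image arc_imp_path drawingD(5) that) simp
  moreover have "compact (crossing d)" for d
    unfolding crossing_def under_def over_def
    by (cases "wt H d = 1") (auto intro!: compact_Un compact_continuous_image continuous_intros)
  ultimately show ?thesis using finite_darts by (auto intro!: compact_Un compact_UN)
qed

lemma centres_far:
  assumes "d \<in> darts H" "d' \<in> darts H" "c d \<noteq> c d'" shows "2 \<le> dist (c d) (c d')"
proof (rule ccontr)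
  assume "\<not> ?thesis"
  then have *: "dist (c d) (c d') \<le> 2" by simp
  let ?m = "midpoint (c d) (c d')"
  have "?m \<in> cball (c d) 1" "?m \<in> cball (c d') 1" using * by (simp_all add: dist_midpoint)
  then have "d' = d \<or> d' = opp H d" by (rule same_disc[OF assms(1,2)])
  then show False using assms(1,3) opp_centre by auto
qed

lemma fst_lift: "fst ` lift = diagram"
proof
  have st: "over d s \<in> range (pt d 0) \<union> range (\<lambda>s. pt d s 0)" "under d s \<in> range (pt d 0) \<union> range (\<lambda>s. pt d s 0)" for d s
    unfolding over_def under_def by auto
  show "fst ` lift \<subseteq> diagram"
  proof
    fix x assume "x \<in> fst ` lift"
    then obtain z where "(x, z) \<in> lift" by auto
    then consider d where "d \<in> darts H" "x \<in> path_image (\<alpha> d)"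
      | d s where "d \<in> darts H" "\<bar>s\<bar> \<le> 1" "x = under d s" | d s where "d \<in> darts H" "\<bar>s\<bar> \<le> 1" "x = over d s"
      unfolding lift_iff by (fastforce simp: abs_le_iff)
    then show "x \<in> diagram"
    proof cases
      case 1 then show ?thesis unfolding diagram_def by blast
    next
      case (2 d s)
      then have "x \<in> cball (c d) 1" using over_under_in_cball by blast
      then show ?thesis using 2 st(2)[where d=d and s=s] unfolding diagram_def by blast
    next
      case (3 d s)
      then have "x \<in> cball (c d) 1" using over_under_in_cball by blast
      then show ?thesis using 3 st(1)[where d=d and s=s] unfolding diagram_def by blast
    qed
  qed
  show "diagram \<subseteq> fst ` lift"
  proof
    fix x assume "x \<in> diagram"
    then obtain d where d: "d \<in> darts H" and x: "x \<in> path_image (\<alpha> d) \<or> x \<in> range (pt d 0) \<inter> cball (c d) 1 \<or> x \<in> range (\<lambda>s. pt d s 0) \<inter> cball (c d) 1"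
      unfolding diagram_def by blast
    have u: "x \<in> fst ` lift" if "x = under d s" "\<bar>s\<bar> \<le> 1" for s
    proof -
      have "(x, 0) \<in> lift" unfolding that(1) by (rule under_in_lift[OF d that(2)])
      then show ?thesis by force
    qed
    have o: "x \<in> fst ` lift" if "x = over d s" "\<bar>s\<bar> \<le> 1" for s
    proof -
      have "(x, 1 - \<bar>s\<bar>) \<in> lift" unfolding that(1) by (rule over_in_lift[OF d that(2)])
      then show ?thesis by force
    qed
    from x show "x \<in> fst ` lift"
    proof (elim disjE)
      assume "x \<in> path_image (\<alpha> d)"
      then have "(x, 0) \<in> lift" unfolding lift_iff using d by blast
      then show ?thesis by force
    next
      assume "x \<in> range (pt d 0) \<inter> cball (c d) 1"
      then obtain s where s: "x = pt d 0 s" "\<bar>s\<bar> \<le> 1" using d by (auto simp del: mem_cball)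
      show ?thesis
      proof (cases "wt H d = 1")
        case True then show ?thesis using o[of "- s"] s by (simp add: over_def)
      next
        case False then show ?thesis using u[of s] s by (simp add: under_def)
      qed
    next
      assume "x \<in> range (\<lambda>s. pt d s 0) \<inter> cball (c d) 1"
      then obtain s where s: "x = pt d s 0" "\<bar>s\<bar> \<le> 1" using d by (auto simp del: mem_cball)
      show ?thesis
      proof (cases "wt H d = 1")
        case True then show ?thesis using u[of s] s by (simp add: under_def)
      next
        case False then show ?thesis using o[of s] s by (simp add: over_def)
      qed
    qed
  qed
qed

lemma over_under_eq_iff:
  assumes d: "d \<in> darts H"
  shows "over d s = under d t \<longleftrightarrow> s = 0 \<and> t = 0" "over d s = over d t \<longleftrightarrow> s = t" "under d s = under d t \<longleftrightarrow> s = t"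
    "over d s = c d \<longleftrightarrow> s = 0" "under d s = c d \<longleftrightarrow> s = 0"
proof -
  have c: "c d = pt d 0 0" by (simp add: pt_def)
  show "over d s = under d t \<longleftrightarrow> s = 0 \<and> t = 0" "over d s = over d t \<longleftrightarrow> s = t" "under d s = under d t \<longleftrightarrow> s = t"
    "over d s = c d \<longleftrightarrow> s = 0" "under d s = c d \<longleftrightarrow> s = 0"
    unfolding c over_def under_def using pt_eq_iff[OF d] by auto
qed

lemma norm_over_dir: "d \<in> darts H \<Longrightarrow> norm (over_dir H u d) = 1"
  using norm_strand1[of d] by (simp add: over_dir_eq strand2_eq norm_mult)

text \<open>This is the condition \<open>crossing_at\<close>, with \<open>over_dir\<close> as the unit vector.\<close>

lemma crossing_coordinates:
  assumes d: "d \<in> darts H" and st: "norm (Complex s t) \<le> 1"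
  shows "(c d + Complex s t * over_dir H u d, z) \<in> lift \<longleftrightarrow> s = 0 \<and> z = 0 \<or> t = 0 \<and> z = 1 - \<bar>s\<bar>"
proof -
  let ?v = "over_dir H u d" and ?x = "c d + Complex s t * over_dir H u d"
  have v0: "?v \<noteq> 0" using norm_over_dir[OF d] by auto
  have s1: "\<bar>s\<bar> \<le> 1" "\<bar>t\<bar> \<le> 1" using abs_Re_le_cmod[of "Complex s t"] abs_Im_le_cmod[of "Complex s t"] st by auto
  have x: "?x \<in> cball (c d) 1" using st norm_over_dir[OF d] by (simp add: dist_norm norm_mult)
  have eqU: "?x = under d r \<longleftrightarrow> s = 0 \<and> t = r" for r
  proof -
    have "?x = under d r \<longleftrightarrow> Complex s t * ?v = (r *\<^sub>R \<i>) * ?v" unfolding under_eq[symmetric] by simp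
    also have "\<dots> \<longleftrightarrow> Complex s t = r *\<^sub>R \<i>" unfolding mult_cancel_right using v0 by blast
    also have "\<dots> \<longleftrightarrow> s = 0 \<and> t = r" by (simp add: complex_eq_iff)
    finally show ?thesis .
  qed
  have eqO: "?x = over d r \<longleftrightarrow> s = r \<and> t = 0" for r
  proof -
    have "?x = over d r \<longleftrightarrow> Complex s t * ?v = of_real r * ?v" unfolding over_eq[symmetric] by (simp add: scaleR_conv_of_real)
    also have "\<dots> \<longleftrightarrow> Complex s t = of_real r" unfolding mult_cancel_right using v0 by blast
    also have "\<dots> \<longleftrightarrow> s = r \<and> t = 0" by (simp add: complex_eq_iff)
    finally show ?thesis .
  qed
  have "(?x, z) \<in> lift \<longleftrightarrow> (?x, z) \<in> crossing d" by (rule lift_in_disc[OF d x])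
  also have "\<dots> \<longleftrightarrow> (\<exists>r\<in>{-1..1}. ?x = under d r \<and> z = 0) \<or> (\<exists>r\<in>{-1..1}. ?x = over d r \<and> z = 1 - \<bar>r\<bar>)"
    unfolding crossing_def by auto
  also have "\<dots> \<longleftrightarrow> s = 0 \<and> z = 0 \<or> t = 0 \<and> z = 1 - \<bar>s\<bar>"
    unfolding eqU eqO using s1 by (auto simp: abs_le_iff)
  finally show ?thesis .
qed

lemma disc_coordinates:
  assumes d: "d \<in> darts H" and x: "norm (x - c d) \<le> r"
  shows "\<exists>s t. x = c d + Complex s t * over_dir H u d \<and> norm (Complex s t) \<le> r"
proof -
  let ?z = "(x - c d) / over_dir H u d"
  have v: "norm (over_dir H u d) = 1" by (rule norm_over_dir[OF d])
  then have "over_dir H u d \<noteq> 0" by auto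
  then have "x = c d + ?z * over_dir H u d" by simp
  moreover have "norm ?z \<le> r" using x v by (simp add: norm_divide)
  ultimately show ?thesis by (intro exI[of _ "Re ?z"] exI[of _ "Im ?z"]) simp
qed

theorem projected_link_lift:
  assumes ne: "darts H \<noteq> {}"
  shows "projected_link lift (c ` darts H)" "\<exists>q. q \<in> diagram \<and> q \<notin> c ` darts H"
proof -
  show "projected_link lift (c ` darts H)"
  proof
    show "compact lift" by (rule compact_lift)
    show "finite (c ` darts H)" using finite_darts by simp
    show "x \<in> c ` darts H" if xz: "(x, z) \<in> lift" "(x, z') \<in> lift" "z \<noteq> z'" for x z z'
    proof -
      have *: "x \<in> c ` darts H" if h: "(x, z) \<in> lift" "(x, z') \<in> lift" "z \<noteq> z'" "z \<noteq> 0" for z z'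
      proof -
        obtain d s where d: "d \<in> darts H" "s \<in> {-1..1}" "x = over d s" "z = 1 - \<bar>s\<bar>" using h(1,4) unfolding lift_iff by blast
        have x: "x = c d + Complex s 0 * over_dir H u d" unfolding d(3) over_eq[symmetric]
          by (simp add: complex_of_real_def scaleR_conv_of_real)
        have n: "norm (Complex s 0) \<le> 1" using d(2) by (auto simp: cmod_def)
        have "s = 0 \<and> z' = 0 \<or> z' = 1 - \<bar>s\<bar>" using crossing_coordinates[OF d(1) n, of z'] h(2) unfolding x by simp
        then have "s = 0" using h(3) d(4) by auto
        then have "x = c d" using over_under_eq_iff(4)[OF d(1)] d(3) by blast
        then show ?thesis using d(1) by blast
      qed
      show ?thesis
      proof (cases "z = 0")
        case True
        then have "z' \<noteq> z" "z' \<noteq> 0" using xz(3) by auto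
        then show ?thesis by (rule *[OF xz(2,1)])
      qed (rule *[OF xz])
    qed
    show "(x, z) \<in> lift \<longleftrightarrow> z = 0 \<or> z = 1" if xc: "x \<in> c ` darts H" for x z
    proof -
      obtain d where d: "d \<in> darts H" "x = c d" using xc by blast
      have "Complex 0 0 = 0" by (simp add: complex_eq_iff)
      then show ?thesis using crossing_coordinates[OF d(1), of 0 0 z] d(2) by simp
    qed
    show "(x, z) \<notin> lift" if k: "k \<in> c ` darts H" "0 < z" "norm (x - k) + z < 1" for k x z
    proof -
      obtain d where d: "d \<in> darts H" "k = c d" using k(1) by blast
      obtain s t where st: "x = c d + Complex s t * over_dir H u d" "norm (Complex s t) \<le> norm (x - k)"
        using disc_coordinates[OF d(1), of x "norm (x - k)"] unfolding d(2) by blast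
      have "\<bar>s\<bar> \<le> norm (Complex s t)" using abs_Re_le_cmod[of "Complex s t"] by simp
      then have "\<bar>s\<bar> + z < 1" "norm (Complex s t) \<le> 1" using st(2) k(2,3) by linarith+
      then show ?thesis using crossing_coordinates[OF d(1), of s t z] k(2) unfolding st(1) by auto
    qed
    show "2 \<le> dist k k'" if "k \<in> c ` darts H" "k' \<in> c ` darts H" "k \<noteq> k'" for k k'
      using that centres_far by blast
  qed
  obtain d where d: "d \<in> darts H" using ne by blast
  let ?q = "pt d (1/2) 0"
  have "?q \<in> diagram" using diagram_in_disc[OF d, of "1/2" 0] by (simp add: power2_eq_square)
  moreover have "?q \<notin> c ` darts H"
  proof
    assume "?q \<in> c ` darts H"
    then obtain d' where d': "d' \<in> darts H" "?q = c d'" by blast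
    have 1: "dist (c d) ?q = 1/2" using dist_pt[OF d, of "1/2" 0] by (simp add: real_sqrt_abs)
    then have "c d \<noteq> c d'" using d'(2) by auto
    then show False using centres_far[OF d d'(1)] 1 d'(2) by simp
  qed
  ultimately show "\<exists>q. q \<in> diagram \<and> q \<notin> c ` darts H" by blast
qed

end

section \<open>The cover of a medial diagram\<close>

locale medial_cover =
  medial_diagram H c u \<alpha> + based_link_cover "medial_lift H c u \<alpha>" "c ` darts H" X p L e f e' f' ninf zinf a
  for H :: "'d plane_graph" and c u :: "'d \<Rightarrow> complex" and \<alpha> :: "'d \<Rightarrow> real \<Rightarrow> complex"
    and X :: "'a::topological_space set" and p :: "'a \<Rightarrow> R4" and L e f e' f' ninf zinf a
begin

lemma proj_eq: "proj = diagram"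
  unfolding proj_def by (rule fst_lift)

lemma crossing_at_dart: "d \<in> darts H \<Longrightarrow> crossing_at (c d) (over_dir H u d)"
  unfolding crossing_at_def using norm_over_dir crossing_coordinates by auto

lemma corner_eq: "corner (c d) (over_dir H u d) s t = (if wt H d = 1 then pt d (t / 2) (- s / 2) else pt d (s / 2) (t / 2))"
  by (auto simp: corner_def over_dir_eq pt_def strand2_eq complex_eq_iff algebra_simps)

lemma tail_opp: "d \<in> darts H \<Longrightarrow> tail_corner (opp H d) = pt d (1/2) (- 1/2)"
  and left_opp: "d \<in> darts H \<Longrightarrow> left_corner (opp H d) = pt d (- 1/2) (- 1/2)"
  by (simp_all add: tail_corner_def left_corner_def pt_opp)

text \<open>Numbering the corners from the direction of the over-strand, black and white corners
  exchange their places when the sign changes.\<close>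

lemma corner_cases:
  assumes d: "d \<in> darts H"
  shows "wt H d = 1 \<Longrightarrow> corner (c d) (over_dir H u d) 1 1 = tail_corner (opp H d)"
    "wt H d = 1 \<Longrightarrow> corner (c d) (over_dir H u d) (-1) 1 = left_corner d"
    "wt H d = 1 \<Longrightarrow> corner (c d) (over_dir H u d) (-1) (-1) = tail_corner d"
    "wt H d = 1 \<Longrightarrow> corner (c d) (over_dir H u d) 1 (-1) = left_corner (opp H d)"
    "wt H d \<noteq> 1 \<Longrightarrow> corner (c d) (over_dir H u d) 1 1 = left_corner d"
    "wt H d \<noteq> 1 \<Longrightarrow> corner (c d) (over_dir H u d) (-1) 1 = tail_corner d"
    "wt H d \<noteq> 1 \<Longrightarrow> corner (c d) (over_dir H u d) (-1) (-1) = left_corner (opp H d)"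
    "wt H d \<noteq> 1 \<Longrightarrow> corner (c d) (over_dir H u d) 1 (-1) = tail_corner (opp H d)"
  unfolding corner_eq tail_opp[OF d] left_opp[OF d] by (simp_all add: tail_corner_def left_corner_def)

text \<open>The elements of the regions, as labels of darts: each vertex or face has one label for every
  upper sheet, repeated at all of its corners.\<close>

definition black :: "'d \<Rightarrow> bool \<Rightarrow> (real \<Rightarrow> 'a) set" where "black d i = transition i (tail_corner d)"
definition white :: "'d \<Rightarrow> bool \<Rightarrow> (real \<Rightarrow> 'a) set" where "white d i = transition i (left_corner d)"

lemma corners_off_proj:
  assumes d: "d \<in> darts H" shows "tail_corner d \<notin> proj" "left_corner d \<notin> proj"
  unfolding proj_eq tail_corner_def left_corner_def
  using diagram_in_disc[OF d, of "- 1/2" "1/2"] diagram_in_disc[OF d, of "1/2" "1/2"] by (simp_all add: power2_eq_square)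

lemma labels_carrier [simp]: "d \<in> darts H \<Longrightarrow> black d i \<in> carrier \<pi>" "d \<in> darts H \<Longrightarrow> white d i \<in> carrier \<pi>"
  unfolding black_def white_def using corners_off_proj transition_carrier by blast+

lemma same_side_component:
  assumes "connected_component (- diagram) x y" shows "same_side x y"
proof -
  have "open (- diagram)" using closed_proj unfolding proj_eq by (simp add: open_Compl)
  then have "path_component (- diagram) x y" using assms by (simp only: open_path_connected_component)
  then obtain g where g: "path g" "path_image g \<subseteq> - diagram" "pathstart g = x" "pathfinish g = y"
    unfolding path_component_def by blast
  have pc: "path_connected (path_image g)" by (rule path_connected_path_image[OF g(1)])
  have d: "path_image g \<inter> proj = {}" using g(2) unfolding proj_eq by blast
  have xy: "x \<in> path_image g" "y \<in> path_image g" using g(3,4) pathstart_in_path_image[of g] pathfinish_in_path_image[of g] by auto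
  show ?thesis unfolding same_side_def
    using colour_connected[OF path_connected_imp_connected[OF pc] d xy] transition_connected[OF pc d xy] by blast
qed

lemma tail_rot: "d \<in> darts H \<Longrightarrow> same_side (tail_corner d) (tail_corner (rot H d))"
  and left_opp_rot: "d \<in> darts H \<Longrightarrow> same_side (left_corner d) (left_corner (opp H (rot H d)))"
  by (rule same_side_component, rule corners_along_arc, assumption)+

lemma black_rot: "d \<in> darts H \<Longrightarrow> black (rot H d) i = black d i"
  and white_opp_rot: "d \<in> darts H \<Longrightarrow> white (opp H (rot H d)) i = white d i"
  using tail_rot left_opp_rot unfolding black_def white_def same_side_def by auto

lemma adjacent_left:
  assumes d: "d \<in> darts H"
  shows "adjacent_sides (left_corner d) (tail_corner d)" "adjacent_sides (left_corner d) (tail_corner (opp H d))"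
proof -
  note cr = crossing_at_dart[OF d] and cc = corner_cases[OF d]
  show "adjacent_sides (left_corner d) (tail_corner d)"
  proof (cases "wt H d = 1")
    case True
    show ?thesis using adjacent_corners(1)[OF cr, of "-1"] unfolding cc(2,3)[OF True] by simp
  next
    case False
    show ?thesis using adjacent_corners(2)[OF cr, of 1] unfolding cc(5,6)[OF False] by simp
  qed
  show "adjacent_sides (left_corner d) (tail_corner (opp H d))"
  proof (cases "wt H d = 1")
    case True
    show ?thesis using adjacent_sides_sym[OF adjacent_corners(2)[OF cr, of 1]] unfolding cc(1,2)[OF True] by simp
  next
    case False
    show ?thesis using adjacent_corners(1)[OF cr, of 1] unfolding cc(5,8)[OF False] by simp
  qed
qed

lemma adjacent_black_white:
  assumes d: "d \<in> darts H"
  shows "inv\<pi> black d (\<not> i) \<cdot> white d (\<not> i) = inv\<pi> white d i \<cdot> black d i"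
    "inv\<pi> white d (\<not> i) \<cdot> black d (\<not> i) = inv\<pi> black d i \<cdot> white d i"
    "inv\<pi> black (opp H d) (\<not> i) \<cdot> white d (\<not> i) = inv\<pi> white d i \<cdot> black (opp H d) i"
    "inv\<pi> white d (\<not> i) \<cdot> black (opp H d) (\<not> i) = inv\<pi> black (opp H d) i \<cdot> white d i"
proof -
  have alg: "inv\<pi> h \<cdot> k = inv\<pi> g \<cdot> l" if "g \<in> carrier \<pi>" "h \<in> carrier \<pi>" "k \<in> carrier \<pi>" "l \<in> carrier \<pi>"
    "g \<cdot> inv\<pi> h \<cdot> k \<cdot> inv\<pi> l = \<one>\<^bsub>\<pi>\<^esub>" for g h k l
  proof -
    have "g \<cdot> inv\<pi> h \<cdot> k = l"
      using that by (metis inv_closed inv_equality inv_inv m_closed)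
    then show ?thesis using that(1-4) by (auto simp: m_assoc inv_cancel)
  qed
  note od = opp_dart[OF d]
  note a = adjacent_left[OF d, unfolded adjacent_sides_def, folded black_def white_def, THEN conjunct2]
  note a11 = a(1)[THEN conjunct1, THEN spec, of i] and a12 = a(1)[THEN conjunct2, THEN spec, of i]
    and a21 = a(2)[THEN conjunct1, THEN spec, of i] and a22 = a(2)[THEN conjunct2, THEN spec, of i]
  have car: "black d j \<in> carrier \<pi>" "white d j \<in> carrier \<pi>" "black (opp H d) j \<in> carrier \<pi>" for j using d od by simp_all
  show "inv\<pi> black d (\<not> i) \<cdot> white d (\<not> i) = inv\<pi> white d i \<cdot> black d i"
    by (rule alg[OF car(2) car(1) car(2) car(1) a11])
  show "inv\<pi> white d (\<not> i) \<cdot> black d (\<not> i) = inv\<pi> black d i \<cdot> white d i"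
    by (rule alg[OF car(1) car(2) car(1) car(2) a12])
  show "inv\<pi> black (opp H d) (\<not> i) \<cdot> white d (\<not> i) = inv\<pi> white d i \<cdot> black (opp H d) i"
    by (rule alg[OF car(2) car(3) car(2) car(3) a21])
  show "inv\<pi> white d (\<not> i) \<cdot> black (opp H d) (\<not> i) = inv\<pi> black (opp H d) i \<cdot> white d i"
    by (rule alg[OF car(3) car(2) car(3) car(2) a22])
qed

text \<open>The crossing relation, in which adjacency of the sides of a strand is used to replace the
  labels of the other upper sheet.\<close>

theorem black_opp:
  assumes d: "d \<in> darts H"
  shows "black (opp H d) i = (if wt H d = 1 then white d i \<cdot> inv\<pi> white (opp H d) i else white (opp H d) i \<cdot> inv\<pi> white d i) \<cdot> black d i"
proof -
  note od = opp_dart[OF d]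
  note cr = crossing_relation[OF crossing_at_dart[OF d], of i]
  have car [simp]: "black d i \<in> carrier \<pi>" "white d i \<in> carrier \<pi>" "black (opp H d) i \<in> carrier \<pi>" "white (opp H d) i \<in> carrier \<pi>"
    using d od by auto
  have alg: "g = h \<cdot> (inv\<pi> k \<cdot> l)" if g: "g \<in> carrier \<pi>" "h \<in> carrier \<pi>" "k \<in> carrier \<pi>" "l \<in> carrier \<pi>"
    "inv\<pi> g \<cdot> h \<cdot> (inv\<pi> k \<cdot> l) = \<one>\<^bsub>\<pi>\<^esub>" for g h k l
  proof -
    have "inv\<pi> g \<cdot> (h \<cdot> (inv\<pi> k \<cdot> l)) = \<one>\<^bsub>\<pi>\<^esub>" using g by (simp add: m_assoc)
    then have "g \<cdot> (inv\<pi> g \<cdot> (h \<cdot> (inv\<pi> k \<cdot> l))) = g" using g by simp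
    then show ?thesis using g by (simp add: inv_cancel)
  qed
  show ?thesis
  proof (cases "wt H d = 1")
    case True
    have "inv\<pi> black (opp H d) i \<cdot> white d i \<cdot> (inv\<pi> black d (\<not> i) \<cdot> white (opp H d) (\<not> i)) = \<one>\<^bsub>\<pi>\<^esub>"
      using cr unfolding corner_cases(1-4)[OF d True] black_def white_def .
    also have "inv\<pi> black d (\<not> i) \<cdot> white (opp H d) (\<not> i) = inv\<pi> white (opp H d) i \<cdot> black d i"
      using adjacent_black_white(3)[OF od, of i] by (simp add: opp_opp[OF d])
    finally have "black (opp H d) i = white d i \<cdot> (inv\<pi> white (opp H d) i \<cdot> black d i)" by (intro alg) simp_all
    then show ?thesis using True by (simp add: m_assoc)
  next
    case False
    have "inv\<pi> white d i \<cdot> black d i \<cdot> (inv\<pi> white (opp H d) (\<not> i) \<cdot> black (opp H d) (\<not> i)) = \<one>\<^bsub>\<pi>\<^esub>"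
      using cr unfolding corner_cases(5-8)[OF d False] black_def white_def .
    also have "inv\<pi> white (opp H d) (\<not> i) \<cdot> black (opp H d) (\<not> i) = inv\<pi> black (opp H d) i \<cdot> white (opp H d) i"
      by (rule adjacent_black_white(2)[OF od])
    finally have "white d i = black d i \<cdot> (inv\<pi> black (opp H d) i \<cdot> white (opp H d) i)" by (intro alg) simp_all
    then have "black (opp H d) i \<cdot> (inv\<pi> black d i \<cdot> white d i) = white (opp H d) i" by (simp add: inv_cancel)
    then have "white (opp H d) i \<cdot> inv\<pi> white d i \<cdot> black d i =
       black (opp H d) i \<cdot> (inv\<pi> black d i \<cdot> white d i) \<cdot> inv\<pi> white d i \<cdot> black d i" by (simp only:)
    also have "\<dots> = black (opp H d) i" by (simp add: m_assoc inv_cancel)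
    finally show ?thesis using False by simp
  qed
qed

lemma centre_in_disc:
  assumes "d \<in> darts H" "d' \<in> darts H" "c d' \<in> cball (c d) 1" shows "c d' = c d"
  using same_disc[OF assms(1,2,3)] opp_centre[OF assms(1)] by auto

lemma outer_segments_off_centres:
  assumes d: "d \<in> darts H"
  shows "outer1 d \<subseteq> proj - c ` darts H" "outer2 d \<subseteq> proj - c ` darts H" "path_image (\<alpha> d) \<subseteq> proj - c ` darts H"
proof -
  have c0: "c d = pt d 0 0" if "d \<in> darts H" for d by (simp add: pt_def)
  have ax: "pt d s t \<in> proj - c ` darts H" if d: "d \<in> darts H" and st: "s = 0 \<and> 0 < \<bar>t\<bar> \<and> \<bar>t\<bar> \<le> 1 \<or> t = 0 \<and> 0 < \<bar>s\<bar> \<and> \<bar>s\<bar> \<le> 1" for d s t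
  proof
    have n: "s\<^sup>2 + t\<^sup>2 \<le> 1" using st by (auto simp: abs_square_le_1)
    then show "pt d s t \<in> proj" unfolding proj_eq using diagram_in_disc[OF d] st by blast
    show "pt d s t \<notin> c ` darts H"
    proof
      assume "pt d s t \<in> c ` darts H"
      then obtain d' where d': "d' \<in> darts H" "c d' = pt d s t" by force
      have "c d' \<in> cball (c d) 1" unfolding d'(2) pt_in_cball[OF d] by (rule n)
      from centre_in_disc[OF d d'(1) this] have "pt d s t = pt d 0 0" using d'(2) c0[OF d] by simp
      then show False using pt_eq_iff[OF d] st by auto
    qed
  qed
  show "outer1 d \<subseteq> proj - c ` darts H" "outer2 d \<subseteq> proj - c ` darts H"
    unfolding pieces_eq by (intro image_subsetI ax[OF d]; simp add: abs_if)+
  show "path_image (\<alpha> d) \<subseteq> proj - c ` darts H"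
  proof
    fix x assume x: "x \<in> path_image (\<alpha> d)"
    have "x \<in> proj" unfolding proj_eq diagram_def using d x by blast
    moreover have "x \<notin> c ` darts H"
    proof
      assume "x \<in> c ` darts H"
      then obtain d' where d': "d' \<in> darts H" "x = c d'" by blast
      have "x = pt d 0 1 \<or> x = pt (rot H d) (- 1) 0"
        by (rule arc_in_disc[OF d d'(1) x]) (simp add: d'(2))
      moreover have "pt d 0 1 \<notin> c ` darts H" using ax[OF d, of 0 1] by auto
      moreover have "pt (rot H d) (- 1) 0 \<notin> c ` darts H" using ax[OF rot_dart[OF d], of "-1" 0] by auto
      moreover have "x \<in> c ` darts H" using d' by blast
      ultimately show False by metis
    qed
    ultimately show "x \<in> proj - c ` darts H" by blast
  qed
qed

text \<open>Matching at the four corners of a crossing spreads over its disc, and from there along the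
  arcs.\<close>

lemma good_near_diagram:
  assumes g: "\<And>d. d \<in> darts H \<Longrightarrow> good Dp Dm (tail_corner d) \<and> good Dp Dm (left_corner d)"
    and q: "q \<in> proj" "q \<notin> c ` darts H"
  shows "good_near Dp Dm q"
proof -
  have disc: "good_near Dp Dm y" if d: "d \<in> darts H" and y: "y \<in> ball (c d) 1" for d y
  proof (rule good_near_strands[OF crossing_at_dart[OF d] _ y])
    fix s t :: real assume st: "s \<in> {1, -1}" "t \<in> {1, -1}"
    note gd = g[OF d] g[OF opp_dart[OF d]]
    show "good Dp Dm (corner (c d) (over_dir H u d) s t)"
    proof (cases "wt H d = 1")
      case True
      show ?thesis using st gd corner_cases(1-4)[OF d True] by (elim insertE emptyE) simp_all
    next
      case False
      show ?thesis using st gd corner_cases(5-8)[OF d False] by (elim insertE emptyE) simp_all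
    qed
  qed
  have in_ball: "pt d s t \<in> ball (c d) 1" if "d \<in> darts H" "s\<^sup>2 + t\<^sup>2 < 1" for d s t
    using that by (simp add: dist_pt)
  have o1: "good_near Dp Dm y" if d: "d \<in> darts H" and y: "y \<in> outer1 d" for d y
  proof (rule good_near_connected[OF _ outer_segments_off_centres(1)[OF d] _ _ y])
    show "connected (outer1 d)" unfolding outer1_def by simp
    show "pt d (- 1/2) 0 \<in> outer1 d" unfolding outer1_def by simp
    show "good_near Dp Dm (pt d (- 1/2) 0)"
      by (rule disc[OF d in_ball[OF d]]) (simp add: power2_eq_square)
  qed
  have o2: "good_near Dp Dm y" if d: "d \<in> darts H" and y: "y \<in> outer2 d \<union> path_image (\<alpha> d)" for d y
  proof (rule good_near_connected[OF _ _ _ _ y])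
    have e: "pt d 0 1 \<in> outer2 d" unfolding outer2_def by simp
    moreover have "pt d 0 1 \<in> path_image (\<alpha> d)" using drawingD(6)[OF d] pathstart_in_path_image[of "\<alpha> d"] by simp
    ultimately show "connected (outer2 d \<union> path_image (\<alpha> d))"
      using connected_path_image[OF arc_imp_path[OF drawingD(5)[OF d]]] unfolding outer2_def
      by (intro connected_Un) auto
    show "outer2 d \<union> path_image (\<alpha> d) \<subseteq> proj - c ` darts H" using outer_segments_off_centres[OF d] by blast
    show "pt d 0 (1/2) \<in> outer2 d \<union> path_image (\<alpha> d)" unfolding outer2_def by simp
    show "good_near Dp Dm (pt d 0 (1/2))"
      by (rule disc[OF d in_ball[OF d]]) (simp add: power2_eq_square)
  qed
  obtain d where d: "d \<in> darts H" and x: "q \<in> path_image (\<alpha> d) \<or> q \<in> outer1 d \<or> q \<in> outer2 d \<or> q \<in> inner1 d \<or> q \<in> inner2 d"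
    using q(1) unfolding proj_eq diagram_pieces by blast
  have i1: "q \<in> ball (c d) 1" if qi: "q \<in> inner1 d \<or> q \<in> inner2 d"
  proof -
    obtain s where "s \<in> {-1/2..1/2}" and s2: "q = pt d s 0 \<or> q = pt d 0 s"
      using qi unfolding pieces_eq by blast
    then have s: "\<bar>s\<bar> \<le> 1/2" "q = pt d s 0 \<or> q = pt d 0 s" by (auto simp: abs_le_iff)
    have "s\<^sup>2 \<le> (1/2)\<^sup>2" using s(1) by (intro abs_le_square_iff[THEN iffD1]) simp
    then have "s\<^sup>2 < 1" by (simp add: power2_eq_square)
    then show ?thesis using s(2) in_ball[OF d, of s 0] in_ball[OF d, of 0 s] by auto
  qed
  from x show ?thesis using o1[OF d] o2[OF d] disc[OF d] i1 by blast
qed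

text \<open>Adjacency, written for the action on a subset that the labels of one upper sheet fix.\<close>

lemma trans_exchange:
  assumes D: "D \<subseteq> carrier \<pi>"
    and c: "b \<in> carrier \<pi>" "b' \<in> carrier \<pi>" "w \<in> carrier \<pi>" "w' \<in> carrier \<pi>" "b0 \<in> carrier \<pi>" "w0 \<in> carrier \<pi>"
    and ex: "inv\<pi> b' \<cdot> w' = inv\<pi> w \<cdot> b"
    and f: "trans (b \<cdot> inv\<pi> b0) D = D" "trans (w \<cdot> inv\<pi> w0) D = D"
  shows "trans (w' \<cdot> inv\<pi> b0) D = trans (b' \<cdot> inv\<pi> w0) D"
proof -
  have w': "w' = b' \<cdot> (inv\<pi> w \<cdot> b)" unfolding ex[symmetric] using c by (simp add: inv_cancel)
  have "trans (w' \<cdot> inv\<pi> b0) D = trans (b' \<cdot> inv\<pi> w) (trans (b \<cdot> inv\<pi> b0) D)"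
    using c D by (subst trans_trans) (simp_all add: w' m_assoc)
  also have "\<dots> = trans (b' \<cdot> inv\<pi> w) (trans (w \<cdot> inv\<pi> w0) D)" unfolding f ..
  also have "\<dots> = trans (b' \<cdot> inv\<pi> w0) D"
    using c D by (subst trans_trans) (simp_all add: m_assoc inv_cancel)
  finally show ?thesis .
qed

text \<open>Attach \<open>D\<close> to the upper sheet \<open>True\<close>. Its labels then force the subsets of the lower sheets,
  which are \<open>B0\<inverse> D\<close> and \<open>W0\<inverse> D\<close> by assumption, and adjacency with connectedness of the graph
  shows that every region forces the same subset \<open>T d\<close> for the other upper sheet. So the
  four subsets match over all regions, and \<open>good_everywhere_fixed\<close> applies.\<close>

theorem fixed_by_regions_imp_fixed:
  assumes d0: "d0 \<in> darts H"
    and conn: "\<And>S. d0 \<in> S \<Longrightarrow> (\<And>d. d \<in> S \<Longrightarrow> d \<in> darts H \<Longrightarrow> rot H d \<in> S \<and> opp H d \<in> S) \<Longrightarrow> darts H \<subseteq> S"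
    and D: "D \<subseteq> carrier \<pi>"
    and BD: "\<And>d. d \<in> darts H \<Longrightarrow> trans (black d True \<cdot> inv\<pi> black d0 True) D = D"
    and WD: "\<And>d. d \<in> darts H \<Longrightarrow> trans (white d True \<cdot> inv\<pi> white d0 True) D = D"
    and g: "g \<in> carrier \<pi>"
  shows "trans g D = D"
proof -
  note od = opp_dart and car = labels_carrier
  define \<kappa> where "\<kappa> = colour (tail_corner d0)"
  have coll: "colour (left_corner d) \<longleftrightarrow> \<not> colour (tail_corner d)" "colour (left_corner d) \<longleftrightarrow> \<not> colour (tail_corner (opp H d))"
    if "d \<in> darts H" for d
    using adjacent_left[OF that] unfolding adjacent_sides_def by auto
  have "darts H \<subseteq> {d. colour (tail_corner d) = \<kappa>}"
  proof (rule conn)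
    fix d assume d: "d \<in> {d. colour (tail_corner d) = \<kappa>}" "d \<in> darts H"
    then show "rot H d \<in> {d. colour (tail_corner d) = \<kappa>} \<and> opp H d \<in> {d. colour (tail_corner d) = \<kappa>}"
      using tail_rot[OF d(2)] coll[OF d(2)] unfolding same_side_def by auto
  qed (simp add: \<kappa>_def)
  then have ct: "colour (tail_corner d) = \<kappa>" "colour (left_corner d) = (\<not> \<kappa>)" if "d \<in> darts H" for d
    using that coll[OF that] by auto
  define B0 W0 where "B0 = black d0 True" and "W0 = white d0 True"
  have c0: "B0 \<in> carrier \<pi>" "W0 \<in> carrier \<pi>" unfolding B0_def W0_def using car[OF d0] by auto
  \<comment> \<open>the subset that the region at \<open>d\<close> forces for the upper sheet \<open>False\<close>\<close>
  define T where "T d = trans (black d False \<cdot> inv\<pi> W0) D" for d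
  have TW: "trans (white d False \<cdot> inv\<pi> B0) D = T d" "trans (white d False \<cdot> inv\<pi> B0) D = T (opp H d)"
    if d: "d \<in> darts H" for d
  proof -
    note f = BD[OF d, folded B0_def] BD[OF od[OF d], folded B0_def] WD[OF d, folded W0_def]
    note ad = adjacent_black_white(1,3)[OF d, of True, unfolded not_True_eq_False]
    show "trans (white d False \<cdot> inv\<pi> B0) D = T d" unfolding T_def
      by (rule trans_exchange[OF D car(1)[OF d] car(1)[OF d] car(2)[OF d] car(2)[OF d] c0 ad(1) f(1,3)])
    show "trans (white d False \<cdot> inv\<pi> B0) D = T (opp H d)" unfolding T_def
      by (rule trans_exchange[OF D car(1)[OF od[OF d]] car(1)[OF od[OF d]] car(2)[OF d] car(2)[OF d] c0 ad(2) f(2,3)])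
  qed
  have "darts H \<subseteq> {d. T d = T d0}"
  proof (rule conn)
    fix d assume d: "d \<in> {d. T d = T d0}" "d \<in> darts H"
    have "T (rot H d) = T d" unfolding T_def black_rot[OF d(2)] ..
    moreover have "T (opp H d) = T d" using TW[OF d(2)] by simp
    ultimately show "rot H d \<in> {d. T d = T d0} \<and> opp H d \<in> {d. T d = T d0}" using d(1) by simp
  qed simp
  then have T: "T d = T d0" if "d \<in> darts H" for d using that by blast
  define Dm where "Dm j = (if j = \<kappa> then trans (inv\<pi> B0) D else trans (inv\<pi> W0) D)" for j
  define Dp where "Dp i = (if i then D else T d0)" for i
  have tt: "trans x (trans (inv\<pi> y) D) = trans (x \<cdot> inv\<pi> y) D" if "x \<in> carrier \<pi>" "y \<in> carrier \<pi>" for x y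
    by (rule trans_trans[OF that(1) inv_closed[OF that(2)] D])
  have good: "good Dp Dm (tail_corner d) \<and> good Dp Dm (left_corner d)" if d: "d \<in> darts H" for d
  proof -
    have "Dp i = trans (black d i) (Dm (i = \<kappa>))" for i
      using T[OF d] BD[OF d, folded B0_def] c0 car[OF d]
      by (cases i; cases \<kappa>) (simp_all add: Dp_def Dm_def tt T_def)
    moreover have "Dp i = trans (white d i) (Dm (i = (\<not> \<kappa>)))" for i
      using T[OF d] TW(1)[OF d] WD[OF d, folded W0_def] c0 car[OF d]
      by (cases i; cases \<kappa>) (simp_all add: Dp_def Dm_def tt)
    ultimately show ?thesis unfolding good_def black_def white_def ct[OF d] by blast
  qed
  have Dsub: "Dp i \<subseteq> carrier \<pi>" "Dm j \<subseteq> carrier \<pi>" for i j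
    unfolding Dp_def Dm_def T_def using D c0 car[OF d0] trans_carrier by auto
  have "good Dp Dm x" if "x \<notin> proj" for x
    by (rule good_near_everywhere[OF good_near_diagram[OF good] that])
  from good_everywhere_fixed[OF Dsub this g, of True] show ?thesis by (simp add: Dp_def)
qed

end

section \<open>Weighted graphs and wheels\<close>

text \<open>By the last condition an edge of weight \<open>0\<close> is followed, at its end, by an edge of another
  weight; so its contraction takes a single step.\<close>

locale weighted_graph =
  fixes G :: "'d plane_graph"
  assumes finite: "finite (darts G)"
    and rot_in: "d \<in> darts G \<Longrightarrow> rot G d \<in> darts G"
    and opp_in: "d \<in> darts G \<Longrightarrow> opp G d \<in> darts G"
    and opp_opp: "d \<in> darts G \<Longrightarrow> opp G (opp G d) = d"
    and wt_opp: "d \<in> darts G \<Longrightarrow> wt G (opp G d) = wt G d"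
    and wt_skip: "d \<in> darts G \<Longrightarrow> wt G d = 0 \<Longrightarrow> wt G (rot G (opp G d)) \<noteq> 0"
begin

abbreviation "SG \<equiv> signed_graph G"

definition len :: "'d \<Rightarrow> nat" where "len d = nat \<bar>wt G d\<bar>"

text \<open>The next dart at a vertex after the edges of weight \<open>0\<close> have been contracted.\<close>

definition nxt :: "'d \<Rightarrow> 'd" where
  "nxt d = (if wt G (rot G d) = 0 then rot G (opp G (rot G d)) else rot G d)"

lemma len_opp [simp]: "d \<in> darts G \<Longrightarrow> len (opp G d) = len d"
  by (simp add: len_def wt_opp)

lemma len_pos: "0 < len d \<longleftrightarrow> wt G d \<noteq> 0"
  by (simp add: len_def)

lemma SG_darts: "(d, j) \<in> darts SG \<longleftrightarrow> d \<in> darts G \<and> j < len d"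
  by (simp add: signed_graph_def len_def Let_def)

lemma SG_opp: "opp SG (d, j) = (opp G d, len d - 1 - j)"
  by (simp add: signed_graph_def len_def Let_def)

lemma SG_wt: "wt SG (d, j) = sgn (wt G d)"
  by (simp add: signed_graph_def Let_def)

lemma SG_rot_pos: "0 < j \<Longrightarrow> rot SG (d, j) = (opp G d, len d - j)"
  by (simp add: signed_graph_def len_def Let_def)

lemma SG_rot_0:
  assumes "d \<in> darts G" shows "rot SG (d, 0) = (nxt d, 0)"
proof -
  let ?skip = "\<lambda>d. rot G (opp G d)"
  let ?m = "LEAST m. wt G ((?skip ^^ m) (rot G d)) \<noteq> 0"
  have r: "rot SG (d, 0) = ((?skip ^^ ?m) (rot G d), 0)"
    by (simp add: signed_graph_def Let_def)
  show ?thesis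
  proof (cases "wt G (rot G d) = 0")
    case False
    then have "?m = 0" by (intro Least_equality) auto
    then show ?thesis unfolding r using False by (simp add: nxt_def)
  next
    case True
    have "?m = 1"
    proof (intro Least_equality)
      show "wt G ((?skip ^^ 1) (rot G d)) \<noteq> 0" using wt_skip[OF rot_in[OF assms] True] by simp
      show "1 \<le> y" if "wt G ((?skip ^^ y) (rot G d)) \<noteq> 0" for y
        using that True by (cases y) auto
    qed
    then show ?thesis unfolding r using True by (simp add: nxt_def)
  qed
qed

lemma nxt_in: "d \<in> darts G \<Longrightarrow> nxt d \<in> darts G" and wt_nxt: "d \<in> darts G \<Longrightarrow> wt G (nxt d) \<noteq> 0"
  using rot_in opp_in wt_skip by (auto simp: nxt_def)

lemma SG_finite: "finite (darts SG)"
proof -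
  have "darts SG = (SIGMA d:darts G. {..<len d})" using SG_darts by auto
  then show ?thesis using finite by simp
qed

lemma SG_rot_in: "h \<in> darts SG \<Longrightarrow> rot SG h \<in> darts SG"
proof -
  assume h: "h \<in> darts SG"
  obtain d j where dj: "h = (d, j)" by (cases h)
  then have d: "d \<in> darts G" "j < len d" using h SG_darts by auto
  show ?thesis
  proof (cases "j = 0")
    case True
    have "0 < len (nxt d)" using wt_nxt[OF d(1)] by (simp add: len_pos)
    then show ?thesis unfolding dj True SG_rot_0[OF d(1)] SG_darts using nxt_in[OF d(1)] by blast
  next
    case False
    then have "rot SG (d, j) = (opp G d, len d - j)" by (intro SG_rot_pos) simp
    then show ?thesis unfolding dj using d False opp_in[OF d(1)] by (simp add: SG_darts)
  qed
qed

lemma SG_opp_in: "h \<in> darts SG \<Longrightarrow> opp SG h \<in> darts SG"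
  by (cases h) (auto simp: SG_darts SG_opp opp_in)

lemma SG_opp_opp: "h \<in> darts SG \<Longrightarrow> opp SG (opp SG h) = h"
  by (cases h) (auto simp: SG_darts SG_opp opp_opp)

lemma SG_wt_opp: "h \<in> darts SG \<Longrightarrow> wt SG (opp SG h) = wt SG h"
  by (cases h) (auto simp: SG_darts SG_opp SG_wt wt_opp)

text \<open>A set of darts closed under the operations of the signed graph contains whole paths, and so
  is closed under the operations of the weighted graph.\<close>

lemma SG_connected:
  assumes S: "\<And>h. h \<in> S \<Longrightarrow> h \<in> darts SG \<Longrightarrow> rot SG h \<in> S \<and> opp SG h \<in> S"
    and d: "d \<in> darts G" "wt G d \<noteq> 0" "(d, 0) \<in> S"
  shows "(nxt d, 0) \<in> S" "(opp G d, 0) \<in> S" "j < len d \<Longrightarrow> (d, j) \<in> S"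
proof -
  have up: "(d, j) \<in> S" if "j < len d" for j using that
  proof (induction j)
    case (Suc j)
    then have s: "(d, j) \<in> S" "(d, j) \<in> darts SG" by (auto simp: SG_darts d(1))
    have o: "(opp G d, len d - 1 - j) \<in> S" using S[OF s] by (simp add: SG_opp)
    have o': "(opp G d, len d - 1 - j) \<in> darts SG" using Suc.prems opp_in[OF d(1)] d(1) by (simp add: SG_darts)
    have "rot SG (opp G d, len d - 1 - j) = (opp G (opp G d), len (opp G d) - (len d - 1 - j))"
      using Suc.prems by (intro SG_rot_pos) simp
    also have "\<dots> = (d, Suc j)" using Suc.prems d(1) by (simp add: opp_opp)
    finally show ?case using S[OF o o'] by simp
  qed (rule d(3))
  show "j < len d \<Longrightarrow> (d, j) \<in> S" by (rule up)
  have l: "0 < len d" using d(2) by (simp add: len_pos)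
  have "(d, 0) \<in> darts SG" using l d(1) by (simp add: SG_darts)
  from S[OF d(3) this] show "(nxt d, 0) \<in> S" by (simp add: SG_rot_0[OF d(1)])
  have "(d, len d - 1) \<in> S" "(d, len d - 1) \<in> darts SG" using up l d(1) by (simp_all add: SG_darts)
  from S[OF this] show "(opp G d, 0) \<in> S" by (simp add: SG_opp)
qed

end

text \<open>Labels of the black and the white corners by elements of a group, as they arise from a
  cover.\<close>

locale region_labels = weighted_graph G + group \<Gamma> for G :: "'d plane_graph" and \<Gamma> :: "('g, 'r) monoid_scheme" (structure) +
  fixes black white :: "'d \<times> nat \<Rightarrow> 'g"
  assumes black_car: "h \<in> darts (signed_graph G) \<Longrightarrow> black h \<in> carrier \<Gamma>"
    and white_car: "h \<in> darts (signed_graph G) \<Longrightarrow> white h \<in> carrier \<Gamma>"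
    and black_rot: "h \<in> darts (signed_graph G) \<Longrightarrow> black (rot (signed_graph G) h) = black h"
    and white_opp_rot: "h \<in> darts (signed_graph G) \<Longrightarrow> white (opp (signed_graph G) (rot (signed_graph G) h)) = white h"
    and black_opp: "h \<in> darts (signed_graph G) \<Longrightarrow> black (opp (signed_graph G) h) =
      (if wt (signed_graph G) h = 1 then white h \<otimes> inv white (opp (signed_graph G) h)
       else white (opp (signed_graph G) h) \<otimes> inv white h) \<otimes> black h"
begin

definition vertex :: "'d \<Rightarrow> 'g" where "vertex d = black (d, 0)"
definition face :: "'d \<Rightarrow> 'g" where "face d = white (d, 0)"

lemma first_dart: "d \<in> darts G \<Longrightarrow> wt G d \<noteq> 0 \<Longrightarrow> (d, 0) \<in> darts SG"
  by (simp add: SG_darts len_pos)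

lemma label_carrier: "d \<in> darts G \<Longrightarrow> wt G d \<noteq> 0 \<Longrightarrow> vertex d \<in> carrier \<Gamma>" "d \<in> darts G \<Longrightarrow> wt G d \<noteq> 0 \<Longrightarrow> face d \<in> carrier \<Gamma>"
  unfolding vertex_def face_def using first_dart black_car white_car by auto

text \<open>The faces beside a path of edges in series are the same all along.\<close>

lemma white_series:
  assumes d: "d \<in> darts G" and j: "j < len d" shows "white (d, j) = face d"
  using j
proof (induction j)
  case (Suc j)
  have h: "(d, Suc j) \<in> darts SG" using Suc.prems d by (simp add: SG_darts)
  have "opp SG (rot SG (d, Suc j)) = (d, j)"
    using Suc.prems d by (simp add: SG_rot_pos SG_opp opp_opp)
  then have "white (d, Suc j) = white (d, j)" using white_opp_rot[OF h] by simp
  then show ?case using Suc by simp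
qed (simp add: face_def)

lemma vertex_nxt: "d \<in> darts G \<Longrightarrow> wt G d \<noteq> 0 \<Longrightarrow> vertex (nxt d) = vertex d"
  using black_rot[OF first_dart] by (simp add: SG_rot_0 vertex_def)

lemma face_opp_nxt: "d \<in> darts G \<Longrightarrow> wt G d \<noteq> 0 \<Longrightarrow> face (opp G (nxt d)) = face d"
proof -
  assume d: "d \<in> darts G" "wt G d \<noteq> 0"
  have n: "nxt d \<in> darts G" "0 < len (nxt d)" using nxt_in[OF d(1)] wt_nxt[OF d(1)] by (auto simp: len_pos)
  have "face d = white (opp SG (nxt d, 0))" using white_opp_rot[OF first_dart[OF d]] by (simp add: SG_rot_0[OF d(1)] face_def)
  also have "\<dots> = white (opp G (nxt d), len (nxt d) - 1)" by (simp add: SG_opp)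
  also have "\<dots> = face (opp G (nxt d))" using n by (intro white_series opp_in) auto
  finally show ?thesis ..
qed

text \<open>Each edge of the path multiplies the label by the same factor or its inverse, according to
  the sign of the weight.\<close>

lemma vertex_opp:
  assumes d: "d \<in> darts G" "wt G d \<noteq> 0"
  shows "vertex (opp G d) = (face d \<otimes> inv face (opp G d)) [^] wt G d \<otimes> vertex d"
proof -
  have od: "opp G d \<in> darts G" "wt G (opp G d) \<noteq> 0" using opp_in d wt_opp by auto
  let ?Y = "face d \<otimes> inv face (opp G d)"
  define Z where "Z = (if 0 < wt G d then ?Y else inv ?Y)"
  have Y: "?Y \<in> carrier \<Gamma>" using label_carrier[OF d] label_carrier[OF od] by simp
  then have Z: "Z \<in> carrier \<Gamma>" by (simp add: Z_def)
  have step: "black (opp SG (d, j)) = Z \<otimes> black (d, j)" if j: "j < len d" for j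
  proof -
    have h: "(d, j) \<in> darts SG" using j d by (simp add: SG_darts)
    have Wo: "white (opp SG (d, j)) = face (opp G d)" unfolding SG_opp using j d by (intro white_series od) auto
    have "wt SG (d, j) = 1 \<longleftrightarrow> 0 < wt G d" using d(2) by (simp add: SG_wt sgn_if)
    then show ?thesis unfolding black_opp[OF h] Wo white_series[OF d(1) j] Z_def
      using label_carrier[OF d] label_carrier[OF od] by (simp add: inv_mult_group)
  qed
  have l: "0 < len d" using d(2) by (simp add: len_pos)
  have Bj: "black (d, j) = Z [^] j \<otimes> vertex d" if "j < len d" for j using that
  proof (induction j)
    case 0 then show ?case using label_carrier(1)[OF d] by (simp add: vertex_def)
  next
    case (Suc j)
    have h: "(d, Suc j) \<in> darts SG" "(d, j) \<in> darts SG" using Suc.prems d by (auto simp: SG_darts)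
    have "rot SG (d, Suc j) = opp SG (d, j)" using Suc.prems by (simp add: SG_rot_pos SG_opp)
    then have "black (d, Suc j) = black (opp SG (d, j))" using black_rot[OF h(1)] by simp
    also have "\<dots> = Z \<otimes> (Z [^] j \<otimes> vertex d)" using step[of j] Suc by simp
    also have "\<dots> = Z [^] Suc j \<otimes> vertex d"
      using Z label_carrier(1)[OF d] nat_pow_Suc2[OF Z, of j] by (simp add: m_assoc del: nat_pow_Suc)
    finally show ?case .
  qed
  have "vertex (opp G d) = black (opp SG (d, len d - 1))" using l by (simp add: SG_opp vertex_def)
  also have "\<dots> = Z \<otimes> (Z [^] (len d - 1) \<otimes> vertex d)" using step[of "len d - 1"] Bj[of "len d - 1"] l by simp
  also have "\<dots> = Z [^] Suc (len d - 1) \<otimes> vertex d"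
    using Z label_carrier(1)[OF d] nat_pow_Suc2[OF Z, of "len d - 1"] by (simp add: m_assoc del: nat_pow_Suc)
  also have "Suc (len d - 1) = len d" using l by simp
  also have "Z [^] len d = ?Y [^] wt G d"
  proof (cases "0 < wt G d")
    case True
    then have "wt G d = int (len d)" by (simp add: len_def)
    then show ?thesis using True by (simp add: Z_def int_pow_int)
  next
    case False
    then have "wt G d = - int (len d)" by (simp add: len_def)
    then show ?thesis using False Y by (simp add: Z_def int_pow_neg int_pow_int nat_pow_inv)
  qed
  finally show ?thesis .
qed

end

lemma wheel_simps [simp]:
  "rot (wheel n k) = wheel_rot n" "opp (wheel n k) (e, t) = (e, \<not> t)" "wt (wheel n k) (e, t) = wheel_wt k e"
  by (simp_all add: wheel_def)

lemma wheel_darts: "(e, t) \<in> darts (wheel n k) \<longleftrightarrow> (\<exists>i\<in>{1..n}. e \<in> {Spoke_x i, Spoke_y i, Rim_xy i, Rim_yx i})"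
  by (auto simp: wheel_def)

lemma wheel_darts_simps [simp]:
  "(Spoke_x i, t) \<in> darts (wheel n k) \<longleftrightarrow> i \<in> {1..n}" "(Spoke_y i, t) \<in> darts (wheel n k) \<longleftrightarrow> i \<in> {1..n}"
  "(Rim_xy i, t) \<in> darts (wheel n k) \<longleftrightarrow> i \<in> {1..n}" "(Rim_yx i, t) \<in> darts (wheel n k) \<longleftrightarrow> i \<in> {1..n}"
  by (auto simp: wheel_darts)

lemma cyc_in [simp]: "i \<in> {1..n} \<Longrightarrow> cyc_next n i \<in> {1..n}" "i \<in> {1..n} \<Longrightarrow> cyc_prev n i \<in> {1..n}"
  by (auto simp: cyc_next_def cyc_prev_def)

lemma cyc_prev_next [simp]: "i \<in> {1..n} \<Longrightarrow> cyc_prev n (cyc_next n i) = i" "i \<in> {1..n} \<Longrightarrow> cyc_next n (cyc_prev n i) = i"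
  by (auto simp: cyc_next_def cyc_prev_def)

lemma wheel_cases:
  assumes "d \<in> darts (wheel n k)"
  obtains i t where "i \<in> {1..n}" "d = (Spoke_x i, t) \<or> d = (Spoke_y i, t) \<or> d = (Rim_xy i, t) \<or> d = (Rim_yx i, t)"
  using assms by (auto simp: wheel_def)

text \<open>Only rim edges from \<open>x\<^sub>i\<close> to \<open>y\<^sub>i\<close> can have weight \<open>0\<close>, and the next edge at either end is
  not of this kind.\<close>

lemma weighted_graph_wheel: "weighted_graph (wheel n k)"
proof
  show "finite (darts (wheel n k))" by (simp add: wheel_def)
  fix d assume d: "d \<in> darts (wheel n k)"
  obtain e t where et: "d = (e, t)" by (cases d)
  obtain i t where i: "i \<in> {1..n}" and c: "d = (Spoke_x i, t) \<or> d = (Spoke_y i, t) \<or> d = (Rim_xy i, t) \<or> d = (Rim_yx i, t)"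
    using wheel_cases[OF d] by metis
  note j = cyc_in[OF i]
  show "rot (wheel n k) d \<in> darts (wheel n k)"
    using c i j by (elim disjE; cases t) (simp_all del: atLeastAtMost_iff)
  show "opp (wheel n k) d \<in> darts (wheel n k)" "opp (wheel n k) (opp (wheel n k) d) = d" "wt (wheel n k) (opp (wheel n k) d) = wt (wheel n k) d"
    using c i by auto
  show "wt (wheel n k) (rot (wheel n k) (opp (wheel n k) d)) \<noteq> 0" if "wt (wheel n k) d = 0"
    using c that by (elim disjE; cases t) simp_all
qed

lemma cyclic_constant:
  assumes "\<And>i. i \<in> {1..n} \<Longrightarrow> P i \<Longrightarrow> P (cyc_next n i)" "P 1" "i \<in> {1..n}"
  shows "P i"
proof -
  have "i \<in> {1..n} \<longrightarrow> P i"
  proof (induction i)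
    case (Suc i)
    show ?case
    proof (cases "i = 0")
      case False
      show ?thesis
      proof
        assume "Suc i \<in> {1..n}"
        then have "i \<in> {1..n}" "cyc_next n i = Suc i" using False by (auto simp: cyc_next_def)
        then show "P (Suc i)" using Suc assms(1)[of i] by simp
      qed
    qed (use assms(2) in simp)
  qed simp
  then show ?thesis using assms(3) by blast
qed

locale wheel_labels = region_labels "wheel n k" \<Gamma> black white
  for n :: nat and k :: "nat \<Rightarrow> int" and \<Gamma> :: "('g, 'r) monoid_scheme" (structure) and black white +
  assumes n1: "1 \<le> n"
begin

lemma one_in [simp]: "1 \<in> {1..n}" using n1 by simp

context notes atLeastAtMost_iff [simp del] One_nat_def [simp del]
begin

text \<open>The cases depend on the vanishing of \<open>k\<close>, when a rim edge is contracted and \<open>x\<^sub>i\<close> and \<open>y\<^sub>i\<close>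
  merge.\<close>

lemma nxt_simps:
  "nxt (Spoke_x i, True) = (Spoke_y i, True)" "nxt (Spoke_y i, True) = (Spoke_x (cyc_next n i), True)"
  "nxt (Spoke_x i, False) = (Rim_yx (cyc_prev n i), False)" "nxt (Rim_yx i, True) = (Spoke_y i, False)"
  "nxt (Rim_xy i, True) = (Spoke_x i, False)" "nxt (Rim_xy i, False) = (Rim_yx i, True)"
  "nxt (Rim_yx i, False) = (if k (cyc_next n i) = 0 then (Rim_yx (cyc_next n i), True) else (Rim_xy (cyc_next n i), True))"
  "nxt (Spoke_y i, False) = (if k i = 0 then (Spoke_x i, False) else (Rim_xy i, False))"
  by (simp_all add: nxt_def)

text \<open>A rim edge of weight \<open>1\<close>, which exists for all weights \<open>k\<close>; its reversed dart has the outer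
  face on its left.\<close>

abbreviation "base \<equiv> ((Rim_yx 1, False), 0 :: nat)"

lemma base_in: "base \<in> darts SG"
  using n1 by (simp add: SG_darts len_def)

lemma wheel_connected:
  assumes base_S: "base \<in> S"
    and S: "\<And>h. h \<in> S \<Longrightarrow> h \<in> darts SG \<Longrightarrow> rot SG h \<in> S \<and> opp SG h \<in> S"
  shows "darts SG \<subseteq> S"
proof -
  have nx: "(nxt d, 0) \<in> S" and op: "(opp (wheel n k) d, 0) \<in> S" and ser: "j < len d \<Longrightarrow> (d, j) \<in> S"
    if "d \<in> darts (wheel n k)" "wt (wheel n k) d \<noteq> 0" "(d, 0) \<in> S" for d j
    using SG_connected[OF S that] by auto
  have yx: "((Spoke_y i, True), 0) \<in> S \<and> ((Spoke_y i, False), 0) \<in> S" if i: "i \<in> {1..n}" "((Rim_yx i, True), 0) \<in> S" for i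
    using nx[of "(Rim_yx i, True)"] op[of "(Spoke_y i, False)"] i by (simp add: nxt_simps)
  have "((Rim_yx i, True), 0) \<in> S \<and> ((Rim_yx i, False), 0) \<in> S" if "i \<in> {1..n}" for i
  proof (rule cyclic_constant[OF _ _ that])
    show "((Rim_yx 1, True), 0) \<in> S \<and> ((Rim_yx 1, False), 0) \<in> S" using op[of "(Rim_yx 1, False)"] base_S n1 by simp
    fix i assume i: "i \<in> {1..n}" and h: "((Rim_yx i, True), 0) \<in> S \<and> ((Rim_yx i, False), 0) \<in> S"
    let ?j = "cyc_next n i"
    have j: "?j \<in> {1..n}" using i by simp
    have "((Rim_yx ?j, True), 0) \<in> S"
    proof (cases "k ?j = 0")
      case True
      then show ?thesis using nx[of "(Rim_yx i, False)"] i h by (simp add: nxt_simps)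
    next
      case False
      then have "((Rim_xy ?j, True), 0) \<in> S" using nx[of "(Rim_yx i, False)"] i h by (simp add: nxt_simps)
      then have "((Rim_xy ?j, False), 0) \<in> S" using op[of "(Rim_xy ?j, True)"] j False by simp
      then show ?thesis using nx[of "(Rim_xy ?j, False)"] j False by (simp add: nxt_simps)
    qed
    then show "((Rim_yx ?j, True), 0) \<in> S \<and> ((Rim_yx ?j, False), 0) \<in> S" using op[of "(Rim_yx ?j, True)"] j by simp
  qed
  then have R: "((Rim_yx i, t), 0) \<in> S" if "i \<in> {1..n}" for i t using that by (cases t) auto
  then have Y: "((Spoke_y i, t), 0) \<in> S" if "i \<in> {1..n}" for i t using yx[OF that] that by (cases t) auto
  have X1: "((Spoke_x i, True), 0) \<in> S" if i: "i \<in> {1..n}" for i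
    using nx[of "(Spoke_y (cyc_prev n i), True)"] Y[of "cyc_prev n i" True] i cyc_in(2)[OF i]
    by (simp add: nxt_simps)
  then have X: "((Spoke_x i, t), 0) \<in> S" if "i \<in> {1..n}" for i t
    using op[of "(Spoke_x i, True)"] X1[OF that] that by (cases t) auto
  have Z1: "((Rim_xy i, False), 0) \<in> S" if i: "i \<in> {1..n}" "k i \<noteq> 0" for i
    using nx[of "(Spoke_y i, False)"] Y[OF i(1), of False] i by (simp add: nxt_simps)
  then have Z: "((Rim_xy i, t), 0) \<in> S" if "i \<in> {1..n}" "k i \<noteq> 0" for i t
    using op[of "(Rim_xy i, False)"] Z1[OF that] that by (cases t) auto
  show ?thesis
  proof
    fix h assume h: "h \<in> darts SG"
    obtain d j where dj: "h = (d, j)" by (cases h)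
    have d: "d \<in> darts (wheel n k)" "j < len d" using h unfolding dj SG_darts by auto
    then have wt: "wt (wheel n k) d \<noteq> 0" using len_pos[of d] by simp
    obtain i t where i: "i \<in> {1..n}" and c: "d = (Spoke_x i, t) \<or> d = (Spoke_y i, t) \<or> d = (Rim_xy i, t) \<or> d = (Rim_yx i, t)"
      using wheel_cases[OF d(1)] by metis
    have "(d, 0) \<in> S" using c i wt X Y Z R by (elim disjE) auto
    from ser[OF d(1) wt this d(2)] show "h \<in> S" unfolding dj .
  qed
qed

lemma face_labels:
  assumes i: "i \<in> {1..n}"
  shows "face (Spoke_y i, False) = face (Spoke_x i, True)"
    "face (Spoke_x (cyc_next n i), False) = face (Spoke_y i, True)"
    "face (Rim_yx i, True) = face (Spoke_y i, True)"
    "k i \<noteq> 0 \<Longrightarrow> face (Rim_xy i, True) = face (Spoke_x i, True)"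
    "face (Rim_yx i, False) = face (Rim_yx 1, False)"
    "k i \<noteq> 0 \<Longrightarrow> face (Rim_xy i, False) = face (Rim_yx 1, False)"
proof -
  show 1: "face (Spoke_y i, False) = face (Spoke_x i, True)"
    using face_opp_nxt[of "(Spoke_x i, True)"] i by (simp add: nxt_simps)
  show 2: "face (Spoke_x (cyc_next n i), False) = face (Spoke_y i, True)"
    using face_opp_nxt[of "(Spoke_y i, True)"] i by (simp add: nxt_simps)
  show "face (Rim_yx i, True) = face (Spoke_y i, True)"
    using face_opp_nxt[of "(Spoke_x (cyc_next n i), False)"] 2 cyc_in(1)[OF i] cyc_prev_next(1)[OF i]
    by (simp add: nxt_simps)
  show "face (Rim_xy i, True) = face (Spoke_x i, True)" if "k i \<noteq> 0"
    using face_opp_nxt[of "(Spoke_y i, False)"] i that 1 by (simp add: nxt_simps)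
  have xy: "face (Rim_yx i, False) = face (Rim_xy i, False)" if "i \<in> {1..n}" "k i \<noteq> 0" for i
    using face_opp_nxt[of "(Rim_xy i, False)"] that by (simp add: nxt_simps)
  have yx: "face (Rim_yx i, False) = face (Rim_yx 1, False)" if "i \<in> {1..n}" for i
  proof (rule cyclic_constant[OF _ _ that])
    fix i assume i: "i \<in> {1..n}" and h: "face (Rim_yx i, False) = face (Rim_yx 1, False)"
    show "face (Rim_yx (cyc_next n i), False) = face (Rim_yx 1, False)"
    proof (cases "k (cyc_next n i) = 0")
      case True
      then show ?thesis using face_opp_nxt[of "(Rim_yx i, False)"] i h by (simp add: nxt_simps)
    next
      case False
      then show ?thesis using face_opp_nxt[of "(Rim_yx i, False)"] i h xy[OF cyc_in(1)[OF i] False] by (simp add: nxt_simps)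
    qed
  qed simp
  show "face (Rim_yx i, False) = face (Rim_yx 1, False)" by (rule yx[OF i])
  show "face (Rim_xy i, False) = face (Rim_yx 1, False)" if "k i \<noteq> 0" using yx[OF i] xy[OF i that] by simp
qed

lemma vertex_labels:
  assumes i: "i \<in> {1..n}"
  shows "vertex (Spoke_x i, True) = vertex (Spoke_x 1, True)" "vertex (Spoke_y i, True) = vertex (Spoke_x 1, True)"
    "vertex (Rim_yx i, True) = vertex (Spoke_y i, False)" "vertex (Rim_yx i, False) = vertex (Spoke_x (cyc_next n i), False)"
    "k i \<noteq> 0 \<Longrightarrow> vertex (Rim_xy i, True) = vertex (Spoke_x i, False)" "k i \<noteq> 0 \<Longrightarrow> vertex (Rim_xy i, False) = vertex (Spoke_y i, False)"
    "k i = 0 \<Longrightarrow> vertex (Spoke_x i, False) = vertex (Spoke_y i, False)"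
proof -
  have y: "vertex (Spoke_y i, True) = vertex (Spoke_x i, True)" if "i \<in> {1..n}" for i
    using vertex_nxt[of "(Spoke_x i, True)"] that by (simp add: nxt_simps)
  show x: "vertex (Spoke_x i, True) = vertex (Spoke_x 1, True)"
  proof (rule cyclic_constant[OF _ _ i])
    fix i assume i: "i \<in> {1..n}" and h: "vertex (Spoke_x i, True) = vertex (Spoke_x 1, True)"
    show "vertex (Spoke_x (cyc_next n i), True) = vertex (Spoke_x 1, True)"
      using vertex_nxt[of "(Spoke_y i, True)"] i y[OF i] h by (simp add: nxt_simps)
  qed simp
  show "vertex (Spoke_y i, True) = vertex (Spoke_x 1, True)" using x y[OF i] by simp
  show "vertex (Rim_yx i, True) = vertex (Spoke_y i, False)" using vertex_nxt[of "(Rim_yx i, True)"] i by (simp add: nxt_simps)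
  show "vertex (Rim_yx i, False) = vertex (Spoke_x (cyc_next n i), False)"
    using vertex_nxt[of "(Spoke_x (cyc_next n i), False)"] cyc_in(1)[OF i] cyc_prev_next(1)[OF i]
    by (simp add: nxt_simps)
  show "vertex (Rim_xy i, True) = vertex (Spoke_x i, False)" if "k i \<noteq> 0"
    using vertex_nxt[of "(Rim_xy i, True)"] i that by (simp add: nxt_simps)
  show "vertex (Rim_xy i, False) = vertex (Spoke_y i, False)" if "k i \<noteq> 0"
    using vertex_nxt[of "(Spoke_y i, False)"] i that by (simp add: nxt_simps)
  show "vertex (Spoke_x i, False) = vertex (Spoke_y i, False)" if "k i = 0"
    using vertex_nxt[of "(Spoke_y i, False)"] i that by (simp add: nxt_simps)
qed

text \<open>The labels satisfy the relations of the wheel. Where \<open>k i = 0\<close> the rim edge gives no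
  relation \<open>vertex_opp\<close>, but the two vertices then have the same label, which is the
  relation for exponent \<open>0\<close>.\<close>

theorem not_left_orderable:
  assumes gen: "\<And>D g. D \<subseteq> carrier \<Gamma> \<Longrightarrow> (\<And>h. h \<in> darts SG \<Longrightarrow> (\<otimes>) (black h \<otimes> inv black base) ` D = D) \<Longrightarrow>
      (\<And>h. h \<in> darts SG \<Longrightarrow> (\<otimes>) (white h \<otimes> inv white base) ` D = D) \<Longrightarrow> g \<in> carrier \<Gamma> \<Longrightarrow> (\<otimes>) g ` D = D"
  shows "\<not> left_orderable \<Gamma>"
proof -
  let ?I = "{1..n}"
  define FT where "FT i = (if i \<in> ?I then face (Spoke_x i, True) else \<one>)" for i
  define FU where "FU i = (if i \<in> ?I then face (Spoke_y i, True) else \<one>)" for i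
  define bx where "bx i = (if i \<in> ?I then vertex (Spoke_x i, False) else \<one>)" for i
  define by' where "by' i = (if i \<in> ?I then vertex (Spoke_y i, False) else \<one>)" for i
  define FO where "FO = face (Rim_yx 1, False)"
  define b0 where "b0 = vertex (Spoke_x 1, True)"
  have one: "1 \<in> ?I" using n1 by simp
  have car: "FT i \<in> carrier \<Gamma>" "FU i \<in> carrier \<Gamma>" "FO \<in> carrier \<Gamma>" "bx i \<in> carrier \<Gamma>" "by' i \<in> carrier \<Gamma>" "b0 \<in> carrier \<Gamma>" for i
    using label_carrier one by (auto simp: FT_def FU_def FO_def bx_def by'_def b0_def)
  show ?thesis
  proof (rule wheel_relations_not_left_orderable[of n FT FU FO bx by' b0 k, OF n1 car])
    fix i assume i: "i \<in> ?I"
    note j = cyc_in(1)[OF i] and wf = face_labels[OF i] and bv = vertex_labels[OF i]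
    show "by' i = (FT i \<otimes> inv FO) [^] k i \<otimes> bx i"
    proof (cases "k i = 0")
      case True
      then show ?thesis using bv(7) i car(4)[of i] by (simp add: by'_def bx_def)
    next
      case False
      then show ?thesis using vertex_opp[of "(Rim_xy i, True)"] i wf(4,6)[OF False] bv(5,6)[OF False]
        by (simp add: by'_def bx_def FT_def FO_def)
    qed
    show "bx (cyc_next n i) = FU i \<otimes> inv FO \<otimes> by' i"
      using vertex_opp[of "(Rim_yx i, True)"] i j wf(3,5) bv(3,4) car(2)[of i] car(3)
      by (simp add: by'_def bx_def FU_def FO_def int_pow_1)
    show "bx (cyc_next n i) = (FT (cyc_next n i) \<otimes> inv FU i) [^] (- 2 :: int) \<otimes> b0"
      using vertex_opp[of "(Spoke_x (cyc_next n i), True)"] i j wf(2) vertex_labels(1)[OF j]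
      by (simp add: bx_def FT_def FU_def b0_def)
    show "by' i = FU i \<otimes> inv FT i \<otimes> b0"
      using vertex_opp[of "(Spoke_y i, True)"] i wf(1) bv(2) car(1,2)[of i]
      by (simp add: by'_def FT_def FU_def b0_def int_pow_1)
  next
    fix D g assume D: "D \<subseteq> carrier \<Gamma>" and g: "g \<in> carrier \<Gamma>"
      and fix_: "\<And>i. i \<in> ?I \<Longrightarrow> (\<otimes>) (FT i \<otimes> inv FO) ` D = D \<and> (\<otimes>) (FU i \<otimes> inv FO) ` D = D"
    have comp: "(\<otimes>) (x \<otimes> y) ` D = (\<otimes>) x ` (\<otimes>) y ` D" if "x \<in> carrier \<Gamma>" "y \<in> carrier \<Gamma>" for x y
      unfolding image_image using that D by (intro image_cong refl) (auto simp: m_assoc)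
    have st1: "(\<otimes>) \<one> ` D = D" using D by (intro equalityI subsetI) (auto simp: image_iff subset_iff intro: bexI[rotated])
    have stm: "(\<otimes>) (x \<otimes> y) ` D = D" if "x \<in> carrier \<Gamma>" "y \<in> carrier \<Gamma>" "(\<otimes>) x ` D = D" "(\<otimes>) y ` D = D" for x y
      using comp that by simp
    have sti: "(\<otimes>) (inv x) ` D = D" if "x \<in> carrier \<Gamma>" "(\<otimes>) x ` D = D" for x
      using comp[of "inv x" x] that st1 by simp
    have Wc: "white h \<in> carrier \<Gamma>" "black h \<in> carrier \<Gamma>" if "h \<in> darts SG" for h using that white_car black_car by auto
    have FO: "FO = white base" by (simp add: FO_def face_def)
    have WF: "(\<otimes>) (white h \<otimes> inv white base) ` D = D" if h: "h \<in> darts SG" for h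
    proof -
      obtain d m where dj: "h = (d, m)" by (cases h)
      have d: "d \<in> darts (wheel n k)" "m < len d" using h unfolding dj SG_darts by auto
      then have wt: "wt (wheel n k) d \<noteq> 0" using len_pos[of d] by simp
      obtain i t where i: "i \<in> ?I" and c: "d = (Spoke_x i, t) \<or> d = (Spoke_y i, t) \<or> d = (Rim_xy i, t) \<or> d = (Rim_yx i, t)"
        using wheel_cases[OF d(1)] by metis
      note wf = face_labels[OF i]
      have sx: "face (Spoke_x i, False) = face (Spoke_y (cyc_prev n i), True)"
        using face_labels(2)[OF cyc_in(2)[OF i]] cyc_prev_next(2)[OF i] by simp
      have "face d = FO \<or> (\<exists>i\<in>?I. face d = FT i \<or> face d = FU i)"
        using c
      proof (elim disjE)
        assume "d = (Spoke_x i, t)"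
        then show ?thesis using i sx cyc_in(2)[OF i] by (cases t) (auto simp: FT_def FU_def)
      next
        assume "d = (Spoke_y i, t)"
        then show ?thesis using i wf(1) by (cases t) (auto simp: FT_def FU_def)
      next
        assume "d = (Rim_xy i, t)"
        then show ?thesis using i wf(4,6) wt by (cases t) (auto simp: FT_def FU_def FO_def)
      next
        assume "d = (Rim_yx i, t)"
        then show ?thesis using i wf(3,5) by (cases t) (auto simp: FT_def FU_def FO_def)
      qed
      moreover have Wh: "white h = face d" unfolding dj by (rule white_series[OF d])
      moreover have FF: "(\<otimes>) (FO \<otimes> inv FO) ` D = D" using st1 car(3) by simp
      ultimately consider "white h = FO" | i where "i \<in> ?I" "white h = FT i \<or> white h = FU i" by metis
      then show ?thesis
      proof cases
        case 1
        show ?thesis unfolding 1 FO[symmetric] by (rule FF)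
      next
        case (2 i)
        show ?thesis using 2(2) fix_[OF 2(1)] unfolding FO[symmetric] by (elim disjE) simp_all
      qed
    qed
    have WW: "(\<otimes>) (white h \<otimes> inv white h') ` D = D" if h: "h \<in> darts SG" "h' \<in> darts SG" for h h'
    proof -
      have "white h \<otimes> inv white h' = (white h \<otimes> inv white base) \<otimes> inv (white h' \<otimes> inv white base)"
        using Wc[OF h(1)] Wc[OF h(2)] Wc[OF base_in] by (simp add: inv_mult_group m_assoc inv_cancel)
      then show ?thesis using stm sti WF[OF h(1)] WF[OF h(2)] Wc[OF h(1)] Wc[OF h(2)] Wc[OF base_in] by simp
    qed
    have "darts SG \<subseteq> {h. h \<in> darts SG \<longrightarrow> (\<otimes>) (black h \<otimes> inv black base) ` D = D}"
    proof (rule wheel_connected)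
      show "base \<in> {h. h \<in> darts SG \<longrightarrow> (\<otimes>) (black h \<otimes> inv black base) ` D = D}"
        using st1 Wc(2)[OF base_in] by simp
      fix h assume h: "h \<in> {h. h \<in> darts SG \<longrightarrow> (\<otimes>) (black h \<otimes> inv black base) ` D = D}" "h \<in> darts SG"
      then have Bh: "(\<otimes>) (black h \<otimes> inv black base) ` D = D" by simp
      note oh = SG_opp_in[OF h(2)]
      define Z where "Z = (if wt SG h = 1 then white h \<otimes> inv white (opp SG h) else white (opp SG h) \<otimes> inv white h)"
      have Z: "Z \<in> carrier \<Gamma>" "(\<otimes>) Z ` D = D"
        unfolding Z_def using WW[OF h(2) oh] WW[OF oh h(2)] Wc[OF h(2)] Wc[OF oh] by auto
      have "black (opp SG h) = Z \<otimes> black h" unfolding Z_def by (rule black_opp[OF h(2)])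
      then have "black (opp SG h) \<otimes> inv black base = Z \<otimes> (black h \<otimes> inv black base)"
        using Z(1) Wc[OF h(2)] Wc[OF base_in] by (simp add: m_assoc)
      then have "(\<otimes>) (black (opp SG h) \<otimes> inv black base) ` D = D"
        using stm[OF Z(1) _ Z(2) Bh] Wc[OF h(2)] Wc[OF base_in] by simp
      then show "rot SG h \<in> {h. h \<in> darts SG \<longrightarrow> (\<otimes>) (black h \<otimes> inv black base) ` D = D} \<and>
          opp SG h \<in> {h. h \<in> darts SG \<longrightarrow> (\<otimes>) (black h \<otimes> inv black base) ` D = D}"
        using Bh black_rot[OF h(2)] by simp
    qed
    then have BB: "(\<otimes>) (black h \<otimes> inv black base) ` D = D" if "h \<in> darts SG" for h using that by blast
    show "(\<otimes>) g ` D = D" by (rule gen[OF D BB WF g])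
  qed
qed

end

end

section \<open>The wheel links\<close>

text \<open>Inverse stereographic projection from the pole \<open>(0, s)\<close> for \<open>s = \<plusminus>1\<close>; the two poles give the
  two charts of the sphere.\<close>

definition stereo :: "real \<Rightarrow> R3 \<Rightarrow> R4" where
  "stereo s w = ((2 / ((norm w)\<^sup>2 + 1)) *\<^sub>R w, s * (((norm w)\<^sup>2 - 1) / ((norm w)\<^sup>2 + 1)))"

lemma inv_stereographic_eq: "inv_stereographic = stereo 1"
  by (rule ext) (simp add: inv_stereographic_def stereo_def)

lemma homeomorphism_stereo:
  assumes s: "s * s = 1"
  shows "homeomorphism UNIV (S3 - {(0, s)}) (stereo s) (\<lambda>y. (1 / (1 - s * snd y)) *\<^sub>R fst y)"
proof (rule homeomorphismI)
  let ?g = "\<lambda>y :: R4. (1 / (1 - s * snd y)) *\<^sub>R fst y"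
  have q: "(norm w)\<^sup>2 + 1 > 0" for w :: R3 by (smt (verit) zero_le_power2)
  have np: "(norm (x, t))\<^sup>2 = (norm x)\<^sup>2 + t\<^sup>2" for x :: R3 and t :: real by (simp add: norm_Pair)
  have s0: "s \<noteq> 0" using s by auto
  have pole: "1 - s * t \<noteq> 0" if "(x, t) \<in> S3 - {(0, s)}" for x t
  proof
    assume "1 - s * t = 0"
    then have "s * (s * t) = s" by simp
    then have ts: "t = s" using s by (simp flip: mult.assoc)
    have "(norm x)\<^sup>2 + t\<^sup>2 = 1" using that by (simp add: norm_Pair)
    then have "x = 0" using ts s by (simp add: power2_eq_square)
    then show False using that ts by simp
  qed
  show "continuous_on UNIV (stereo s)"
    unfolding stereo_def using q by (intro continuous_intros) (smt (verit))+
  show "continuous_on (S3 - {(0, s)}) ?g"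
  proof (intro continuous_intros ballI)
    fix y assume "y \<in> S3 - {(0, s)}"
    then show "1 - s * snd y \<noteq> 0" using pole[of "fst y" "snd y"] by simp
  qed
  have eq: "1 - s * (s * (((norm w)\<^sup>2 - 1) / ((norm w)\<^sup>2 + 1))) = 2 / ((norm w)\<^sup>2 + 1)" for w :: R3
  proof -
    have "s * (s * (((norm w)\<^sup>2 - 1) / ((norm w)\<^sup>2 + 1))) = ((norm w)\<^sup>2 - 1) / ((norm w)\<^sup>2 + 1)"
      using s by (simp flip: mult.assoc)
    then show ?thesis using q[of w] by (simp add: field_simps)
  qed
  show "?g (stereo s w) = w" for w
  proof -
    define r where "r = (norm w)\<^sup>2"
    have r: "r + 1 > 0" using q[of w] by (simp add: r_def)
    have "?g (stereo s w) = (1 / (2 / (r + 1))) *\<^sub>R (2 / (r + 1)) *\<^sub>R w"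
      unfolding stereo_def fst_conv snd_conv eq r_def ..
    also have "\<dots> = ((1 / (2 / (r + 1))) * (2 / (r + 1))) *\<^sub>R w" by simp
    also have "(1 / (2 / (r + 1))) * (2 / (r + 1)) = 1" using r by (simp only: field_simps) simp
    finally show ?thesis by simp
  qed
  show "stereo s ` UNIV \<subseteq> S3 - {(0, s)}"
  proof
    fix y assume "y \<in> stereo s ` UNIV"
    then obtain w where y: "y = stereo s w" by blast
    define r where "r = (norm w)\<^sup>2"
    have r: "r + 1 > 0" using q[of w] by (simp add: r_def)
    have "(norm y)\<^sup>2 = (norm ((2 / (r + 1)) *\<^sub>R w))\<^sup>2 + (s * ((r - 1) / (r + 1)))\<^sup>2"
      unfolding y stereo_def r_def by (rule np)
    also have "(norm ((2 / (r + 1)) *\<^sub>R w))\<^sup>2 = (2 / (r + 1))\<^sup>2 * r"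
      by (simp only: norm_scaleR power_mult_distrib power2_abs r_def)
    also have "(s * ((r - 1) / (r + 1)))\<^sup>2 = ((r - 1) / (r + 1))\<^sup>2"
      by (simp only: power_mult_distrib power2_eq_square[of s] s mult_1)
    also have "(2 / (r + 1))\<^sup>2 * r + ((r - 1) / (r + 1))\<^sup>2 = (4 * r + (r - 1)\<^sup>2) / (r + 1)\<^sup>2"
      unfolding power_divide by (simp add: add_divide_distrib)
    also have "4 * r + (r - 1)\<^sup>2 = (r + 1)\<^sup>2" by (simp add: power2_eq_square algebra_simps)
    finally have "(norm y)\<^sup>2 = 1\<^sup>2" using r by simp
    then have n: "norm y = 1" by (rule power2_eq_imp_eq) auto
    have "y \<noteq> (0, s)"
    proof
      assume y0: "y = (0, s)"
      then have "(2 / (r + 1)) *\<^sub>R w = 0" unfolding y stereo_def r_def by simp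
      then have "w = 0" using r by simp
      then have "snd y = - s" unfolding y stereo_def by simp
      then show False using y0 s0 by simp
    qed
    then show "y \<in> S3 - {(0, s)}" using n by simp
  qed
  show "stereo s (?g y) = y" if y: "y \<in> S3 - {(0, s)}" for y
  proof -
    obtain x t where xt: "y = (x, t)" by (cases y)
    have d: "1 - s * t \<noteq> 0" using pole y unfolding xt by blast
    define m where "m = s * t"
    have m: "1 - m \<noteq> 0" using d by (simp add: m_def)
    have "m\<^sup>2 = (s * s) * t\<^sup>2" by (simp add: m_def power2_eq_square)
    moreover have "(norm x)\<^sup>2 + t\<^sup>2 = 1" using y unfolding xt by (simp add: norm_Pair)
    ultimately have x: "(norm x)\<^sup>2 = 1 - m\<^sup>2" using s by simp
    have "(norm ((1 / (1 - m)) *\<^sub>R x))\<^sup>2 = (1 - m\<^sup>2) / (1 - m)\<^sup>2"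
      by (simp add: power_mult_distrib power_divide x)
    also have "1 - m\<^sup>2 = (1 + m) * (1 - m)" by (simp add: power2_eq_square algebra_simps)
    also have "(1 + m) * (1 - m) / (1 - m)\<^sup>2 = (1 + m) / (1 - m)" using m by (simp add: power2_eq_square)
    finally have nq: "(norm ((1 / (1 - m)) *\<^sub>R x))\<^sup>2 = (1 + m) / (1 - m)" .
    have p: "(1 + m) / (1 - m) + 1 = 2 / (1 - m)" "(1 + m) / (1 - m) - 1 = 2 * m / (1 - m)"
      using m by (auto simp: field_simps)
    have "stereo s (?g y) = ((2 / (2 / (1 - m))) *\<^sub>R (1 / (1 - m)) *\<^sub>R x, s * ((2 * m / (1 - m)) / (2 / (1 - m))))"
      unfolding stereo_def xt fst_conv snd_conv m_def[symmetric] nq p ..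
    also have "(2 / (2 / (1 - m))) *\<^sub>R (1 / (1 - m)) *\<^sub>R x = x" using m by simp
    also have "(2 * m / (1 - m)) / (2 / (1 - m)) = m" using m by simp
    also have "s * m = t" using s by (simp add: m_def flip: mult.assoc)
    finally show ?thesis unfolding xt .
  qed
qed auto

lemma stereo_inversion:
  assumes "w \<noteq> 0" shows "stereo (-1) w = stereo 1 ((1 / (norm w)\<^sup>2) *\<^sub>R w)"
proof -
  define r where "r = (norm w)\<^sup>2"
  have r: "r > 0" using assms by (simp add: r_def)
  have "(norm ((1 / r) *\<^sub>R w))\<^sup>2 = r / r\<^sup>2" by (simp add: power_mult_distrib power_divide r_def)
  then have n: "(norm ((1 / r) *\<^sub>R w))\<^sup>2 = 1 / r" using r by (simp add: power2_eq_square)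
  have d: "1 / r + 1 = (r + 1) / r" "1 / r - 1 = (1 - r) / r"
    using r by (simp_all add: add_divide_distrib diff_divide_distrib)
  have "2 / (1 / r + 1) * (1 / r) = 2 / (r + 1)" unfolding d using r by simp
  moreover have "(1 / r - 1) / (1 / r + 1) = (1 - r) / (r + 1)" unfolding d using r by simp
  moreover have "- 1 * ((r - 1) / (r + 1)) = (1 - r) / (r + 1)" by (simp flip: minus_divide_left)
  ultimately have "stereo 1 ((1 / r) *\<^sub>R w) = ((2 / (r + 1)) *\<^sub>R w, - 1 * ((r - 1) / (r + 1)))"
    unfolding stereo_def n scaleR_scaleR by (simp only: mult_1)
  then show ?thesis unfolding r_def[symmetric] by (simp only: stereo_def[of "-1"] r_def[symmetric])
qed

lemma homeomorphism_restrict_pole: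
  assumes h: "homeomorphism S3 S3 h h'" and N: "N \<in> S3"
  shows "homeomorphism (S3 - {N}) (S3 - {h N}) h h'"
proof (rule homeomorphism_of_subsets[OF h])
  have "inj_on h S3" by (rule inj_onI) (metis homeomorphism_apply1[OF h])
  then have "h ` (S3 - {N}) = h ` S3 - h ` {N}" by (rule inj_on_image_set_diff) (use N in auto)
  then show "h ` (S3 - {N}) = S3 - {h N}" using homeomorphism_image1[OF h] by simp
qed auto

text \<open>Only the final homeomorphism of the isotopy matters: composed with the stereographic charts
  it gives charts in which \<open>L\<close> is the lift of the diagram.\<close>

lemma link_cover_of_drawing:
  assumes md: "medial_diagram H c u \<alpha>" and ne: "darts H \<noteq> {}"
    and iso: "ambient_isotopic S3 (inv_stereographic ` medial_lift H c u \<alpha>) L"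
    and dbc: "double_branched_cover X p L" and a: "a \<in> X"
  shows "\<exists>e f e' f' ninf zinf. medial_cover H c u \<alpha> X p L e f e' f' ninf zinf a"
proof -
  interpret medial_diagram H c u \<alpha> by (rule md)
  obtain Hi where Hi: "\<forall>t\<in>{0..1 :: real}. \<exists>h. homeomorphism S3 S3 (\<lambda>x. Hi (t, x)) h"
    "(\<lambda>x. Hi (1, x)) ` inv_stereographic ` medial_lift H c u \<alpha> = L"
    using iso unfolding ambient_isotopic_def by blast
  define h1 where "h1 = (\<lambda>x. Hi (1 :: real, x))"
  have "\<exists>h. homeomorphism S3 S3 (\<lambda>x. Hi (1 :: real, x)) h" by (rule bspec[OF Hi(1)]) simp
  then obtain h1' where h1: "homeomorphism S3 S3 h1 h1'" unfolding h1_def by blast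
  have poles: "(0, 1) \<in> S3" "(0, -1) \<in> S3" by (simp_all add: norm_Pair)
  have s1: "(1 :: real) * 1 = 1" "(-1 :: real) * (-1) = 1" by simp_all
  have e: "homeomorphism UNIV (S3 - {h1 (0, 1)}) (h1 \<circ> stereo 1) ((\<lambda>y. (1 / (1 - 1 * snd y)) *\<^sub>R fst y) \<circ> h1')"
    by (rule homeomorphism_compose[OF homeomorphism_stereo[OF s1(1)] homeomorphism_restrict_pole[OF h1 poles(1)]])
  have f: "homeomorphism UNIV (S3 - {h1 (0, -1)}) (h1 \<circ> stereo (-1)) ((\<lambda>y. (1 / (1 - (-1) * snd y)) *\<^sub>R fst y) \<circ> h1')"
    by (rule homeomorphism_compose[OF homeomorphism_stereo[OF s1(2)] homeomorphism_restrict_pole[OF h1 poles(2)]])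
  have eL: "(h1 \<circ> stereo 1) ` lift = L"
    using Hi(2) unfolding h1_def inv_stereographic_eq by (simp add: image_comp)
  have ec: "continuous_on lift (h1 \<circ> stereo 1)"
    by (rule continuous_on_subset[of UNIV]) (use e in \<open>auto simp: homeomorphism_def\<close>)
  have closed: "closed L"
    unfolding eL[symmetric] by (intro compact_imp_closed compact_continuous_image ec compact_lift)
  have f0: "(h1 \<circ> stereo (-1)) 0 = h1 (0, 1)" by (simp add: stereo_def)
  have inv: "(h1 \<circ> stereo (-1)) w = (h1 \<circ> stereo 1) ((1 / (norm w)\<^sup>2) *\<^sub>R w)" if "w \<noteq> 0" for w
    using stereo_inversion[OF that] by simp
  have pl: "projected_link lift (c ` darts H)" by (rule projected_link_lift(1)[OF ne])
  have "\<exists>q. q \<in> projected_link.proj lift \<and> q \<notin> c ` darts H"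
    unfolding projected_link.proj_def[OF pl] fst_lift by (rule projected_link_lift(2)[OF ne])
  with e eL f f0 inv have "link_cover_axioms lift (c ` darts H) L (h1 \<circ> stereo 1) (h1 \<circ> stereo (-1))
     ((\<lambda>y. (1 / (1 - 1 * snd y)) *\<^sub>R fst y) \<circ> h1') ((\<lambda>y. (1 / (1 - (-1) * snd y)) *\<^sub>R fst y) \<circ> h1') (h1 (0, 1)) (h1 (0, -1))"
    by (intro link_cover_axioms.intro)
  then have "medial_cover H c u \<alpha> X p L (h1 \<circ> stereo 1) (h1 \<circ> stereo (-1))
     ((\<lambda>y. (1 / (1 - 1 * snd y)) *\<^sub>R fst y) \<circ> h1') ((\<lambda>y. (1 / (1 - (-1) * snd y)) *\<^sub>R fst y) \<circ> h1') (h1 (0, 1)) (h1 (0, -1)) a"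
    by (intro medial_cover.intro md based_link_cover.intro link_cover.intro pl branched_cover.intro based_space.intro dbc closed a)
  then show ?thesis by blast
qed

theorem theorem1p2:
  fixes n :: nat and k :: "nat \<Rightarrow> int" and L :: "R4 set"
    and X :: "'a::topological_space set" and p :: "'a \<Rightarrow> R4" and a :: 'a
  assumes "n \<ge> 1"
    and "is_link_L n k L"
    and "double_branched_cover X p L"
    and "a \<in> X"
  shows "\<not> left_orderable (fundamental_group X a)"
proof -
  let ?H = "signed_graph (wheel n k)"
  interpret w: weighted_graph "wheel n k" by (rule weighted_graph_wheel)
  obtain c u \<alpha> where drawing: "medial_drawing ?H c u \<alpha>"
    and iso: "ambient_isotopic S3 (inv_stereographic ` medial_lift ?H c u \<alpha>) L"
    using assms(2) unfolding is_link_L_def link_of_weighted_graph_def by blast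
  have md: "medial_diagram ?H c u \<alpha>"
    by (intro medial_diagram.intro w.SG_finite w.SG_rot_in w.SG_opp_in w.SG_opp_opp w.SG_wt_opp drawing)
  have base: "((Rim_yx 1, False), 0) \<in> darts ?H"
    using assms(1) by (simp add: w.SG_darts w.len_def)
  then have ne: "darts ?H \<noteq> {}" by blast
  obtain e f e' f' ninf zinf where mc: "medial_cover ?H c u \<alpha> X p L e f e' f' ninf zinf a"
    using link_cover_of_drawing[OF md ne iso assms(3,4)] by blast
  interpret C: medial_cover ?H c u \<alpha> X p L e f e' f' ninf zinf a by (rule mc)
  interpret R: wheel_labels n k "fundamental_group X a" "\<lambda>h. C.black h True" "\<lambda>h. C.white h True"
  proof unfold_locales
    fix h assume h: "h \<in> darts ?H"
    show "C.black h True \<in> carrier (fundamental_group X a)" "C.white h True \<in> carrier (fundamental_group X a)"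
      using C.labels_carrier[OF h] by auto
    show "C.black (rot ?H h) True = C.black h True" by (rule C.black_rot[OF h])
    show "C.white (opp ?H (rot ?H h)) True = C.white h True" by (rule C.white_opp_rot[OF h])
    show "C.black (opp ?H h) True = (if wt ?H h = 1
         then C.white h True \<otimes>\<^bsub>fundamental_group X a\<^esub> inv\<^bsub>fundamental_group X a\<^esub> C.white (opp ?H h) True
         else C.white (opp ?H h) True \<otimes>\<^bsub>fundamental_group X a\<^esub> inv\<^bsub>fundamental_group X a\<^esub> C.white h True) \<otimes>\<^bsub>fundamental_group X a\<^esub> C.black h True"
      by (rule C.black_opp[OF h])
  qed (rule assms(1))
  show ?thesis
  proof (rule R.not_left_orderable)
    fix D g
    assume D: "D \<subseteq> carrier (fundamental_group X a)"
      and BD: "\<And>h. h \<in> darts ?H \<Longrightarrow> (\<otimes>\<^bsub>fundamental_group X a\<^esub>) (C.black h True \<otimes>\<^bsub>fundamental_group X a\<^esub>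
          inv\<^bsub>fundamental_group X a\<^esub> C.black ((Rim_yx 1, False), 0) True) ` D = D"
      and WD: "\<And>h. h \<in> darts ?H \<Longrightarrow> (\<otimes>\<^bsub>fundamental_group X a\<^esub>) (C.white h True \<otimes>\<^bsub>fundamental_group X a\<^esub>
          inv\<^bsub>fundamental_group X a\<^esub> C.white ((Rim_yx 1, False), 0) True) ` D = D"
      and g: "g \<in> carrier (fundamental_group X a)"
    show "(\<otimes>\<^bsub>fundamental_group X a\<^esub>) g ` D = D"
      using C.fixed_by_regions_imp_fixed[OF base R.wheel_connected D _ _ g] BD WD
      unfolding C.trans_def by blast
  qed
qed

end
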